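(* Let $\Omega\subset\mathbb{R}^2$ be an open and bounded set with smooth boundary, let $\frac23\le s<1$, and let $f=(f_1,f_2)\in W^{s,\frac{2}{s}}(\Omega,\mathbb{R}^2)$. Suppose that $\mathrm{Jac}(f)\ge 0$ in $\Omega$ (in the distributional sense) and that $\mathrm{curl}(f)=0$ in the distributional sense, i.e. $$-\int_\Omega \left(f_2\,\partial_1\varphi-f_1\,\partial_2\varphi\right)dx=0\qquad\text{for all }\varphi\in C_c^\infty(\Omega).$$ Then $f$ is continuous in $\Omega$ (that is, $f$ agrees a.e. in $\Omega$ with a continuous map).
   Context: For $s\in(0,1)$, $p\in(1,\infty)$ and $\Omega\subset\mathbb{R}^n$ open, $W^{s,p}(\Omega,\mathbb{R}^m)$ is the space of maps $f\in L^p(\Omega,\mathbb{R}^m)$ with $[f]_{W^{s,p}(\Omega)}:=\left(\int_\Omega\int_\Omega\frac{|f(x)-f(y)|^p}{|x-y|^{n+sp}}\,dx\,dy\right)^{1/p}<\infty$, with norm $\|f\|_{L^p(\Omega)}+[f]_{W^{s,p}(\Omega)}$; $W^{s,p}_0(\Omega)$ is the closure of $C_c^\infty(\Omega)$ in the $W^{s,p}$-norm. Distributional Jacobian (here $n=2$): for $\Omega\subset\mathbb{R}^n$ open and bounded with smooth boundary, $\frac{n}{n+1}\le s<1$, $f\in W^{s,\frac{n}{s}}(\Omega,\mathbb{R}^n)$ and $\varphi\in W_0^{(1-s)n,\frac{1}{1-s}}(\Omega)$ set $\mathrm{Jac}(f)[\varphi]:=\lim_{k\to\infty}\int_\Omega\det(Df_k)\,\varphi_k\,dx$,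 where $f_k\in C^\infty(\overline\Omega,\mathbb{R}^n)$ converges to $f$ in $W^{s,\frac{n}{s}}(\Omega)$ and $\varphi_k\in C_c^\infty(\Omega)$ converges to $\varphi$ in $W^{(1-s)n,\frac{1}{1-s}}(\Omega)$. It is known that this limit exists, is independent of the approximating sequences, and is a bounded linear functional of $\varphi$. Since $s\ge\frac{n}{n+1}$, one has $W^{s,\frac{n}{s}}_0(\Omega)\subset W_0^{(1-s)n,\frac{1}{1-s}}(\Omega)$, so $\mathrm{Jac}(f)[\varphi]$ makes sense for $\varphi\in W^{s,\frac{n}{s}}_0(\Omega)$. $\mathrm{Jac}(f)\ge 0$ in $\Omega$ means $\mathrm{Jac}(f)[\varphi]\ge 0$ for all $\varphi\in W^{s,\frac{n}{s}}_0(\Omega)$ with $\varphi\ge 0$ a.e. *)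

theory Defs
  imports "HOL-Analysis.Analysis"
begin

section \<open>Smooth functions and smooth domains\<close>

text \<open>The two notions below are intended for open sets \<open>S\<close> only.\<close>

primrec Ck_on :: "nat \<Rightarrow> 'a::euclidean_space set \<Rightarrow> ('a \<Rightarrow> 'b::euclidean_space) \<Rightarrow> bool"
  where
    "Ck_on 0 S f \<longleftrightarrow> continuous_on S f"
  | "Ck_on (Suc k) S f \<longleftrightarrow>
       (\<forall>x\<in>S. f differentiable (at x)) \<and>
       (\<forall>v. Ck_on k S (\<lambda>x. frechet_derivative f (at x) v))"

definition smooth_on :: "'a::euclidean_space set \<Rightarrow> ('a \<Rightarrow> 'b::euclidean_space) \<Rightarrow> bool"
  where "smooth_on S f \<longleftrightarrow> (\<forall>k. Ck_on k S f)"

text \<open>The space of functions smooth up to the boundary, that is, those extending smoothly to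
  a neighbourhood of the closure.\<close>

definition smooth_closure :: "'a::euclidean_space set \<Rightarrow> ('a \<Rightarrow> 'b::euclidean_space) set"
  where "smooth_closure \<Omega> = {f. \<exists>U. open U \<and> closure \<Omega> \<subseteq> U \<and> smooth_on U f}"

definition test_functions :: "'a::euclidean_space set \<Rightarrow> ('a \<Rightarrow> real) set"
  where "test_functions \<Omega> =
    {\<phi>. smooth_on UNIV \<phi> \<and> compact (closure {x. \<phi> x \<noteq> 0}) \<and> closure {x. \<phi> x \<noteq> 0} \<subseteq> \<Omega>}"

definition pderiv_at :: "'n \<Rightarrow> (real^'n \<Rightarrow> real) \<Rightarrow> real^'n::finite \<Rightarrow> real"
  where "pderiv_at i \<phi> x = frechet_derivative \<phi> (at x) (axis i 1)"

text \<open>Near each boundary point, the open set \<open>\<Omega>\<close> is the region strictly above the graph of a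
  smooth function over some hyperplane. The hyperplane is given by its unit normal \<open>e\<close>, and
  \<open>x - (x \<bullet> e) *\<^sub>R e\<close> is the orthogonal projection of \<open>x\<close> to it; only the values of \<open>\<gamma>\<close> on the
  hyperplane matter.\<close>

definition has_smooth_boundary :: "'a::euclidean_space set \<Rightarrow> bool"
  where "has_smooth_boundary \<Omega> \<longleftrightarrow>
    (\<forall>x0 \<in> frontier \<Omega>. \<exists>r>0. \<exists>e. \<exists>\<gamma>::'a \<Rightarrow> real.
       norm e = 1 \<and> smooth_on UNIV \<gamma> \<and>
       \<Omega> \<inter> ball x0 r = {x \<in> ball x0 r. x \<bullet> e > \<gamma> (x - (x \<bullet> e) *\<^sub>R e)})"


section \<open>Fractional Sobolev spaces\<close>

text \<open>Elements of the spaces are represented by functions on the whole of \<open>'a\<close>, whose values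
  outside \<open>\<Omega>\<close> play no role.\<close>

definition gagliardo_energy ::
    "'a::euclidean_space set \<Rightarrow> real \<Rightarrow> real \<Rightarrow> ('a \<Rightarrow> 'b::euclidean_space) \<Rightarrow> ennreal"
  where "gagliardo_energy \<Omega> s p f =
    (\<integral>\<^sup>+x. (\<integral>\<^sup>+y. ennreal (norm (f x - f y) powr p / norm (x - y) powr (real DIM('a) + s * p))
       \<partial>lebesgue_on \<Omega>) \<partial>lebesgue_on \<Omega>)"

definition Wsp ::
    "'a::euclidean_space set \<Rightarrow> real \<Rightarrow> real \<Rightarrow> ('a \<Rightarrow> 'b::euclidean_space) set"
  where "Wsp \<Omega> s p =
    {f. f \<in> borel_measurable (lebesgue_on \<Omega>) \<and>
        integrable (lebesgue_on \<Omega>) (\<lambda>x. norm (f x) powr p) \<and>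
        gagliardo_energy \<Omega> s p f < \<infinity>}"

text \<open>Meaningful for \<open>f \<in> Wsp \<Omega> s p\<close> only.\<close>

definition Wsp_norm ::
    "'a::euclidean_space set \<Rightarrow> real \<Rightarrow> real \<Rightarrow> ('a \<Rightarrow> 'b::euclidean_space) \<Rightarrow> real"
  where "Wsp_norm \<Omega> s p f =
    (LINT x|lebesgue_on \<Omega>. norm (f x) powr p) powr (1 / p) +
    enn2real (gagliardo_energy \<Omega> s p f) powr (1 / p)"

definition Wsp_tendsto ::
    "'a::euclidean_space set \<Rightarrow> real \<Rightarrow> real \<Rightarrow>
       (nat \<Rightarrow> 'a \<Rightarrow> 'b::euclidean_space) \<Rightarrow> ('a \<Rightarrow> 'b) \<Rightarrow> bool"
  where "Wsp_tendsto \<Omega> s p F f \<longleftrightarrow>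
    (\<forall>k. F k \<in> Wsp \<Omega> s p) \<and> f \<in> Wsp \<Omega> s p \<and>
    (\<lambda>k. Wsp_norm \<Omega> s p (\<lambda>x. F k x - f x)) \<longlonglongrightarrow> 0"

definition Wsp0 :: "'a::euclidean_space set \<Rightarrow> real \<Rightarrow> real \<Rightarrow> ('a \<Rightarrow> real) set"
  where "Wsp0 \<Omega> s p =
    {\<phi>. \<exists>\<Phi>. (\<forall>k. \<Phi> k \<in> test_functions \<Omega>) \<and> Wsp_tendsto \<Omega> s p \<Phi> \<phi>}"


section \<open>The distributional Jacobian\<close>

text \<open>For \<open>f \<in> Wsp \<Omega> s (n/s)\<close> and \<open>\<phi> \<in> Wsp0 \<Omega> ((1-s)n) (1/(1-s))\<close> with \<open>n/(n+1) \<le> s < 1\<close>, and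
  \<open>\<Omega>\<close> open and bounded with smooth boundary, approximating sequences exist, the limit exists
  and it does not depend on them, so that the description is proper.\<close>

definition distr_Jac ::
    "(real^'n::finite) set \<Rightarrow> real \<Rightarrow> (real^'n \<Rightarrow> real^'n) \<Rightarrow> (real^'n \<Rightarrow> real) \<Rightarrow> real"
  where "distr_Jac \<Omega> s f \<phi> =
    (THE L. \<forall>F \<Phi>.
       (\<forall>k. F k \<in> smooth_closure \<Omega>) \<and>
       Wsp_tendsto \<Omega> s (real CARD('n) / s) F f \<and>
       (\<forall>k. \<Phi> k \<in> test_functions \<Omega>) \<and>
       Wsp_tendsto \<Omega> ((1 - s) * real CARD('n)) (1 / (1 - s)) \<Phi> \<phi> \<longrightarrow>
       (\<lambda>k. LINT x|lebesgue_on \<Omega>. det (jacobian (F k) (at x)) * \<Phi> k x) \<longlonglongrightarrow> L)"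

definition distr_Jac_nonneg ::
    "(real^'n::finite) set \<Rightarrow> real \<Rightarrow> (real^'n \<Rightarrow> real^'n) \<Rightarrow> bool"
  where "distr_Jac_nonneg \<Omega> s f \<longleftrightarrow>
    (\<forall>\<phi> \<in> Wsp0 \<Omega> s (real CARD('n) / s).
       (AE x in lebesgue_on \<Omega>. \<phi> x \<ge> 0) \<longrightarrow> distr_Jac \<Omega> s f \<phi> \<ge> 0)"

end

theory Submission
 imports Defs
begin

text \<open>
 For a smooth map \<open>(a, b)\<close> of the plane and a test function \<open>phi\<close>, let \<open>T(a, b, phi)\<close> be the integral of the Jacobian of
 \<open>(a, b)\<close> times \<open>phi\<close>. It changes sign when two arguments are exchanged, whence \<open>T(a, b, h(a)) = 0\<close>. So a map whose Jacobian
 is strictly positive admits no test function \<open>h(a) >= 0\<close> other than \<open>0\<close>. This is a maximum principle: if \<open>a < M\<close> on a circle,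
 the function \<open>h(a)\<close> that measures the excess over \<open>M\<close> inside the circle is such a test function, so \<open>a <= M\<close> inside.
 Applied to \<open>a\<close>, \<open>- a\<close>, \<open>b\<close>, \<open>- b\<close> it says that both components of the map are monotone in the sense of Lebesgue, and monotone
 functions that oscillate little on suitable small circles are continuous.

 Strict positivity comes from the curl condition: the Jacobian of \<open>f + (- x_2, x_1)\<close> is that of \<open>f\<close> plus the curl of \<open>f\<close>
 plus \<open>1\<close> (\<open>triform_shift\<close>, \<open>shifted_jacobian_positive\<close>).

 For a map of fractional regularity this has to be done with approximating sequences. With \<open>p = 2/s\<close> and \<open>q = 1/(1-s)\<close>
 one has \<open>2/p + 1/q = 1\<close>, and both Gagliardo kernels are \<open>|x - y|^-4\<close>. The estimate of \<open>T\<close> by the \<open>p\<close>-energies of \<open>a\<close> and \<open>b\<close>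
 and the \<open>q\<close>-norm of \<open>phi\<close> (\<open>triform_energy_bound\<close>) compares mollifications at consecutive dyadic scales. It shows that the
 distributional Jacobian is well defined (\<open>distr_Jac_tendsto\<close>), and that \<open>T(a_l, b_l, h(a_k))\<close> is close to
 \<open>T(a_k, b_k, h(a_k)) = 0\<close> for large \<open>k\<close> and \<open>l\<close>, which gives the maximum principle for the limit (\<open>circle_maximum_principle\<close>).
 Here \<open>s >= 2/3\<close>, that is \<open>p <= q\<close>, ensures that \<open>h(a_k)\<close> stays bounded in the space of test functions.

 A circle on which infinitely many \<open>a_k\<close> differ from their average by at most a power of the energy of a larger ball is
 found by averaging over the radius (\<open>good_circle\<close>). As the energy of small balls tends to zero, the oscillation of the
 components on small balls does too (\<open>local_upper_bound\<close>), so there is a continuous representative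
 (\<open>continuous_representative\<close>). The smooth boundary enters through the measure density of
 the domain (\<open>smooth_boundary_plump\<close>), which permits mollification up to the boundary.
\<close>

section \<open>Notation\<close>

abbreviation Borel :: "('a::topological_space => 'b::topological_space) set" where
 "Borel == borel_measurable borel"

abbreviation nn_lborel :: "('a::euclidean_space => ennreal) => ennreal" (binder "NN " 10) where
 "nn_lborel f == nn_integral lborel f"

abbreviation epow :: "real => real => ennreal" where "epow p t == ennreal (\<bar>t\<bar> powr p)"

abbreviation fder :: "('a::real_normed_vector => 'b::real_normed_vector) => 'a => 'a => 'b" where
 "fder f x == frechet_derivative f (at x)"

abbreviation tends (infixr "---->" 60) where "X ----> L == X \<longlonglongrightarrow> L"

section \<open>Smooth functions\<close>

lemma Ck_on_Suc_imp: "Ck_on (Suc k) S f ==> Ck_on k S f"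
proof (induction k arbitrary: f)
 case 0
 then show ?case
  by (auto intro!: continuous_at_imp_continuous_on differentiable_imp_continuous_within)
next
 case (Suc k)
 then show ?case by (metis Ck_on.simps(2))
qed

lemma Ck_on_subset: "Ck_on k S f ==> T \<subseteq> S ==> Ck_on k T f"
proof (induction k arbitrary: f)
 case 0
 then show ?case by (auto intro: continuous_on_subset)
next
 case (Suc k)
 have "Ck_on k T (%x. fder f x v)" for v
  by (rule Suc.IH) (use Suc.prems in auto)
 then show ?case using Suc.prems by auto
qed

lemma Ck_on_SucI:
 assumes "!!x. x \<in> S ==> (f has_derivative f' x) (at x)"
  and "!!v. Ck_on k S (%x. f' x v)" and "open S"
 shows "Ck_on (Suc k) S f"
proof -
 have eq: "fder f x = f' x" if "x \<in> S" for x
  using frechet_derivative_at[OF assms(1)[OF that]] by simp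
 have cong: "Ck_on k S g" if "Ck_on k S h" "!!x. x \<in> S ==> g x = h x" for g h :: "'a => 'b"
  using that
 proof (induction k arbitrary: g h)
  case 0
  then show ?case by (simp cong: continuous_on_cong)
 next
  case (Suc k)
  have d: "(g has_derivative fder h x) (at x)" if "x \<in> S" for x
  proof -
   have "(h has_derivative fder h x) (at x)"
    using Suc.prems(1) that by (simp add: frechet_derivative_works[symmetric])
   then show ?thesis
    using has_derivative_transform_within_open[OF _ assms(3) that] Suc.prems(2) by metis
  qed
  have "Ck_on k S (%x. fder g x v)" for v
  proof (rule Suc.IH)
   show "Ck_on k S (%x. fder h x v)" using Suc.prems(1) by simp
   show "fder g x v = fder h x v" if "x \<in> S" for x
    using frechet_derivative_at[OF d[OF that]] by simp
  qed
  then show ?case using d by (auto simp: differentiable_def)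
 qed
 have "Ck_on k S (%x. fder f x v)" for v
  by (rule cong[OF assms(2)[of v]]) (simp add: eq)
 then show ?thesis using assms(1) by (auto simp: differentiable_def)
qed

lemma Ck_on_SucD:
 assumes "Ck_on (Suc k) S f" "x \<in> S"
 shows "(f has_derivative fder f x) (at x)"
 using assms by (simp add: frechet_derivative_works[symmetric])

lemma Ck_on_cong:
 assumes "Ck_on k S f" "open S" "!!x. x \<in> S ==> g x = f x"
 shows "Ck_on k S g"
proof (cases k)
 case 0
 then show ?thesis using assms by (simp cong: continuous_on_cong)
next
 case (Suc j)
 show ?thesis unfolding Suc
 proof (rule Ck_on_SucI[OF _ _ assms(2)])
  fix x assume x: "x \<in> S"
  show "(g has_derivative fder f x) (at x)"
   using has_derivative_transform_within_open[OF Ck_on_SucD[OF assms(1)[unfolded Suc] x] assms(2) x] assms(3) by metis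
 next
  show "Ck_on j S (%x. fder f x v)" for v
   using assms(1)[unfolded Suc] by simp
 qed
qed

lemma Ck_on_Un:
 assumes "open A" "open B" "Ck_on k A f" "Ck_on k B f"
 shows "Ck_on k (A \<union> B) f"
 using assms(3,4)
proof (induction k arbitrary: f)
 case 0
 then show ?case by (metis Ck_on.simps(1) continuous_on_open_Un[OF assms(1,2)])
next
 case (Suc k)
 have "Ck_on k (A \<union> B) (%x. fder f x v)" for v
  by (rule Suc.IH) (use Suc.prems in simp_all)
 moreover have "f differentiable at x" if "x \<in> A \<union> B" for x
  using Suc.prems that by (meson Ck_on.simps(2) UnE)
 ultimately show ?case unfolding Ck_on.simps by blast
qed

lemma Ck_on_const: "open S ==> Ck_on k S (%x. c)"
proof (induction k arbitrary: c)
 case (Suc k)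
 show ?case
  by (rule Ck_on_SucI[where f' = "%_ _. 0"]) (use Suc.prems Suc.IH[OF Suc.prems] in auto)
qed auto

lemma Ck_on_bounded_linear:
 assumes "bounded_linear L" "open S" "Ck_on k S f"
 shows "Ck_on k S (%x. L (f x))"
 using assms(3)
proof (induction k arbitrary: f)
 case 0
 then show ?case using assms(1) by (simp add: bounded_linear.continuous_on)
next
 case (Suc k)
 show ?case
 proof (rule Ck_on_SucI[OF _ _ assms(2)])
  show "((%x. L (f x)) has_derivative (%v. L (fder f x v))) (at x)" if "x \<in> S" for x
   by (rule bounded_linear.has_derivative[OF assms(1) Ck_on_SucD[OF Suc.prems that]])
  show "Ck_on k S (%x. L (fder f x v))" for v
   by (rule Suc.IH) (use Suc.prems in simp)
 qed
qed

lemma Ck_on_add: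
 assumes "open S" "Ck_on k S f" "Ck_on k S g"
 shows "Ck_on k S (%x. f x + g x)"
 using assms(2,3)
proof (induction k arbitrary: f g)
 case 0
 then show ?case by (simp add: continuous_on_add)
next
 case (Suc k)
 show ?case
 proof (rule Ck_on_SucI[OF _ _ assms(1)])
  show "((%x. f x + g x) has_derivative (%v. fder f x v + fder g x v)) (at x)" if "x \<in> S" for x
   by (rule has_derivative_add[OF Ck_on_SucD[OF Suc.prems(1) that] Ck_on_SucD[OF Suc.prems(2) that]])
  show "Ck_on k S (%x. fder f x v + fder g x v)" for v
   by (rule Suc.IH) (use Suc.prems in auto)
 qed
qed

lemma Ck_on_scaleR:
 fixes f :: "'a::euclidean_space => real" and g :: "'a => 'b::euclidean_space"
 assumes "open S" "Ck_on k S f" "Ck_on k S g"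
 shows "Ck_on k S (%x. f x *\<^sub>R g x)"
 using assms(2,3)
proof (induction k arbitrary: f g)
 case 0
 then show ?case by (simp add: continuous_on_scaleR)
next
 case (Suc k)
 show ?case
 proof (rule Ck_on_SucI[OF _ _ assms(1)])
  show "((%x. f x *\<^sub>R g x) has_derivative
    (%v. f x *\<^sub>R fder g x v + fder f x v *\<^sub>R g x)) (at x)" if "x \<in> S" for x
   by (rule has_derivative_scaleR[OF Ck_on_SucD[OF Suc.prems(1) that] Ck_on_SucD[OF Suc.prems(2) that]])
  show "Ck_on k S (%x. f x *\<^sub>R fder g x v + fder f x v *\<^sub>R g x)" for v
   by (intro Ck_on_add[OF assms(1)] Suc.IH Suc.prems[THEN Ck_on_Suc_imp]) (use Suc.prems in auto)
 qed
qed

lemma Ck_on_mult: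
 fixes f g :: "'a::euclidean_space => real"
 assumes "open S" "Ck_on k S f" "Ck_on k S g"
 shows "Ck_on k S (%x. f x * g x)"
 using Ck_on_scaleR[OF assms] by simp

lemma Ck_on_compose_real:
 fixes G :: "'a::euclidean_space => real" and hs :: "nat => real => real"
 assumes "open S" "Ck_on k S G"
  and hs: "!!n x. x \<in> S ==> (hs n has_real_derivative hs (Suc n) (G x)) (at (G x))"
 shows "Ck_on k S (%x. hs n (G x))"
 using assms(2)
proof (induction k arbitrary: n)
 case 0
 have "isCont (%x. hs n (G x)) x" if "x \<in> S" for x
 proof -
  have "isCont G x" using 0 assms(1) that by (simp add: continuous_on_eq_continuous_at)
  moreover have "isCont (hs n) (G x)" using hs[OF that] by (rule DERIV_isCont)
  ultimately show ?thesis by (rule isCont_o2)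
 qed
 then show ?case by (simp add: continuous_at_imp_continuous_on)
next
 case (Suc k)
 show ?case
 proof (rule Ck_on_SucI[OF _ _ assms(1)])
  show "((%x. hs n (G x)) has_derivative (%v. hs (Suc n) (G x) * fder G x v)) (at x)" if "x \<in> S" for x
   using has_derivative_compose[OF Ck_on_SucD[OF Suc.prems that] hs[OF that, of n, unfolded has_field_derivative_def]] .
  show "Ck_on k S (%x. hs (Suc n) (G x) * fder G x v)" for v
   by (intro Ck_on_mult[OF assms(1)] Suc.IH Suc.prems[THEN Ck_on_Suc_imp]) (use Suc.prems in auto)
 qed
qed

lemma Ck_on_inverse:
 fixes G :: "'a::euclidean_space => real"
 assumes "open S" "Ck_on k S G" "!!x. x \<in> S ==> G x ~= 0"
 shows "Ck_on k S (%x. inverse (G x))"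
proof -
 define hs where "hs = (%n t::real. (-1)^n * fact n * inverse t ^ Suc n)"
 have *: "(hs n has_real_derivative hs (Suc n) t) (at t)" if "t ~= 0" for n t
 proof -
  have "(inverse has_real_derivative - (inverse t ^ Suc (Suc 0))) (at t)"
   using that by (rule DERIV_inverse)
  from DERIV_cmult[OF DERIV_power[OF this, of "Suc n"], of "(-1)^n * fact n"] show ?thesis
   unfolding hs_def by (rule DERIV_cong) (simp add: algebra_simps)
 qed
 from Ck_on_compose_real[OF assms(1,2), of hs 0] * assms(3) show ?thesis
  by (simp add: hs_def)
qed

lemma Ck_on_compose_affine:
 fixes f :: "'a::euclidean_space => 'b::euclidean_space"
 assumes "Ck_on k UNIV f"
 shows "Ck_on k UNIV (%x. f (c *\<^sub>R x + b))"
 using assms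
proof (induction k arbitrary: f)
 case 0
 then show ?case by (auto intro!: continuous_intros continuous_on_compose2[of UNIV f])
next
 case (Suc k)
 show ?case
 proof (rule Ck_on_SucI)
  show "((%x. f (c *\<^sub>R x + b)) has_derivative (%v. c *\<^sub>R fder f (c *\<^sub>R x + b) v)) (at x)" for x
  proof -
   have d: "(f has_derivative fder f (c *\<^sub>R x + b)) (at (c *\<^sub>R x + b))"
    by (rule Ck_on_SucD[OF Suc.prems]) simp
   have "((%x. c *\<^sub>R x + b) has_derivative (%v. c *\<^sub>R v)) (at x)"
    by (auto intro!: derivative_eq_intros)
   from has_derivative_compose[OF this d] show ?thesis
    by (simp add: linear_cmul[OF has_derivative_linear[OF d]])
  qed
  show "Ck_on k UNIV (%x. c *\<^sub>R fder f (c *\<^sub>R x + b) v)" for v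
   by (intro Ck_on_bounded_linear[OF bounded_linear_scaleR_right] Suc.IH) (use Suc.prems in auto)
 qed auto
qed

lemma smooth_onD: "smooth_on S f ==> Ck_on k S f" by (simp add: smooth_on_def)

lemma Ck_on_id: "open S ==> Ck_on k S (%x. x)"
proof (cases k)
 case (Suc j)
 assume "open S"
 then show ?thesis unfolding Suc by (intro Ck_on_SucI[where f' = "%x v. v"] Ck_on_const) auto
qed auto

lemma smooth_on_frechet:
 assumes "smooth_on S f" shows "smooth_on S (%x. fder f x v)"
 unfolding smooth_on_def
proof
 fix k
 have "Ck_on (Suc k) S f" using assms by (rule smooth_onD)
 then show "Ck_on k S (%x. fder f x v)" by simp
qed

lemma smooth_on_has_derivative: "smooth_on S f ==> x \<in> S ==> (f has_derivative fder f x) (at x)"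
 using Ck_on_SucD[of 0 S f x] by (simp add: smooth_on_def del: Ck_on.simps)

lemma smooth_on_continuous: "smooth_on S f ==> continuous_on S f"
 by (auto simp: smooth_on_def dest: spec[of _ 0])

section \<open>A flat profile\<close>

text \<open>The \<open>n\<close>-th derivative of \<open>exp (- 1 / t)\<close> for \<open>t > 0\<close> is a polynomial in \<open>1 / t\<close> times the same exponential. The exponential
 wins at \<open>0\<close>, so all derivatives extend by zero to \<open>t <= 0\<close>.\<close>

primrec flat_poly :: "nat => real poly" where
 "flat_poly 0 = 1"
| "flat_poly (Suc n) = [:0,0,1:] * (flat_poly n - pderiv (flat_poly n))"

definition flat_deriv :: "nat => real => real" where
 "flat_deriv n t = (if t <= 0 then 0 else poly (flat_poly n) (inverse t) * exp (- inverse t))"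

lemma poly_exp_decay: "((%u::real. poly P u * exp (- u)) \<longlongrightarrow> 0) at_top"
proof -
 have "((%u::real. \<Sum>i\<le>degree P. coeff P i * (u ^ i / exp u)) \<longlongrightarrow> (\<Sum>i\<le>degree P. coeff P i * 0)) at_top"
  by (intro tendsto_intros tendsto_power_div_exp_0)
 then show ?thesis
  by (simp add: poly_altdef sum_distrib_right exp_minus divide_inverse mult.assoc)
qed

lemma flat_deriv_DERIV: "(flat_deriv n has_real_derivative flat_deriv (Suc n) t) (at t)"
proof -
 consider "t < 0" | "t = 0" | "t > 0" by linarith
 then show ?thesis
 proof cases
  case 1
  have "((%_. 0) has_real_derivative 0) (at t)" by simp
  then have "(flat_deriv n has_real_derivative 0) (at t)"
   by (rule has_field_derivative_transform_within_open[of _ _ _ "{..<0}"]) (use 1 in \<open>auto simp: flat_deriv_def\<close>)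
  then show ?thesis using 1 by (simp add: flat_deriv_def)
 next
  case 3
  have "((%t. poly (flat_poly n) (inverse t) * exp (- inverse t)) has_real_derivative flat_deriv (Suc n) t) (at t)"
   using 3 by (auto intro!: derivative_eq_intros simp: flat_deriv_def field_simps power2_eq_square)
  then show ?thesis
   by (rule has_field_derivative_transform_within_open[of _ _ _ "{0<..}"]) (use 3 in \<open>auto simp: flat_deriv_def\<close>)
 next
  case 2
  have "((%u::real. poly ([:0,1:] * flat_poly n) u * exp (- u)) \<longlongrightarrow> 0) at_top"
   by (rule poly_exp_decay)
  then have "((%t::real. poly ([:0,1:] * flat_poly n) (inverse t) * exp (- inverse t)) \<longlongrightarrow> 0) (at_right 0)"
   by (rule filterlim_compose[OF _ filterlim_inverse_at_top_right])
  then have r: "((%t. flat_deriv n t / t) \<longlongrightarrow> 0) (at_right 0)"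
   by (rule Lim_transform_eventually)
    (auto simp: eventually_at_right_less flat_deriv_def field_simps eventually_at_filter)
  have l: "((%t. flat_deriv n t / t) \<longlongrightarrow> 0) (at_left 0)"
   by (rule Lim_transform_eventually[of "%_. 0"]) (auto simp: flat_deriv_def eventually_at_filter)
  have "((%t. flat_deriv n t / t) \<longlongrightarrow> 0) (at 0)"
   using l r by (simp add: filterlim_split_at)
  then show ?thesis using 2
   by (simp add: has_field_derivative_iff flat_deriv_def)
 qed
qed

definition flat :: "real => real" where "flat = flat_deriv 0"

lemma flat_eq: "flat t = (if t <= 0 then 0 else exp (- inverse t))"
 by (simp add: flat_def flat_deriv_def)

lemma flat_nonneg: "0 <= flat t" and flat_le_1: "flat t <= 1" and flat_pos_iff: "flat t > 0 \<longleftrightarrow> t > 0"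
 by (auto simp: flat_eq)

lemma flat_Lipschitz: "\<bar>flat a - flat b\<bar> <= 2 * \<bar>a - b\<bar>"
proof -
 have b: "norm (flat_deriv 1 t) <= 2" for t
 proof (cases "t <= 0")
  case False
  define u where "u = inverse t"
  have u: "u > 0" using False by (simp add: u_def)
  have "1 + u + u^2/2 <= exp u" using u exp_lower_Taylor_quadratic[of u] by simp
  then have "u^2 <= 2 * exp u" using u by (simp add: field_simps)
  then have "u^2 * exp (-u) <= 2" by (simp add: exp_minus field_simps)
  moreover have "flat_deriv 1 t = u^2 * exp (-u)"
   using False by (simp add: flat_deriv_def u_def power2_eq_square pderiv_1)
  ultimately show ?thesis by simp
 qed (simp add: flat_deriv_def)
 have "norm (flat a - flat b) <= 2 * norm (a - b)"
  using b by (intro field_differentiable_bound[of UNIV flat "flat_deriv 1" 2])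
   (auto simp: flat_def flat_deriv_DERIV[of 0, simplified])
 then show ?thesis by simp
qed

lemma smooth_on_flat:
 fixes G :: "'a::euclidean_space => real"
 assumes "open S" "smooth_on S G" shows "smooth_on S (%x. flat (G x))"
 using Ck_on_compose_real[OF assms(1) smooth_onD[OF assms(2)], of flat_deriv _ 0] flat_deriv_DERIV
 by (auto simp: smooth_on_def flat_def)

section \<open>Partial derivatives and the Jacobian bracket\<close>

lemma pderiv_at_eq: "(f has_derivative D) (at x) ==> pderiv_at i f x = D (axis i 1)"
 using frechet_derivative_at[of f D x] by (simp add: pderiv_at_def)

lemma smooth_on_pderiv: "smooth_on S f ==> smooth_on S (pderiv_at i f)"
 using smooth_on_frechet[of S f "axis i 1"] by (simp add: pderiv_at_def[abs_def])

lemma smooth_on_add: "open S ==> smooth_on S f ==> smooth_on S g ==> smooth_on S (%x. f x + g x)"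
 by (simp add: smooth_on_def Ck_on_add)

lemma smooth_on_mult:
 fixes f g :: "'a::euclidean_space => real"
 shows "open S ==> smooth_on S f ==> smooth_on S g ==> smooth_on S (%x. f x * g x)"
 by (simp add: smooth_on_def Ck_on_mult)

lemma smooth_on_const: "open S ==> smooth_on S (%x. c)"
 by (simp add: smooth_on_def Ck_on_const)

lemma smooth_on_cmult:
 fixes f :: "'a::euclidean_space => real"
 shows "open S ==> smooth_on S f ==> smooth_on S (%x. c * f x)"
 by (intro smooth_on_mult smooth_on_const)

lemma smooth_on_diff:
 fixes f g :: "'a::euclidean_space => real"
 shows "open S ==> smooth_on S f ==> smooth_on S g ==> smooth_on S (%x. f x - g x)"
 using smooth_on_add[of S f "%x. -1 * g x"] smooth_on_cmult[of S g "-1"] by simp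

lemma smooth_on_bounded_linear:
 "bounded_linear L ==> open S ==> smooth_on S f ==> smooth_on S (%x. L (f x))"
 by (simp add: smooth_on_def Ck_on_bounded_linear)

lemma smooth_on_subset: "smooth_on S f ==> T \<subseteq> S ==> smooth_on T f"
 by (auto simp: smooth_on_def intro: Ck_on_subset)

lemma smooth_on_Un: "open A ==> open B ==> smooth_on A f ==> smooth_on B f ==> smooth_on (A \<union> B) f"
 by (simp add: smooth_on_def Ck_on_Un)

lemma smooth_on_cong: "smooth_on S f ==> open S ==> (!!x. x \<in> S ==> g x = f x) ==> smooth_on S g"
 unfolding smooth_on_def using Ck_on_cong by blast

lemma smooth_on_zero_extension:
 assumes "open V" "closed K" "K \<subseteq> V" "smooth_on V g" "!!x. x \<notin> K ==> g x = 0"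
 shows "smooth_on UNIV g"
proof -
 have "smooth_on (- K) g"
  by (rule smooth_on_cong[OF smooth_on_const[of _ 0]]) (use assms in auto)
 then have "smooth_on (V \<union> - K) g"
  using assms by (intro smooth_on_Un) auto
 moreover have "V \<union> - K = UNIV" using assms(3) by auto
 ultimately show ?thesis by simp
qed

text \<open>The quotient is symmetric in \<open>u\<close> and \<open>v\<close>, so its limit yields the symmetry of second derivatives.\<close>

lemma mixed_second_difference:
 fixes b :: "'a::euclidean_space => real"
 assumes "open V" "smooth_on V b" "x \<in> V"
 shows "((%h. (b (x + h *\<^sub>R u + h *\<^sub>R v) - b (x + h *\<^sub>R u) - b (x + h *\<^sub>R v) + b x) / h^2)
  \<longlongrightarrow> fder (%x. frechet_derivative b (at x) u) x v) (at_right 0)"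
proof -
 define F where "F = (%x. fder b x u)"
 define G where "G = (%x. fder F x v)"
 have sF: "smooth_on V F" unfolding F_def by (rule smooth_on_frechet[OF assms(2)])
 have sG: "smooth_on V G" unfolding G_def by (rule smooth_on_frechet[OF sF])
 have cG: "isCont G x" using smooth_on_continuous[OF sG] assms(1,3) by (simp add: continuous_on_eq_continuous_at)
 obtain r where r: "r > 0" "ball x r \<subseteq> V" using assms(1,3) openE by blast
 define B where "B = norm u + norm v + 1"
 have Bp: "B > 0" by (simp add: B_def add_nonneg_pos)
 have bd: "(b has_derivative fder b y) (at y)" if "y \<in> V" for y
  by (rule smooth_on_has_derivative[OF assms(2) that])
 have Fd: "(F has_derivative fder F y) (at y)" if "y \<in> V" for y
  by (rule smooth_on_has_derivative[OF sF that])
 have line: "((%t. f (y + t *\<^sub>R w)) has_real_derivative D w) (at t)"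
  if "(f has_derivative D) (at (y + t *\<^sub>R w))" for f :: "'a => real" and y w t D
 proof -
  have "((%t. y + t *\<^sub>R w) has_derivative (%t. t *\<^sub>R w)) (at t)"
   by (auto intro!: derivative_eq_intros)
  from has_derivative_compose[OF this that] show ?thesis
   by (simp add: has_field_derivative_def linear_cmul[OF has_derivative_linear[OF that]] mult_commute_abs)
 qed
 have key: "\<exists>y. dist y x <= h * B \<and>
   (b (x + h *\<^sub>R u + h *\<^sub>R v) - b (x + h *\<^sub>R u) - b (x + h *\<^sub>R v) + b x) / h^2 = G y"
  if h: "0 < h" "h * B < r" for h
 proof -
  have inV: "x + s *\<^sub>R u + t *\<^sub>R v \<in> V" and dst: "dist (x + s *\<^sub>R u + t *\<^sub>R v) x <= h * B"
   if "0 <= s" "s <= h" "0 <= t" "t <= h" for s t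
  proof -
   have "norm (s *\<^sub>R u + t *\<^sub>R v) <= s * norm u + t * norm v"
    using norm_triangle_ineq[of "s *\<^sub>R u" "t *\<^sub>R v"] that by simp
   also have "... <= h * norm u + h * norm v"
    using that by (intro add_mono mult_right_mono) auto
   also have "... <= h * B" using h by (simp add: B_def algebra_simps)
   finally have *: "norm (s *\<^sub>R u + t *\<^sub>R v) <= h * B" .
   then show "dist (x + s *\<^sub>R u + t *\<^sub>R v) x <= h * B" by (simp add: dist_norm add.assoc)
   then show "x + s *\<^sub>R u + t *\<^sub>R v \<in> V" using r(2) h(2) by (auto simp: mem_ball dist_commute)
  qed
  define phi where "phi = (%s. b ((x + h *\<^sub>R v) + s *\<^sub>R u) - b (x + s *\<^sub>R u))"
  have "(phi has_real_derivative (F ((x + h *\<^sub>R v) + s *\<^sub>R u) - F (x + s *\<^sub>R u))) (at s)" if "0 <= s" "s <= h" for s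
   unfolding phi_def F_def
   using inV[of s h] inV[of s 0] that h
   by (intro DERIV_diff line bd) (auto simp: add_ac)
  from MVT2[of 0 h phi, OF h(1) this] obtain s where s: "0 < s" "s < h"
   and e1: "phi h - phi 0 = h * (F ((x + h *\<^sub>R v) + s *\<^sub>R u) - F (x + s *\<^sub>R u))" by auto
  have "((%t. F ((x + s *\<^sub>R u) + t *\<^sub>R v)) has_real_derivative G ((x + s *\<^sub>R u) + t *\<^sub>R v)) (at t)" if "0 <= t" "t <= h" for t
   unfolding G_def using inV[of s t] that s by (intro line Fd) auto
  from MVT2[of 0 h "%t. F ((x + s *\<^sub>R u) + t *\<^sub>R v)", OF h(1) this] obtain t where t: "0 < t" "t < h"
   and e2: "F ((x + s *\<^sub>R u) + h *\<^sub>R v) - F (x + s *\<^sub>R u) = h * G ((x + s *\<^sub>R u) + t *\<^sub>R v)" by auto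
  have "b (x + h *\<^sub>R u + h *\<^sub>R v) - b (x + h *\<^sub>R u) - b (x + h *\<^sub>R v) + b x = phi h - phi 0"
   by (simp add: phi_def add_ac)
  also have "... = h^2 * G (x + s *\<^sub>R u + t *\<^sub>R v)"
   using e1 e2 by (simp add: power2_eq_square add_ac)
  finally show ?thesis using h(1) dst[of s t] s t by (intro exI[of _ "x + s *\<^sub>R u + t *\<^sub>R v"]) auto
 qed
 have "((%h. (b (x + h *\<^sub>R u + h *\<^sub>R v) - b (x + h *\<^sub>R u) - b (x + h *\<^sub>R v) + b x) / h^2) \<longlongrightarrow> G x) (at_right 0)"
 proof (rule tendstoI)
  fix e :: real assume "e > 0"
  then obtain d where d: "d > 0" "!!y. dist y x < d ==> dist (G y) (G x) < e"
   using cG unfolding continuous_at_eps_delta by metis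
  have "eventually (%h. h * B < min r d) (at_right 0)"
  proof (rule order_tendstoD(2))
   show "((%h. h * B) \<longlongrightarrow> 0) (at_right 0)" by (rule tendsto_eq_intros | simp)+
   show "0 < min r d" using r d by simp
  qed
  moreover have "eventually (%h::real. h > 0) (at_right 0)" by (simp add: eventually_at_right_less)
  ultimately show "eventually (%h. dist ((b (x + h *\<^sub>R u + h *\<^sub>R v) - b (x + h *\<^sub>R u) - b (x + h *\<^sub>R v) + b x) / h^2) (G x) < e) (at_right 0)"
  proof eventually_elim
   case (elim h)
   then obtain y where "dist y x <= h * B" "(b (x + h *\<^sub>R u + h *\<^sub>R v) - b (x + h *\<^sub>R u) - b (x + h *\<^sub>R v) + b x) / h^2 = G y"
    using key[of h] by auto
   then show ?case using d(2)[of y] elim by simp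
  qed
 qed
 then show ?thesis by (simp add: G_def F_def)
qed

lemma frechet_derivative_commute:
 fixes b :: "'a::euclidean_space => real"
 assumes "open V" "smooth_on V b" "x \<in> V"
 shows "fder (%x. frechet_derivative b (at x) u) x v =
  fder (%x. frechet_derivative b (at x) v) x u"
proof (rule tendsto_unique[OF _ mixed_second_difference[OF assms, of u v]])
 show "((%h. (b (x + h *\<^sub>R u + h *\<^sub>R v) - b (x + h *\<^sub>R u) - b (x + h *\<^sub>R v) + b x) / h^2)
  \<longlongrightarrow> fder (%x. frechet_derivative b (at x) v) x u) (at_right 0)"
 proof -
  have "b (x + h *\<^sub>R v + h *\<^sub>R u) - b (x + h *\<^sub>R v) - b (x + h *\<^sub>R u) + b x
   = b (x + h *\<^sub>R u + h *\<^sub>R v) - b (x + h *\<^sub>R u) - b (x + h *\<^sub>R v) + b x" for h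
   by (simp add: add_ac)
  then show ?thesis using mixed_second_difference[OF assms, of v u] by (simp only:)
 qed
qed simp

lemma pderiv_at_commute:
 fixes b :: "real^'n => real"
 assumes "open V" "smooth_on V b" "x \<in> V"
 shows "pderiv_at i (pderiv_at j b) x = pderiv_at j (pderiv_at i b) x"
 using frechet_derivative_commute[OF assms] by (simp add: pderiv_at_def[abs_def])

lemma integrable_continuous_compact:
 fixes g :: "'a::euclidean_space => 'b::euclidean_space"
 assumes "continuous_on UNIV g" "compact K" "!!x. x \<notin> K ==> g x = 0"
 shows "integrable lborel g"
proof -
 have "integrable lborel (%x. indicator K x *\<^sub>R g x)"
  by (rule borel_integrable_compact[OF assms(2) continuous_on_subset[OF assms(1)]]) simp
 moreover have "(%x. indicator K x *\<^sub>R g x) = g" using assms(3) by (auto simp: indicator_def)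
 ultimately show ?thesis by simp
qed

lemma integral_lborel_translation:
 fixes g :: "'a::euclidean_space => real"
 assumes [measurable]: "g \<in> Borel"
 shows "integral\<^sup>L lborel (%x. g (x + c)) = integral\<^sup>L lborel g"
proof -
 have "integral\<^sup>L lborel g = integral\<^sup>L (distr lborel borel ((+) c)) g"
  by (simp add: lborel_distr_plus)
 also have "... = integral\<^sup>L lborel (%x. g (c + x))" by (rule integral_distr) auto
 finally show ?thesis by (simp add: add.commute)
qed

lemma frechet_derivative_zero_outside:
 assumes "closed K" "!!x. x \<notin> K ==> f x = 0" "x \<notin> K"
 shows "fder f x v = 0"
proof -
 have "((%x. 0) has_derivative (%_. 0)) (at x)" by simp
 then have "(f has_derivative (%_. 0)) (at x)"
  by (rule has_derivative_transform_within_open[of _ _ _ _ "- K"]) (use assms in auto)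
 from frechet_derivative_at[OF this] show ?thesis by (metis)
qed

lemma pderiv_at_zero_outside:
 assumes "closed K" "!!x. x \<notin> K ==> f x = 0" "x \<notin> K"
 shows "pderiv_at i f x = 0"
 using frechet_derivative_zero_outside[OF assms] by (simp add: pderiv_at_def)

text \<open>Difference quotients of \<open>\<psi>\<close> have integral zero by translation invariance of the measure.\<close>

lemma integral_derivative_zero:
 fixes \<psi> :: "'a::euclidean_space => real"
 assumes s: "smooth_on UNIV \<psi>" and K: "compact K" and z: "!!x. x \<notin> K ==> \<psi> x = 0"
 shows "integral\<^sup>L lborel (%x. fder \<psi> x e) = 0"
proof -
 define D where "D = (%x. fder \<psi> x e)"
 have cD: "continuous_on UNIV D" unfolding D_def by (rule smooth_on_continuous[OF smooth_on_frechet[OF s]])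
 have c\<psi>: "continuous_on UNIV \<psi>" by (rule smooth_on_continuous[OF s])
 have zD: "D x = 0" if "x \<notin> K" for x
  unfolding D_def by (rule frechet_derivative_zero_outside[OF compact_imp_closed[OF K] z that])
 have [measurable]: "\<psi> \<in> Borel" "D \<in> Borel"
  using c\<psi> cD borel_measurable_continuous_onI by auto
 have "bounded (D ` K)" using compact_continuous_image[OF continuous_on_subset[OF cD] K] compact_imp_bounded by blast
 then obtain M where M: "M > 0" "!!x. x \<in> K ==> norm (D x) <= M"
  unfolding bounded_pos by auto
 have M': "\<bar>D x\<bar> <= M" for x using M zD[of x] by (cases "x \<in> K") auto
 obtain R where R: "!!x. x \<in> K ==> norm x <= R" using compact_imp_bounded[OF K] bounded_iff by blast
 have line: "((%t. \<psi> (y + t *\<^sub>R e)) has_real_derivative D (y + t *\<^sub>R e)) (at t)" for y t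
 proof -
  have d: "(\<psi> has_derivative fder \<psi> (y + t *\<^sub>R e)) (at (y + t *\<^sub>R e))"
   by (rule smooth_on_has_derivative[OF s]) simp
  have "((%t. y + t *\<^sub>R e) has_derivative (%t. t *\<^sub>R e)) (at t)"
   by (auto intro!: derivative_eq_intros)
  from has_derivative_compose[OF this d] show ?thesis
   by (simp add: has_field_derivative_def D_def linear_cmul[OF has_derivative_linear[OF d]] mult_commute_abs)
 qed
 define h where "h = (%n::nat. 1 / real (Suc n))"
 have h: "0 < h n" "h n <= 1" for n by (auto simp: h_def)
 have h0: "h ----> 0" unfolding h_def by (rule LIMSEQ_inverse_real_of_nat[unfolded inverse_eq_divide])
 define q where "q = (%n x. (\<psi> (x + h n *\<^sub>R e) - \<psi> x) / h n)"
 have lim: "(%n. integral\<^sup>L lborel (q n)) ----> integral\<^sup>L lborel D"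
 proof (rule integral_dominated_convergence[where w = "%x. M * indicator (cball 0 (R + norm e)) x"])
  show "integrable lborel (%x. M * indicator (cball 0 (R + norm e)) x :: real)"
   using emeasure_lborel_cball_finite by (intro integrable_mult_right integrable_real_indicator) auto
  show "AE x in lborel. (%n. q n x) ----> D x"
  proof (rule AE_I2)
   fix x
   have "((%t. (\<psi> (x + t *\<^sub>R e) - \<psi> x) / t) \<longlongrightarrow> D x) (at 0)"
    using line[of x 0] by (simp add: has_field_derivative_iff)
   moreover have "filterlim h (at 0) sequentially"
    using h0 h(1) by (auto simp: filterlim_at intro!: always_eventually less_imp_neq[symmetric])
   ultimately show "(%n. q n x) ----> D x"
    unfolding q_def by (rule filterlim_compose)
  qed
  show "AE x in lborel. norm (q n x) <= M * indicator (cball 0 (R + norm e)) x" for n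
  proof (rule AE_I2)
   fix x
   have "\<exists>z>0. z < h n \<and> \<psi> (x + h n *\<^sub>R e) - \<psi> (x + 0 *\<^sub>R e) = (h n - 0) * D (x + z *\<^sub>R e)"
    by (rule MVT2[OF h(1)]) (rule line)
   then obtain t where t: "0 < t" "t < h n" "\<psi> (x + h n *\<^sub>R e) - \<psi> x = h n * D (x + t *\<^sub>R e)" by auto
   have q: "q n x = D (x + t *\<^sub>R e)" using t(3) h(1)[of n] by (simp add: q_def)
   show "norm (q n x) <= M * indicator (cball 0 (R + norm e)) x"
   proof (cases "x + t *\<^sub>R e \<in> K")
    case True
    have "norm x <= norm (x + t *\<^sub>R e) + norm (t *\<^sub>R e)"
     using norm_triangle_ineq4[of "x + t *\<^sub>R e" "t *\<^sub>R e"] by simp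
    also have "norm (t *\<^sub>R e) <= norm e" using t h(2)[of n] by (simp add: mult_left_le_one_le)
    finally have "x \<in> cball 0 (R + norm e)" using R[OF True] by (simp add: mem_cball)
    then show ?thesis using M' q by simp
   next
    case False
    then show ?thesis using q zD M(1) by simp
   qed
  qed
 qed (auto simp: q_def)
 have i\<psi>: "integrable lborel \<psi>" by (rule integrable_continuous_compact[OF c\<psi> K z])
 have "integral\<^sup>L lborel (q n) = 0" for n
 proof -
  have "integrable lborel (%x. \<psi> (x + h n *\<^sub>R e))"
  proof (rule integrable_continuous_compact)
   show "continuous_on UNIV (%x. \<psi> (x + h n *\<^sub>R e))"
    by (intro continuous_on_compose2[OF c\<psi>] continuous_intros) auto
   show "compact ((%x. - (h n *\<^sub>R e) + x) ` K)" by (rule compact_translation[OF K])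
   show "\<psi> (x + h n *\<^sub>R e) = 0" if "x \<notin> (%x. - (h n *\<^sub>R e) + x) ` K" for x
    using that by (intro z) (force simp: image_iff)
  qed
  then show ?thesis unfolding q_def using i\<psi> integral_lborel_translation[of \<psi> "h n *\<^sub>R e"] by simp
 qed
 then show ?thesis using lim LIMSEQ_unique[of "%_. 0::real" 0] unfolding D_def by simp
qed

text \<open>The Jacobian determinant of the map \<open>(a, b)\<close>.\<close>

definition bracket :: "(real^2 => real) => (real^2 => real) => real^2 => real" where
 "bracket a b x = pderiv_at 1 a x * pderiv_at 2 b x - pderiv_at 2 a x * pderiv_at 1 b x"

lemma smooth_on_bracket: "open V ==> smooth_on V a ==> smooth_on V b ==> smooth_on V (bracket a b)"
 unfolding bracket_def[abs_def] by (intro smooth_on_diff smooth_on_mult smooth_on_pderiv)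

lemma bracket_antisym: "bracket a b x = - bracket b a x"
 by (simp add: bracket_def)

lemma pderiv_at_mult:
 fixes a b :: "real^'n => real"
 assumes "smooth_on V a" "smooth_on V b" "x \<in> V"
 shows "pderiv_at i (%x. a x * b x) x = a x * pderiv_at i b x + pderiv_at i a x * b x"
 using pderiv_at_eq[OF has_derivative_mult[OF smooth_on_has_derivative[OF assms(1,3)] smooth_on_has_derivative[OF assms(2,3)]], of i]
 by (simp add: pderiv_at_def)

lemma pderiv_at_diff:
 fixes a b :: "real^'n => real"
 assumes "smooth_on V a" "smooth_on V b" "x \<in> V"
 shows "pderiv_at i (%x. a x - b x) x = pderiv_at i a x - pderiv_at i b x"
 using pderiv_at_eq[OF has_derivative_diff[OF smooth_on_has_derivative[OF assms(1,3)] smooth_on_has_derivative[OF assms(2,3)]], of i]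
 by (simp add: pderiv_at_def)

text \<open>The two integrands differ by the divergence of \<open>(a phi d_2 b, - a phi d_1 b)\<close>, in which the second derivatives of \<open>b\<close>
 cancel by symmetry.\<close>

lemma integral_bracket_by_parts:
 assumes V: "open V" and K: "compact K" "K \<subseteq> V" and a: "smooth_on V a" and b: "smooth_on V b"
  and phi: "smooth_on UNIV phi" and z: "!!x. x \<notin> K ==> phi x = 0"
 shows "integrable lborel (%x. bracket a b x * phi x)"
  and "integrable lborel (%x. a x * bracket b phi x)"
  and "integral\<^sup>L lborel (%x. bracket a b x * phi x) = integral\<^sup>L lborel (%x. a x * bracket b phi x)"
proof -
 have phiV: "smooth_on V phi" by (rule smooth_on_subset[OF phi]) simp
 have cK: "closed K" using K(1) by (rule compact_imp_closed)
 have zp: "pderiv_at i phi x = 0" if "x \<notin> K" for i x by (rule pderiv_at_zero_outside[OF cK z that])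
 note ext = smooth_on_zero_extension[OF V cK K(2)]
 have s1: "smooth_on UNIV (%x. bracket a b x * phi x)"
  by (rule ext) (auto intro!: smooth_on_mult smooth_on_bracket V a b phiV z)
 have s2: "smooth_on UNIV (%x. a x * bracket b phi x)"
  by (rule ext) (auto intro!: smooth_on_mult smooth_on_bracket V a b phiV, simp add: bracket_def zp)
 show i1: "integrable lborel (%x. bracket a b x * phi x)"
  by (rule integrable_continuous_compact[OF smooth_on_continuous[OF s1] K(1)]) (simp add: z)
 show i2: "integrable lborel (%x. a x * bracket b phi x)"
  by (rule integrable_continuous_compact[OF smooth_on_continuous[OF s2] K(1)]) (simp add: zp bracket_def)
 define \<psi> where "\<psi> = (%j x. (a x * phi x) * pderiv_at j b x)"
 have s\<psi>V: "smooth_on V (\<psi> j)" for j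
  unfolding \<psi>_def by (intro smooth_on_mult smooth_on_pderiv V a b phiV)
 have z\<psi>: "\<psi> j x = 0" if "x \<notin> K" for j x by (simp add: \<psi>_def z[OF that])
 have s\<psi>: "smooth_on UNIV (\<psi> j)" for j by (rule ext[OF s\<psi>V z\<psi>])
 have int\<psi>: "integral\<^sup>L lborel (pderiv_at i (\<psi> j)) = 0" for i j
  using integral_derivative_zero[OF s\<psi> K(1) z\<psi>] by (simp add: pderiv_at_def[abs_def])
 have in\<psi>: "integrable lborel (pderiv_at i (\<psi> j))" for i j
  by (rule integrable_continuous_compact[OF smooth_on_continuous[OF smooth_on_pderiv[OF s\<psi>]] K(1)
     pderiv_at_zero_outside[OF cK z\<psi>]])
 have pt: "bracket a b x * phi x - a x * bracket b phi x = pderiv_at 1 (\<psi> 2) x - pderiv_at 2 (\<psi> 1) x" for x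
 proof (cases "x \<in> V")
  case True
  have p: "pderiv_at i (\<psi> j) x = (a x * phi x) * pderiv_at i (pderiv_at j b) x
    + (a x * pderiv_at i phi x + pderiv_at i a x * phi x) * pderiv_at j b x" for i j
   unfolding \<psi>_def
   by (subst pderiv_at_mult[OF smooth_on_mult[OF V a phiV] smooth_on_pderiv[OF b] True])
    (simp add: pderiv_at_mult[OF a phiV True])
  show ?thesis
   unfolding p bracket_def using pderiv_at_commute[OF V b True, of 1 2]
   by (simp add: algebra_simps)
 next
  case False
  then have "x \<notin> K" using K(2) by auto
  then show ?thesis using z zp pderiv_at_zero_outside[OF cK z\<psi>] by (simp add: bracket_def)
 qed
 have "integral\<^sup>L lborel (%x. bracket a b x * phi x) - integral\<^sup>L lborel (%x. a x * bracket b phi x)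
   = integral\<^sup>L lborel (%x. pderiv_at 1 (\<psi> 2) x - pderiv_at 2 (\<psi> 1) x)"
  using i1 i2 by (simp add: pt[symmetric])
 also have "... = 0" using in\<psi> int\<psi> by simp
 finally show "integral\<^sup>L lborel (%x. bracket a b x * phi x) = integral\<^sup>L lborel (%x. a x * bracket b phi x)" by simp
qed

section \<open>Lipschitz bounds and convolutions\<close>

lemma onorm_le_sum_Basis:
 fixes D :: "'a::euclidean_space => 'b::euclidean_space"
 assumes "linear D"
 shows "norm (D v) <= (\<Sum>b\<in>Basis. norm (D b)) * norm v"
proof -
 have "D v = (\<Sum>b\<in>Basis. (v \<bullet> b) *\<^sub>R D b)"
  by (subst (1) euclidean_representation[symmetric, of v])
   (simp add: linear_sum[OF assms] linear_cmul[OF assms])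
 also have "norm ... <= (\<Sum>b\<in>Basis. norm v * norm (D b))"
  by (rule order_trans[OF norm_sum]) (auto intro!: sum_mono mult_right_mono Basis_le_norm)
 finally show ?thesis by (simp add: sum_distrib_left mult.commute)
qed

lemma smooth_derivative_bounded:
 fixes f :: "'a::euclidean_space => 'b::euclidean_space"
 assumes "smooth_on V f" "compact K" "K \<subseteq> V"
 obtains M where "M >= 0" "!!x v. x \<in> K ==> norm (fder f x v) <= M * norm v"
proof -
 have "\<exists>M\<ge>0. \<forall>x\<in>K. norm (fder f x b) <= M" for b
 proof -
  have "continuous_on K (%x. fder f x b)"
   by (rule continuous_on_subset[OF smooth_on_continuous[OF smooth_on_frechet[OF assms(1)]] assms(3)])
  then have "bounded ((%x. fder f x b) ` K)"
   using compact_continuous_image assms(2) compact_imp_bounded by blast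
  then obtain M where "\<forall>x\<in>K. norm (fder f x b) <= M"
   unfolding bounded_iff by auto
  then show ?thesis by (intro exI[of _ "max 0 M"]) (auto simp: le_max_iff_disj)
 qed
 then obtain M where M: "!!b. M b >= 0" "!!b x. x \<in> K ==> norm (fder f x b) <= M b"
  by metis
 show ?thesis
 proof
  show "(\<Sum>b\<in>Basis. M b) >= 0" using M(1) by (simp add: sum_nonneg)
  fix x v assume x: "x \<in> K"
  have "linear (fder f x)"
   using smooth_on_has_derivative[OF assms(1)] x assms(3) has_derivative_linear by blast
  from onorm_le_sum_Basis[OF this, of v]
  show "norm (fder f x v) <= (\<Sum>b\<in>Basis. M b) * norm v"
   by (rule order_trans) (auto intro!: mult_right_mono sum_mono M(2)[OF x])
 qed
qed

lemma derivative_bound_Lipschitz: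
 fixes f :: "'a::euclidean_space => 'b::euclidean_space"
 assumes "smooth_on V f" "S \<subseteq> V" "convex S" "M >= 0"
  and M: "!!x v. x \<in> S ==> norm (fder f x v) <= M * norm v"
  and "x \<in> S" "y \<in> S"
 shows "norm (f x - f y) <= M * norm (x - y)"
proof (rule differentiable_bound[OF assms(3), of f "%x. fder f x"])
 show "(f has_derivative fder f x) (at x within S)" if "x \<in> S" for x
  using smooth_on_has_derivative[OF assms(1)] that assms(2) has_derivative_at_withinI by blast
 show "onorm (fder f x) <= M" if "x \<in> S" for x
  by (rule onorm_le) (rule M[OF that])
qed (use assms in auto)

lemma smooth_Lipschitz_on_convex:
 fixes f :: "'a::euclidean_space => 'b::euclidean_space"
 assumes "smooth_on V f" "compact S" "S \<subseteq> V" "convex S"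
 obtains M where "M >= 0" "!!x y. x \<in> S ==> y \<in> S ==> norm (f x - f y) <= M * norm (x - y)"
proof -
 from smooth_derivative_bounded[OF assms(1-3)] obtain M where
  M: "M >= 0" "!!x v. x \<in> S ==> norm (fder f x v) <= M * norm v" by blast
 show ?thesis
  by (rule that[OF M(1)]) (rule derivative_bound_Lipschitz[OF assms(1,3,4) M])
qed

lemma smooth_compact_support_Lipschitz:
 fixes f :: "'a::euclidean_space => 'b::euclidean_space"
 assumes "smooth_on UNIV f" "compact K" "!!x. x \<notin> K ==> f x = 0"
 obtains M where "M >= 0" "!!x v. norm (fder f x v) <= M * norm v"
  "!!x y. norm (f x - f y) <= M * norm (x - y)"
proof -
 from smooth_derivative_bounded[OF assms(1,2)] obtain M where
  M: "M >= 0" "!!x v. x \<in> K ==> norm (fder f x v) <= M * norm v" by blast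
 have M': "norm (fder f x v) <= M * norm v" for x v
  using M frechet_derivative_zero_outside[OF compact_imp_closed[OF assms(2)] assms(3)]
  by (cases "x \<in> K") auto
 show ?thesis
  by (rule that[OF M(1) M']) (rule derivative_bound_Lipschitz[OF assms(1) _ _ M(1) M', of UNIV], auto)
qed

definition conv :: "('a::euclidean_space => real) => ('a => real) => 'a => real" where
 "conv k f x = (LBINT z. k (x - z) * f z)"

lemma conv_integrable:
 fixes k f :: "'a::euclidean_space => real"
 assumes "continuous_on UNIV k" "!!y. \<bar>k y\<bar> <= M" "integrable lborel f"
 shows "integrable lborel (%z. k (x - z) * f z)"
proof (rule Bochner_Integration.integrable_bound[where f = "%z. M * f z"])
 show "integrable lborel (%z. M * f z)" using assms(3) by simp
 have [measurable]: "k \<in> Borel" using assms(1) by (rule borel_measurable_continuous_onI)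
 have [measurable]: "f \<in> Borel" using assms(3) by (simp add: borel_measurable_integrable)
 show "(%z. k (x - z) * f z) \<in> borel_measurable lborel" by measurable
 show "AE z in lborel. norm (k (x - z) * f z) <= norm (M * f z)"
 proof (rule AE_I2)
  fix z
  have "\<bar>k (x - z)\<bar> <= \<bar>M\<bar>" using assms(2)[of "x - z"] by linarith
  then show "norm (k (x - z) * f z) <= norm (M * f z)" by (simp add: abs_mult mult_right_mono)
 qed
qed

lemma smooth_compact_support_bounded:
 fixes f :: "'a::euclidean_space => real"
 assumes "smooth_on UNIV f" "compact K" "!!x. x \<notin> K ==> f x = 0"
 obtains M where "M >= 0" "!!x. \<bar>f x\<bar> <= M"
proof -
 have "bounded (f ` K)"
  using compact_continuous_image[OF continuous_on_subset[OF smooth_on_continuous[OF assms(1)]] assms(2)] compact_imp_bounded by blast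
 then obtain M where "\<forall>x\<in>K. \<bar>f x\<bar> <= M" unfolding bounded_iff by auto
 then have "\<bar>f x\<bar> <= max 0 M" for x using assms(3)[of x] by (cases "x \<in> K") (auto simp: le_max_iff_disj)
 then show ?thesis using that[of "max 0 M"] by auto
qed

lemma second_order_remainder:
 fixes k :: "'a::euclidean_space => real"
 assumes s: "smooth_on UNIV k" and K: "compact K" and z: "!!x. x \<notin> K ==> k x = 0"
 obtains M where "!!y h. \<bar>k (y + h) - k y - fder k y h\<bar> <= M * norm h ^ 2"
proof -
 have cK: "closed K" using K by (rule compact_imp_closed)
 have "\<exists>M\<ge>0. \<forall>x y. norm (fder k x b - fder k y b) <= M * norm (x - y)" for b
  using smooth_compact_support_Lipschitz[OF smooth_on_frechet[OF s] K frechet_derivative_zero_outside[OF cK z]] by metis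
 then obtain M where M: "!!b. M b >= 0" "!!b x y. norm (fder k x b - fder k y b) <= M b * norm (x - y)"
  by metis
 have d: "(k has_derivative fder k y) (at y)" for y
  by (rule smooth_on_has_derivative[OF s]) simp
 have lin: "linear (fder k y)" for y using d by (rule has_derivative_linear)
 show ?thesis
 proof (rule that[of "\<Sum>b\<in>Basis. M b"])
  fix y h
  have "((%t. k (y + t *\<^sub>R h)) has_real_derivative fder k (y + t *\<^sub>R h) h) (at t)" for t
  proof -
   have "((%t. y + t *\<^sub>R h) has_derivative (%t. t *\<^sub>R h)) (at t)"
    by (auto intro!: derivative_eq_intros)
   from has_derivative_compose[OF this d] show ?thesis
    by (simp add: has_field_derivative_def linear_cmul[OF lin] mult_commute_abs)
  qed
  then have "\<exists>z::real>0. z < 1 \<and> k (y + 1 *\<^sub>R h) - k (y + 0 *\<^sub>R h) = (1 - 0) * fder k (y + z *\<^sub>R h) h"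
   by (intro MVT2) auto
  then obtain t where t: "0 < t" "t < 1" "k (y + h) - k y = fder k (y + t *\<^sub>R h) h" by auto
  have "linear (%v. fder k (y + t *\<^sub>R h) v - fder k y v)"
   by (intro linear_compose_sub lin)
  from onorm_le_sum_Basis[OF this, of h]
  have "\<bar>k (y + h) - k y - fder k y h\<bar> <=
   (\<Sum>b\<in>Basis. norm (fder k (y + t *\<^sub>R h) b - fder k y b)) * norm h"
   using t(3) by simp
  also have "... <= (\<Sum>b\<in>Basis. M b * norm h) * norm h"
  proof (intro mult_right_mono sum_mono)
   fix b :: 'a
   have "norm (fder k (y + t *\<^sub>R h) b - fder k y b) <= M b * norm (t *\<^sub>R h)"
    using M(2)[of "y + t *\<^sub>R h" b y] by simp
   also have "... <= M b * norm h" using t M(1)[of b] by (intro mult_left_mono) (auto simp: mult_left_le_one_le)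
   finally show "norm (fder k (y + t *\<^sub>R h) b - fder k y b) <= M b * norm h" .
  qed simp
  finally show "\<bar>k (y + h) - k y - fder k y h\<bar> <= (\<Sum>b\<in>Basis. M b) * norm h ^ 2"
   by (simp add: sum_distrib_right power2_eq_square mult.assoc)
 qed
qed

lemma conv_has_derivative:
 fixes k f :: "'a::euclidean_space => real"
 assumes s: "smooth_on UNIV k" and K: "compact K" and z: "!!x. x \<notin> K ==> k x = 0" and f: "integrable lborel f"
 shows "(conv k f has_derivative (%v. conv (%y. fder k y v) f x)) (at x)"
proof -
 have cK: "closed K" using K by (rule compact_imp_closed)
 have d: "(k has_derivative fder k y) (at y)" for y
  by (rule smooth_on_has_derivative[OF s]) simp
 have lin: "linear (fder k y)" for y using d by (rule has_derivative_linear)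
 have i0: "integrable lborel (%z. k (x - z) * f z)" for x
  using smooth_compact_support_bounded[OF s K z] conv_integrable[OF smooth_on_continuous[OF s] _ f] by metis
 have i1: "integrable lborel (%z. fder k (x - z) v * f z)" for v
  using smooth_compact_support_bounded[OF smooth_on_frechet[OF s] K frechet_derivative_zero_outside[OF cK z], of v]
   conv_integrable[OF smooth_on_continuous[OF smooth_on_frechet[OF s]] _ f] by metis
 obtain M where M: "!!y h. \<bar>k (y + h) - k y - fder k y h\<bar> <= M * norm h ^ 2"
  using second_order_remainder[OF s K z] by metis
 let ?L = "%v. conv (%y. fder k y v) f x"
 have "linear ?L"
 proof (rule linearI)
  show "?L (u + v) = ?L u + ?L v" for u v
   unfolding conv_def Bochner_Integration.integral_add[OF i1 i1, symmetric]
   by (simp add: linear_add[OF lin] algebra_simps)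
  show "?L (c *\<^sub>R u) = c *\<^sub>R ?L u" for c u
   unfolding conv_def by (simp add: linear_cmul[OF lin] mult.assoc)
 qed
 then have bl: "bounded_linear ?L" by (simp add: linear_conv_bounded_linear)
 define I where "I = (LBINT z. \<bar>f z\<bar>)"
 have est: "norm (conv k f (x + h) - conv k f x - ?L h) <= (M * I * norm h) * norm h" for h
 proof -
  have "conv k f (x + h) - conv k f x - ?L h =
   (LBINT z. (k ((x - z) + h) - k (x - z) - fder k (x - z) h) * f z)"
   unfolding conv_def using i0[of "x + h"] i0[of x] i1[of h]
   by (simp add: algebra_simps flip: Bochner_Integration.integral_diff)
  also have "norm ... <= (LBINT z. M * norm h ^ 2 * \<bar>f z\<bar>)"
  proof (rule order_trans[OF integral_norm_bound integral_mono])
   show "integrable lborel (%z. norm ((k ((x - z) + h) - k (x - z) - fder k (x - z) h) * f z))"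
    using i0[of "x + h"] i0[of x] i1[of h] by (intro integrable_norm) (simp add: algebra_simps)
   show "integrable lborel (%z. M * norm h ^ 2 * \<bar>f z\<bar>)" using f by simp
  qed (auto simp: abs_mult intro!: mult_right_mono M)
  also have "... = (M * I * norm h) * norm h" by (simp add: I_def power2_eq_square)
  finally show ?thesis .
 qed
 have "((%h. norm (conv k f (x + h) - conv k f x - ?L h) / norm h) \<longlongrightarrow> 0) (at 0)"
 proof (rule Lim_null_comparison)
  show "\<forall>\<^sub>F h in at 0. norm (norm (conv k f (x + h) - conv k f x - ?L h) / norm h) <= M * I * norm h"
   using est by (auto simp: eventually_at_filter divide_le_eq intro!: always_eventually)
  show "((%h::'a. M * I * norm h) \<longlongrightarrow> 0) (at 0)" by (rule tendsto_eq_intros | simp)+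
 qed
 then show ?thesis using bl by (simp add: has_derivative_at)
qed

section \<open>Normalized mollification\<close>

definition bump :: "'a::euclidean_space => real" where "bump y = flat (1 - y \<bullet> y)"

lemma smooth_on_bump: "smooth_on UNIV (bump :: 'a::euclidean_space => real)"
proof -
 have "smooth_on UNIV (%y::'a. y \<bullet> y)"
 proof -
  have "smooth_on UNIV (%y::'a. y \<bullet> b)" for b
   by (rule smooth_on_bounded_linear[OF bounded_linear_inner_left]) (auto simp: smooth_on_def Ck_on_id)
  then have "smooth_on UNIV (%y::'a. (y \<bullet> b) * (y \<bullet> b))" for b by (intro smooth_on_mult) auto
  then have sq: "smooth_on UNIV (%y::'a. (y \<bullet> b) * (y \<bullet> b))" for b .
  have "smooth_on UNIV (%y::'a. \<Sum>b\<in>B. (y \<bullet> b) * (y \<bullet> b))" if "finite B" for B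
   using that by (induction B rule: finite_induct) (auto intro!: smooth_on_add smooth_on_const sq)
  from this[OF finite_Basis] show ?thesis by (simp add: euclidean_inner[symmetric])
 qed
 then show ?thesis unfolding bump_def[abs_def]
  by (intro smooth_on_flat smooth_on_diff smooth_on_const) auto
qed

lemma bump_nonneg: "0 <= bump y" and bump_le_1: "bump y <= 1"
 by (auto simp: bump_def flat_nonneg flat_le_1)

lemma bump_pos_iff: "bump y > 0 \<longleftrightarrow> norm y < 1"
proof -
 have "y \<bullet> y < 1 \<longleftrightarrow> norm y < 1" by (simp add: power2_norm_eq_inner[symmetric] abs_square_less_1)
 then show ?thesis by (simp add: bump_def flat_pos_iff)
qed

lemma bump_zero: "norm y >= 1 ==> bump y = 0"
 using bump_pos_iff[of y] bump_nonneg[of y] by linarith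

definition bump_lower :: real where "bump_lower = exp (- (16/7))"

lemma bump_lower_pos: "bump_lower > 0" by (simp add: bump_lower_def)

lemma bump_ge_lower: assumes "norm y <= 3/4" shows "bump y >= bump_lower"
proof -
 have "y \<bullet> y <= (3/4)^2" using assms by (simp add: power2_norm_eq_inner[symmetric] power_mono)
 then have a: "1 - y \<bullet> y >= 7/16" by (simp add: power2_eq_square)
 then have "inverse (1 - y \<bullet> y) <= inverse (7/16)" by (intro le_imp_inverse_le) auto
 then show ?thesis using a by (simp add: bump_def flat_eq bump_lower_def)
qed

definition rbump :: "real => 'a::euclidean_space => real" where "rbump r y = bump (y /\<^sub>R r)"

lemma smooth_on_rbump: "smooth_on UNIV (rbump r :: 'a::euclidean_space => real)"
 unfolding smooth_on_def
proof
 show "Ck_on k UNIV (rbump r :: 'a => real)" for k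
  using Ck_on_compose_affine[OF smooth_onD[OF smooth_on_bump], of k "inverse r" 0]
  by (simp add: rbump_def[abs_def])
qed

lemma rbump_nonneg: "0 <= rbump r y" and rbump_le_1: "rbump r y <= 1"
 by (auto simp: rbump_def bump_nonneg bump_le_1)

lemma rbump_zero: "r > 0 ==> norm y >= r ==> rbump r y = 0"
 by (auto simp: rbump_def field_simps intro!: bump_zero)

lemma rbump_ge_lower: "r > 0 ==> norm y <= 3/4 * r ==> rbump r y >= bump_lower"
 by (auto simp: rbump_def field_simps intro!: bump_ge_lower)

lemma rbump_zero': "r > 0 ==> y \<notin> cball 0 r ==> rbump r y = 0"
 by (rule rbump_zero) auto

lemma rbump_derivative_bound:
 obtains M where "M > 0" "!!r (y::'a::euclidean_space) (v::'a). r > 0 ==> \<bar>fder (rbump r) y v\<bar> <= M / r * norm v"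
proof -
 obtain M where M: "M >= 0" "!!(x::'a) v. norm (fder bump x v) <= M * norm v"
  using smooth_compact_support_Lipschitz[OF smooth_on_bump compact_cball[of 0 1]] bump_zero
  by (metis dual_order.order_iff_strict linorder_not_le mem_cball_0)
 show ?thesis
 proof (rule that[of "M + 1"])
  fix r :: real and y v :: 'a assume r: "r > 0"
  have d: "(bump has_derivative fder bump (y /\<^sub>R r)) (at (y /\<^sub>R r))"
   by (rule smooth_on_has_derivative[OF smooth_on_bump]) simp
  have "((%y. y /\<^sub>R r) has_derivative (%v. v /\<^sub>R r)) (at y)" by (auto intro!: derivative_eq_intros)
  from has_derivative_compose[OF this d]
  have "(rbump r has_derivative (%v. fder bump (y /\<^sub>R r) (v /\<^sub>R r))) (at y)"
   by (simp add: rbump_def[abs_def])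
  from frechet_derivative_at[OF this]
  have "\<bar>fder (rbump r) y v\<bar> <= M * norm (v /\<^sub>R r)"
   using M(2)[of "y /\<^sub>R r" "v /\<^sub>R r"] by (metis real_norm_def)
  also have "... <= (M + 1) / r * norm v" using r by (simp add: field_simps)
  finally show "\<bar>fder (rbump r) y v\<bar> <= (M + 1) / r * norm v" .
 qed (use M in simp)
qed

text \<open>Dividing by this mass makes \<open>mollify\<close> reproduce constants also near the boundary of \<open>A\<close>; this replaces an extension
 operator for functions on \<open>A\<close>.\<close>

definition mollifier_mass :: "'a::euclidean_space set => real => 'a => real" where
 "mollifier_mass A r x = (LBINT z. rbump r (x - z) * indicator A z)"

definition mollify :: "'a::euclidean_space set => real => ('a => real) => 'a => real" where
 "mollify A r f x = (LBINT z. rbump r (x - z) * (indicator A z * f z)) / mollifier_mass A r x"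

lemma emeasure_cball_2: "r >= 0 ==> emeasure lborel (cball (x::real^2) r) = ennreal (pi * r^2)"
 using content_cball[of r x] emeasure_eq_ennreal_measure[of lborel "cball x r"] emeasure_lborel_cball_finite[of x r]
 by (simp add: unit_ball_vol_2 measure_def)

lemma emeasure_ball_2: "r >= 0 ==> emeasure lborel (ball (x::real^2) r) = ennreal (pi * r^2)"
 using content_ball[of r x] emeasure_eq_ennreal_measure[of lborel "ball x r"] emeasure_lborel_ball_finite[of x r]
 by (simp add: unit_ball_vol_2 measure_def)

definition locally_integrable :: "('a::euclidean_space => real) => bool" where
 "locally_integrable f \<longleftrightarrow> f \<in> Borel \<and> (\<forall>R. integrable lborel (%z. indicator (cball 0 R) z * f z))"

abbreviation locally_integrable_on :: "'a::euclidean_space set => ('a => real) => bool" where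
 "locally_integrable_on A f == locally_integrable (%z. indicator A z * f z)"

lemma integrable_locally_integrable:
 assumes "integrable lborel f" shows "locally_integrable f"
 unfolding locally_integrable_def
proof (intro conjI allI)
 show "f \<in> Borel" using assms by (simp add: borel_measurable_integrable)
 fix R show "integrable lborel (%z. indicator (cball 0 R) z * f z)"
  using integrable_mult_indicator[OF _ assms, of "cball 0 R"] by simp
qed

lemma bounded_locally_integrable:
 assumes [measurable]: "f \<in> Borel" and "!!x. \<bar>f x\<bar> <= M"
 shows "locally_integrable f"
 unfolding locally_integrable_def
proof (intro conjI allI)
 fix R
 have "integrable lborel (%z::'a. M * indicator (cball 0 R) z :: real)"
  using emeasure_lborel_cball_finite by (intro integrable_mult_right integrable_real_indicator) auto
 then show "integrable lborel (%z. indicator (cball 0 R) z * f z)"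
 proof (rule Bochner_Integration.integrable_bound)
  show "AE z in lborel. norm (indicator (cball 0 R) z * f z) <= norm (M * indicator (cball 0 R) z)"
  proof (rule AE_I2)
   fix z show "norm (indicator (cball 0 R) z * f z) <= norm (M * indicator (cball 0 R) z)"
    using assms(2)[of z] by (auto simp: indicator_def)
  qed
  have "(%z. indicator (cball 0 R) z * f z) \<in> Borel"
   by (intro borel_measurable_times assms(1) borel_measurable_indicator) simp
  then show "(%z. indicator (cball 0 R) z * f z) \<in> borel_measurable lborel" by simp
 qed
qed (rule assms)

lemma conv_restrict:
 assumes z: "!!y. y \<notin> cball 0 R0 ==> k y = 0" and "norm x <= R"
 shows "conv k f x = conv k (%z. indicator (cball 0 (R + R0)) z * f z) x"
 unfolding conv_def
proof (rule Bochner_Integration.integral_cong[OF refl])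
 fix y
 show "k (x - y) * f y = k (x - y) * (indicator (cball 0 (R + R0)) y * f y)"
 proof (cases "y \<in> cball 0 (R + R0)")
  case False
  have "norm y <= norm x + norm (x - y)" using norm_triangle_ineq4[of x "x - y"] by simp
  then have "x - y \<notin> cball 0 R0" using False assms(2) by auto
  then show ?thesis using z by simp
 qed simp
qed

lemma conv_locally_has_derivative:
 fixes k f :: "'a::euclidean_space => real"
 assumes s: "smooth_on UNIV k" and z: "!!y. y \<notin> cball 0 R0 ==> k y = 0" and f: "locally_integrable f"
 shows "(conv k f has_derivative (%v. conv (%y. fder k y v) f x)) (at x)"
proof -
 let ?R = "norm x + 1"
 let ?f = "%z. indicator (cball 0 (?R + R0)) z * f z"
 have i: "integrable lborel ?f" using f by (auto simp: locally_integrable_def)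
 have "(conv k ?f has_derivative (%v. conv (%y. fder k y v) ?f x)) (at x)"
  by (rule conv_has_derivative[OF s compact_cball z i])
 then have "(conv k f has_derivative (%v. conv (%y. fder k y v) ?f x)) (at x)"
  by (rule has_derivative_transform_within_open[of _ _ _ _ "ball 0 ?R"])
   (auto intro!: conv_restrict[symmetric] z simp: dist_norm)
 moreover have "conv (%y. fder k y v) ?f x = conv (%y. fder k y v) f x" for v
  by (rule conv_restrict[symmetric]) (auto intro!: frechet_derivative_zero_outside[OF closed_cball z])
 ultimately show ?thesis by simp
qed

lemma smooth_on_conv_locally:
 fixes k f :: "'a::euclidean_space => real"
 assumes s: "smooth_on UNIV k" and z: "!!y. y \<notin> cball 0 R0 ==> k y = 0" and f: "locally_integrable f"
 shows "smooth_on UNIV (conv k f)"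
proof -
 have "Ck_on n UNIV (conv k f)" for n
  using s z
 proof (induction n arbitrary: k)
  case 0
  have "isCont (conv k f) x" for x
   using has_derivative_continuous[OF conv_locally_has_derivative[OF 0(1) 0(2) f]] .
  then show ?case by (simp add: continuous_at_imp_continuous_on)
 next
  case (Suc n)
  show ?case
  proof (rule Ck_on_SucI)
   show "(conv k f has_derivative (%v. conv (%y. fder k y v) f x)) (at x)" for x
    by (rule conv_locally_has_derivative[OF Suc.prems(1) Suc.prems(2) f])
   show "Ck_on n UNIV (conv (%y. fder k y v) f)" for v
    by (rule Suc.IH[OF smooth_on_frechet[OF Suc.prems(1)]
       frechet_derivative_zero_outside[OF closed_cball Suc.prems(2)]])
  qed simp
 qed
 then show ?thesis by (simp add: smooth_on_def)
qed

lemma mollifier_mass_conv: "mollifier_mass A r = conv (rbump r) (indicator A)"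
 by (simp add: mollifier_mass_def conv_def fun_eq_iff)

lemma mollify_conv: "mollify A r f x = conv (rbump r) (%z. indicator A z * f z) x / mollifier_mass A r x"
 by (simp add: mollify_def conv_def)

lemma indicator_locally_integrable:
 "A \<in> sets borel ==> locally_integrable (indicator A :: 'a::euclidean_space => real)"
 by (rule bounded_locally_integrable[of _ 1]) (auto simp: indicator_def)

lemma smooth_on_mollifier_mass: "r > 0 ==> A \<in> sets borel ==> smooth_on UNIV (mollifier_mass A r)"
 unfolding mollifier_mass_conv
 by (rule smooth_on_conv_locally[OF smooth_on_rbump rbump_zero' indicator_locally_integrable])

lemma smooth_on_inverse:
 fixes g :: "'a::euclidean_space => real"
 shows "open S ==> smooth_on S g ==> (!!x. x \<in> S ==> g x ~= 0) ==> smooth_on S (%x. inverse (g x))"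
 by (simp add: smooth_on_def Ck_on_inverse)

lemma smooth_on_mollify:
 assumes r: "r > 0" and A: "A \<in> sets borel" and f: "locally_integrable_on A f"
  and S: "open S" "!!x. x \<in> S ==> mollifier_mass A r x ~= 0"
 shows "smooth_on S (mollify A r f)"
proof -
 have 1: "smooth_on S (conv (rbump r) (%z. indicator A z * f z))"
  by (rule smooth_on_subset[OF smooth_on_conv_locally[OF smooth_on_rbump rbump_zero' f]]) (use r in auto)
 have 2: "smooth_on S (mollifier_mass A r)"
  by (rule smooth_on_subset[OF smooth_on_mollifier_mass[OF r A]]) simp
 have "smooth_on S (%x. conv (rbump r) (%z. indicator A z * f z) x * inverse (mollifier_mass A r x))"
  by (intro smooth_on_mult smooth_on_inverse 1 2 S)
 then show ?thesis by (simp add: mollify_conv[abs_def] divide_inverse)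
qed

section \<open>Kernels of mean zero\<close>

definition zero_mean_kernel :: "(real^2 => real) => (real^2) set => real => bool" where
 "zero_mean_kernel kappa S B \<longleftrightarrow> kappa \<in> Borel \<and> (\<forall>z. \<bar>kappa z\<bar> <= B) \<and> (\<forall>z. z \<notin> S --> kappa z = 0)
   \<and> (LBINT z. kappa z) = 0"

definition pair_osc :: "real => (real^2) set => (real^2 => real) => ennreal" where
 "pair_osc p S f = (NN z. (NN w. indicator S z * indicator S w * epow p (f z - f w)))"

lemma powr_young:
 fixes g lam p :: real
 assumes "g >= 0" "lam > 0" "p >= 1" shows "g <= lam + lam powr (1 - p) * g powr p"
proof (cases "g <= lam")
 case True then show ?thesis by (simp add: add_increasing2)
next
 case False
 then have g: "g > 0" using assms by simp
 have "1 <= (g / lam) powr (p - 1)" using False assms by (intro ge_one_powr_ge_zero) (auto simp: field_simps)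
 then have "g * 1 <= g * (g / lam) powr (p - 1)" using g by (intro mult_left_mono) auto
 also have "... = g powr 1 * (g powr (p - 1) * lam powr (1 - p))"
  using g assms by (simp add: powr_divide powr_diff)
 also have "... = lam powr (1 - p) * g powr p" using g powr_mult_base[of g "p - 1"] by (simp add: mult.assoc[symmetric])
 finally show ?thesis using assms by simp
qed

text \<open>Since \<open>kappa\<close> has mean zero, its integral against \<open>f\<close> is the average over \<open>w \<in> S\<close> of the integrals of
 \<open>kappa z * (f z - f w)\<close>. The power \<open>p\<close> then enters as in Jensen's inequality, through \<open>powr_young\<close>.\<close>

lemma zero_mean_kernel_bound:
 fixes f :: "real^2 => real"
 assumes k: "zero_mean_kernel kappa S (M / r^2)" and S: "S \<in> sets borel"
  and r: "r > 0" and c: "c > 0" "ennreal (c * r^2) <= emeasure lborel S" and L: "emeasure lborel S <= ennreal (L * r^2)"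
  and M: "M > 0" and p: "p >= 1" and f: "f \<in> Borel" "integrable lborel (%z. indicator S z * f z)"
 shows "epow p (LBINT z. kappa z * f z) <= ennreal (2 * M / c * (2 * M * L) powr (p - 1) / r^4) * pair_osc p S f"
proof -
 have [measurable]: "kappa \<in> Borel" "S \<in> sets borel" "f \<in> Borel"
  and kB: "!!z. \<bar>kappa z\<bar> <= M / r^2" and kS: "!!z. z \<notin> S ==> kappa z = 0" and k0: "(LBINT z. kappa z) = 0"
  using k S f by (auto simp: zero_mean_kernel_def)
 define m where "m = measure lborel S"
 have fin: "emeasure lborel S < \<infinity>" using L by (simp add: order_le_less_trans)
 then have em: "emeasure lborel S = ennreal m" by (simp add: m_def emeasure_eq_ennreal_measure)
 have mpos: "c * r^2 <= m" using c(2) em by (simp add: m_def)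
 have m0: "m > 0" using mpos c(1) r by (smt (verit) mult_pos_pos zero_less_power)
 have "L * r^2 >= 0" using L em m0 by (metis ennreal_neg ennreal_le_iff2 linorder_le_cases not_le)
 then have mL: "m <= L * r^2" using L em by simp
 have L0: "L > 0" using mL m0 r by (smt (verit) mult_nonpos_nonneg zero_le_power)
 define t where "t = \<bar>LBINT z. kappa z * f z\<bar>"
 have ik: "integrable lborel kappa"
 proof (rule Bochner_Integration.integrable_bound[where f = "%z. (M / r^2) * indicator S z"])
  show "integrable lborel (%z. (M / r^2) * indicator S z :: real)"
   using fin by (intro integrable_mult_right integrable_real_indicator) auto
  show "AE z in lborel. norm (kappa z) <= norm ((M / r^2) * indicator S z :: real)"
  proof (rule AE_I2)
   fix z show "norm (kappa z) <= norm ((M / r^2) * indicator S z :: real)"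
    using kB[of z] kS[of z] M by (cases "z \<in> S") auto
  qed
 qed simp
 have ikf: "integrable lborel (%z. kappa z * f z)"
 proof (rule Bochner_Integration.integrable_bound[where f = "%z. (M / r^2) * (indicator S z * f z)"])
  show "integrable lborel (%z. (M / r^2) * (indicator S z * f z))" using f(2) by simp
  show "AE z in lborel. norm (kappa z * f z) <= norm ((M / r^2) * (indicator S z * f z))"
  proof (rule AE_I2)
   fix z show "norm (kappa z * f z) <= norm ((M / r^2) * (indicator S z * f z))"
    using mult_right_mono[OF kB[of z], of "\<bar>f z\<bar>"] kS[of z] M by (cases "z \<in> S") (auto simp: abs_mult)
  qed
 qed simp
 have tw: "ennreal t <= (NN z. ennreal (M / r^2) * (indicator S z * ennreal \<bar>f z - f w\<bar>))" for w
 proof -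
  have "(LBINT z. kappa z * f z) = (LBINT z. kappa z * f z - kappa z * f w)"
   using ikf ik k0 by simp
  also have "... = (LBINT z. kappa z * (f z - f w))" by (simp add: algebra_simps)
  finally have "t = norm (LBINT z. kappa z * (f z - f w))" by (simp add: t_def)
  moreover have "integrable lborel (%z. kappa z * (f z - f w))"
   using ikf ik by (simp add: right_diff_distrib)
  ultimately have "ennreal t <= (NN z. norm (kappa z * (f z - f w)))"
   using integral_norm_bound_ennreal[of lborel "%z. kappa z * (f z - f w)"] by simp
  also have "... <= (NN z. ennreal (M / r^2) * (indicator S z * ennreal \<bar>f z - f w\<bar>))"
  proof (rule nn_integral_mono)
   fix z
   show "ennreal (norm (kappa z * (f z - f w))) <= ennreal (M / r^2) * (indicator S z * ennreal \<bar>f z - f w\<bar>)"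
    using mult_right_mono[OF kB[of z], of "\<bar>f z - f w\<bar>"] kS[of z] M
    by (cases "z \<in> S") (auto simp: abs_mult ennreal_mult[symmetric] intro!: ennreal_leI)
  qed
  finally show ?thesis .
 qed
 have young: "ennreal (t * m) <= ennreal (M / r^2 * (lam * m^2)) + ennreal (M / r^2 * lam powr (1 - p)) * pair_osc p S f"
  if l: "lam > 0" for lam
 proof -
  have "ennreal (t * m) = (NN w. ennreal t * indicator S w)"
   using em m0 by (simp add: nn_integral_cmult_indicator ennreal_mult t_def)
  also have "... <= (NN w. indicator S w * (NN z. ennreal (M / r^2) * (indicator S z * ennreal \<bar>f z - f w\<bar>)))"
  proof (rule nn_integral_mono)
   fix w
   show "ennreal t * indicator S w <= indicator S w * (NN z. ennreal (M / r^2) * (indicator S z * ennreal \<bar>f z - f w\<bar>))"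
    using tw[of w] by (cases "w \<in> S") simp_all
  qed
  also have "... <= (NN w. indicator S w * (NN z. ennreal (M / r^2 * lam) * indicator S z +
     ennreal (M / r^2 * lam powr (1 - p)) * (indicator S z * epow p (f w - f z))))"
  proof (intro nn_integral_mono mult_left_mono)
   fix z w
   have "M / r^2 * \<bar>f z - f w\<bar> <= M / r^2 * (lam + lam powr (1 - p) * \<bar>f z - f w\<bar> powr p)"
    using M l p by (intro mult_left_mono powr_young) auto
   then show "ennreal (M / r^2) * (indicator S z * ennreal \<bar>f z - f w\<bar>) <= ennreal (M / r^2 * lam) * indicator S z +
     ennreal (M / r^2 * lam powr (1 - p)) * (indicator S z * epow p (f w - f z))"
    using M l by (cases "z \<in> S")
     (auto simp: ennreal_mult[symmetric] ennreal_plus[symmetric] abs_minus_commute algebra_simps simp del: ennreal_plus intro!: ennreal_leI)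
  qed auto
  also have "... = (NN w. ennreal (M / r^2 * (lam * m)) * indicator S w + ennreal (M / r^2 * lam powr (1 - p)) *
     (NN z. indicator S w * indicator S z * epow p (f w - f z)))"
  proof (intro nn_integral_cong)
   fix w
   show "indicator S w * (NN z. ennreal (M / r^2 * lam) * indicator S z +
     ennreal (M / r^2 * lam powr (1 - p)) * (indicator S z * epow p (f w - f z))) =
     ennreal (M / r^2 * (lam * m)) * indicator S w + ennreal (M / r^2 * lam powr (1 - p)) *
     (NN z. indicator S w * indicator S z * epow p (f w - f z))"
    using M l m0 em
    by (cases "w \<in> S")
     (auto simp: nn_integral_add nn_integral_cmult nn_integral_cmult_indicator ennreal_mult[symmetric] mult.assoc)
  qed
  also have "... = ennreal (M / r^2 * (lam * m^2)) + ennreal (M / r^2 * lam powr (1 - p)) * pair_osc p S f"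
   unfolding pair_osc_def using M l m0 em
   by (simp add: nn_integral_add nn_integral_cmult nn_integral_cmult_indicator ennreal_mult[symmetric] power2_eq_square mult.assoc)
  finally show ?thesis .
 qed
 show ?thesis
 proof (cases "t = 0")
  case True
  then show ?thesis using p by (simp add: t_def)
 next
  case False
  then have t: "t > 0" by (simp add: t_def)
  define lam where "lam = t * r^2 / (2 * M * m)"
  have l: "lam > 0" using t r M m0 by (simp add: lam_def)
  have half: "M / r^2 * (lam * m^2) = t * m / 2"
   using r M m0 by (simp add: lam_def power2_eq_square field_simps)
  show ?thesis
  proof (cases "pair_osc p S f")
   case (real I)
   define K where "K = M / r^2 * lam powr (1 - p) * I"
   have K0: "K >= 0" using M real by (simp add: K_def)
   have "ennreal (t * m) <= ennreal (t * m / 2 + K)"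
    using young[OF l] real M unfolding half K_def
    by (simp add: ennreal_mult[symmetric] ennreal_plus[symmetric] t m0 less_imp_le del: ennreal_plus)
   then have "t * m <= t * m / 2 + K"
    using t m0 K0 by (subst (asm) ennreal_le_iff) auto
   then have "t * m / 2 <= K" by simp
   then have "t * m / 2 * lam powr (p - 1) <= M / r^2 * I * (lam powr (1 - p) * lam powr (p - 1))"
    unfolding K_def by (metis mult.commute mult.left_commute mult_right_mono powr_ge_zero)
   then have "t * m / 2 * lam powr (p - 1) <= M / r^2 * I" using l by (simp flip: powr_add)
   moreover have "lam powr (p - 1) = t powr (p - 1) * (r^2 / (2 * M * m)) powr (p - 1)"
    using t r M m0 by (simp add: lam_def powr_mult flip: times_divide_eq_right)
   ultimately have "(t powr 1 * t powr (p - 1)) * (m / 2 * (r^2 / (2 * M * m)) powr (p - 1)) <= M / r^2 * I"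
    using t by (simp add: mult_ac)
   then have "t powr p * (m / 2 * (r^2 / (2 * M * m)) powr (p - 1)) <= M / r^2 * I"
    by (simp only: powr_add[symmetric] add_diff_cancel_left' add_diff_inverse_nat diff_add_cancel add.commute[of 1] mult_1)
   then have "t powr p <= M / r^2 * I / (m / 2 * (r^2 / (2 * M * m)) powr (p - 1))"
    using m0 r M by (subst pos_le_divide_eq) (auto simp: powr_gt_zero)
   also have "... = 2 * M / (r^2 * m) * ((2 * M * m) / r^2) powr (p - 1) * I"
    using m0 r M by (simp add: powr_divide field_simps)
   also have "... <= 2 * M / (r^2 * (c * r^2)) * ((2 * M * (L * r^2)) / r^2) powr (p - 1) * I"
    using m0 r M c(1) mpos mL p real
    by (intro mult_right_mono mult_mono divide_left_mono powr_mono2 divide_right_mono mult_left_mono) auto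
   also have "... = 2 * M / c * (2 * M * L) powr (p - 1) / r^4 * I"
    using r c(1) by (simp add: power2_eq_square power4_eq_xxxx field_simps)
   finally have "ennreal (t powr p) <= ennreal (2 * M / c * (2 * M * L) powr (p - 1) / r^4 * I)"
    by (rule ennreal_leI)
   also have "... = ennreal (2 * M / c * (2 * M * L) powr (p - 1) / r^4) * ennreal I"
    using M c(1) r real by (intro ennreal_mult) auto
   finally show ?thesis unfolding t_def[symmetric] real .
  next
   case top
   have "2 * M / c * (2 * M * L) powr (p - 1) / r^4 > 0" using M c(1) L0 r by simp
   then have "ennreal (2 * M / c * (2 * M * L) powr (p - 1) / r^4) ~= 0"
    by (simp only: ennreal_eq_0_iff not_le)
   then have "ennreal (2 * M / c * (2 * M * L) powr (p - 1) / r^4) * pair_osc p S f = top"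
    unfolding top ennreal_mult_eq_top_iff by blast
   then show ?thesis by simp
  qed
 qed
qed

lemma rbump_borel [measurable]: "rbump r \<in> Borel"
 using smooth_on_continuous[OF smooth_on_rbump] by (rule borel_measurable_continuous_onI)

lemma rbump_derivative_borel [measurable]: "(%y. fder (rbump r) y v) \<in> Borel"
 using smooth_on_continuous[OF smooth_on_frechet[OF smooth_on_rbump]] by (rule borel_measurable_continuous_onI)

lemma rbump_derivative_zero: "r > 0 ==> y \<notin> cball 0 r ==> fder (rbump r) y v = 0"
 by (rule frechet_derivative_zero_outside[of "cball 0 r"]) (auto intro: rbump_zero)

lemma integrable_rbump_cut:
 assumes "r > 0" and [measurable]: "A \<in> sets borel"
 shows "integrable lborel (%z. rbump r (x - z) * indicator A z)"
  "integrable lborel (%z. fder (rbump r) (x - z) v * indicator A z)"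
proof -
 have *: "integrable lborel (%z. g (x - z) * indicator A z)"
  if [measurable]: "g \<in> Borel" and b: "!!y. \<bar>g y\<bar> <= B" and z: "!!y. y \<notin> cball 0 r ==> g y = 0" for g :: "'a => real" and B
 proof (rule Bochner_Integration.integrable_bound[where f = "%z. B * indicator (cball x r) z"])
  show "integrable lborel (%z. B * indicator (cball x r) z :: real)"
   using emeasure_lborel_cball_finite by (intro integrable_mult_right integrable_real_indicator) auto
  have "(%z. g (x - z) * indicator A z) \<in> Borel" by measurable
  then show "(%z. g (x - z) * indicator A z) \<in> borel_measurable lborel" by simp
  show "AE z in lborel. norm (g (x - z) * indicator A z) <= norm (B * indicator (cball x r) z :: real)"
  proof (rule AE_I2)
   fix z
   have "0 <= B" using b[of 0] by linarith
   then show "norm (g (x - z) * indicator A z) <= norm (B * indicator (cball x r) z :: real)"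
    using b[of "x - z"] z[of "x - z"] by (auto simp: indicator_def dist_norm abs_mult norm_minus_commute)
  qed
 qed
 show "integrable lborel (%z. rbump r (x - z) * indicator A z)"
  by (rule *[of _ 1]) (use assms(1) in \<open>auto simp: rbump_nonneg rbump_le_1 abs_of_nonneg intro: rbump_zero\<close>)
 obtain M where M: "!!r (y::'a) v. r > 0 ==> \<bar>fder (rbump r) y v\<bar> <= M / r * norm v"
  using rbump_derivative_bound by metis
 show "integrable lborel (%z. fder (rbump r) (x - z) v * indicator A z)"
  by (rule *[OF _ M]) (use assms(1) in \<open>auto intro: rbump_derivative_zero\<close>)
qed

lemma kernel_integral_bound:
 fixes g :: "real^2 => real"
 assumes "r > 0" "!!z. \<bar>g z\<bar> <= B" "!!z. z \<notin> cball x r ==> g z = 0" "integrable lborel g"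
 shows "\<bar>LBINT z. g z\<bar> <= B * (pi * r^2)"
proof -
 have B: "B >= 0" using assms(2)[of 0] by linarith
 have "\<bar>LBINT z. g z\<bar> <= (LBINT z. \<bar>g z\<bar>)" using integral_norm_bound[of lborel g] by simp
 also have "... <= (LBINT z. B * indicator (cball x r) z)"
 proof (rule integral_mono)
  show "integrable lborel (%z. B * indicator (cball x r) z :: real)"
   using emeasure_lborel_cball_finite by (intro integrable_mult_right integrable_real_indicator) auto
  show "\<bar>g z\<bar> <= B * indicator (cball x r) z" for z
   using assms(2)[of z] assms(3)[of z] by (auto simp: indicator_def)
 qed (use assms in auto)
 also have "... = B * (pi * r^2)"
  using emeasure_cball_2[of r x] assms(1) by (simp add: measure_def)
 finally show ?thesis .
qed

lemma mollifier_mass_ge: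
 assumes "r > 0" and [measurable]: "A \<in> sets borel" "B \<in> sets borel" and "B \<subseteq> A" "B \<subseteq> cball x (3/4 * r)"
  and "ennreal m <= emeasure lborel B"
 shows "bump_lower * m <= mollifier_mass A r x"
proof -
 have fin: "emeasure lborel B < \<infinity>"
  using emeasure_mono[OF assms(5), of lborel] emeasure_lborel_cball_finite[of x "3/4 * r"] by (auto simp: order_le_less_trans)
 have "emeasure lborel B = ennreal (measure lborel B)"
  by (rule emeasure_eq_ennreal_measure) (use fin in auto)
 then have "m <= measure lborel B"
  using assms(6) by (metis ennreal_le_iff measure_nonneg)
 then have "bump_lower * m <= bump_lower * measure lborel B" using bump_lower_pos by simp
 also have "... = (LBINT z. bump_lower * indicator B z)" by simp
 also have "... <= mollifier_mass A r x"
  unfolding mollifier_mass_def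
 proof (rule integral_mono)
  show "integrable lborel (%z. bump_lower * indicator B z :: real)"
   using fin by (intro integrable_mult_right integrable_real_indicator) auto
  show "bump_lower * indicator B z <= rbump r (x - z) * indicator A z" for z
   using assms(1,4,5) rbump_ge_lower[of r "x - z"] rbump_nonneg[of r "x - z"]
   by (auto simp: indicator_def dist_norm)
 qed (rule integrable_rbump_cut[OF assms(1,2)])
 finally show ?thesis .
qed

text \<open>The derivative of a quotient of two convolutions is an integral against a kernel. The kernel has mean zero because the
 quotient reproduces constants.\<close>

lemma mollify_derivative_kernel:
 fixes c :: real
 assumes c: "c > 0"
 obtains C where "C > 0"
  "!!A r (x::real^2) v f. A \<in> sets borel ==> r > 0 ==> c * r^2 <= mollifier_mass A r x ==>
   locally_integrable_on A f ==>
   \<exists>kappa. zero_mean_kernel kappa (A \<inter> cball x r) (C * norm v / r^3) \<and> fder (mollify A r f) x v = (LBINT z. kappa z * f z)"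
proof -
 obtain M where M: "M > 0" "!!r (y::real^2) v. r > 0 ==> \<bar>fder (rbump r) y v\<bar> <= M / r * norm v"
  using rbump_derivative_bound by metis
 define C where "C = M / c + M * pi / c^2"
 show ?thesis
 proof (rule that)
  show "C > 0" using M(1) c by (simp add: C_def add_pos_pos)
  fix A :: "(real^2) set" and r :: real and x v :: "real^2" and f :: "real^2 => real"
  assume A[measurable]: "A \<in> sets borel" and r: "r > 0" and mass: "c * r^2 <= mollifier_mass A r x"
   and f: "locally_integrable_on A f"
  define m where "m = mollifier_mass A r x"
  define D where "D = (%y. fder (rbump r) y v :: real)"
  define m' where "m' = (LBINT z. D (x - z) * indicator A z)"
  define kappa where "kappa = (%z. D (x - z) * indicator A z / m - rbump r (x - z) * indicator A z * m' / m^2)"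
  have [measurable]: "D \<in> Borel" unfolding D_def by measurable
  have m: "c * r^2 <= m" "m > 0" using mass c r unfolding m_def by (auto intro: less_le_trans[of 0 "c * r^2"])
  have DB: "\<bar>D y\<bar> <= M / r * norm v" for y unfolding D_def by (rule M(2)[OF r])
  have D0: "D y = 0" if "y \<notin> cball 0 r" for y unfolding D_def by (rule rbump_derivative_zero[OF r that])
  have B0: "M / r * norm v >= 0" using M(1) r by simp
  have m'B: "\<bar>m'\<bar> <= M / r * norm v * (pi * r^2)"
   unfolding m'_def
  proof (rule kernel_integral_bound[OF r])
   show "\<bar>D (x - z) * indicator A z\<bar> <= M / r * norm v" for z
    using DB[of "x - z"] B0 by (auto simp: indicator_def)
   show "D (x - z) * indicator A z = 0" if "z \<notin> cball x r" for z
    using D0[of "x - z"] that by (auto simp: dist_norm norm_minus_commute)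
  qed (auto simp: D_def intro!: integrable_rbump_cut r)
  have kB: "\<bar>kappa z\<bar> <= C * norm v / r^3" for z
  proof -
   have "\<bar>kappa z\<bar> <= \<bar>D (x - z) * indicator A z / m\<bar> + \<bar>rbump r (x - z) * indicator A z * m' / m^2\<bar>"
    unfolding kappa_def by (rule abs_triangle_ineq4)
   also have "\<bar>D (x - z) * indicator A z / m\<bar> <= (M / r * norm v) / (c * r^2)"
   proof -
    have "\<bar>D (x - z) * indicator A z / m\<bar> = \<bar>D (x - z) * indicator A z\<bar> / m" using m by simp
    also have "... <= (M / r * norm v) / (c * r^2)"
     using m c r B0 DB[of "x - z"] by (intro frac_le) (auto simp: indicator_def)
    finally show ?thesis .
   qed
   also have "\<bar>rbump r (x - z) * indicator A z * m' / m^2\<bar> <= (M / r * norm v * (pi * r^2)) / (c * r^2)^2"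
   proof -
    have "\<bar>rbump r (x - z) * indicator A z * m' / m^2\<bar> = (rbump r (x - z) * indicator A z * \<bar>m'\<bar>) / m^2"
     using rbump_nonneg[of r "x - z"] by (auto simp: abs_mult indicator_def)
    also have "... <= (M / r * norm v * (pi * r^2)) / (c * r^2)^2"
    proof (rule frac_le)
     have "rbump r (x - z) * indicator A z * \<bar>m'\<bar> <= 1 * \<bar>m'\<bar>"
      using rbump_nonneg[of r "x - z"] rbump_le_1[of r "x - z"] by (intro mult_right_mono) (auto simp: indicator_def)
     then show "rbump r (x - z) * indicator A z * \<bar>m'\<bar> <= M / r * norm v * (pi * r^2)" using m'B by simp
     show "(c * r^2)^2 <= m^2" using m c r by (intro power_mono) auto
    qed (use c r mult_nonneg_nonneg[OF B0, of "pi * r^2"] in auto)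
    finally show ?thesis .
   qed
   also have "(M / r * norm v) / (c * r^2) + (M / r * norm v * (pi * r^2)) / (c * r^2)^2 = C * norm v / r^3"
    using r c by (simp add: C_def field_simps power2_eq_square power3_eq_cube)
   finally show ?thesis by simp
  qed
  have iD: "integrable lborel (%z. D (x - z) * indicator A z)" unfolding D_def by (rule integrable_rbump_cut[OF r A])
  have irho: "integrable lborel (%z. rbump r (x - z) * indicator A z)" by (rule integrable_rbump_cut[OF r A])
  have "(LBINT z. kappa z) = m' / m - m * m' / m^2"
   unfolding kappa_def using iD irho by (simp add: m'_def m_def mollifier_mass_def)
  then have k0: "(LBINT z. kappa z) = 0" using m by (simp add: power2_eq_square)
  have zk: "zero_mean_kernel kappa (A \<inter> cball x r) (C * norm v / r^3)"
   unfolding zero_mean_kernel_def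
  proof (intro conjI allI impI)
   show "kappa \<in> Borel" unfolding kappa_def by measurable
   show "\<bar>kappa z\<bar> <= C * norm v / r^3" for z by (rule kB)
   show "kappa z = 0" if "z \<notin> A \<inter> cball x r" for z
    using that D0[of "x - z"] rbump_zero'[OF r, of "x - z"] by (auto simp: kappa_def dist_norm indicator_def norm_minus_commute)
  qed (rule k0)
  let ?f = "%z. indicator A z * f z"
  have dN: "(conv (rbump r) ?f has_derivative (%v. conv (%y. fder (rbump r) y v) ?f x)) (at x)"
   by (rule conv_locally_has_derivative[OF smooth_on_rbump rbump_zero'[OF r] f])
  have dm: "(mollifier_mass A r has_derivative (%v. conv (%y. fder (rbump r) y v) (indicator A) x)) (at x)"
   unfolding mollifier_mass_conv
   by (rule conv_locally_has_derivative[OF smooth_on_rbump rbump_zero'[OF r] indicator_locally_integrable[OF A]])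
  have "(mollify A r f has_derivative (%v. - conv (rbump r) ?f x * (inverse m * conv (%y. fder (rbump r) y v) (indicator A) x * inverse m)
    + conv (%y. fder (rbump r) y v) ?f x / m)) (at x)"
   using has_derivative_divide[OF dN dm] m(2) unfolding mollify_conv[abs_def] m_def by simp
  then have fd: "fder (mollify A r f) x v = conv D ?f x / m - conv (rbump r) ?f x * m' / m^2"
   using fun_cong[OF frechet_derivative_at, of "mollify A r f" _ x v]
   by (simp add: D_def m'_def conv_def power2_eq_square divide_inverse mult_ac)
  have loc: "integrable lborel (%z. g (x - z) * ?f z)"
   if [measurable]: "g \<in> Borel" and b: "!!y. \<bar>g y\<bar> <= B" and z: "!!y. y \<notin> cball 0 r ==> g y = 0" for g :: "real^2 => real" and B
  proof (rule Bochner_Integration.integrable_bound)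
   show "integrable lborel (%z. B * (indicator (cball 0 (norm x + r)) z * ?f z))"
    using f by (intro integrable_mult_right) (auto simp: locally_integrable_def)
   have [measurable]: "?f \<in> Borel" using f by (simp add: locally_integrable_def)
   have "(%z. g (x - z) * ?f z) \<in> Borel" by measurable
   then show "(%z. g (x - z) * ?f z) \<in> borel_measurable lborel" by simp
   show "AE z in lborel. norm (g (x - z) * ?f z) <= norm (B * (indicator (cball 0 (norm x + r)) z * ?f z))"
   proof (rule AE_I2)
    fix z
    have B: "0 <= B" using b[of 0] by linarith
    show "norm (g (x - z) * ?f z) <= norm (B * (indicator (cball 0 (norm x + r)) z * ?f z))"
    proof (cases "x - z \<in> cball 0 r")
     case True
     have "norm z <= norm x + norm (x - z)" using norm_triangle_ineq4[of x "x - z"] by simp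
     then have "z \<in> cball 0 (norm x + r)" using True by simp
     then show ?thesis using mult_right_mono[OF b[of "x - z"], of "\<bar>?f z\<bar>"] B by (simp add: abs_mult)
    qed (simp add: z)
   qed
  qed
  have i1: "integrable lborel (%z. D (x - z) * ?f z)" by (rule loc[OF _ DB D0]) auto
  have i2: "integrable lborel (%z. rbump r (x - z) * ?f z)"
   by (rule loc[of _ 1]) (use r in \<open>auto simp: abs_of_nonneg rbump_nonneg rbump_le_1 intro: rbump_zero\<close>)
  have "(LBINT z. kappa z * f z) = (LBINT z. (D (x - z) * ?f z) / m - (rbump r (x - z) * ?f z) * (m' / m^2))"
   by (rule Bochner_Integration.integral_cong[OF refl]) (simp add: kappa_def algebra_simps)
  also have "... = conv D ?f x / m - conv (rbump r) ?f x * m' / m^2"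
   using i1 i2 by (simp add: conv_def)
  finally show "\<exists>kappa. zero_mean_kernel kappa (A \<inter> cball x r) (C * norm v / r^3) \<and> fder (mollify A r f) x v = (LBINT z. kappa z * f z)"
   using zk fd by metis
 qed
qed

section \<open>Nonlocal energies\<close>

text \<open>One definition for several weights: \<open>inv4\<close> is the Gagliardo kernel, the same for both function spaces involved; \<open>near r\<close>
 and its product with \<open>inv4\<close> see only pairs at distance below \<open>r\<close>.\<close>

definition pair_int :: "(real^2 => ennreal) => real => (real^2) set => (real^2 => real) => ennreal" where
 "pair_int w p A f = (NN x. (NN y. indicator A x * indicator A y * (w (x - y) * epow p (f x - f y))))"

definition inv4 :: "real^2 => ennreal" where "inv4 u = ennreal (1 / norm u ^ 4)"

lemma inv4_borel [measurable]: "inv4 \<in> Borel"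
 unfolding inv4_def by measurable

abbreviation energy :: "real => (real^2) set => (real^2 => real) => ennreal" where
 "energy \<equiv> pair_int inv4"

definition near :: "real => real^2 => ennreal" where "near r = indicator (ball 0 r)"

lemma near_borel [measurable]: "near r \<in> Borel"
 unfolding near_def by (rule borel_measurable_indicator) simp

abbreviation energy_near :: "real => real => (real^2) set => (real^2 => real) => ennreal" where
 "energy_near r \<equiv> pair_int (%u. near r u * inv4 u)"

lemma pair_int_mono:
 assumes "!!u. u ~= 0 ==> w u <= w' u"
 shows "pair_int w p A f <= pair_int w' p A f"
 unfolding pair_int_def
proof (intro nn_integral_mono)
 fix x y
 show "indicator A x * indicator A y * (w (x - y) * epow p (f x - f y)) <=
  indicator A x * indicator A y * (w' (x - y) * epow p (f x - f y))"
  using assms[of "x - y"] by (cases "x = y") (auto intro!: mult_left_mono mult_right_mono)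
qed

lemma pair_int_mono_set: "A \<subseteq> B ==> pair_int w p A f <= pair_int w p B f"
 unfolding pair_int_def
 by (intro nn_integral_mono mult_right_mono mult_mono) (auto simp: indicator_def)

lemma pair_int_measurable [measurable]:
 assumes [measurable]: "w \<in> Borel" "A \<in> sets borel" "f \<in> Borel"
 shows "(%(x, y). indicator A x * indicator A y * (w (x - y) * epow p (f x - f y))) \<in> borel_measurable (lborel \<Otimes>\<^sub>M lborel)"
 by measurable

lemma pair_int_cmult:
 assumes [measurable]: "w \<in> Borel" "A \<in> sets borel" "f \<in> Borel"
 shows "pair_int (%u. c * w u) p A f = c * pair_int w p A f"
proof -
 have "pair_int (%u. c * w u) p A f = (NN x. (NN y. c * (indicator A x * indicator A y * (w (x - y) * epow p (f x - f y)))))"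
  unfolding pair_int_def by (simp add: mult_ac)
 also have "... = c * pair_int w p A f"
  unfolding pair_int_def by (simp add: nn_integral_cmult)
 finally show ?thesis .
qed

lemma pair_int_add:
 assumes [measurable]: "w \<in> Borel" "w' \<in> Borel" "A \<in> sets borel" "f \<in> Borel"
 shows "pair_int (%u. w u + w' u) p A f = pair_int w p A f + pair_int w' p A f"
proof -
 have "pair_int (%u. w u + w' u) p A f = (NN x. (NN y. indicator A x * indicator A y * (w (x - y) * epow p (f x - f y))
   + indicator A x * indicator A y * (w' (x - y) * epow p (f x - f y))))"
  unfolding pair_int_def by (simp add: distrib_left distrib_right)
 also have "... = pair_int w p A f + pair_int w' p A f"
  unfolding pair_int_def by (simp add: nn_integral_add)
 finally show ?thesis .
qed

lemma pair_int_sum: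
 assumes [measurable]: "!!j. w j \<in> Borel" "A \<in> sets borel" "f \<in> Borel"
 shows "(\<Sum>j<(n::nat). pair_int (w j) p A f) = pair_int (%u. \<Sum>j<n. w j u) p A f"
proof (induction n)
 case 0
 then show ?case by (simp add: pair_int_def)
next
 case (Suc n)
 then show ?case by (simp add: pair_int_add assms)
qed

lemma near_le_energy_near:
 assumes "r >= 0" and [measurable]: "A \<in> sets borel" "f \<in> Borel"
 shows "pair_int (near r) p A f <= ennreal (r^4) * energy_near r p A f"
proof -
 have "pair_int (near r) p A f <= pair_int (%u. ennreal (r^4) * (near r u * inv4 u)) p A f"
 proof (rule pair_int_mono)
  fix u :: "real^2" assume u: "u ~= 0"
  show "near r u <= ennreal (r^4) * (near r u * inv4 u)"
  proof (cases "norm u < r")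
   case True
   have "norm u ^ 4 <= r^4" using True by (intro power_mono) auto
   then have "1 <= r^4 * (1 / norm u ^ 4)" using u by simp
   then have "ennreal 1 <= ennreal (r^4 * (1 / norm u ^ 4))" by (rule ennreal_leI)
   also have "... = ennreal (r^4) * ennreal (1 / norm u ^ 4)" by (rule ennreal_mult) auto
   finally show ?thesis using True by (simp add: near_def inv4_def)
  qed (simp add: near_def)
 qed
 also have "... = ennreal (r^4) * energy_near r p A f" by (rule pair_int_cmult) measurable
 finally show ?thesis .
qed

lemma energy_near_le: "energy_near r p A f <= energy p A f"
 by (rule pair_int_mono) (auto simp: near_def indicator_def)

lemma energy_near_mono: "r <= r' ==> energy_near r p A f <= energy_near r' p A f"
 by (rule pair_int_mono) (auto simp: near_def indicator_def)

text \<open>A pair at distance \<open>d\<close> is counted at the scales above \<open>d\<close> only, with weights growing geometrically up to about \<open>d^-4\<close>.\<close>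

lemma dyadic_near_sum:
 assumes "rho > 0" and [measurable]: "A \<in> sets borel" "f \<in> Borel"
 shows "(\<Sum>j<n. ennreal ((2^j / rho)^4) * pair_int (near (rho / 2^j)) p A f) <= ennreal 2 * energy p A f"
proof -
 have "(\<Sum>j<n. ennreal ((2^j / rho)^4) * pair_int (near (rho / 2^j)) p A f)
  = pair_int (%u. \<Sum>j<n. ennreal ((2^j / rho)^4) * near (rho / 2^j) u) p A f"
  by (subst pair_int_sum[symmetric]) (auto simp: pair_int_cmult)
 also have "... <= pair_int (%u. ennreal 2 * inv4 u) p A f"
 proof (rule pair_int_mono)
  fix u :: "real^2" assume u: "u ~= 0"
  define d where "d = norm u"
  have d: "d > 0" using u by (simp add: d_def)
  have p16: "(2^n)^4 = (16::real)^n" for n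
  proof -
   have "(2^n)^4 = ((2::real)^4)^n" by (simp only: power_mult[symmetric] mult.commute)
   then show ?thesis by simp
  qed
  define S where "S = (%n. \<Sum>j<n. (2^j / rho)^4 * (if d < rho / 2^j then 1 else 0 :: real))"
  have S0: "15 * S n <= 16^n / rho^4" for n
  proof (induction n)
   case (Suc n)
   have "(2^n / rho)^4 = 16^n / rho^4" by (simp add: power_divide p16)
   then have "S (Suc n) <= S n + 16^n / rho^4" using assms(1) by (simp add: S_def)
   then show ?case using Suc by (simp add: field_simps)
  qed (use assms(1) in \<open>simp add: S_def\<close>)
  have S1: "S n <= 2 / d^4" for n
  proof (induction n)
   case (Suc n)
   show ?case
   proof (cases "d < rho / 2^n")
    case True
    have "(d * 2^n)^4 <= rho^4" using True d assms(1) by (intro power_mono) (auto simp: field_simps)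
    then have "d^4 * 16^n <= rho^4" by (simp add: power_mult_distrib p16)
    then have "16^n / rho^4 <= 1 / d^4" using d assms(1) by (simp add: field_simps)
    moreover have "15 * S (Suc n) <= 16 * (16^n / rho^4)" using S0[of "Suc n"] by simp
    moreover have "1 / d^4 > 0" using d by simp
    ultimately have "15 * S (Suc n) <= 15 * (2 * (1 / d^4))" by linarith
    then show ?thesis by simp
   next
    case False
    then show ?thesis using Suc by (simp add: S_def)
   qed
  qed (use d in \<open>simp add: S_def\<close>)
  have "(\<Sum>j<n. ennreal ((2^j / rho)^4) * near (rho / 2^j) u) = (\<Sum>j<n. ennreal ((2^j / rho)^4 * (if d < rho / 2^j then 1 else 0)))"
   by (intro sum.cong) (auto simp: near_def d_def)
  also have "... = ennreal (S n)" unfolding S_def using assms(1) by (intro sum_ennreal) auto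
  also have "... <= ennreal (2 / d^4)" using S1 by (rule ennreal_leI)
  also have "... = ennreal 2 * inv4 u" by (simp add: inv4_def d_def ennreal_mult[symmetric] del: ennreal_numeral)
  finally show "(\<Sum>j<n. ennreal ((2^j / rho)^4) * near (rho / 2^j) u) <= ennreal 2 * inv4 u" .
 qed
 also have "... = ennreal 2 * energy p A f" by (rule pair_int_cmult) measurable
 finally show ?thesis .
qed

lemma integral_pair_osc:
 assumes "r >= 0" and [measurable]: "A \<in> sets borel" "f \<in> Borel"
 shows "(NN x. pair_osc p (A \<inter> cball x r) f) <= ennreal (pi * r^2) * pair_int (near (3 * r)) p A f"
proof (cases "r = 0")
 case True
 have "pair_osc p (A \<inter> cball x r) f = 0" for x
 proof -
  have "pair_osc p (A \<inter> cball x r) f = (\<integral>\<^sup>+z. (\<integral>\<^sup>+w. 0 \<partial>(lborel::(real^2) measure)) \<partial>(lborel::(real^2) measure))"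
   unfolding pair_osc_def using True by (intro nn_integral_cong) (auto simp: indicator_def)
  then show ?thesis by simp
 qed
 then show ?thesis by simp
next
 case False
 then have r: "r > 0" using assms by simp
 define g where "g = (%z w. indicator A z * indicator A w * (near (3 * r) (z - w) * epow p (f z - f w)) :: ennreal)"
 have [measurable]: "(%(z,w). g z w) \<in> borel_measurable (lborel \<Otimes>\<^sub>M lborel)" unfolding g_def by measurable
 have [measurable]: "(%(x::real^2, z::real^2). indicator (cball x r) z :: ennreal) \<in> borel_measurable (borel \<Otimes>\<^sub>M borel)"
 proof -
  have "(%(x::real^2, z::real^2). indicator {0..r} (dist x z) :: ennreal) \<in> borel_measurable (borel \<Otimes>\<^sub>M borel)" by measurable
  moreover have "(%(x::real^2, z::real^2). indicator {0..r} (dist x z) :: ennreal) = (%(x, z). indicator (cball x r) z)"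
   by (auto simp: indicator_def fun_eq_iff)
  ultimately show ?thesis by simp
 qed
 have "(NN x. pair_osc p (A \<inter> cball x r) f) <=
   (NN x. (NN z. (NN w. indicator (cball x r) z * g z w)))"
  unfolding pair_osc_def
 proof (intro nn_integral_mono)
  fix x z w :: "real^2"
  have "norm (z - w) < 3 * r" if "dist x z <= r" "dist x w <= r"
   using dist_triangle3[of z w x] that r by (simp add: dist_norm)
  then show "indicator (A \<inter> cball x r) z * indicator (A \<inter> cball x r) w * epow p (f z - f w) <= indicator (cball x r) z * g z w"
   by (auto simp: g_def indicator_def near_def)
 qed
 also have "... = (NN x. (NN z. indicator (cball x r) z * (NN w. g z w)))"
  by (intro nn_integral_cong) (simp add: nn_integral_cmult)
 also have "... = (NN z. (NN x. indicator (cball x r) z * (NN w. g z w)))"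
  by (rule lborel_pair.Fubini') measurable
 also have "... = (NN z. ennreal (pi * r^2) * (NN w. g z w))"
 proof (intro nn_integral_cong)
  fix z
  have "(NN x. indicator (cball x r) z * (NN w. g z w)) = (NN x. (NN w. g z w) * indicator (cball z r) x)"
   by (intro nn_integral_cong) (auto simp: indicator_def dist_commute)
  then show "(NN x. indicator (cball x r) z * (NN w. g z w)) = ennreal (pi * r^2) * (NN w. g z w)"
   using r by (simp add: nn_integral_cmult_indicator emeasure_cball_2 mult.commute)
 qed
 also have "... = ennreal (pi * r^2) * pair_int (near (3 * r)) p A f"
  unfolding pair_int_def g_def by (rule nn_integral_cmult) measurable
 finally show ?thesis .
qed

section \<open>Integrals of the singular kernel\<close>

lemma nn_integral_near: "rho >= 0 ==> (NN u. near rho u) = ennreal (pi * rho^2)"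
 by (simp add: near_def emeasure_ball_2)

lemma nn_integral_near_power:
 assumes p: "p > 2" and rho: "rho > 0"
 shows "(NN u. near rho u * (inv4 u * ennreal (norm u powr p))) <= ennreal (4 * pi / (1 - 2 powr (2 - p)) * rho powr (p - 2))"
proof -
 define a where "a = p - 2"
 have a: "a > 0" using p by (simp add: a_def)
 define r where "r = (%j. rho / 2^j)"
 have r: "r j > 0" for j using rho by (simp add: r_def)
 have pt: "near rho u * (inv4 u * ennreal (norm u powr p)) <= (\<Sum>j. ennreal (4 * r j powr a / r j ^ 2) * near (r j) u)" for u
 proof (cases "0 < norm u \<and> norm u < rho")
  case True
  have "\<exists>n. rho / norm u < 2^n" using real_arch_pow[of 2 "rho / norm u"] by simp
  then have ex: "\<exists>n. r n <= norm u" using True by (auto simp: r_def field_simps intro: less_imp_le)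
  define n where "n = (LEAST n. r n <= norm u)"
  have n: "r n <= norm u" unfolding n_def using ex by (rule LeastI_ex)
  have "n ~= 0"
  proof
   assume "n = 0" then show False using n True by (simp add: r_def)
  qed
  then obtain j where j: "n = Suc j" by (cases n) auto
  have j2: "norm u < r j" using not_less_Least[of j "%n. r n <= norm u"] j by (simp add: n_def)
  have j1: "r j / 2 <= norm u" using n j by (simp add: r_def)
  have "norm u powr p / norm u ^ 4 = norm u powr a / norm u ^ 2"
  proof -
   have "norm u powr p = norm u powr a * norm u ^ 2" using True by (simp add: a_def powr_diff)
   then show ?thesis using True by (simp add: power2_eq_square power4_eq_xxxx)
  qed
  also have "... <= r j powr a / (r j / 2) ^ 2"
   using True j1 j2 a r[of j] by (intro frac_le powr_mono2 power_mono) auto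
  also have "... = 4 * r j powr a / r j ^ 2" by (simp add: power2_eq_square)
  finally have "ennreal (1 / norm u ^ 4 * norm u powr p) <= ennreal (4 * r j powr a / r j ^ 2)"
   by (intro ennreal_leI) simp
  then have "near rho u * (inv4 u * ennreal (norm u powr p)) <= ennreal (4 * r j powr a / r j ^ 2) * near (r j) u"
   using True j2 by (simp add: near_def inv4_def ennreal_mult[symmetric])
  also have "... <= (\<Sum>j. ennreal (4 * r j powr a / r j ^ 2) * near (r j) u)"
   using sum_le_suminf[OF summableI, of "{j}" "%j. ennreal (4 * r j powr a / r j ^ 2) * near (r j) u"] by simp
  finally show ?thesis .
 next
  case False
  then show ?thesis by (auto simp: near_def)
 qed
 have "(NN u. near rho u * (inv4 u * ennreal (norm u powr p))) <= (NN u. (\<Sum>j. ennreal (4 * r j powr a / r j ^ 2) * near (r j) u))"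
  by (intro nn_integral_mono pt)
 also have "... = (\<Sum>j. ennreal (4 * r j powr a / r j ^ 2) * ennreal (pi * r j ^ 2))"
  using r by (simp add: nn_integral_suminf nn_integral_cmult nn_integral_near less_imp_le)
 also have "... = (\<Sum>j. ennreal (4 * pi * rho powr a * (2 powr (- a)) ^ j))"
 proof (rule suminf_cong)
  fix j
  have "r j powr a = rho powr a * (2 powr (- a)) ^ j"
  proof -
   have "(2 ^ j) powr a = (2 powr a) ^ j" by (simp add: powr_realpow[symmetric] powr_powr mult.commute)
   moreover have "r j powr a = rho powr a / (2 ^ j) powr a" using rho by (simp add: r_def powr_divide)
   ultimately show ?thesis by (simp add: powr_minus power_inverse divide_inverse)
  qed
  then have "4 * r j powr a / r j ^ 2 * (pi * r j ^ 2) = 4 * pi * rho powr a * (2 powr (- a)) ^ j"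
   using r[of j] by (simp add: field_simps)
  then show "ennreal (4 * r j powr a / r j ^ 2) * ennreal (pi * r j ^ 2) = ennreal (4 * pi * rho powr a * (2 powr (- a)) ^ j)"
   using r[of j] by (simp add: ennreal_mult[symmetric])
 qed
 also have "... = ennreal (4 * pi * rho powr a * (1 / (1 - 2 powr (- a))))"
 proof (rule suminf_ennreal_eq)
  have "(2::real) powr (- a) < 1" using a by (simp add: powr_less_one)
  then show "(%j. 4 * pi * rho powr a * (2 powr (- a)) ^ j) sums (4 * pi * rho powr a * (1 / (1 - 2 powr (- a))))"
   by (intro sums_mult geometric_sums) simp
 qed simp
 finally show ?thesis by (simp add: a_def mult.commute mult.left_commute)
qed

definition far :: "real => real^2 => ennreal" where "far r u = (if norm u < r then 0 else inv4 u)"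

lemma far_borel [measurable]: "far r \<in> Borel"
 unfolding far_def by measurable

lemma near_far: "near r u * inv4 u + far r u = inv4 u"
 by (simp add: near_def far_def)

lemma nn_integral_far:
 assumes rho: "rho > 0"
 shows "(NN u. far rho u) <= ennreal (16 * pi / rho^2)"
proof -
 define r where "r = (%j. rho * 2^j)"
 have r: "r j > 0" for j using rho by (simp add: r_def)
 have pt: "far rho u <= (\<Sum>j. ennreal (1 / r j ^ 4) * near (2 * r j) u)" for u
 proof (cases "rho <= norm u")
  case True
  have ex: "\<exists>n. norm u < r n" using real_arch_pow[of 2 "norm u / rho"] rho by (auto simp: r_def field_simps)
  define n where "n = (LEAST n. norm u < r n)"
  have n: "norm u < r n" unfolding n_def using ex by (rule LeastI_ex)
  have "n ~= 0"
  proof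
   assume "n = 0" then show False using n True by (simp add: r_def)
  qed
  then obtain j where j: "n = Suc j" by (cases n) auto
  have j2: "r j <= norm u" using not_less_Least[of j "%n. norm u < r n"] j by (simp add: n_def)
  have j1: "norm u < 2 * r j" using n j by (simp add: r_def)
  have "far rho u <= ennreal (1 / r j ^ 4) * near (2 * r j) u"
  proof -
   have "norm u ^ 4 > 0" using True rho by (intro zero_less_power) linarith
   then show ?thesis
    using True j1 j2 r[of j] by (auto simp: far_def near_def inv4_def intro!: ennreal_leI divide_left_mono power_mono mult_pos_pos)
  qed
  also have "... <= (\<Sum>j. ennreal (1 / r j ^ 4) * near (2 * r j) u)"
   using sum_le_suminf[OF summableI, of "{j}" "%j. ennreal (1 / r j ^ 4) * near (2 * r j) u"] by simp
  finally show ?thesis .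
 next
  case False
  then show ?thesis by (auto simp: far_def)
 qed
 have "(NN u. far rho u) <= (NN u. (\<Sum>j. ennreal (1 / r j ^ 4) * near (2 * r j) u))"
  by (intro nn_integral_mono pt)
 also have "... = (\<Sum>j. ennreal (1 / r j ^ 4) * ennreal (pi * (2 * r j) ^ 2))"
 proof -
  have "(NN u. near (2 * r j) u) = ennreal (pi * (2 * r j) ^ 2)" for j
   using r[of j] by (intro nn_integral_near) simp
  then show ?thesis by (simp add: nn_integral_suminf nn_integral_cmult)
 qed
 also have "... = (\<Sum>j. ennreal (4 * pi / rho^2 * (1/4) ^ j))"
 proof (rule suminf_cong)
  fix j
  have e: "(2 ^ j)^2 = (4::real)^j"
  proof -
   have "(2^j)^2 = ((2::real)^2)^j" by (simp only: power_mult[symmetric] mult.commute)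
   then show ?thesis by simp
  qed
  have "1 / r j ^ 4 * (pi * (2 * r j) ^ 2) = 4 * pi / r j ^ 2"
   using r[of j] by (simp add: power2_eq_square power4_eq_xxxx field_simps)
  also have "... = 4 * pi / rho^2 * (1/4) ^ j" using rho by (simp add: r_def power_mult_distrib e power_one_over)
  finally show "ennreal (1 / r j ^ 4) * ennreal (pi * (2 * r j) ^ 2) = ennreal (4 * pi / rho^2 * (1/4) ^ j)"
   by (simp add: ennreal_mult[symmetric])
 qed
 also have "... = ennreal (4 * pi / rho^2 * (1 / (1 - 1/4)))"
 proof (rule suminf_ennreal_eq)
  show "(%j. 4 * pi / rho^2 * (1/4) ^ j) sums (4 * pi / rho^2 * (1 / (1 - 1/4)))"
   by (intro sums_mult geometric_sums) simp
 qed simp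
 also have "... <= ennreal (16 * pi / rho^2)"
 proof (rule ennreal_leI)
  have "4 * pi / rho^2 * (1 / (1 - 1/4)) = 16 * pi / rho^2 / 3" by simp
  also have "... <= 16 * pi / rho^2 / 1" using rho by (intro divide_left_mono) auto
  finally show "4 * pi / rho^2 * (1 / (1 - 1/4)) <= 16 * pi / rho^2" by simp
 qed
 finally show ?thesis .
qed

lemma nn_integral_lborel_diff:
 fixes g :: "'a::euclidean_space => ennreal"
 assumes [measurable]: "g \<in> Borel"
 shows "(NN y. g (x - y)) = (NN u. g u)"
proof -
 have "(NN u. g u) = (\<integral>\<^sup>+u. g u \<partial>(distr lborel borel (%y. x + (-1) *\<^sub>R y)))"
  using lborel_affine[of "-1" x] by (simp add: density_1)
 also have "... = (NN y. g (x - y))" by (subst nn_integral_distr) auto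
 finally show ?thesis by simp
qed

lemma energy_near_tendsto_0:
 assumes [measurable]: "A \<in> sets borel" "f \<in> Borel" and fin: "energy p A f < \<infinity>"
  and r: "r ----> 0"
 shows "(%n. energy_near (r n) p A f) ----> 0"
proof -
 define G where "G = (%(x, y). indicator A x * indicator A y * (inv4 (x - y) * epow p (f x - f y)) :: ennreal)"
 have [measurable]: "G \<in> borel_measurable (lborel \<Otimes>\<^sub>M lborel)" unfolding G_def by measurable
 have eG: "energy p A f = (\<integral>\<^sup>+z. G z \<partial>(lborel \<Otimes>\<^sub>M lborel))"
  by (subst lborel.nn_integral_fst[symmetric]) (simp_all add: pair_int_def G_def)
 have eN: "energy_near r p A f = (\<integral>\<^sup>+z. near r (fst z - snd z) * G z \<partial>(lborel \<Otimes>\<^sub>M lborel))" for r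
  by (subst lborel.nn_integral_fst[symmetric]) (simp_all add: pair_int_def G_def mult_ac)
 have "(%n. (\<integral>\<^sup>+z. near (r n) (fst z - snd z) * G z \<partial>(lborel \<Otimes>\<^sub>M lborel))) ----> (\<integral>\<^sup>+(z::(real^2) \<times> (real^2)). 0 \<partial>(lborel \<Otimes>\<^sub>M lborel))"
 proof (rule nn_integral_dominated_convergence[where w = G])
  show "(\<integral>\<^sup>+z. G z \<partial>(lborel \<Otimes>\<^sub>M lborel)) < \<infinity>" using fin eG by simp
  show "AE z in lborel \<Otimes>\<^sub>M lborel. near (r n) (fst z - snd z) * G z <= G z" for n
   by (intro AE_I2) (auto simp: near_def indicator_def)
  show "AE z in lborel \<Otimes>\<^sub>M lborel. (%n. near (r n) (fst z - snd z) * G z) ----> 0"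
  proof (intro AE_I2)
   fix z :: "(real^2) \<times> (real^2)"
   show "(%n. near (r n) (fst z - snd z) * G z) ----> 0"
   proof (cases "fst z = snd z")
    case True
    then have "G z = 0" by (auto simp: G_def case_prod_beta inv4_def)
    then show ?thesis by simp
   next
    case False
    then have "eventually (%n. r n < norm (fst z - snd z)) sequentially"
     using order_tendstoD(2)[OF r] by simp
    then have "eventually (%n. near (r n) (fst z - snd z) * G z = 0) sequentially"
     by eventually_elim (simp add: near_def)
    then show ?thesis by (simp add: tendsto_eventually)
   qed
  qed
 qed measurable
 then show ?thesis by (simp add: eN)
qed

section \<open>Measure density and approximation\<close>

text \<open>The measure density condition: it bounds the mass of a mollifier from below up to the boundary.\<close>

definition plump :: "(real^2) set => real => real => bool" where
 "plump A kappa t0 \<longleftrightarrow> A \<in> sets borel \<and> kappa > 0 \<and> t0 > 0 \<and>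
   (\<forall>x\<in>A. \<forall>t. 0 < t \<and> t <= t0 --> ennreal (kappa * t^2) <= emeasure lborel (A \<inter> ball x t))"

lemma plump_UNIV: "t0 > 0 ==> plump UNIV 1 t0"
 using pi_gt3 by (auto simp: plump_def emeasure_ball_2 intro!: ennreal_leI)

lemma plump_cball_lower:
 assumes "plump A kappa t0" "x' \<in> A" "dist x x' <= r / 2" "0 < r" "r / 4 <= t0"
 shows "ennreal (kappa / 16 * r^2) <= emeasure lborel (A \<inter> cball x r)"
  and "bump_lower * (kappa / 16 * r^2) <= mollifier_mass A r x"
proof -
 have [measurable]: "A \<in> sets borel" using assms(1) by (simp add: plump_def)
 have sub: "ball x' (r / 4) \<subseteq> cball x (3/4 * r)"
 proof
  fix z assume "z \<in> ball x' (r / 4)"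
  then show "z \<in> cball x (3/4 * r)" using dist_triangle[of x z x'] assms(3) by simp
 qed
 have m: "ennreal (kappa / 16 * r^2) <= emeasure lborel (A \<inter> ball x' (r / 4))"
 proof -
  have "ennreal (kappa * (r / 4)^2) <= emeasure lborel (A \<inter> ball x' (r / 4))"
   using assms unfolding plump_def by simp
  then show ?thesis by (simp add: power2_eq_square)
 qed
 show "bump_lower * (kappa / 16 * r^2) <= mollifier_mass A r x"
  by (rule mollifier_mass_ge[where B = "A \<inter> ball x' (r / 4)"]) (use assms sub m in auto)
 have "cball x (3/4 * r) \<subseteq> cball x r" using assms(4) by auto
 with sub have "A \<inter> ball x' (r / 4) \<subseteq> A \<inter> cball x r" by auto
 from emeasure_mono[OF this, of lborel] m
 show "ennreal (kappa / 16 * r^2) <= emeasure lborel (A \<inter> cball x r)" by (auto intro: order_trans)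
qed

lemma emeasure_Int_cball_le: "r >= 0 ==> emeasure lborel (A \<inter> cball (x::real^2) r) <= ennreal (pi * r^2)"
 using emeasure_mono[of "A \<inter> cball x r" "cball x r" lborel] by (simp add: emeasure_cball_2)

lemma plump_kernel_bound:
 assumes kappa0: "kappa0 > 0" and M: "M > 0" and p: "p >= 1"
 obtains C where "C > 0"
  "!!A t0 x x' r k f. plump A kappa0 t0 ==> x' \<in> A ==> dist x x' <= r / 2 ==> 0 < r ==> r / 4 <= t0 ==>
   zero_mean_kernel k (A \<inter> cball x r) (M / r^2) ==> f \<in> Borel ==> locally_integrable_on A f ==>
   epow p (LBINT z. k z * f z) <= ennreal (C / r^4) * pair_osc p (A \<inter> cball x r) f"
proof
 let ?C = "2 * M / (kappa0 / 16) * (2 * M * pi) powr (p - 1)"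
 show "?C > 0" using M kappa0 by simp
 fix A t0 x x' r k f
 assume pl: "plump A kappa0 t0" "x' \<in> A" "dist x x' <= r / 2" "0 < r" "r / 4 <= t0"
  and k: "zero_mean_kernel k (A \<inter> cball x r) (M / r^2)" and f: "f \<in> Borel"
  and loc: "locally_integrable_on A f"
 have A: "A \<in> sets borel" using pl(1) by (simp add: plump_def)
 have "integrable lborel (%z. indicator (cball x r) z * (indicator (cball 0 (norm x + r)) z * (indicator A z * f z)))"
  using loc integrable_mult_indicator[of "cball x r" lborel "%z. indicator (cball 0 (norm x + r)) z * (indicator A z * f z)"]
  by (simp add: locally_integrable_def)
 moreover have "indicator (cball x r) z * (indicator (cball 0 (norm x + r)) z * (indicator A z * f z)) = indicator (A \<inter> cball x r) z * f z" for z
  using norm_triangle_ineq4[of x "x - z"] by (auto simp: indicator_def dist_norm)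
 ultimately have i: "integrable lborel (%z. indicator (A \<inter> cball x r) z * f z)" by simp
 show "epow p (LBINT z. k z * f z) <= ennreal (?C / r^4) * pair_osc p (A \<inter> cball x r) f"
  by (rule zero_mean_kernel_bound[OF k _ pl(4) _ plump_cball_lower(1)[OF pl] emeasure_Int_cball_le M p f i])
   (use A kappa0 pl in auto)
qed

lemma plump_derivative_bound:
 assumes kappa0: "kappa0 > 0" and p: "p >= 1"
 obtains C where "C > 0"
  "!!A t0 x x' r v f. plump A kappa0 t0 ==> x' \<in> A ==> dist x x' <= r / 2 ==> 0 < r ==> r / 4 <= t0 ==>
   f \<in> Borel ==> locally_integrable_on A f ==>
   epow p (fder (mollify A r f) x v) <= ennreal ((norm v / r) powr p * (C / r^4)) * pair_osc p (A \<inter> cball x r) f"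
proof -
 define c where "c = bump_lower * (kappa0 / 16)"
 have c: "c > 0" using kappa0 bump_lower_pos by (simp add: c_def)
 show ?thesis
 proof (rule mollify_derivative_kernel[OF c], goal_cases)
 case M: (1 M)
 show ?thesis
 proof (rule plump_kernel_bound[OF kappa0 M(1) p], goal_cases)
 case C: (1 C)
 show ?thesis
 proof (rule that[OF C(1)])
  fix A t0 x x' r v f
  assume pl: "plump A kappa0 t0" "x' \<in> A" "dist x x' <= r / 2" "0 < r" "r / 4 <= t0" and f: "f \<in> Borel"
   and loc: "locally_integrable_on A f"
  have A: "A \<in> sets borel" using pl(1) by (simp add: plump_def)
  have "c * r^2 <= mollifier_mass A r x" using plump_cball_lower(2)[OF pl] by (simp add: c_def)
  from M(2)[OF A pl(4) this loc, of v] obtain k where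
   k: "zero_mean_kernel k (A \<inter> cball x r) (M * norm v / r^3)" and fd: "fder (mollify A r f) x v = (LBINT z. k z * f z)" by blast
  show "epow p (fder (mollify A r f) x v) <= ennreal ((norm v / r) powr p * (C / r^4)) * pair_osc p (A \<inter> cball x r) f"
  proof (cases "v = 0")
   case True
   then have "k = (%_. 0)" using k by (auto simp: zero_mean_kernel_def)
   then show ?thesis using fd by simp
  next
   case False
   define s where "s = norm v / r"
   have s: "s > 0" using False pl by (simp add: s_def)
   have e: "M * norm v / r^3 = s * (M / r^2)" using pl by (simp add: s_def power2_eq_square power3_eq_cube mult_ac)
   have "zero_mean_kernel (%z. k z / s) (A \<inter> cball x r) (M / r^2)"
    unfolding zero_mean_kernel_def
   proof (intro conjI allI impI)
    show "(%z. k z / s) \<in> Borel"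
     using k unfolding zero_mean_kernel_def by (intro borel_measurable_divide borel_measurable_const) blast
    show "\<bar>k z / s\<bar> <= M / r^2" for z
    proof -
     have "\<bar>k z\<bar> <= s * (M / r^2)" using k by (simp add: zero_mean_kernel_def e)
     then have "\<bar>k z\<bar> / s <= M / r^2" using s by (simp add: pos_divide_le_eq mult.commute)
     then show ?thesis using s by simp
    qed
    show "k z / s = 0" if "z \<notin> A \<inter> cball x r" for z using k that by (simp add: zero_mean_kernel_def)
    show "(LBINT z. k z / s) = 0" using k by (simp add: zero_mean_kernel_def)
   qed
   from C(2)[OF pl this f loc]
   have *: "epow p ((LBINT z. k z * f z) / s) <= ennreal (C / r^4) * pair_osc p (A \<inter> cball x r) f"
    by simp
   have "\<bar>LBINT z. k z * f z\<bar> powr p = s powr p * \<bar>(LBINT z. k z * f z) / s\<bar> powr p"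
    using s by (simp add: powr_mult[symmetric])
   then have "epow p (LBINT z. k z * f z) = ennreal (s powr p) * epow p ((LBINT z. k z * f z) / s)"
    by (simp add: ennreal_mult)
   also have "... <= ennreal (s powr p) * (ennreal (C / r^4) * pair_osc p (A \<inter> cball x r) f)"
    by (rule mult_left_mono[OF *]) simp
   also have "... = ennreal (s powr p * (C / r^4)) * pair_osc p (A \<inter> cball x r) f"
   proof -
    have "ennreal (s powr p * (C / r^4)) = ennreal (s powr p) * ennreal (C / r^4)"
     using C(1) pl(4) by (intro ennreal_mult) auto
    then show ?thesis by (simp only: mult.assoc)
   qed
   finally show ?thesis by (simp add: fd s_def)
  qed
 qed
 qed
 qed
qed

lemma ennreal_mult_merge: "0 <= a ==> 0 <= b ==> ennreal a * (ennreal b * E) = ennreal (a * b) * E"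
 by (simp add: ennreal_mult mult.assoc)

lemma power_mean_bound:
 fixes g :: "real^2 => real"
 assumes [measurable]: "S \<in> sets borel" "g \<in> Borel" and g: "!!z. g z >= 0"
  and L: "emeasure lborel S <= ennreal (L * r^2)" "L > 0" and r: "r > 0" and B: "B > 0" and t: "t >= 0" and p: "p >= 1"
  and h: "ennreal t <= (NN z. ennreal (B / r^2) * (indicator S z * ennreal (g z)))"
 shows "ennreal (t powr p) <= ennreal (2 * B * (2 * B * L) powr (p - 1) / r^2) * (NN z. indicator S z * ennreal (g z powr p))"
proof (cases "t = 0")
 case True
 then show ?thesis using p by simp
next
 case False
 then have t: "t > 0" using t by simp
 define lam where "lam = t / (2 * B * L)"
 have l: "lam > 0" using t B L by (simp add: lam_def)
 define I where "I = (NN z. indicator S z * ennreal (g z powr p))"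
 have "ennreal t <= (NN z. ennreal (B / r^2 * lam) * indicator S z + ennreal (B / r^2 * lam powr (1 - p)) * (indicator S z * ennreal (g z powr p)))"
 proof (rule order_trans[OF h nn_integral_mono])
  fix z
  have "B / r^2 * g z <= B / r^2 * (lam + lam powr (1 - p) * g z powr p)"
   using B l p g by (intro mult_left_mono powr_young) auto
  then show "ennreal (B / r^2) * (indicator S z * ennreal (g z)) <= ennreal (B / r^2 * lam) * indicator S z + ennreal (B / r^2 * lam powr (1 - p)) * (indicator S z * ennreal (g z powr p))"
   using B l g by (cases "z \<in> S")
    (auto simp: ennreal_mult[symmetric] ennreal_plus[symmetric] algebra_simps simp del: ennreal_plus intro!: ennreal_leI)
 qed
 also have "... = ennreal (B / r^2 * lam) * emeasure lborel S + ennreal (B / r^2 * lam powr (1 - p)) * I"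
  unfolding I_def by (simp add: nn_integral_add nn_integral_cmult nn_integral_cmult_indicator)
 also have "... <= ennreal (B / r^2 * lam) * ennreal (L * r^2) + ennreal (B / r^2 * lam powr (1 - p)) * I"
  by (intro add_mono mult_left_mono L) auto
 also have "ennreal (B / r^2 * lam) * ennreal (L * r^2) = ennreal (t / 2)"
  using B L r t by (simp add: ennreal_mult[symmetric] lam_def)
 finally have h2: "ennreal t <= ennreal (t / 2) + ennreal (B / r^2 * lam powr (1 - p)) * I" .
 show ?thesis
 proof (cases I)
  case (real i)
  define K where "K = B / r^2 * lam powr (1 - p) * i"
  have K0: "K >= 0" using B real by (simp add: K_def)
  have "ennreal (B / r^2 * lam powr (1 - p)) * I = ennreal K"
   unfolding K_def real using B real(1) by (intro ennreal_mult[symmetric]) auto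
  then have "ennreal t <= ennreal (t / 2 + K)" using h2 t K0 by (simp add: ennreal_plus)
  then have "t <= t / 2 + K" using t K0 by (subst (asm) ennreal_le_iff) auto
  then have "t / 2 * lam powr (p - 1) <= K * lam powr (p - 1)" by (intro mult_right_mono) auto
  also have "... = B / r^2 * i * (lam powr (1 - p) * lam powr (p - 1))" by (simp add: K_def)
  also have "... = B / r^2 * i" using l by (simp flip: powr_add)
  finally have a: "t / 2 * lam powr (p - 1) <= B / r^2 * i" .
  have "lam powr (p - 1) = t powr (p - 1) / (2 * B * L) powr (p - 1)"
   using t B L by (simp add: lam_def powr_divide)
  moreover have "t * t powr (p - 1) = t powr p" using t powr_mult_base[of t "p - 1"] by simp
  ultimately have "t powr p / (2 * (2 * B * L) powr (p - 1)) <= B / r^2 * i" using a by simp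
  then have "t powr p <= B / r^2 * i * (2 * (2 * B * L) powr (p - 1))"
   using B L by (subst (asm) pos_divide_le_eq) auto
  then have "ennreal (t powr p) <= ennreal (2 * B * (2 * B * L) powr (p - 1) / r^2 * i)"
   by (intro ennreal_leI) (simp add: mult_ac)
  also have "... = ennreal (2 * B * (2 * B * L) powr (p - 1) / r^2) * ennreal i"
   using B L real by (intro ennreal_mult) auto
  finally show ?thesis unfolding I_def[symmetric] real .
 next
  case top
  have "2 * B * (2 * B * L) powr (p - 1) / r^2 > 0" using B L r by simp
  then have "ennreal (2 * B * (2 * B * L) powr (p - 1) / r^2) ~= 0" by (simp only: ennreal_eq_0_iff not_le)
  then have "ennreal (2 * B * (2 * B * L) powr (p - 1) / r^2) * I = top"
   unfolding top ennreal_mult_eq_top_iff by blast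
  then show ?thesis unfolding I_def[symmetric] by simp
 qed
qed

lemma locally_integrable_integrable_cball:
 assumes "locally_integrable g"
 shows "integrable lborel (%z. indicator (cball x r) z * g z)"
proof -
 have "integrable lborel (%z. indicator (cball x r) z * (indicator (cball 0 (norm x + r)) z * g z))"
  using assms integrable_mult_indicator[of "cball x r" lborel "%z. indicator (cball 0 (norm x + r)) z * g z"]
  by (simp add: locally_integrable_def)
 moreover have "indicator (cball x r) z * (indicator (cball 0 (norm x + r)) z * g z) = indicator (cball x r) z * g z" for z
  using norm_triangle_ineq4[of x "x - z"] by (auto simp: indicator_def dist_norm)
 ultimately show ?thesis by simp
qed

lemma integrable_rbump_mult:
 assumes r: "r > 0" and g: "locally_integrable g"
 shows "integrable lborel (%z. rbump r (x - z) * g z)"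
proof (rule Bochner_Integration.integrable_bound[OF locally_integrable_integrable_cball[OF g, of x r]])
 have [measurable]: "g \<in> Borel" using g by (simp add: locally_integrable_def)
 have "(%z. rbump r (x - z) * g z) \<in> Borel" by measurable
 then show "(%z. rbump r (x - z) * g z) \<in> borel_measurable lborel" by simp
 show "AE z in lborel. norm (rbump r (x - z) * g z) <= norm (indicator (cball x r) z * g z)"
 proof (rule AE_I2)
  fix z
  show "norm (rbump r (x - z) * g z) <= norm (indicator (cball x r) z * g z)"
   using rbump_nonneg[of r "x - z"] rbump_le_1[of r "x - z"] rbump_zero[OF r, of "x - z"]
   by (cases "z \<in> cball x r") (auto simp: abs_mult dist_norm mult_left_le_one_le)
 qed
qed

lemma mollify_borel:
 assumes "r > 0" "A \<in> sets borel" "locally_integrable_on A f"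
 shows "mollify A r f \<in> Borel"
proof -
 have [measurable]: "conv (rbump r) (%z. indicator A z * f z) \<in> Borel"
  by (intro borel_measurable_continuous_onI smooth_on_continuous smooth_on_conv_locally[OF smooth_on_rbump rbump_zero'[OF assms(1)] assms(3)])
 have [measurable]: "mollifier_mass A r \<in> Borel"
  by (intro borel_measurable_continuous_onI smooth_on_continuous smooth_on_mollifier_mass[OF assms(1,2)])
 show ?thesis unfolding mollify_conv[abs_def] by measurable
qed

lemma mollify_minus_bound:
 assumes kappa0: "kappa0 > 0" and p: "p >= 1"
 obtains C where "C > 0"
  "!!A t0 x r f. plump A kappa0 t0 ==> x \<in> A ==> 0 < r ==> r / 4 <= t0 ==>
   f \<in> Borel ==> locally_integrable_on A f ==>
   epow p (mollify A r f x - f x) <= ennreal (C / r^2) * (NN z. indicator (A \<inter> cball x r) z * epow p (f x - f z))"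
proof -
 define c where "c = bump_lower * (kappa0 / 16)"
 have c: "c > 0" using kappa0 bump_lower_pos by (simp add: c_def)
 define B where "B = 1 / c"
 have B: "B > 0" using c by (simp add: B_def)
 show ?thesis
 proof
  show "2 * B * (2 * B * pi) powr (p - 1) > 0" using B by simp
  fix A t0 x r and f :: "real^2 => real"
  assume pl: "plump A kappa0 t0" and x: "x \<in> A" and r: "0 < r" "r / 4 <= t0" and f[measurable]: "f \<in> Borel"
   and loc: "locally_integrable_on A f"
  have A[measurable]: "A \<in> sets borel" using pl by (simp add: plump_def)
  define m where "m = mollifier_mass A r x"
  have m: "c * r^2 <= m" using plump_cball_lower(2)[OF pl x, of x r] r by (simp add: c_def m_def)
  then have m0: "m > 0" using c r by (auto intro: less_le_trans[of 0 "c * r^2"])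
  have i1: "integrable lborel (%z. rbump r (x - z) * (indicator A z * f z))" by (rule integrable_rbump_mult[OF r(1) loc])
  have i2: "integrable lborel (%z. rbump r (x - z) * indicator A z)" by (rule integrable_rbump_cut[OF r(1) A])
  have "mollify A r f x - f x = (LBINT z. rbump r (x - z) * (indicator A z * f z) / m - rbump r (x - z) * indicator A z * (f x / m))"
   using i1 i2 m0 by (simp add: mollify_def m_def mollifier_mass_def)
  also have "... = (LBINT z. rbump r (x - z) * indicator A z * (f z - f x) / m)"
  proof (intro Bochner_Integration.integral_cong refl)
   fix z
   have "rbump r (x - z) * (indicator A z * f z) - rbump r (x - z) * indicator A z * f x = rbump r (x - z) * indicator A z * (f z - f x)"
    by (simp add: algebra_simps)
   then show "rbump r (x - z) * (indicator A z * f z) / m - rbump r (x - z) * indicator A z * (f x / m) = rbump r (x - z) * indicator A z * (f z - f x) / m"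
    by (simp only: times_divide_eq_right diff_divide_distrib[symmetric])
  qed
  finally have e: "mollify A r f x - f x = (LBINT z. rbump r (x - z) * indicator A z * (f z - f x) / m)" .
  have i3: "integrable lborel (%z. rbump r (x - z) * indicator A z * (f z - f x) / m)"
  proof -
   have "integrable lborel (%z. (rbump r (x - z) * (indicator A z * f z) - f x * (rbump r (x - z) * indicator A z)) / m)"
    using i1 i2 by simp
   then show ?thesis by (simp add: algebra_simps)
  qed
  have "ennreal \<bar>mollify A r f x - f x\<bar> <= (NN z. norm (rbump r (x - z) * indicator A z * (f z - f x) / m))"
   using integral_norm_bound_ennreal[OF i3] e by simp
  also have "... <= (NN z. ennreal (B / r^2) * (indicator (A \<inter> cball x r) z * ennreal \<bar>f x - f z\<bar>))"
  proof (rule nn_integral_mono)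
   fix z
   show "ennreal (norm (rbump r (x - z) * indicator A z * (f z - f x) / m)) <= ennreal (B / r^2) * (indicator (A \<inter> cball x r) z * ennreal \<bar>f x - f z\<bar>)"
   proof (cases "z \<in> A \<inter> cball x r")
    case True
    have "rbump r (x - z) / m <= 1 / (c * r^2)"
     using rbump_nonneg[of r "x - z"] rbump_le_1[of r "x - z"] m m0 c r by (intro frac_le) auto
    then have "rbump r (x - z) / m * \<bar>f x - f z\<bar> <= B / r^2 * \<bar>f x - f z\<bar>"
     by (intro mult_right_mono) (auto simp: B_def)
    then show ?thesis using True B m0 rbump_nonneg[of r "x - z"]
     by (auto simp: ennreal_mult[symmetric] abs_mult abs_minus_commute intro!: ennreal_leI)
   next
    case False
    then show ?thesis using rbump_zero[OF r(1), of "x - z"] by (auto simp: dist_norm indicator_def)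
   qed
  qed
  finally have h: "ennreal \<bar>mollify A r f x - f x\<bar> <= (NN z. ennreal (B / r^2) * (indicator (A \<inter> cball x r) z * ennreal \<bar>f x - f z\<bar>))" .
  show "epow p (mollify A r f x - f x) <= ennreal (2 * B * (2 * B * pi) powr (p - 1) / r^2) * (NN z. indicator (A \<inter> cball x r) z * epow p (f x - f z))"
   by (rule power_mean_bound[OF _ _ _ emeasure_Int_cball_le _ r(1) B _ p h]) (use r in auto)
 qed
qed

lemma powr_diff_bound: "p >= 0 ==> \<bar>a - b\<bar> powr p <= 2 powr p * (\<bar>a\<bar> powr p + \<bar>b\<bar> powr p)" for a b p :: real
proof -
 assume p: "p >= 0"
 have "\<bar>a - b\<bar> powr p <= (2 * max \<bar>a\<bar> \<bar>b\<bar>) powr p" using p by (intro powr_mono2) auto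
 also have "... = 2 powr p * (max \<bar>a\<bar> \<bar>b\<bar>) powr p" by (simp add: powr_mult)
 also have "... <= 2 powr p * (\<bar>a\<bar> powr p + \<bar>b\<bar> powr p)" by (intro mult_left_mono) (auto simp: max_def)
 finally show ?thesis .
qed

lemma pair_int_diff:
 assumes [measurable]: "w \<in> Borel" "A \<in> sets borel" "f \<in> Borel" "g \<in> Borel"
  and p: "p >= 0"
 shows "pair_int w p A (%x. f x - g x) <= ennreal (2 powr p) * (pair_int w p A f + pair_int w p A g)"
proof -
 have "pair_int w p A (%x. f x - g x) <= (NN x. (NN y. ennreal (2 powr p) * (indicator A x * indicator A y * (w (x - y) * epow p (f x - f y))
   + indicator A x * indicator A y * (w (x - y) * epow p (g x - g y)))))"
  unfolding pair_int_def
 proof (intro nn_integral_mono)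
  fix x y
  have "\<bar>f x - g x - (f y - g y)\<bar> powr p <= 2 powr p * (\<bar>f x - f y\<bar> powr p + \<bar>g x - g y\<bar> powr p)"
   using powr_diff_bound[OF p, of "f x - f y" "g x - g y"] by (simp add: algebra_simps)
  then have "epow p (f x - g x - (f y - g y)) <= ennreal (2 powr p) * (epow p (f x - f y) + epow p (g x - g y))"
   by (auto simp: ennreal_mult[symmetric] ennreal_plus[symmetric] simp del: ennreal_plus intro!: ennreal_leI)
  then have "indicator A x * indicator A y * (w (x - y) * epow p (f x - g x - (f y - g y))) <=
    indicator A x * indicator A y * (w (x - y) * (ennreal (2 powr p) * (epow p (f x - f y) + epow p (g x - g y))))"
   by (intro mult_left_mono) auto
  then show "indicator A x * indicator A y * (w (x - y) * epow p (f x - g x - (f y - g y))) <=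
   ennreal (2 powr p) * (indicator A x * indicator A y * (w (x - y) * epow p (f x - f y))
   + indicator A x * indicator A y * (w (x - y) * epow p (g x - g y)))"
   by (simp add: distrib_left mult_ac)
 qed
 also have "... = ennreal (2 powr p) * (pair_int w p A f + pair_int w p A g)"
  unfolding pair_int_def by (simp add: nn_integral_cmult nn_integral_add)
 finally show ?thesis .
qed

lemma pair_osc_mono: "S \<subseteq> T ==> pair_osc p S f <= pair_osc p T f"
 unfolding pair_osc_def by (intro nn_integral_mono mult_right_mono mult_mono) (auto simp: indicator_def)

lemma pair_osc_measurable [measurable]:
 assumes [measurable]: "A \<in> sets borel" "f \<in> Borel"
 shows "(%x. pair_osc p (A \<inter> cball x r) f) \<in> Borel"
proof -
 have "(%x. (NN z. (NN w. (indicator A z * indicator {..r} (dist x z)) * (indicator A w * indicator {..r} (dist x w)) * epow p (f z - f w)))) \<in> Borel"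
  by measurable
 moreover have "(indicator A z * indicator {..r} (dist x z) :: ennreal) = indicator (A \<inter> cball x r) z" for x z
  by (auto simp: indicator_def)
 ultimately show ?thesis unfolding pair_osc_def by simp
qed

lemma smooth_on_segment_mvt:
 fixes F :: "'a::euclidean_space => real"
 assumes "smooth_on S F" and "!!t. 0 <= t ==> t <= 1 ==> y + t *\<^sub>R (x - y) \<in> S"
 shows "\<exists>t. 0 < t \<and> t < 1 \<and> F x - F y = frechet_derivative F (at (y + t *\<^sub>R (x - y))) (x - y)"
proof -
 have "((%t. F (y + t *\<^sub>R (x - y))) has_real_derivative frechet_derivative F (at (y + t *\<^sub>R (x - y))) (x - y)) (at t)"
  if "0 <= t" "t <= 1" for t
 proof -
  have d: "(F has_derivative frechet_derivative F (at (y + t *\<^sub>R (x - y)))) (at (y + t *\<^sub>R (x - y)))"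
   by (rule smooth_on_has_derivative[OF assms(1) assms(2)[OF that]])
  have "((%t. y + t *\<^sub>R (x - y)) has_derivative (%t. t *\<^sub>R (x - y))) (at t)"
   by (auto intro!: derivative_eq_intros)
  from has_derivative_compose[OF this d] show ?thesis
   by (simp add: has_field_derivative_def linear_cmul[OF has_derivative_linear[OF d]] mult_commute_abs)
 qed
 then have "\<exists>t::real>0. t < 1 \<and> F (y + 1 *\<^sub>R (x - y)) - F (y + 0 *\<^sub>R (x - y)) = (1 - 0) * frechet_derivative F (at (y + t *\<^sub>R (x - y))) (x - y)"
  by (intro MVT2) auto
 then show ?thesis by auto
qed

text \<open>Below the scale \<open>r\<close> a mollified function is controlled through its derivative, and \<open>norm (x - y) powr p\<close> makes the kernel
 integrable on the diagonal because \<open>p > 2\<close>.\<close>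

lemma mollify_near_energy:
 assumes kappa0: "kappa0 > 0" and p: "p > 2"
 obtains C where "C > 0"
  "!!A t0 r f. plump A kappa0 t0 ==> 0 < r ==> r / 4 <= t0 ==>
   f \<in> Borel ==> locally_integrable_on A f ==>
   energy_near (r / 4) p A (mollify A r f) <= ennreal C * energy_near (6 * r) p A f"
proof -
 have p1: "p >= 1" using p by simp
 show ?thesis
 proof (rule plump_derivative_bound[OF kappa0 p1], goal_cases)
 case C: (1 C)
 define Cp where "Cp = 4 * pi / (1 - 2 powr (2 - p))"
 have Cp: "Cp > 0" using p by (simp add: Cp_def powr_less_one)
 show ?thesis
 proof
  show "C * Cp * (4 * pi) * 1296 > 0" using C Cp by simp
  fix A t0 r and f :: "real^2 => real"
  assume pl: "plump A kappa0 t0" and r: "0 < r" "r / 4 <= t0" and f[measurable]: "f \<in> Borel"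
   and loc: "locally_integrable_on A f"
  have A[measurable]: "A \<in> sets borel" using pl by (simp add: plump_def)
  define F where "F = mollify A r f"
  have [measurable]: "F \<in> Borel" unfolding F_def by (rule mollify_borel[OF r(1) A loc])
  define S where "S = {x. mollifier_mass A r x ~= 0}"
  have oS: "open S"
  proof -
   have "continuous_on UNIV (mollifier_mass A r)" by (rule smooth_on_continuous[OF smooth_on_mollifier_mass[OF r(1) A]])
   then have "open (mollifier_mass A r -` (- {0}))" by (intro open_vimage) auto
   then show ?thesis by (simp add: S_def vimage_def)
  qed
  have sF: "smooth_on S F" unfolding F_def by (rule smooth_on_mollify[OF r(1) A loc oS]) (simp add: S_def)
  have inS: "\<xi> \<in> S" if "x \<in> A" "dist \<xi> x <= r / 2" for x \<xi>
  proof -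
   have "bump_lower * (kappa0 / 16 * r^2) > 0" using kappa0 bump_lower_pos r by simp
   then show ?thesis using plump_cball_lower(2)[OF pl that r] by (auto simp: S_def)
  qed
  have pt: "near (r / 4) (x - y) * epow p (F x - F y) <=
    near (r / 4) (x - y) * (ennreal (norm (x - y) powr p) * (ennreal (C / (r powr p * r^4)) * pair_osc p (A \<inter> cball x (2 * r)) f))"
   if x: "x \<in> A" for x y
  proof (cases "norm (x - y) < r / 4")
   case True
   have seg: "dist (y + t *\<^sub>R (x - y)) x <= r / 4" if "0 <= t" "t <= 1" for t
   proof -
    have "y + t *\<^sub>R (x - y) - x = (1 - t) *\<^sub>R (y - x)" by (simp add: algebra_simps)
    then have "dist (y + t *\<^sub>R (x - y)) x = (1 - t) * norm (x - y)" using that by (simp add: dist_norm norm_minus_commute)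
    also have "... <= norm (x - y)" using that by (intro mult_left_le_one_le) auto
    finally show ?thesis using True by simp
   qed
   have "\<exists>t. 0 < t \<and> t < 1 \<and> F x - F y = frechet_derivative F (at (y + t *\<^sub>R (x - y))) (x - y)"
    by (rule smooth_on_segment_mvt[OF sF]) (use inS[OF x] seg r in force)
   then obtain t where t: "0 < t" "t < 1" "F x - F y = frechet_derivative F (at (y + t *\<^sub>R (x - y))) (x - y)" by blast
   define \<xi> where "\<xi> = y + t *\<^sub>R (x - y)"
   have d\<xi>: "dist \<xi> x <= r / 4" unfolding \<xi>_def using seg t by simp
   have "epow p (F x - F y) <= ennreal ((norm (x - y) / r) powr p * (C / r^4)) * pair_osc p (A \<inter> cball \<xi> r) f"
    using C(2)[OF pl x _ r f loc, of \<xi> "x - y"] d\<xi> r t(3) by (simp add: F_def \<xi>_def)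
   also have "... <= ennreal ((norm (x - y) / r) powr p * (C / r^4)) * pair_osc p (A \<inter> cball x (2 * r)) f"
   proof (intro mult_left_mono pair_osc_mono)
    show "A \<inter> cball \<xi> r \<subseteq> A \<inter> cball x (2 * r)"
    proof
     fix z assume "z \<in> A \<inter> cball \<xi> r"
     then show "z \<in> A \<inter> cball x (2 * r)" using dist_triangle[of x z \<xi>] d\<xi> r by (auto simp: dist_commute)
    qed
   qed simp
   also have "ennreal ((norm (x - y) / r) powr p * (C / r^4)) = ennreal (norm (x - y) powr p) * ennreal (C / (r powr p * r^4))"
    using r C(1) by (simp add: ennreal_mult[symmetric] powr_divide)
   finally show ?thesis by (simp add: mult.assoc mult_left_mono)
  qed (simp add: near_def)
  have inner: "(NN y. indicator A x * indicator A y * (near (r / 4) (x - y) * inv4 (x - y) * epow p (F x - F y)))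
   <= ennreal (C * Cp / r^6) * pair_osc p (A \<inter> cball x (2 * r)) f" for x
  proof (cases "x \<in> A")
   case True
   let ?P = "pair_osc p (A \<inter> cball x (2 * r)) f"
   have "(NN y. indicator A x * indicator A y * (near (r / 4) (x - y) * inv4 (x - y) * epow p (F x - F y)))
    <= (NN y. near (r / 4) (x - y) * (inv4 (x - y) * ennreal (norm (x - y) powr p)) * (ennreal (C / (r powr p * r^4)) * ?P))"
   proof (intro nn_integral_mono)
    fix y
    have "indicator A x * indicator A y * (near (r / 4) (x - y) * inv4 (x - y) * epow p (F x - F y))
     <= inv4 (x - y) * (near (r / 4) (x - y) * epow p (F x - F y))"
     by (auto simp: indicator_def mult_ac)
    also have "... <= inv4 (x - y) * (near (r / 4) (x - y) * (ennreal (norm (x - y) powr p) * (ennreal (C / (r powr p * r^4)) * ?P)))"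
     by (intro mult_left_mono pt True) simp
    finally show "indicator A x * indicator A y * (near (r / 4) (x - y) * inv4 (x - y) * epow p (F x - F y))
     <= near (r / 4) (x - y) * (inv4 (x - y) * ennreal (norm (x - y) powr p)) * (ennreal (C / (r powr p * r^4)) * ?P)"
     by (simp add: mult_ac)
   qed
   also have "... = (NN u. near (r / 4) u * (inv4 u * ennreal (norm u powr p))) * (ennreal (C / (r powr p * r^4)) * ?P)"
    by (subst nn_integral_multc) (auto intro!: arg_cong2[where f = "(*)"] nn_integral_lborel_diff)
   also have "... <= ennreal (Cp * (r / 4) powr (p - 2)) * (ennreal (C / (r powr p * r^4)) * ?P)"
    unfolding Cp_def by (intro mult_right_mono nn_integral_near_power p) (use r in auto)
   also have "... <= ennreal (Cp * r powr (p - 2)) * (ennreal (C / (r powr p * r^4)) * ?P)"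
    using r Cp p by (intro mult_right_mono ennreal_leI mult_left_mono powr_mono2) auto
   also have "... = ennreal (C * Cp / r^6) * ?P"
   proof -
    have "r powr (p - 2) = r powr p / r^2" using r by (simp add: powr_diff)
    then have "Cp * r powr (p - 2) * (C / (r powr p * r^4)) = C * Cp / r^6"
     using r by (simp add: field_simps power2_eq_square eval_nat_numeral)
    then show ?thesis using C Cp r by (simp add: ennreal_mult[symmetric] mult.assoc[symmetric])
   qed
   finally show ?thesis .
  qed simp
  have "energy_near (r / 4) p A F <= (NN x. ennreal (C * Cp / r^6) * pair_osc p (A \<inter> cball x (2 * r)) f)"
   unfolding pair_int_def by (intro nn_integral_mono inner)
  also have "... = ennreal (C * Cp / r^6) * (NN x. pair_osc p (A \<inter> cball x (2 * r)) f)"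
   by (intro nn_integral_cmult) simp
  also have "... <= ennreal (C * Cp / r^6) * (ennreal (pi * (2 * r)^2) * pair_int (near (3 * (2 * r))) p A f)"
   using r by (intro mult_left_mono integral_pair_osc) auto
  also have "... <= ennreal (C * Cp / r^6) * (ennreal (pi * (2 * r)^2) * (ennreal ((6 * r)^4) * energy_near (6 * r) p A f))"
   using near_le_energy_near[of "6 * r" A f p] r by (intro mult_left_mono) auto
  also have "... = ennreal (C * Cp * (4 * pi) * 1296) * energy_near (6 * r) p A f"
  proof -
   have "C * Cp / r^6 * (pi * (2 * r)^2 * (6 * r)^4) = C * Cp * (4 * pi) * 1296"
    using r by (simp add: field_simps eval_nat_numeral)
   moreover have "ennreal (C * Cp / r^6) * (ennreal (pi * (2 * r)^2) * (ennreal ((6 * r)^4) * E)) = ennreal (C * Cp / r^6 * (pi * (2 * r)^2 * (6 * r)^4)) * E" for E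
   proof -
    have n: "0 <= C * Cp / r^6" "0 <= pi * (2 * r)^2" "0 <= (6 * r)^4" using C Cp r by auto
    show ?thesis
     unfolding ennreal_mult_merge[OF n(2,3)] ennreal_mult_merge[OF n(1) mult_nonneg_nonneg[OF n(2,3)]] ..
   qed
   ultimately show ?thesis by (simp only:)
  qed
  finally show "energy_near (r / 4) p A (mollify A r f) <= ennreal (C * Cp * (4 * pi) * 1296) * energy_near (6 * r) p A f"
   by (simp add: F_def)
 qed
 qed
qed

definition Lp_int :: "real => (real^2) set => (real^2 => real) => ennreal" where
 "Lp_int p A u = (NN x. indicator A x * epow p (u x))"

lemma inv4_minus: "inv4 (x - y) = inv4 (y - x)" by (simp add: inv4_def norm_minus_commute)
lemma far_minus: "far r (x - y) = far r (y - x)" by (simp add: far_def inv4_minus norm_minus_commute)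

lemma pair_int_far_le:
 assumes [measurable]: "A \<in> sets borel" "u \<in> Borel" and rho: "rho > 0" and p: "p >= 0"
 shows "pair_int (far rho) p A u <= ennreal (2 powr p * (32 * pi / rho^2)) * Lp_int p A u"
proof -
 define h where "h = (%x. indicator A x * epow p (u x))"
 have [measurable]: "h \<in> Borel" unfolding h_def by measurable
 have hL: "Lp_int p A u = (NN x. h x)" by (simp add: Lp_int_def h_def)
 have "pair_int (far rho) p A u <= (NN x. (NN y. ennreal (2 powr p) * (h x * far rho (x - y) + h y * far rho (x - y))))"
  unfolding pair_int_def
 proof (intro nn_integral_mono)
  fix x y
  have "epow p (u x - u y) <= ennreal (2 powr p) * (epow p (u x) + epow p (u y))"
   using powr_diff_bound[OF p, of "u x" "u y"]
   by (auto simp: ennreal_mult[symmetric] ennreal_plus[symmetric] simp del: ennreal_plus intro!: ennreal_leI)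
  from mult_left_mono[OF this, of "far rho (x - y)"]
  show "indicator A x * indicator A y * (far rho (x - y) * epow p (u x - u y)) <= ennreal (2 powr p) * (h x * far rho (x - y) + h y * far rho (x - y))"
   by (cases "x \<in> A"; cases "y \<in> A") (simp_all add: h_def distrib_left mult_ac)
 qed
 also have "... = ennreal (2 powr p) * ((NN x. (NN y. h x * far rho (x - y))) + (NN x. (NN y. h y * far rho (x - y))))"
  by (simp add: nn_integral_cmult nn_integral_add)
 also have "(NN x. (NN y. h y * far rho (x - y))) = (NN y. (NN x. h y * far rho (x - y)))"
  by (rule lborel_pair.Fubini') measurable
 also have "... = (NN x. (NN y. h x * far rho (x - y)))"
  by (intro nn_integral_cong) (simp add: far_minus)
 also have "(NN x. (NN y. h x * far rho (x - y))) = (NN x. h x) * (NN u. far rho u)"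
  by (simp add: nn_integral_cmult nn_integral_multc nn_integral_lborel_diff)
 also have "ennreal (2 powr p) * ((NN x. h x) * (NN u. far rho u) + (NN x. h x) * (NN u. far rho u))
  <= ennreal (2 powr p) * ((NN x. h x) * ennreal (16 * pi / rho^2) + (NN x. h x) * ennreal (16 * pi / rho^2))"
  by (intro mult_left_mono add_mono nn_integral_far[OF rho]) auto
 also have "... = ennreal (2 powr p * (32 * pi / rho^2)) * Lp_int p A u"
 proof -
  have "(NN x. h x) * ennreal (16 * pi / rho^2) + (NN x. h x) * ennreal (16 * pi / rho^2) = ennreal (16 * pi / rho^2 + 16 * pi / rho^2) * (NN x. h x)"
   by (subst ennreal_plus) (auto simp: algebra_simps)
  then show ?thesis unfolding hL by (subst ennreal_mult) (auto simp: mult.assoc add_divide_distrib[symmetric])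
 qed
 finally show ?thesis .
qed

text \<open>Close pairs are covered by \<open>mollify_near_energy\<close>, distant ones by the \<open>L^p\<close> bound. Both errors are measured by the energy
 at distances below \<open>6 * r\<close>, which vanishes with \<open>r\<close> when the energy is finite.\<close>

lemma mollify_approximation:
 assumes kappa0: "kappa0 > 0" and p: "p > 2"
 obtains C where "C > 0"
  "!!A t0 r f. plump A kappa0 t0 ==> 0 < r ==> r / 4 <= t0 ==>
   f \<in> Borel ==> locally_integrable_on A f ==>
   Lp_int p A (%x. mollify A r f x - f x) <= ennreal (C * r^2) * energy_near (6 * r) p A f"
  "!!A t0 r f. plump A kappa0 t0 ==> 0 < r ==> r / 4 <= t0 ==>
   f \<in> Borel ==> locally_integrable_on A f ==>
   energy p A (%x. mollify A r f x - f x) <= ennreal C * energy_near (6 * r) p A f"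
proof -
 have p1: "p >= 1" and p0: "p >= 0" using p by auto
 show ?thesis
 proof (rule mollify_minus_bound[OF kappa0 p1], goal_cases)
 case K: (1 K)
 show ?thesis
 proof (rule mollify_near_energy[OF kappa0 p], goal_cases)
 case C1: (1 C1)
 define C2 where "C2 = 2 powr p * (C1 + 1) + 2 powr p * (32 * 16 * pi) * (16 * K)"
 have C2: "C2 > 0" using C1 K by (simp add: C2_def add_pos_pos)
 have Lp: "Lp_int p A (%x. mollify A r f x - f x) <= ennreal (16 * K * r^2) * energy_near (6 * r) p A f"
  if pl: "plump A kappa0 t0" and r: "0 < r" "r / 4 <= t0" and f[measurable]: "f \<in> Borel" and loc: "locally_integrable_on A f"
  for A t0 r f
 proof -
  have A[measurable]: "A \<in> sets borel" using pl by (simp add: plump_def)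
  have "Lp_int p A (%x. mollify A r f x - f x) <=
   (NN x. (NN z. ennreal (K / r^2) * (indicator A x * indicator A z * (near (2 * r) (x - z) * epow p (f x - f z)))))"
   unfolding Lp_int_def
  proof (intro nn_integral_mono)
   fix x
   show "indicator A x * epow p (mollify A r f x - f x) <=
    (NN z. ennreal (K / r^2) * (indicator A x * indicator A z * (near (2 * r) (x - z) * epow p (f x - f z))))"
   proof (cases "x \<in> A")
    case True
    have "epow p (mollify A r f x - f x) <= ennreal (K / r^2) * (NN z. indicator (A \<inter> cball x r) z * epow p (f x - f z))"
     by (rule K(2)[OF pl True r f loc])
    also have "... <= ennreal (K / r^2) * (NN z. indicator A z * (near (2 * r) (x - z) * epow p (f x - f z)))"
     using r by (intro mult_left_mono nn_integral_mono) (auto simp: indicator_def near_def dist_norm norm_minus_commute)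
    finally show ?thesis using True by (simp add: nn_integral_cmult)
   qed simp
  qed
  also have "... = ennreal (K / r^2) * pair_int (near (2 * r)) p A f"
   unfolding pair_int_def by (simp add: nn_integral_cmult)
  also have "... <= ennreal (K / r^2) * (ennreal ((2 * r)^4) * energy_near (2 * r) p A f)"
   using r by (intro mult_left_mono near_le_energy_near) auto
  also have "... <= ennreal (K / r^2) * (ennreal ((2 * r)^4) * energy_near (6 * r) p A f)"
   using r by (intro mult_left_mono energy_near_mono) auto
  also have "... = ennreal (K / r^2 * (2 * r)^4) * energy_near (6 * r) p A f"
   using K r by (intro ennreal_mult_merge) auto
  also have "K / r^2 * (2 * r)^4 = 16 * K * r^2" using r by (simp add: field_simps eval_nat_numeral)
  finally show ?thesis .
 qed
 show ?thesis
 proof (rule that[of "C2 + 16 * K"])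
  show "C2 + 16 * K > 0" using C2 K by simp
  fix A t0 r and f :: "real^2 => real"
  assume pl: "plump A kappa0 t0" and r: "0 < r" "r / 4 <= t0" and f[measurable]: "f \<in> Borel" and loc: "locally_integrable_on A f"
  have A[measurable]: "A \<in> sets borel" using pl by (simp add: plump_def)
  let ?E = "energy_near (6 * r) p A f"
  note L = Lp[OF pl r f loc]
  have "ennreal (16 * K * r^2) <= ennreal ((C2 + 16 * K) * r^2)"
   using C2 by (intro ennreal_leI mult_right_mono) auto
  from order_trans[OF L mult_right_mono[OF this]]
  show "Lp_int p A (%x. mollify A r f x - f x) <= ennreal ((C2 + 16 * K) * r^2) * ?E" by simp
  have F[measurable]: "mollify A r f \<in> Borel" by (rule mollify_borel[OF r(1) A loc])
  have "energy p A (%x. mollify A r f x - f x) = energy_near (r / 4) p A (%x. mollify A r f x - f x) + pair_int (far (r / 4)) p A (%x. mollify A r f x - f x)"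
   by (subst pair_int_add[symmetric]) (auto simp: near_far)
  also have "... <= ennreal (2 powr p) * (ennreal C1 * ?E + ?E) + ennreal (2 powr p * (32 * pi / (r / 4)^2)) * (ennreal (16 * K * r^2) * ?E)"
  proof (intro add_mono)
   have "energy_near (r / 4) p A (%x. mollify A r f x - f x) <= ennreal (2 powr p) * (energy_near (r / 4) p A (mollify A r f) + energy_near (r / 4) p A f)"
    by (rule pair_int_diff) (use p0 in measurable)
   also have "... <= ennreal (2 powr p) * (ennreal C1 * ?E + ?E)"
    using r by (intro mult_left_mono add_mono C1(2)[OF pl r f loc] energy_near_mono) auto
   finally show "energy_near (r / 4) p A (%x. mollify A r f x - f x) <= ennreal (2 powr p) * (ennreal C1 * ?E + ?E)" .
   have "pair_int (far (r / 4)) p A (%x. mollify A r f x - f x) <= ennreal (2 powr p * (32 * pi / (r / 4)^2)) * Lp_int p A (%x. mollify A r f x - f x)"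
    by (rule pair_int_far_le) (use p0 r in auto)
   also have "... <= ennreal (2 powr p * (32 * pi / (r / 4)^2)) * (ennreal (16 * K * r^2) * ?E)"
    by (intro mult_left_mono L) auto
   finally show "pair_int (far (r / 4)) p A (%x. mollify A r f x - f x) <= ennreal (2 powr p * (32 * pi / (r / 4)^2)) * (ennreal (16 * K * r^2) * ?E)" .
  qed
  also have "... = ennreal C2 * ?E"
  proof -
   have a: "ennreal C1 * ?E + ?E = ennreal (C1 + 1) * ?E" using C1(1) by (simp add: distrib_right ennreal_plus)
   have b: "ennreal (2 powr p) * (ennreal (C1 + 1) * ?E) = ennreal (2 powr p * (C1 + 1)) * ?E"
    using C1(1) by (intro ennreal_mult_merge) auto
   have c: "ennreal (2 powr p * (32 * pi / (r / 4)^2)) * (ennreal (16 * K * r^2) * ?E) = ennreal (2 powr p * (32 * pi / (r / 4)^2) * (16 * K * r^2)) * ?E"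
    using K(1) by (intro ennreal_mult_merge) auto
   have d: "2 powr p * (32 * pi / (r / 4)^2) * (16 * K * r^2) = 2 powr p * (32 * 16 * pi) * (16 * K)"
    using r by (simp add: field_simps power2_eq_square)
   have e: "ennreal C2 = ennreal (2 powr p * (C1 + 1)) + ennreal (2 powr p * (32 * 16 * pi) * (16 * K))"
    unfolding C2_def using C1(1) K(1) by (intro ennreal_plus) auto
   show ?thesis unfolding a b c d e by (simp only: distrib_right)
  qed
  also have "... <= ennreal (C2 + 16 * K) * ?E"
   using K by (intro mult_right_mono ennreal_leI) auto
  finally show "energy p A (%x. mollify A r f x - f x) <= ennreal (C2 + 16 * K) * ?E" .
 qed
 qed
 qed
qed

section \<open>Extension by zero\<close>

lemma nn_integral_lborel_affine:
 fixes g :: "real^2 => ennreal"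
 assumes [measurable]: "g \<in> Borel"
 shows "(NN x. g x) = 4 * (NN w. g (2 *\<^sub>R w - y))"
proof -
 have "(NN x. g x) = (\<integral>\<^sup>+x. g x \<partial>(density (distr lborel borel (%x. - y + 2 *\<^sub>R x)) (%_. ennreal (\<bar>2\<bar> ^ DIM(real^2)))))"
  using lborel_affine[of 2 "- y"] by simp
 also have "... = (NN w. 4 * g (- y + 2 *\<^sub>R w))"
  by (simp add: nn_integral_density nn_integral_distr)
 also have "... = 4 * (NN w. g (2 *\<^sub>R w - y))"
  by (subst nn_integral_cmult) auto
 finally show ?thesis .
qed

lemma inv4_double: "inv4 (2 *\<^sub>R u) = ennreal (1/16) * inv4 u"
 by (simp add: inv4_def ennreal_mult[symmetric] power_mult_distrib)

lemma powr_split_small: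
 assumes p: "p > (0::real)"
 obtains b where "b > 0" "!!x w :: real. \<bar>x\<bar> powr p <= 3/2 * \<bar>w\<bar> powr p + b * \<bar>x - w\<bar> powr p"
proof -
 define e where "e = (3/2) powr (1 / p) - 1"
 have "(3/2) powr (1 / p) > (1::real)" using p by (intro gr_one_powr) auto
 then have e: "e > 0" by (simp add: e_def)
 have e1: "(1 + e) powr p = 3/2" using p by (simp add: e_def powr_powr)
 show ?thesis
 proof (rule that[of "(1 + 1 / e) powr p"])
  have "1 + 1 / e > 0" using e by (simp add: add_pos_pos)
  then show "(1 + 1 / e) powr p > 0" by simp
  fix x w :: real
  show "\<bar>x\<bar> powr p <= 3/2 * \<bar>w\<bar> powr p + (1 + 1 / e) powr p * \<bar>x - w\<bar> powr p"
  proof (cases "\<bar>x - w\<bar> <= e * \<bar>w\<bar>")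
   case True
   then have "\<bar>x\<bar> <= (1 + e) * \<bar>w\<bar>" by (simp add: algebra_simps)
   then have "\<bar>x\<bar> powr p <= ((1 + e) * \<bar>w\<bar>) powr p" using p by (intro powr_mono2) auto
   also have "... = 3/2 * \<bar>w\<bar> powr p" using e by (simp add: powr_mult e1)
   finally show ?thesis by (simp add: add_increasing2)
  next
   case False
   then have "\<bar>w\<bar> <= \<bar>x - w\<bar> / e" using e by (simp add: field_simps)
   then have "\<bar>x\<bar> <= (1 + 1 / e) * \<bar>x - w\<bar>" by (simp add: algebra_simps)
   then have "\<bar>x\<bar> powr p <= ((1 + 1 / e) * \<bar>x - w\<bar>) powr p" using p by (intro powr_mono2) auto
   also have "... = (1 + 1 / e) powr p * \<bar>x - w\<bar> powr p" using e by (simp add: powr_mult)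
   finally show ?thesis by (simp add: add_increasing)
  qed
 qed
qed

text \<open>What has to be bounded is the interaction \<open>J\<close> of \<open>A\<close> with its complement. Given \<open>x \<in> A\<close> and \<open>y \<notin> A\<close>, look at the
 midpoint \<open>w\<close>. If \<open>w \<notin> A\<close>, substituting \<open>w\<close> for \<open>y\<close> gives a quarter of \<open>J\<close>. If \<open>w \<in> A\<close>, replace \<open>Phi x\<close> by \<open>Phi w\<close>, at
 the cost of a factor \<open>3/2\<close> and of a term bounded by the energy inside \<open>A\<close>; this gives three eighths of \<open>J\<close>. As \<open>J\<close> is
 finite and \<open>1/4 + 3/8 < 1\<close>, both parts can be absorbed.\<close>

lemma energy_zero_extension:
 assumes p: "p > 0"
 obtains C where "C > 0"
  "!!A K Phi. open A ==> compact K ==> K \<subseteq> A ==> Phi \<in> Borel ==> (\<exists>B. \<forall>x. \<bar>Phi x\<bar> <= B) ==>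
   (!!x. x \<notin> K ==> Phi x = 0) ==> energy p UNIV Phi <= ennreal C * energy p A Phi"
proof -
 obtain b where b: "b > 0" "!!x w :: real. \<bar>x\<bar> powr p <= 3/2 * \<bar>w\<bar> powr p + b * \<bar>x - w\<bar> powr p"
  using powr_split_small[OF p] by metis
 show ?thesis
 proof (rule that[of "1 + 2 * b"])
  show "1 + 2 * b > 0" using b by simp
  fix A K :: "(real^2) set" and Phi :: "real^2 => real"
  assume A: "open A" and K: "compact K" "K \<subseteq> A" and [measurable]: "Phi \<in> Borel" and bd: "\<exists>B. \<forall>x. \<bar>Phi x\<bar> <= B"
   and z: "!!x. x \<notin> K ==> Phi x = 0"
  have [measurable]: "A \<in> sets borel" using A by simp
  define h where "h = (%x. epow p (Phi x))"
  have [measurable]: "h \<in> Borel" unfolding h_def by measurable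
  have hz: "h x = 0" if "x \<notin> K" for x by (simp add: h_def z[OF that])
  (* J is finite because Phi vanishes at a positive distance from the complement of A. *)
  define J where "J = (NN x. (NN y. indicator A x * indicator (- A) y * (inv4 (x - y) * h x)))"
  define E where "E = energy p A Phi"
  have Jfin: "J < \<infinity>"
  proof -
   obtain B where B: "!!x. \<bar>Phi x\<bar> <= B" using bd by blast
   have "K \<inter> (- A) = {}" using K by auto
   then obtain d where d: "d > 0" "!!x y. x \<in> K ==> y \<in> - A ==> d <= dist x y"
    using separate_compact_closed[OF K(1), of "- A"] A by (metis closed_Compl)
   have "J <= (NN x. (NN y. (ennreal (B powr p) * indicator K x) * far d (x - y)))"
    unfolding J_def
   proof (intro nn_integral_mono)
    fix x y
    show "indicator A x * indicator (- A) y * (inv4 (x - y) * h x) <= (ennreal (B powr p) * indicator K x) * far d (x - y)"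
    proof (cases "x \<in> K \<and> y \<in> - A")
     case True
     then have "\<not> norm (x - y) < d" using d(2)[of x y] by (simp add: dist_norm)
     moreover have "h x <= ennreal (B powr p)" unfolding h_def using B[of x] p by (intro ennreal_leI powr_mono2) auto
     moreover have "x \<in> A" using True K by auto
     ultimately show ?thesis using True by (auto simp: far_def mult.commute[of "inv4 (x - y)"] intro!: mult_right_mono)
    qed (auto simp: hz)
   qed
   also have "... = ennreal (B powr p) * emeasure lborel K * (NN u. far d u)"
   proof -
    have [measurable]: "K \<in> sets borel" using K by (simp add: compact_imp_closed)
    show ?thesis by (simp add: nn_integral_cmult nn_integral_multc nn_integral_lborel_diff nn_integral_cmult_indicator)
   qed
   also have "... < \<infinity>"
    using emeasure_compact_finite[OF K(1)] nn_integral_far[OF d(1)]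
    by (auto simp: ennreal_mult_less_top order_le_less_trans)
   finally show ?thesis .
  qed
  let ?m = "%x y. (1/2) *\<^sub>R (x + y) :: real^2"
  define J1 where "J1 = (NN x. (NN y. indicator A x * indicator (- A) (?m x y) * (inv4 (x - y) * h x)))"
  define J2 where "J2 = (NN x. (NN y. indicator (- A) y * indicator A (?m x y) * (inv4 (x - y) * h (?m x y))))"
  define J3 where "J3 = (NN x. (NN y. indicator A x * indicator A (?m x y) * (inv4 (x - y) * epow p (Phi x - Phi (?m x y)))))"
  have split: "J <= J1 + (ennreal (3/2) * J2 + ennreal b * J3)"
  proof -
   have "J <= (NN x. (NN y. indicator A x * indicator (- A) (?m x y) * (inv4 (x - y) * h x) +
     (ennreal (3/2) * (indicator (- A) y * indicator A (?m x y) * (inv4 (x - y) * h (?m x y))) +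
      ennreal b * (indicator A x * indicator A (?m x y) * (inv4 (x - y) * epow p (Phi x - Phi (?m x y)))))))"
    unfolding J_def
   proof (intro nn_integral_mono)
    fix x y
    have "h x <= ennreal (3/2) * h (?m x y) + ennreal b * epow p (Phi x - Phi (?m x y))"
     unfolding h_def using b(2)[of "Phi x" "Phi (?m x y)"] b(1)
     by (auto simp: ennreal_mult[symmetric] ennreal_plus[symmetric] simp del: ennreal_plus intro!: ennreal_leI)
    from mult_left_mono[OF this, of "inv4 (x - y)"]
    have *: "inv4 (x - y) * h x <= ennreal (3/2) * (inv4 (x - y) * h (?m x y)) + ennreal b * (inv4 (x - y) * epow p (Phi x - Phi (?m x y)))"
     by (simp add: distrib_left mult_ac)
    show "indicator A x * indicator (- A) y * (inv4 (x - y) * h x) <= indicator A x * indicator (- A) (?m x y) * (inv4 (x - y) * h x) +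
     (ennreal (3/2) * (indicator (- A) y * indicator A (?m x y) * (inv4 (x - y) * h (?m x y))) +
      ennreal b * (indicator A x * indicator A (?m x y) * (inv4 (x - y) * epow p (Phi x - Phi (?m x y)))))"
     using * by (cases "x \<in> A"; cases "y \<in> A"; cases "?m x y \<in> A") simp_all
   qed
   also have "... = J1 + (ennreal (3/2) * J2 + ennreal b * J3)"
    unfolding J1_def J2_def J3_def by (simp add: nn_integral_cmult nn_integral_add)
   finally show ?thesis .
  qed
  have sub: "?m x (2 *\<^sub>R w - x) = w" "?m (2 *\<^sub>R w - x) x = w" "x - (2 *\<^sub>R w - x) = 2 *\<^sub>R (x - w)" "(2 *\<^sub>R w - x) - x = 2 *\<^sub>R (w - x)" for x w :: "real^2"
   by (simp_all add: scaleR_2)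
  have four: "4 * (NN w. G w * (ennreal (1/16) * inv4 (u w) * H w)) = ennreal (1/4) * (NN w. G w * (inv4 (u w) * H w))"
   if [measurable]: "G \<in> Borel" "u \<in> Borel" "H \<in> Borel" for G H :: "real^2 => ennreal" and u
  proof -
   have "(NN w. G w * (ennreal (1/16) * inv4 (u w) * H w)) = ennreal (1/16) * (NN w. G w * (inv4 (u w) * H w))"
    by (subst nn_integral_cmult[symmetric]) (auto simp: mult_ac)
   moreover have "ennreal 4 * (ennreal (1/16) * X) = ennreal (1/4) * X" for X by (subst ennreal_mult_merge) auto
   ultimately show ?thesis by simp
  qed
  have J1: "J1 <= ennreal (1/4) * J"
  proof -
   have "J1 = (NN x. ennreal (1/4) * (NN w. indicator A x * indicator (- A) w * (inv4 (x - w) * h x)))"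
    unfolding J1_def
   proof (intro nn_integral_cong)
    fix x
    have "(NN y. indicator A x * indicator (- A) (?m x y) * (inv4 (x - y) * h x)) = 4 * (NN w. (indicator A x * indicator (- A) w) * (ennreal (1/16) * inv4 (x - w) * h x))"
     by (subst nn_integral_lborel_affine[where y = x], measurable) (simp only: sub inv4_double)
    also have "... = ennreal (1/4) * (NN w. indicator A x * indicator (- A) w * (inv4 (x - w) * h x))"
     by (rule four) measurable
    finally show "(NN y. indicator A x * indicator (- A) (?m x y) * (inv4 (x - y) * h x)) = ennreal (1/4) * (NN w. indicator A x * indicator (- A) w * (inv4 (x - w) * h x))" .
   qed
   also have "... = ennreal (1/4) * J" unfolding J_def by (simp add: nn_integral_cmult)
   finally show ?thesis by simp
  qed
  have J2: "J2 <= ennreal (1/4) * J"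
  proof -
   have "J2 = (NN y. (NN x. indicator (- A) y * indicator A (?m x y) * (inv4 (x - y) * h (?m x y))))"
    unfolding J2_def by (rule lborel_pair.Fubini'[symmetric]) measurable
   also have "... = (NN y. ennreal (1/4) * (NN w. indicator (- A) y * indicator A w * (inv4 (w - y) * h w)))"
   proof (intro nn_integral_cong)
    fix y
    have "(NN x. indicator (- A) y * indicator A (?m x y) * (inv4 (x - y) * h (?m x y))) = 4 * (NN w. (indicator (- A) y * indicator A w) * (ennreal (1/16) * inv4 (w - y) * h w))"
     by (subst nn_integral_lborel_affine[where y = y], measurable) (simp only: sub inv4_double)
    also have "... = ennreal (1/4) * (NN w. indicator (- A) y * indicator A w * (inv4 (w - y) * h w))"
     by (rule four) measurable
    finally show "(NN x. indicator (- A) y * indicator A (?m x y) * (inv4 (x - y) * h (?m x y))) = ennreal (1/4) * (NN w. indicator (- A) y * indicator A w * (inv4 (w - y) * h w))" .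
   qed
   also have "... = ennreal (1/4) * (NN y. (NN w. indicator (- A) y * indicator A w * (inv4 (w - y) * h w)))"
    by (simp add: nn_integral_cmult)
   also have "(NN y. (NN w. indicator (- A) y * indicator A w * (inv4 (w - y) * h w))) = (NN w. (NN y. indicator (- A) y * indicator A w * (inv4 (w - y) * h w)))"
    by (rule lborel_pair.Fubini') measurable
   also have "... = J" unfolding J_def by (intro nn_integral_cong) (simp add: mult_ac)
   finally show ?thesis by simp
  qed
  have J3: "J3 <= ennreal (1/4) * E"
  proof -
   have "J3 = (NN x. ennreal (1/4) * (NN w. indicator A x * indicator A w * (inv4 (x - w) * epow p (Phi x - Phi w))))"
    unfolding J3_def
   proof (intro nn_integral_cong)
    fix x
    have "(NN y. indicator A x * indicator A (?m x y) * (inv4 (x - y) * epow p (Phi x - Phi (?m x y)))) = 4 * (NN w. (indicator A x * indicator A w) * (ennreal (1/16) * inv4 (x - w) * epow p (Phi x - Phi w)))"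
     by (subst nn_integral_lborel_affine[where y = x], measurable) (simp only: sub inv4_double)
    also have "... = ennreal (1/4) * (NN w. indicator A x * indicator A w * (inv4 (x - w) * epow p (Phi x - Phi w)))"
     by (rule four) measurable
    finally show "(NN y. indicator A x * indicator A (?m x y) * (inv4 (x - y) * epow p (Phi x - Phi (?m x y)))) = ennreal (1/4) * (NN w. indicator A x * indicator A w * (inv4 (x - w) * epow p (Phi x - Phi w)))" .
   qed
   also have "... = ennreal (1/4) * E" unfolding E_def pair_int_def by (simp add: nn_integral_cmult)
   finally show ?thesis by simp
  qed
  have JE: "J <= ennreal b * E"
  proof (cases E)
   case (real e)
   obtain j where j: "J = ennreal j" "j >= 0" using Jfin by (cases J) auto
   have "J <= ennreal (1/4) * J + (ennreal (3/2) * (ennreal (1/4) * J) + ennreal b * (ennreal (1/4) * E))"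
    by (rule order_trans[OF split]) (intro add_mono mult_left_mono J1 J2 J3, auto)
   also have "... = ennreal (1/4 * j + (3/2 * (1/4 * j) + b * (1/4 * e)))"
   proof -
    have n: "0 <= 1/4 * j" "0 <= 3/2 * (1/4 * j)" "0 <= 1/4 * e" "0 <= b * (1/4 * e)" using b(1) j(2) real(1) by auto
    have m: "ennreal (1/4) * ennreal j = ennreal (1/4 * j)" "ennreal (3/2) * ennreal (1/4 * j) = ennreal (3/2 * (1/4 * j))"
     "ennreal (1/4) * ennreal e = ennreal (1/4 * e)" "ennreal b * ennreal (1/4 * e) = ennreal (b * (1/4 * e))"
     using n b(1) j(2) real(1) by (intro ennreal_mult[symmetric]; simp)+
    show ?thesis unfolding j real m
     using n by (simp only: ennreal_plus[symmetric] add_nonneg_nonneg)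
   qed
   finally have "j <= 1/4 * j + (3/2 * (1/4 * j) + b * (1/4 * e))"
    unfolding j using b(1) j(2) real(1) by (subst (asm) ennreal_le_iff) auto
   then have "3 * j <= 2 * (b * e)" by simp
   then have "j <= b * e" using j(2) by linarith
   then show ?thesis unfolding j real using b(1) real(1) by (simp add: ennreal_mult[symmetric] ennreal_leI)
  next
   case top
   have "ennreal b ~= 0" using b(1) by simp
   then have "ennreal b * E = top" unfolding top ennreal_mult_eq_top_iff by blast
   then show ?thesis by simp
  qed
  have "energy p UNIV Phi <= (NN x. (NN y. indicator A x * indicator A y * (inv4 (x - y) * epow p (Phi x - Phi y))
    + (indicator A x * indicator (- A) y * (inv4 (x - y) * h x) + indicator A y * indicator (- A) x * (inv4 (x - y) * h y))))"
   unfolding pair_int_def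
  proof (intro nn_integral_mono)
   fix x y
   have "x \<notin> A ==> Phi x = 0" "y \<notin> A ==> Phi y = 0" using z K by auto
   then show "indicator UNIV x * indicator UNIV y * (inv4 (x - y) * epow p (Phi x - Phi y)) <=
    indicator A x * indicator A y * (inv4 (x - y) * epow p (Phi x - Phi y))
    + (indicator A x * indicator (- A) y * (inv4 (x - y) * h x) + indicator A y * indicator (- A) x * (inv4 (x - y) * h y))"
    by (cases "x \<in> A"; cases "y \<in> A") (simp_all add: h_def)
  qed
  also have "... = E + (J + (NN x. (NN y. indicator A y * indicator (- A) x * (inv4 (x - y) * h y))))"
   unfolding E_def J_def pair_int_def by (simp add: nn_integral_add)
  also have "(NN x. (NN y. indicator A y * indicator (- A) x * (inv4 (x - y) * h y))) = (NN y. (NN x. indicator A y * indicator (- A) x * (inv4 (x - y) * h y)))"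
   by (rule lborel_pair.Fubini') measurable
  also have "... = J" unfolding J_def by (intro nn_integral_cong) (simp add: inv4_minus)
  also have "E + (J + J) <= E + (ennreal b * E + ennreal b * E)" by (intro add_mono JE) simp
  also have "... = ennreal (1 + 2 * b) * E"
  proof -
   have "ennreal (1 + (b + b)) = ennreal 1 + ennreal (b + b)" using b(1) by (intro ennreal_plus) auto
   also have "ennreal (b + b) = ennreal b + ennreal b" using b(1) by (intro ennreal_plus) auto
   finally have "ennreal (1 + 2 * b) = 1 + (ennreal b + ennreal b)" by simp
   then show ?thesis by (simp only: distrib_right mult_1_left)
  qed
  finally show "energy p UNIV Phi <= ennreal (1 + 2 * b) * energy p A Phi" by (simp add: E_def)
 qed
qed

section \<open>The trilinear form\<close>

lemma plump_difference_bound: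
 assumes kappa0: "kappa0 > 0" and p: "p >= 1"
 obtains C where "C > 0"
  "!!A t0 x x' r f. plump A kappa0 t0 ==> x' \<in> A ==> dist x x' <= r / 4 ==> 0 < r ==> r / 4 <= t0 ==>
   f \<in> Borel ==> locally_integrable_on A f ==>
   epow p (mollify A (r / 2) f x - mollify A r f x) <= ennreal (C / r^4) * pair_osc p (A \<inter> cball x r) f"
proof -
 define c where "c = bump_lower * (kappa0 / 16)"
 have c: "c > 0" using kappa0 bump_lower_pos by (simp add: c_def)
 define M where "M = 5 / c"
 have M: "M > 0" using c by (simp add: M_def)
 show ?thesis
 proof (rule plump_kernel_bound[OF kappa0 M p], goal_cases)
 case C: (1 C)
 show ?thesis
 proof (rule that[OF C(1)])
  fix A t0 x x' r f
  assume pl: "plump A kappa0 t0" "x' \<in> A" "dist x x' <= r / 4" "0 < r" "r / 4 <= t0" and f: "f \<in> Borel"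
   and loc: "locally_integrable_on A f"
  have A[measurable]: "A \<in> sets borel" using pl(1) by (simp add: plump_def)
  define s where "s = r / 2"
  have s: "s > 0" "s <= r" using pl by (auto simp: s_def)
  have d: "dist x x' <= r / 2" using pl zero_le_dist[of x x'] by simp
  define m where "m = mollifier_mass A r x"
  define n where "n = mollifier_mass A s x"
  have m: "c * r^2 <= m" using plump_cball_lower(2)[OF pl(1,2) d pl(4,5)] by (simp add: c_def m_def)
  have n: "c * s^2 <= n" using plump_cball_lower(2)[OF pl(1,2), of x s] pl(3,4,5) by (simp add: c_def n_def s_def)
  have m0: "m > 0" using m c pl(4) by (auto intro: less_le_trans[of 0 "c * r^2"])
  have n0: "n > 0" using n c s by (auto intro: less_le_trans[of 0 "c * s^2"])
  define k where "k = (%z. rbump s (x - z) * indicator A z / n - rbump r (x - z) * indicator A z / m)"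
  have i1: "integrable lborel (%z. rbump r (x - z) * (indicator A z * f z))" by (rule integrable_rbump_mult[OF pl(4) loc])
  have i2: "integrable lborel (%z. rbump s (x - z) * (indicator A z * f z))" by (rule integrable_rbump_mult[OF s(1) loc])
  have i3: "integrable lborel (%z. rbump r (x - z) * indicator A z)" by (rule integrable_rbump_cut[OF pl(4) A])
  have i4: "integrable lborel (%z. rbump s (x - z) * indicator A z)" by (rule integrable_rbump_cut[OF s(1) A])
  have k0: "(LBINT z. k z) = 0"
   unfolding k_def using i3 i4 m0 n0 by (simp add: m_def[unfolded mollifier_mass_def] n_def[unfolded mollifier_mass_def])
  have kb: "\<bar>k z\<bar> <= M / r^2" for z
  proof -
   have "\<bar>k z\<bar> <= \<bar>rbump s (x - z) * indicator A z / n\<bar> + \<bar>rbump r (x - z) * indicator A z / m\<bar>"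
    unfolding k_def by (rule abs_triangle_ineq4)
   also have "\<bar>rbump s (x - z) * indicator A z / n\<bar> <= 1 / (c * s^2)"
   proof -
    have "rbump s (x - z) * indicator A z / n <= 1 / (c * s^2)"
     using n n0 c s rbump_le_1[of s "x - z"] rbump_nonneg[of s "x - z"] by (intro frac_le) (auto simp: indicator_def)
    then show ?thesis using n0 rbump_nonneg[of s "x - z"] by (simp add: abs_of_nonneg)
   qed
   also have "\<bar>rbump r (x - z) * indicator A z / m\<bar> <= 1 / (c * r^2)"
   proof -
    have "rbump r (x - z) * indicator A z / m <= 1 / (c * r^2)"
     using m m0 c pl(4) rbump_le_1[of r "x - z"] rbump_nonneg[of r "x - z"] by (intro frac_le) (auto simp: indicator_def)
    then show ?thesis using m0 rbump_nonneg[of r "x - z"] by (simp add: abs_of_nonneg)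
   qed
   also have "1 / (c * s^2) + 1 / (c * r^2) = M / r^2" using c pl(4) by (simp add: M_def s_def field_simps power2_eq_square)
   finally show ?thesis by simp
  qed
  have zk: "zero_mean_kernel k (A \<inter> cball x r) (M / r^2)"
   unfolding zero_mean_kernel_def
  proof (intro conjI allI impI)
   show "k \<in> Borel" unfolding k_def by measurable
   show "k z = 0" if "z \<notin> A \<inter> cball x r" for z
    using that rbump_zero[OF pl(4), of "x - z"] rbump_zero[OF s(1), of "x - z"] s(2)
    by (auto simp: k_def dist_norm indicator_def norm_minus_commute)
  qed (auto intro: kb k0)
  have "(LBINT z. k z * f z) = (LBINT z. rbump s (x - z) * (indicator A z * f z) / n - rbump r (x - z) * (indicator A z * f z) / m)"
   by (intro Bochner_Integration.integral_cong refl) (simp add: k_def left_diff_distrib mult.assoc)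
  also have "... = mollify A s f x - mollify A r f x"
   using i1 i2 by (simp add: mollify_def m_def n_def)
  finally show "epow p (mollify A (r / 2) f x - mollify A r f x) <= ennreal (C / r^4) * pair_osc p (A \<inter> cball x r) f"
   using C(2)[OF pl(1,2) d pl(4,5) zk f loc] by (simp add: s_def)
 qed
 qed
qed

lemma young3:
 fixes u v w :: real
 assumes nn: "u >= 0" "v >= 0" "w >= 0" and p: "p1 > 0" "p2 > 0" "p3 > 0" "1 / p1 + 1 / p2 + 1 / p3 = 1"
 shows "u * v * w <= u powr p1 + v powr p2 + w powr p3"
proof -
 define m where "m = max (u powr p1) (max (v powr p2) (w powr p3))"
 have m0: "m >= 0" by (simp add: m_def le_max_iff_disj)
 have root: "t <= m powr (1 / q)" if "t >= 0" "t powr q <= m" "q > 0" for t q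
 proof -
  have "t = (t powr q) powr (1 / q)" using that by (simp add: powr_powr)
  also have "... <= m powr (1 / q)" using that by (intro powr_mono2) auto
  finally show ?thesis .
 qed
 have "u * v * w <= m powr (1 / p1) * m powr (1 / p2) * m powr (1 / p3)"
  using nn p by (intro mult_mono root mult_nonneg_nonneg) (auto simp: m_def le_max_iff_disj)
 also have "... = m" using p(4) m0 by (simp flip: powr_add)
 also have "... <= u powr p1 + v powr p2 + w powr p3" unfolding m_def by (auto simp: max_def add_nonneg_nonneg)
 finally show ?thesis .
qed

text \<open>Young's inequality for three factors; the two derivatives cost \<open>1 / rho\<close> each.\<close>

lemma bracket_pointwise_bound:
 assumes p: "p1 > 0" "p2 > 0" "p3 > 0" "1 / p1 + 1 / p2 + 1 / p3 = 1" and rho: "rho > 0"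
  and a: "epow p1 (\<alpha>) <= OA"
  and b: "!!i. epow p2 (rho * pderiv_at i b x) <= OB"
  and c: "!!i. epow p3 (rho * pderiv_at i phi x) <= OC"
 shows "ennreal \<bar>\<alpha> * bracket b phi x\<bar> <= ennreal (2 / rho^2) * (OA + OB + OC)"
proof -
 have tm: "ennreal \<bar>\<alpha> * (pderiv_at i b x * pderiv_at j phi x)\<bar> <= ennreal (1 / rho^2) * (OA + OB + OC)" for i j
 proof -
  let ?u = "\<bar>\<alpha>\<bar>" and ?v = "\<bar>rho * pderiv_at i b x\<bar>" and ?w = "\<bar>rho * pderiv_at j phi x\<bar>"
  have "\<bar>\<alpha> * (pderiv_at i b x * pderiv_at j phi x)\<bar> = 1 / rho^2 * (?u * ?v * ?w)"
   using rho by (simp add: abs_mult power2_eq_square)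
  also have "... <= 1 / rho^2 * (?u powr p1 + ?v powr p2 + ?w powr p3)"
   by (intro mult_left_mono young3 p) auto
  finally have "ennreal \<bar>\<alpha> * (pderiv_at i b x * pderiv_at j phi x)\<bar> <= ennreal (1 / rho^2 * (?u powr p1 + ?v powr p2 + ?w powr p3))"
   by (rule ennreal_leI)
  also have "... = ennreal (1 / rho^2) * (ennreal (?u powr p1) + ennreal (?v powr p2) + ennreal (?w powr p3))"
   by (subst ennreal_mult) (auto simp: ennreal_plus)
  also have "... <= ennreal (1 / rho^2) * (OA + OB + OC)"
   by (intro mult_left_mono add_mono a b c) auto
  finally show ?thesis .
 qed
 have "\<bar>\<alpha> * bracket b phi x\<bar> <= \<bar>\<alpha> * (pderiv_at 1 b x * pderiv_at 2 phi x)\<bar> + \<bar>\<alpha> * (pderiv_at 2 b x * pderiv_at 1 phi x)\<bar>"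
  unfolding bracket_def right_diff_distrib by (rule abs_triangle_ineq4)
 then have "ennreal \<bar>\<alpha> * bracket b phi x\<bar> <= ennreal \<bar>\<alpha> * (pderiv_at 1 b x * pderiv_at 2 phi x)\<bar> + ennreal \<bar>\<alpha> * (pderiv_at 2 b x * pderiv_at 1 phi x)\<bar>"
  by (simp add: ennreal_plus[symmetric] ennreal_leI del: ennreal_plus)
 also have "... <= ennreal (1 / rho^2) * (OA + OB + OC) + ennreal (1 / rho^2) * (OA + OB + OC)"
  by (intro add_mono tm)
 also have "... = ennreal (2 / rho^2) * (OA + OB + OC)"
 proof -
  have "ennreal (2 / rho^2) = ennreal (1 / rho^2) + ennreal (1 / rho^2)"
   by (subst ennreal_plus[symmetric]) auto
  then show ?thesis by (simp only: distrib_right)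
 qed
 finally show ?thesis .
qed

definition triform :: "(real^2 => real) => (real^2 => real) => (real^2 => real) => real" where
 "triform a b phi = (LBINT x. bracket a b x * phi x)"

lemma triform_cyclic:
 assumes "open V" "compact K" "K \<subseteq> V" "smooth_on V a" "smooth_on V b" "smooth_on UNIV phi" "!!x. x \<notin> K ==> phi x = 0"
 shows "triform a b phi = (LBINT x. a x * bracket b phi x)"
 unfolding triform_def by (rule integral_bracket_by_parts(3)[OF assms])

lemma bracket_diff_left:
 assumes "smooth_on V a" "smooth_on V a'" "x \<in> V"
 shows "bracket (%x. a x - a' x) b x = bracket a b x - bracket a' b x"
 unfolding bracket_def pderiv_at_diff[OF assms] by (simp add: algebra_simps)

lemma bracket_diff_right:
 assumes "smooth_on V b" "smooth_on V b'" "x \<in> V"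
 shows "bracket a (%x. b x - b' x) x = bracket a b x - bracket a b' x"
 unfolding bracket_def pderiv_at_diff[OF assms] by (simp add: algebra_simps)

lemma integral_cong_off:
 fixes f g :: "'a::euclidean_space => real"
 assumes "!!x. x \<in> V ==> f x = g x" "!!x. x \<notin> V ==> f x = 0" "!!x. x \<notin> V ==> g x = 0"
 shows "(LBINT x. f x) = (LBINT x. g x)"
 by (intro Bochner_Integration.integral_cong refl) (metis assms)

text \<open>One argument is exchanged at a time, and partial integration moves each difference out of the bracket, so that no
 derivative falls on a difference.\<close>

lemma triform_difference:
 assumes V: "open V" and K: "compact K" "K \<subseteq> V" and s: "smooth_on V a" "smooth_on V a'" "smooth_on V b" "smooth_on V b'"
  and phi: "smooth_on UNIV phi" "smooth_on UNIV phi'" and z: "!!x. x \<notin> K ==> phi x = 0" "!!x. x \<notin> K ==> phi' x = 0"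
 shows "triform a b phi - triform a' b' phi' =
  (LBINT x. (a x - a' x) * bracket b phi x) - (LBINT x. (b x - b' x) * bracket a' phi x) + (LBINT x. (phi x - phi' x) * bracket a' b' x)"
proof -
 have sd: "smooth_on V (%x. a x - a' x)" "smooth_on V (%x. b x - b' x)" "smooth_on UNIV (%x. phi x - phi' x)"
  by (intro smooth_on_diff V s phi open_UNIV)+
 note ibp = integral_bracket_by_parts[OF V K]
 have z0: "x \<notin> V ==> phi x = 0" "x \<notin> V ==> phi' x = 0" for x using z K(2) by auto
 have 1: "triform a b phi - triform a' b phi = (LBINT x. (a x - a' x) * bracket b phi x)"
 proof -
  have "triform a b phi - triform a' b phi = (LBINT x. bracket a b x * phi x - bracket a' b x * phi x)"
   unfolding triform_def using ibp(1)[OF s(1,3) phi(1) z(1)] ibp(1)[OF s(2,3) phi(1) z(1)] by simp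
  also have "... = (LBINT x. bracket (%x. a x - a' x) b x * phi x)"
   by (rule integral_cong_off[of V]) (auto simp: bracket_diff_left[OF s(1,2)] z0 algebra_simps)
  finally show ?thesis using ibp(3)[OF sd(1) s(3) phi(1) z(1)] by simp
 qed
 have 2: "triform a' b phi - triform a' b' phi = - (LBINT x. (b x - b' x) * bracket a' phi x)"
 proof -
  have "triform a' b phi - triform a' b' phi = (LBINT x. bracket a' b x * phi x - bracket a' b' x * phi x)"
   unfolding triform_def using ibp(1)[OF s(2,3) phi(1) z(1)] ibp(1)[OF s(2,4) phi(1) z(1)] by simp
  also have "... = (LBINT x. - (bracket (%x. b x - b' x) a' x * phi x))"
   by (rule integral_cong_off[of V])
    (auto simp: bracket_diff_left[OF s(3,4)] bracket_antisym[of a' b] bracket_antisym[of a' b'] z0 algebra_simps)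
  finally show ?thesis using ibp(3)[OF sd(2) s(2) phi(1) z(1)] by simp
 qed
 have 3: "triform a' b' phi - triform a' b' phi' = (LBINT x. (phi x - phi' x) * bracket a' b' x)"
  unfolding triform_def using ibp(1)[OF s(2,4) phi(1) z(1)] ibp(1)[OF s(2,4) phi(2) z(2)]
  by (simp add: algebra_simps flip: Bochner_Integration.integral_diff)
 show ?thesis using 1 2 3 by simp
qed

text \<open>The average oscillation of \<open>f\<close> at scale \<open>rho\<close> around \<open>x\<close>. It bounds both the change of the mollification from one dyadic
 scale to the next and \<open>rho\<close> times its derivative.\<close>

definition scale_osc :: "real => (real^2) set => real => (real^2 => real) => real^2 => ennreal" where
 "scale_osc p A rho f x = ennreal (1 / rho^4) * pair_osc p (A \<inter> cball x (4 * rho)) f"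

lemma scale_osc_measurable [measurable]:
 assumes [measurable]: "A \<in> sets borel" "f \<in> Borel"
 shows "scale_osc p A rho f \<in> Borel"
 unfolding scale_osc_def[abs_def] by measurable

lemma nn_integral_scale_osc:
 assumes "rho > 0" and [measurable]: "A \<in> sets borel" "f \<in> Borel"
 shows "(NN x. scale_osc p A rho f x) <= ennreal (16 * pi / rho^2) * pair_int (near (12 * rho)) p A f"
proof -
 have "(NN x. scale_osc p A rho f x) = ennreal (1 / rho^4) * (NN x. pair_osc p (A \<inter> cball x (4 * rho)) f)"
  unfolding scale_osc_def by (rule nn_integral_cmult) measurable
 also have "... <= ennreal (1 / rho^4) * (ennreal (pi * (4 * rho)^2) * pair_int (near (3 * (4 * rho))) p A f)"
  using assms by (intro mult_left_mono integral_pair_osc) auto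
 also have "... = ennreal (1 / rho^4 * (pi * (4 * rho)^2)) * pair_int (near (12 * rho)) p A f"
  by (subst ennreal_mult_merge) auto
 also have "1 / rho^4 * (pi * (4 * rho)^2) = 16 * pi / rho^2" using assms(1) by (simp add: field_simps eval_nat_numeral)
 finally show ?thesis .
qed

lemma scale_pointwise:
 assumes kappa0: "kappa0 > 0" and p: "p >= 1"
 obtains C where "C > 0"
  "!!A t0 x x' rho f. plump A kappa0 t0 ==> x' \<in> A ==> dist x x' <= rho ==> 0 < rho ==> rho <= t0 ==>
   f \<in> Borel ==> locally_integrable_on A f ==>
   epow p (mollify A (2 * rho) f x - mollify A (4 * rho) f x) <= ennreal C * scale_osc p A rho f x"
  "!!A t0 x x' rho r f i. plump A kappa0 t0 ==> x' \<in> A ==> dist x x' <= rho ==> 0 < rho ==> rho <= t0 ==> r \<in> {2 * rho, 4 * rho} ==>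
   f \<in> Borel ==> locally_integrable_on A f ==>
   epow p (rho * pderiv_at i (mollify A r f) x) <= ennreal C * scale_osc p A rho f x"
proof -
 show ?thesis
 proof (rule plump_difference_bound[OF kappa0 p], goal_cases)
 case C1: (1 C1)
 show ?thesis
 proof (rule plump_derivative_bound[OF kappa0 p], goal_cases)
 case C2: (1 C2)
 show ?thesis
 proof (rule that[of "C1 + C2"])
  show "C1 + C2 > 0" using C1 C2 by simp
  fix A t0 x x' rho f
  assume pl: "plump A kappa0 t0" "x' \<in> A" "dist x x' <= rho" "0 < rho" "rho <= t0" and f: "f \<in> Borel"
   and loc: "locally_integrable_on A f"
  have "epow p (mollify A (2 * rho) f x - mollify A (4 * rho) f x) <= ennreal (C1 / (4 * rho)^4) * pair_osc p (A \<inter> cball x (4 * rho)) f"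
   using C1(2)[OF pl(1,2) _ _ _ f loc, of x "4 * rho"] pl by simp
  also have "... <= ennreal ((C1 + C2) * (1 / rho^4)) * pair_osc p (A \<inter> cball x (4 * rho)) f"
  proof (intro mult_right_mono ennreal_leI)
   have "C1 / (4 * rho)^4 <= (C1 + C2) / rho^4"
    using pl C1 C2 by (intro frac_le power_mono) auto
   then show "C1 / (4 * rho)^4 <= (C1 + C2) * (1 / rho^4)" by simp
  qed simp
  also have "... = ennreal (C1 + C2) * scale_osc p A rho f x"
   unfolding scale_osc_def using C1 C2 by (intro ennreal_mult_merge[symmetric]) auto
  finally show "epow p (mollify A (2 * rho) f x - mollify A (4 * rho) f x) <= ennreal (C1 + C2) * scale_osc p A rho f x" .
 next
  fix A t0 x x' rho r f and i :: 2
  assume pl: "plump A kappa0 t0" "x' \<in> A" "dist x x' <= rho" "0 < rho" "rho <= t0" and r: "r \<in> {2 * rho, 4 * rho}"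
   and f: "f \<in> Borel" and loc: "locally_integrable_on A f"
  then have r': "0 < r" "rho <= r" "r <= 4 * rho" "dist x x' <= r / 2" "r / 4 <= t0" using pl by auto
  have n1: "norm (axis i (1::real)) = 1" by (rule norm_axis_1)
  have "\<bar>rho * pderiv_at i (mollify A r f) x\<bar> powr p = rho powr p * \<bar>fder (mollify A r f) x (axis i 1)\<bar> powr p"
   using pl(4) by (simp add: pderiv_at_def abs_mult powr_mult)
  then have "epow p (rho * pderiv_at i (mollify A r f) x) = ennreal (rho powr p) * epow p (fder (mollify A r f) x (axis i 1))"
   by (simp add: ennreal_mult)
  also have "... <= ennreal (rho powr p) * (ennreal ((norm (axis i (1::real)) / r) powr p * (C2 / r^4)) * pair_osc p (A \<inter> cball x r) f)"
   by (intro mult_left_mono C2(2)[OF pl(1,2) r'(4,1,5) f loc]) simp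
  also have "... = ennreal (rho powr p * ((1 / r) powr p * (C2 / r^4))) * pair_osc p (A \<inter> cball x r) f"
   unfolding n1 using C2(1) r'(1) by (intro ennreal_mult_merge) auto
  also have "... <= ennreal ((C1 + C2) * (1 / rho^4)) * pair_osc p (A \<inter> cball x (4 * rho)) f"
  proof (rule mult_mono)
   have "rho powr p * (1 / r) powr p = (rho / r) powr p" using pl(4) r'(1) by (simp add: powr_mult[symmetric])
   also have "... <= 1" using pl(4) r' p by (intro powr_le1) auto
   finally have "rho powr p * (1 / r) powr p * (C2 / r^4) <= 1 * ((C1 + C2) / rho^4)"
    using pl(4) r' C1 C2 by (intro mult_mono frac_le power_mono) auto
   then show "ennreal (rho powr p * ((1 / r) powr p * (C2 / r^4))) <= ennreal ((C1 + C2) * (1 / rho^4))"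
    by (intro ennreal_leI) (simp add: mult.assoc)
   show "pair_osc p (A \<inter> cball x r) f <= pair_osc p (A \<inter> cball x (4 * rho)) f"
    by (rule pair_osc_mono) (use r' in auto)
  qed auto
  also have "... = ennreal (C1 + C2) * scale_osc p A rho f x"
   unfolding scale_osc_def using C1 C2 by (intro ennreal_mult_merge[symmetric]) auto
  finally show "epow p (rho * pderiv_at i (mollify A r f) x) <= ennreal (C1 + C2) * scale_osc p A rho f x" .
 qed
 qed
 qed
qed

lemma smooth_on_mollify_mass:
 assumes "r > 0" "A \<in> sets borel" "locally_integrable_on A f"
 shows "open {x. mollifier_mass A r x ~= 0}" "smooth_on {x. mollifier_mass A r x ~= 0} (mollify A r f)"
proof -
 have "continuous_on UNIV (mollifier_mass A r)" by (rule smooth_on_continuous[OF smooth_on_mollifier_mass[OF assms(1,2)]])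
 then have "open (mollifier_mass A r -` (- {0}))" by (intro open_vimage) auto
 then show *: "open {x. mollifier_mass A r x ~= 0}" by (simp add: vimage_def)
 show "smooth_on {x. mollifier_mass A r x ~= 0} (mollify A r f)"
  by (rule smooth_on_mollify[OF assms *]) simp
qed

lemma plump_mass_nonzero:
 assumes "plump A kappa t0" "x' \<in> A" "dist x x' <= r / 2" "0 < r" "r / 4 <= t0"
 shows "mollifier_mass A r x ~= 0"
proof -
 have "bump_lower * (kappa / 16 * r^2) > 0" using assms bump_lower_pos by (simp add: plump_def)
 then show ?thesis using plump_cball_lower(2)[OF assms] by auto
qed

lemma smooth_on_mollify_UNIV:
 assumes "r > 0" "locally_integrable (f :: real^2 => real)"
 shows "smooth_on UNIV (mollify UNIV r f)"
proof -
 have "mollifier_mass UNIV r x ~= 0" for x :: "real^2"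
  using plump_mass_nonzero[OF plump_UNIV[OF assms(1)], of x x r] assms(1) by simp
 then show ?thesis using smooth_on_mollify_mass(2)[of r UNIV f] assms by simp
qed

lemma mollify_zero_outside:
 assumes "r > 0" "!!z. z \<notin> K ==> f z = 0" "!!z. z \<in> K ==> r <= dist x z"
 shows "mollify UNIV r f x = 0"
proof -
 have "rbump r (x - z) * (indicator UNIV z * f z) = 0" for z
  using assms(2)[of z] assms(3)[of z] rbump_zero[OF assms(1), of "x - z"] by (cases "z \<in> K") (auto simp: dist_norm)
 then show ?thesis unfolding mollify_def by (simp only: Bochner_Integration.integral_zero div_0)
qed

definition thicken :: "'a::euclidean_space set => real => 'a set" where
 "thicken K r = {x + y | x y. x \<in> K \<and> y \<in> cball 0 r}"

lemma compact_thicken: "compact K ==> compact (thicken K r)"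
 unfolding thicken_def by (rule compact_sums) auto

lemma mem_thicken: "x \<in> thicken K r \<longleftrightarrow> (\<exists>z\<in>K. dist x z <= r)"
proof
 assume "x \<in> thicken K r"
 then obtain z y where "z \<in> K" "norm y <= r" "x = z + y" by (auto simp: thicken_def)
 then show "\<exists>z\<in>K. dist x z <= r" by (intro bexI[of _ z]) (auto simp: dist_norm norm_minus_commute)
next
 assume "\<exists>z\<in>K. dist x z <= r"
 then obtain z where z: "z \<in> K" "dist x z <= r" by blast
 then have "x = z + (x - z)" "x - z \<in> cball 0 r" by (auto simp: dist_norm norm_minus_commute)
 with z show "x \<in> thicken K r" unfolding thicken_def by blast
qed

lemma ennreal_abs_integral_le:
 fixes g :: "'a => real"
 shows "ennreal \<bar>LINT x|M. g x\<bar> <= (\<integral>\<^sup>+x. ennreal \<bar>g x\<bar> \<partial>M)"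
proof (cases "integrable M g")
 case True
 then show ?thesis using integral_norm_bound_ennreal[OF True] by simp
qed (simp add: not_integrable_integral_eq)

lemma Lp_int_add_le:
 assumes [measurable]: "A \<in> sets borel" "u \<in> Borel" "v \<in> Borel" and p: "p >= 0"
 shows "Lp_int p A (%x. u x + v x) <= ennreal (2 powr p) * (Lp_int p A u + Lp_int p A v)"
proof -
 have "Lp_int p A (%x. u x + v x) <= (NN x. ennreal (2 powr p) * (indicator A x * epow p (u x) + indicator A x * epow p (v x)))"
  unfolding Lp_int_def
 proof (intro nn_integral_mono)
  fix x
  have "epow p (u x + v x) <= ennreal (2 powr p) * (epow p (u x) + epow p (v x))"
   using powr_diff_bound[OF p, of "u x" "- v x"]
   by (auto simp: ennreal_mult[symmetric] ennreal_plus[symmetric] simp del: ennreal_plus intro!: ennreal_leI)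
  then show "indicator A x * epow p (u x + v x) <= ennreal (2 powr p) * (indicator A x * epow p (u x) + indicator A x * epow p (v x))"
   by (cases "x \<in> A") simp_all
 qed
 also have "... = ennreal (2 powr p) * (Lp_int p A u + Lp_int p A v)"
  unfolding Lp_int_def by (simp add: nn_integral_cmult nn_integral_add)
 finally show ?thesis .
qed

lemma pair_int_near_mono: "r <= r' ==> pair_int (near r) p A f <= pair_int (near r') p A f"
 by (rule pair_int_mono) (auto simp: near_def indicator_def)

text \<open>Each of the three terms of \<open>triform_difference\<close> is a difference times two derivatives, that is, \<open>1 / r^2\<close> times a product of
 three quantities controlled by \<open>OA\<close>, \<open>OB\<close> and \<open>OC\<close>.\<close>

lemma triform_step:
 assumes p: "p > 0" and q: "q > 0" and pq: "2 / p + 1 / q = 1" and r: "r > 0"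
  and U: "open U" and K: "compact K" "K \<subseteq> U" and s: "smooth_on U a" "smooth_on U a'" "smooth_on U b" "smooth_on U b'"
  and phi: "smooth_on UNIV phi" "smooth_on UNIV phi'" and z: "!!x. x \<notin> K ==> phi x = 0" "!!x. x \<notin> K ==> phi' x = 0"
  and [measurable]: "OA \<in> Borel" "OB \<in> Borel" "OC \<in> Borel"
  and A: "!!x. x \<in> K ==> epow p (a x - a' x) <= OA x" "!!x i. x \<in> K ==> epow p (r * pderiv_at i a' x) <= OA x"
  and B: "!!x. x \<in> K ==> epow p (b x - b' x) <= OB x" "!!x i. x \<in> K ==> epow p (r * pderiv_at i b x) <= OB x"
   "!!x i. x \<in> K ==> epow p (r * pderiv_at i b' x) <= OB x"
  and C: "!!x. x \<in> K ==> epow q (phi x - phi' x) <= OC x" "!!x i. x \<in> K ==> epow q (r * pderiv_at i phi x) <= OC x"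
 shows "ennreal \<bar>triform a b phi - triform a' b' phi'\<bar> <= ennreal (6 / r^2) * ((NN x. OA x) + (NN x. OB x) + (NN x. OC x))"
proof -
 let ?S = "(NN x. OA x) + (NN x. OB x) + (NN x. OC x)"
 have e: "1 / p + 1 / p + 1 / q = 1" "1 / q + 1 / p + 1 / p = 1" using pq by auto
 have I: "ennreal \<bar>LBINT x. g x\<bar> <= ennreal (2 / r^2) * ?S"
  if g: "!!x. x \<in> K ==> ennreal \<bar>g x\<bar> <= ennreal (2 / r^2) * (OA x + OB x + OC x)" "!!x. x \<notin> K ==> g x = 0" for g
 proof -
  have "ennreal \<bar>LBINT x. g x\<bar> <= (NN x. ennreal (2 / r^2) * (OA x + OB x + OC x))"
  proof (rule order_trans[OF ennreal_abs_integral_le nn_integral_mono])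
   fix x show "ennreal \<bar>g x\<bar> <= ennreal (2 / r^2) * (OA x + OB x + OC x)" using g[of x] by (cases "x \<in> K") auto
  qed
  then show ?thesis by (simp add: nn_integral_cmult nn_integral_add)
 qed
 have zb: "bracket f phi x = 0" if "x \<notin> K" for f x
  using pderiv_at_zero_outside[OF compact_imp_closed[OF K(1)] z(1) that] by (simp add: bracket_def)
 define X Y Z where "X = (LBINT x. (a x - a' x) * bracket b phi x)" and "Y = (LBINT x. (b x - b' x) * bracket a' phi x)"
  and "Z = (LBINT x. (phi x - phi' x) * bracket a' b' x)"
 have X: "ennreal \<bar>X\<bar> <= ennreal (2 / r^2) * ?S"
  unfolding X_def by (rule I, rule bracket_pointwise_bound[OF p p q e(1) r A(1) B(2) C(2)]) (simp_all add: zb)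
 have Y: "ennreal \<bar>Y\<bar> <= ennreal (2 / r^2) * ?S"
  unfolding Y_def
 proof (rule I)
  show "ennreal \<bar>(b x - b' x) * bracket a' phi x\<bar> <= ennreal (2 / r^2) * (OA x + OB x + OC x)" if "x \<in> K" for x
   using bracket_pointwise_bound[OF p p q e(1) r B(1)[OF that] A(2)[OF that] C(2)[OF that]] by (simp add: add_ac)
 qed (simp add: zb)
 have Z: "ennreal \<bar>Z\<bar> <= ennreal (2 / r^2) * ?S"
  unfolding Z_def
 proof (rule I)
  show "ennreal \<bar>(phi x - phi' x) * bracket a' b' x\<bar> <= ennreal (2 / r^2) * (OA x + OB x + OC x)" if "x \<in> K" for x
   using bracket_pointwise_bound[OF q p p e(2) r C(1)[OF that] A(2)[OF that] B(3)[OF that]] by (simp add: add_ac)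
 qed (simp add: z)
 have "triform a b phi - triform a' b' phi' = X - Y + Z"
  unfolding X_def Y_def Z_def by (rule triform_difference[OF U K s phi z])
 then have "\<bar>triform a b phi - triform a' b' phi'\<bar> <= \<bar>X\<bar> + \<bar>Y\<bar> + \<bar>Z\<bar>" by linarith
 then have "ennreal \<bar>triform a b phi - triform a' b' phi'\<bar> <= ennreal \<bar>X\<bar> + ennreal \<bar>Y\<bar> + ennreal \<bar>Z\<bar>"
  by (simp add: ennreal_leI flip: ennreal_plus)
 also have "... <= ennreal (2 / r^2) * ?S + ennreal (2 / r^2) * ?S + ennreal (2 / r^2) * ?S" by (intro add_mono X Y Z)
 also have "... = (ennreal (2 / r^2) + ennreal (2 / r^2) + ennreal (2 / r^2)) * ?S" by (simp only: distrib_right)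
 also have "ennreal (2 / r^2) + ennreal (2 / r^2) + ennreal (2 / r^2) = ennreal (6 / r^2)" by (simp flip: ennreal_plus)
 finally show ?thesis .
qed

text \<open>Mollify all three arguments at the scales \<open>t0 / 2^j\<close>. Passing from one scale \<open>rho\<close> to the next changes the form by at most
 \<open>rho^-4\<close> times the integrated oscillations at distance about \<open>rho\<close>, and by \<open>dyadic_near_sum\<close> these add up to the energies.
 The form at the coarsest scale is bounded directly. This estimate is what gives a meaning to the Jacobian of a map that
 has no derivatives.\<close>

lemma triform_energy_bound:
 assumes pl: "plump A kappa0 t0" and oA: "open A" and p: "p > 2" and q: "q > 2" and pq: "2 / p + 1 / q = 1"
 obtains C where "C > 0"
  "!!a b Phi V K. open V ==> A \<subseteq> V ==> smooth_on V a ==> smooth_on V b ==> a \<in> Borel ==> b \<in> Borel ==>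
    locally_integrable_on A a ==> locally_integrable_on A b ==>
    smooth_on UNIV Phi ==> compact K ==> K \<subseteq> A ==> (\<forall>x. x \<notin> K --> Phi x = 0) ==>
    ennreal \<bar>triform a b Phi\<bar> <= ennreal C * (energy p A a + energy p A b + energy q UNIV Phi + Lp_int q UNIV Phi)"
proof -
 have kappa0: "kappa0 > 0" and t0: "t0 > 0" and A[measurable]: "A \<in> sets borel" using pl by (auto simp: plump_def)
 have plU: "plump UNIV 1 t0" by (rule plump_UNIV[OF t0])
 have p1: "p >= 1" and q1: "q >= 1" and p0: "p > 0" and q0: "q > 0" using p q by auto
 have e1: "1 / p + 1 / p + 1 / q = 1" and e2: "1 / q + 1 / p + 1 / p = 1" using pq by auto
 show ?thesis
 proof (rule scale_pointwise[OF kappa0 p1], goal_cases)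
 case Cp: (1 Cp)
 show ?thesis
 proof (rule scale_pointwise[OF zero_less_one q1], goal_cases)
 case Cq: (1 Cq)
 show ?thesis
 proof (rule mollify_approximation[OF zero_less_one q], goal_cases)
 case Ca: (1 Ca)
 show ?thesis
 proof (rule mollify_approximation[OF kappa0 p], goal_cases)
 case Cm: (1 Cm)
 define G where "G = (Cp + 16 * 4 powr q * Cq) * (16 * pi)"
 have G: "G > 0" using Cp Cq by (simp add: G_def add_pos_pos)
 define H where "H = 2 / t0^2 * (G / t0^2 * (12 * t0)^4 + 2 powr q * (Ca * t0^2 + 1))"
 have H: "H > 0" using G Ca t0 by (simp add: H_def add_pos_pos add_nonneg_pos)
 define C where "C = H + 12 * G * 12^4"
 have C: "C > 0" using H G by (simp add: C_def add_pos_pos)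
 show ?thesis
 proof (rule that[OF C])
  fix a b Phi :: "real^2 => real" and V K
  assume V: "open V" "A \<subseteq> V" and a: "smooth_on V a" and b: "smooth_on V b"
   and am[measurable]: "a \<in> Borel" and bm[measurable]: "b \<in> Borel"
   and la: "locally_integrable_on A a" and lb: "locally_integrable_on A b"
   and Phi: "smooth_on UNIV Phi" and K: "compact K" "K \<subseteq> A" and z': "\<forall>x. x \<notin> K --> Phi x = 0"
  have z: "Phi x = 0" if "x \<notin> K" for x using z' that by blast
  have Phim[measurable]: "Phi \<in> Borel" by (rule borel_measurable_continuous_onI[OF smooth_on_continuous[OF Phi]])
  have lPhi: "locally_integrable Phi"
   using smooth_compact_support_bounded[OF Phi K(1) z] bounded_locally_integrable[OF Phim] by metis
  have lPhi': "locally_integrable_on UNIV Phi" using lPhi by simp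
  define rho where "rho = (%j. t0 / 2^j :: real)"
  have rho: "rho j > 0" "rho j <= t0" for j using t0 by (auto simp: rho_def divide_le_eq)
  have rhoS: "4 * rho (Suc j) = 2 * rho j" "rho (Suc j) = 2 * (rho j / 4)" for j by (auto simp: rho_def)
  define \<alpha> where "\<alpha> = (%j. mollify A (4 * rho j) a)"
  define \<beta> where "\<beta> = (%j. mollify A (4 * rho j) b)"
  (* Phi is spread less than a and b, so that its support stays where their mollifications are smooth. *)
  define phi where "phi = (%j. mollify UNIV (rho j) Phi)"
  define T where "T = (%j. triform (\<alpha> j) (\<beta> j) (phi j))"
  define N where "N = (%j. pair_int (near (12 * rho j)) p A a + pair_int (near (12 * rho j)) p A b + pair_int (near (12 * rho j)) q UNIV Phi)"
  define E where "E = energy p A a + energy p A b + energy q UNIV Phi"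
  define OA where "OA = (%j x. ennreal Cp * scale_osc p A (rho j) a x)"
  define OB where "OB = (%j x. ennreal Cp * scale_osc p A (rho j) b x)"
  define OC where "OC = (%j x. ennreal (4 powr q * Cq) * scale_osc q UNIV (rho j / 4) Phi x)"
  have [measurable]: "OA j \<in> Borel" "OB j \<in> Borel" "OC j \<in> Borel" for j
   unfolding OA_def OB_def OC_def by measurable
  have near_x: "\<exists>x'\<in>A. dist x x' <= rho j" if "x \<in> thicken K (rho j)" for x j using that K by (auto simp: mem_thicken)
  have OAd: "epow p (\<alpha> (Suc j) x - \<alpha> j x) <= OA j x" and OBd: "epow p (\<beta> (Suc j) x - \<beta> j x) <= OB j x"
   and OAp: "epow p (rho j * pderiv_at i (\<alpha> j) x) <= OA j x"
   and OBp: "epow p (rho j * pderiv_at i (\<beta> j) x) <= OB j x"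
   and OBp': "epow p (rho j * pderiv_at i (\<beta> (Suc j)) x) <= OB j x"
   if x: "x \<in> thicken K (rho j)" for x j i
  proof -
   obtain x' where x': "x' \<in> A" "dist x x' <= rho j" using near_x[OF x] by blast
   note c = Cp(2)[OF pl x' rho(1,2)] and d = Cp(3)[OF pl x' rho(1,2)]
   show "epow p (\<alpha> (Suc j) x - \<alpha> j x) <= OA j x" unfolding \<alpha>_def OA_def rhoS(1) by (rule c[OF am la])
   show "epow p (\<beta> (Suc j) x - \<beta> j x) <= OB j x" unfolding \<beta>_def OB_def rhoS(1) by (rule c[OF bm lb])
   show "epow p (rho j * pderiv_at i (\<alpha> j) x) <= OA j x" unfolding \<alpha>_def OA_def by (rule d[OF _ am la]) simp
   show "epow p (rho j * pderiv_at i (\<beta> j) x) <= OB j x" unfolding \<beta>_def OB_def by (rule d[OF _ bm lb]) simp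
   show "epow p (rho j * pderiv_at i (\<beta> (Suc j)) x) <= OB j x" unfolding \<beta>_def OB_def rhoS(1) by (rule d[OF _ bm lb]) simp
  qed
  have OCd: "epow q (phi (Suc j) x - phi j x) <= OC j x"
   and OCp: "epow q (rho j * pderiv_at i (phi (Suc j)) x) <= OC j x" for x j i
  proof -
   have s: "0 < rho j / 4" "rho j / 4 <= t0" "dist x x <= rho j / 4" using rho[of j] by auto
   have e: "4 * (rho j / 4) = rho j" by simp
   have "epow q (phi (Suc j) x - phi j x) <= ennreal Cq * scale_osc q UNIV (rho j / 4) Phi x"
    using Cq(2)[OF plU UNIV_I s(3,1,2) Phim lPhi'] unfolding phi_def rhoS(2) e .
   also have "... <= OC j x" unfolding OC_def
    using Cq(1) q0 ge_one_powr_ge_zero[of 4 q] by (intro mult_right_mono ennreal_leI) auto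
   finally show "epow q (phi (Suc j) x - phi j x) <= OC j x" .
   have "\<bar>rho j * pderiv_at i (phi (Suc j)) x\<bar> = 4 * \<bar>rho j / 4 * pderiv_at i (phi (Suc j)) x\<bar>" by simp
   then have "\<bar>rho j * pderiv_at i (phi (Suc j)) x\<bar> powr q = 4 powr q * \<bar>rho j / 4 * pderiv_at i (phi (Suc j)) x\<bar> powr q"
    by (simp only: powr_mult[of 4] abs_ge_zero zero_le_numeral)
   then have "epow q (rho j * pderiv_at i (phi (Suc j)) x) = ennreal (4 powr q) * epow q (rho j / 4 * pderiv_at i (phi (Suc j)) x)"
    by (simp only: ennreal_mult powr_ge_zero)
   also have "... <= ennreal (4 powr q) * (ennreal Cq * scale_osc q UNIV (rho j / 4) Phi x)"
    unfolding phi_def rhoS(2) by (intro mult_left_mono Cq(3)[OF plU UNIV_I s(3,1,2) _ Phim lPhi']) auto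
   also have "... = OC j x" unfolding OC_def using Cq(1) by (intro ennreal_mult_merge) auto
   finally show "epow q (rho j * pderiv_at i (phi (Suc j)) x) <= OC j x" .
  qed
  have intAB: "(NN x. ennreal Cp * scale_osc p A (rho j) f x) <= ennreal (G / rho j^2) * pair_int (near (12 * rho j)) p A f"
   if [measurable]: "f \<in> Borel" for f j
  proof -
   have "(NN x. ennreal Cp * scale_osc p A (rho j) f x) = ennreal Cp * (NN x. scale_osc p A (rho j) f x)"
    by (rule nn_integral_cmult) measurable
   also have "... <= ennreal Cp * (ennreal (16 * pi / rho j^2) * pair_int (near (12 * rho j)) p A f)"
    by (intro mult_left_mono nn_integral_scale_osc rho) auto
   also have "... = ennreal (Cp * (16 * pi / rho j^2)) * pair_int (near (12 * rho j)) p A f"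
    using Cp(1) by (intro ennreal_mult_merge) auto
   also have "... <= ennreal (G / rho j^2) * pair_int (near (12 * rho j)) p A f"
   proof (intro mult_right_mono ennreal_leI)
    have "Cp * (16 * pi) <= G" unfolding G_def using Cq(1) by (intro mult_right_mono) auto
    then have "Cp * (16 * pi) / rho j^2 <= G / rho j^2" by (intro divide_right_mono) auto
    then show "Cp * (16 * pi / rho j^2) <= G / rho j^2" by simp
   qed simp
   finally show ?thesis .
  qed
  have intC: "(NN x. OC j x) <= ennreal (G / rho j^2) * pair_int (near (12 * rho j)) q UNIV Phi" for j
  proof -
   have "(NN x. OC j x) = ennreal (4 powr q * Cq) * (NN x. scale_osc q UNIV (rho j / 4) Phi x)"
    unfolding OC_def by (rule nn_integral_cmult) measurable
   also have "... <= ennreal (4 powr q * Cq) * (ennreal (16 * pi / (rho j / 4)^2) * pair_int (near (12 * (rho j / 4))) q UNIV Phi)"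
    using rho[of j] by (intro mult_left_mono nn_integral_scale_osc) auto
   also have "... <= ennreal (4 powr q * Cq) * (ennreal (16 * pi / (rho j / 4)^2) * pair_int (near (12 * rho j)) q UNIV Phi)"
    using rho[of j] by (intro mult_left_mono pair_int_near_mono) auto
   also have "... = ennreal (4 powr q * Cq * (16 * pi / (rho j / 4)^2)) * pair_int (near (12 * rho j)) q UNIV Phi"
    using Cq(1) by (intro ennreal_mult_merge) auto
   also have "... <= ennreal (G / rho j^2) * pair_int (near (12 * rho j)) q UNIV Phi"
   proof (intro mult_right_mono ennreal_leI)
    have "(16 * 4 powr q * Cq) * (16 * pi) <= G" unfolding G_def using Cp(1) by (intro mult_right_mono) auto
    then have "(16 * 4 powr q * Cq) * (16 * pi) / rho j^2 <= G / rho j^2" by (intro divide_right_mono) auto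
    then show "4 powr q * Cq * (16 * pi / (rho j / 4)^2) <= G / rho j^2" by (simp add: power_divide mult_ac)
   qed simp
   finally show ?thesis .
  qed
  have smphi: "smooth_on UNIV (phi j)" for j unfolding phi_def by (rule smooth_on_mollify_UNIV[OF rho(1) lPhi])
  have zphi: "phi j x = 0" if "x \<notin> thicken K r" "rho j <= r" for j x r
   unfolding phi_def by (rule mollify_zero_outside[of _ K]) (use rho(1) z that in \<open>auto simp: mem_thicken\<close>)
  have cT: "compact (thicken K r)" for r by (rule compact_thicken[OF K(1)])
  have diffT: "ennreal \<bar>T (Suc j) - T j\<bar> <= ennreal (6 * G / rho j^4) * N j" for j
  proof -
   let ?K = "thicken K (rho j)"
   define U where "U = {x. mollifier_mass A (4 * rho j) x ~= 0} \<inter> {x. mollifier_mass A (4 * rho (Suc j)) x ~= 0}"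
   have r4: "4 * rho j > 0" "4 * rho (Suc j) > 0" using rho(1)[of j] rho(1)[of "Suc j"] by auto
   have U: "open U" unfolding U_def using smooth_on_mollify_mass(1)[OF _ A la] r4 by auto
   have KU: "?K \<subseteq> U"
   proof
    fix x assume "x \<in> ?K"
    then obtain x' where x': "x' \<in> A" "dist x x' <= rho j" using near_x by blast
    have m1: "mollifier_mass A (4 * rho j) x ~= 0"
     by (rule plump_mass_nonzero[OF pl x'(1)]) (use x'(2) rho[of j] in auto)
    have m2: "mollifier_mass A (4 * rho (Suc j)) x ~= 0"
     unfolding rhoS(1) by (rule plump_mass_nonzero[OF pl x'(1)]) (use x'(2) rho[of j] in auto)
    show "x \<in> U" unfolding U_def using m1 m2 by auto
   qed
   have s: "smooth_on U (\<alpha> (Suc j))" "smooth_on U (\<alpha> j)" "smooth_on U (\<beta> (Suc j))" "smooth_on U (\<beta> j)"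
    using smooth_on_mollify_mass(2)[OF r4(1) A la] smooth_on_mollify_mass(2)[OF r4(2) A la]
     smooth_on_mollify_mass(2)[OF r4(1) A lb] smooth_on_mollify_mass(2)[OF r4(2) A lb]
    by (auto simp: U_def \<alpha>_def \<beta>_def intro: smooth_on_subset)
   have zz: "phi (Suc j) x = 0" "phi j x = 0" if "x \<notin> ?K" for x
   proof -
    have "rho (Suc j) <= rho j" using rho(1)[of j] rhoS(2)[of j] by simp
    then show "phi (Suc j) x = 0" "phi j x = 0" using zphi[OF that] by auto
   qed
   have "ennreal \<bar>T (Suc j) - T j\<bar> <= ennreal (6 / rho j^2) * ((NN x. OA j x) + (NN x. OB j x) + (NN x. OC j x))"
    unfolding T_def by (rule triform_step[OF p0 q0 pq rho(1) U cT KU s smphi smphi zz _ _ _ OAd OAp OBd OBp' OBp OCd OCp]) measurable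
   also have "... <= ennreal (6 / rho j^2) * (ennreal (G / rho j^2) * N j)"
    unfolding OA_def OB_def N_def distrib_left by (intro add_mono mult_left_mono intAB intC) auto
   also have "... = ennreal (6 / rho j^2 * (G / rho j^2)) * N j" using G by (intro ennreal_mult_merge) auto
   also have "6 / rho j^2 * (G / rho j^2) = 6 * G / rho j^4" by (simp add: eval_nat_numeral)
   finally show ?thesis .
  qed
  have sumT: "(\<Sum>j<n. ennreal \<bar>T (Suc j) - T j\<bar>) <= ennreal (12 * G * 12^4) * E" for n
  proof -
   have t12: "12 * t0 > 0" using t0 by simp
   have "(\<Sum>j<n. ennreal \<bar>T (Suc j) - T j\<bar>) <= (\<Sum>j<n. ennreal (6 * G * 12^4) * (ennreal ((2^j / (12 * t0))^4) * N j))"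
   proof (rule sum_mono)
    fix j
    have "6 * G / rho j^4 = 6 * G * 12^4 * (2^j / (12 * t0))^4"
     using t0 by (simp add: rho_def power_divide power_mult_distrib)
    moreover have "ennreal (6 * G * 12^4) * (ennreal ((2^j / (12 * t0))^4) * N j) = ennreal (6 * G * 12^4 * (2^j / (12 * t0))^4) * N j"
     using G by (intro ennreal_mult_merge) auto
    ultimately show "ennreal \<bar>T (Suc j) - T j\<bar> <= ennreal (6 * G * 12^4) * (ennreal ((2^j / (12 * t0))^4) * N j)"
     using diffT[of j] by (simp only:)
   qed
   also have "... = ennreal (6 * G * 12^4) * (\<Sum>j<n. ennreal ((2^j / (12 * t0))^4) * N j)" by (rule sum_distrib_left[symmetric])
   also have "(\<Sum>j<n. ennreal ((2^j / (12 * t0))^4) * N j) =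
     (\<Sum>j<n. ennreal ((2^j / (12 * t0))^4) * pair_int (near (12 * t0 / 2^j)) p A a)
    + (\<Sum>j<n. ennreal ((2^j / (12 * t0))^4) * pair_int (near (12 * t0 / 2^j)) p A b)
    + (\<Sum>j<n. ennreal ((2^j / (12 * t0))^4) * pair_int (near (12 * t0 / 2^j)) q UNIV Phi)"
    by (simp add: N_def rho_def distrib_left sum.distrib)
   also have "ennreal (6 * G * 12^4) * ... <= ennreal (6 * G * 12^4) * (ennreal 2 * energy p A a + ennreal 2 * energy p A b + ennreal 2 * energy q UNIV Phi)"
    by (intro mult_left_mono add_mono dyadic_near_sum[OF t12]) auto
   also have "... = ennreal (6 * G * 12^4) * (ennreal 2 * E)" by (simp only: E_def distrib_left)
   also have "... = ennreal (6 * G * 12^4 * 2) * E" using G by (intro ennreal_mult_merge) auto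
   finally show ?thesis by (simp add: mult.commute mult.left_commute)
  qed
  have T0: "ennreal \<bar>T 0\<bar> <= ennreal H * (E + Lp_int q UNIV Phi)"
  proof -
   have r0: "rho 0 = t0" by (simp add: rho_def)
   have [measurable]: "phi 0 \<in> Borel" by (rule borel_measurable_continuous_onI[OF smooth_on_continuous[OF smphi]])
   have "ennreal \<bar>T 0\<bar> <= (NN x. ennreal (2 / t0^2) * (indicator UNIV x * epow q (phi 0 x) + OA 0 x + OB 0 x))"
    unfolding T_def triform_def
   proof (rule order_trans[OF ennreal_abs_integral_le nn_integral_mono])
    fix x
    show "ennreal \<bar>bracket (\<alpha> 0) (\<beta> 0) x * phi 0 x\<bar> <= ennreal (2 / t0^2) * (indicator UNIV x * epow q (phi 0 x) + OA 0 x + OB 0 x)"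
    proof (cases "x \<in> thicken K (rho 0)")
     case True
     have "ennreal \<bar>phi 0 x * bracket (\<alpha> 0) (\<beta> 0) x\<bar> <= ennreal (2 / rho 0^2) * (epow q (phi 0 x) + OA 0 x + OB 0 x)"
      by (rule bracket_pointwise_bound[OF q0 p0 p0 e2 rho(1) order_refl OAp[OF True] OBp[OF True]])
     then show ?thesis by (simp add: r0 mult.commute)
    next
     case False
     then have "phi 0 x = 0" using zphi[of x "rho 0" 0] by simp
     then show ?thesis by simp
    qed
   qed
   also have "... = ennreal (2 / t0^2) * (Lp_int q UNIV (phi 0) + (NN x. OA 0 x) + (NN x. OB 0 x))"
    unfolding Lp_int_def by (simp add: nn_integral_cmult nn_integral_add)
   also have "... <= ennreal (2 / t0^2) * (ennreal (2 powr q) * (ennreal (Ca * t0^2) * energy q UNIV Phi + Lp_int q UNIV Phi)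
     + ennreal (G / t0^2 * (12 * t0)^4) * energy p A a + ennreal (G / t0^2 * (12 * t0)^4) * energy p A b)"
   proof (intro mult_left_mono add_mono)
    have "Lp_int q UNIV (phi 0) = Lp_int q UNIV (%x. (phi 0 x - Phi x) + Phi x)" by simp
    also have "... <= ennreal (2 powr q) * (Lp_int q UNIV (%x. phi 0 x - Phi x) + Lp_int q UNIV Phi)"
     by (rule Lp_int_add_le) (use q0 in auto)
    also have "... <= ennreal (2 powr q) * (ennreal (Ca * t0^2) * energy q UNIV Phi + Lp_int q UNIV Phi)"
    proof (intro mult_left_mono add_mono)
     have "Lp_int q UNIV (%x. phi 0 x - Phi x) <= ennreal (Ca * t0^2) * energy_near (6 * t0) q UNIV Phi"
      unfolding phi_def r0 using t0 by (intro Ca(2)[OF plU _ _ Phim lPhi']) auto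
     also have "... <= ennreal (Ca * t0^2) * energy q UNIV Phi" by (intro mult_left_mono energy_near_le) auto
     finally show "Lp_int q UNIV (%x. phi 0 x - Phi x) <= ennreal (Ca * t0^2) * energy q UNIV Phi" .
    qed auto
    finally show "Lp_int q UNIV (phi 0) <= ennreal (2 powr q) * (ennreal (Ca * t0^2) * energy q UNIV Phi + Lp_int q UNIV Phi)" .
    have ab: "(NN x. ennreal Cp * scale_osc p A (rho 0) f x) <= ennreal (G / t0^2 * (12 * t0)^4) * energy p A f"
     if [measurable]: "f \<in> Borel" for f
    proof -
     have "(NN x. ennreal Cp * scale_osc p A (rho 0) f x) <= ennreal (G / t0^2) * pair_int (near (12 * t0)) p A f"
      using intAB[OF that, of 0] by (simp only: r0)
     also have "... <= ennreal (G / t0^2) * (ennreal ((12 * t0)^4) * energy_near (12 * t0) p A f)"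
      using t0 by (intro mult_left_mono near_le_energy_near) auto
     also have "... <= ennreal (G / t0^2) * (ennreal ((12 * t0)^4) * energy p A f)"
      by (intro mult_left_mono energy_near_le) auto
     also have "... = ennreal (G / t0^2 * (12 * t0)^4) * energy p A f" using G by (intro ennreal_mult_merge) auto
     finally show ?thesis .
    qed
    show "(NN x. OA 0 x) <= ennreal (G / t0^2 * (12 * t0)^4) * energy p A a"
     "(NN x. OB 0 x) <= ennreal (G / t0^2 * (12 * t0)^4) * energy p A b"
     unfolding OA_def OB_def by (rule ab[OF am], rule ab[OF bm])
   qed auto
   also have "... <= ennreal (2 / t0^2) * (ennreal (G / t0^2 * (12 * t0)^4 + 2 powr q * (Ca * t0^2 + 1)) * (E + Lp_int q UNIV Phi))"
   proof (intro mult_left_mono)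
    define g1 where "g1 = G / t0^2 * (12 * t0)^4"
    define g2 where "g2 = 2 powr q * (Ca * t0^2 + 1)"
    have g: "0 <= g1" "0 <= g2" using G Ca by (auto simp: g1_def g2_def)
    have "ennreal (2 powr q) * (ennreal (Ca * t0^2) * energy q UNIV Phi + Lp_int q UNIV Phi) <= ennreal (2 powr q) * (ennreal (Ca * t0^2 + 1) * (energy q UNIV Phi + Lp_int q UNIV Phi))"
    proof (intro mult_left_mono)
     have "ennreal (Ca * t0^2) <= ennreal (Ca * t0^2 + 1)" "ennreal 1 <= ennreal (Ca * t0^2 + 1)"
      using Ca(1) by (auto intro!: ennreal_leI)
     then show "ennreal (Ca * t0^2) * energy q UNIV Phi + Lp_int q UNIV Phi <= ennreal (Ca * t0^2 + 1) * (energy q UNIV Phi + Lp_int q UNIV Phi)"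
      unfolding distrib_left using mult_right_mono[of "ennreal 1" "ennreal (Ca * t0^2 + 1)" "Lp_int q UNIV Phi"]
      by (intro add_mono mult_right_mono) auto
    qed simp
    also have "... = ennreal g2 * (energy q UNIV Phi + Lp_int q UNIV Phi)"
     unfolding g2_def using Ca(1) by (intro ennreal_mult_merge) auto
    also have "... <= ennreal (g1 + g2) * (energy q UNIV Phi + Lp_int q UNIV Phi)"
     using g by (intro mult_right_mono ennreal_leI) auto
    finally have s1: "ennreal (2 powr q) * (ennreal (Ca * t0^2) * energy q UNIV Phi + Lp_int q UNIV Phi) <= ennreal (g1 + g2) * (energy q UNIV Phi + Lp_int q UNIV Phi)" .
    have s2: "ennreal g1 * X <= ennreal (g1 + g2) * X" for X using g by (intro mult_right_mono ennreal_leI) auto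
    have "ennreal (2 powr q) * (ennreal (Ca * t0^2) * energy q UNIV Phi + Lp_int q UNIV Phi) + ennreal g1 * energy p A a + ennreal g1 * energy p A b
     <= ennreal (g1 + g2) * (energy q UNIV Phi + Lp_int q UNIV Phi) + ennreal (g1 + g2) * energy p A a + ennreal (g1 + g2) * energy p A b"
     by (intro add_mono s1 s2)
    also have "... = ennreal (g1 + g2) * (E + Lp_int q UNIV Phi)" by (simp add: E_def distrib_left add_ac)
    finally show "ennreal (2 powr q) * (ennreal (Ca * t0^2) * energy q UNIV Phi + Lp_int q UNIV Phi)
     + ennreal (G / t0^2 * (12 * t0)^4) * energy p A a + ennreal (G / t0^2 * (12 * t0)^4) * energy p A b
     <= ennreal (G / t0^2 * (12 * t0)^4 + 2 powr q * (Ca * t0^2 + 1)) * (E + Lp_int q UNIV Phi)"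
     by (simp only: g1_def g2_def)
   qed simp
   also have "... = ennreal H * (E + Lp_int q UNIV Phi)"
    unfolding H_def using G Ca t0 by (intro ennreal_mult_merge) auto
   finally show ?thesis .
  qed
  let ?B = "ennreal C * (E + Lp_int q UNIV Phi)"
  have Tn: "ennreal \<bar>T n\<bar> <= ?B" for n
  proof -
   have "T n = T 0 + (\<Sum>j<n. T (Suc j) - T j)" by (simp add: sum_lessThan_telescope)
   then have "\<bar>T n\<bar> <= \<bar>T 0\<bar> + (\<Sum>j<n. \<bar>T (Suc j) - T j\<bar>)"
    using sum_abs[of "%j. T (Suc j) - T j" "{..<n}"] by linarith
   then have "ennreal \<bar>T n\<bar> <= ennreal (\<bar>T 0\<bar> + (\<Sum>j<n. \<bar>T (Suc j) - T j\<bar>))" by (rule ennreal_leI)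
   also have "... = ennreal \<bar>T 0\<bar> + (\<Sum>j<n. ennreal \<bar>T (Suc j) - T j\<bar>)"
    by (simp add: ennreal_plus sum_nonneg sum_ennreal)
   also have "... <= ennreal H * (E + Lp_int q UNIV Phi) + ennreal (12 * G * 12^4) * E" by (intro add_mono T0 sumT)
   also have "... <= ennreal H * (E + Lp_int q UNIV Phi) + ennreal (12 * G * 12^4) * (E + Lp_int q UNIV Phi)"
    by (intro add_mono mult_left_mono) auto
   also have "... = ?B" unfolding C_def using H G by (subst ennreal_plus) (auto simp: distrib_right)
   finally show ?thesis .
  qed
  have rho0: "rho ----> 0"
  proof -
   have "(%j. t0 * (1/2)^j) ----> 0" by (intro tendsto_mult_right_zero LIMSEQ_realpow_zero) auto
   moreover have "(%j. t0 * (1/2)^j) = rho" by (simp add: fun_eq_iff rho_def power_divide)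
   ultimately show ?thesis by simp
  qed
  (* The step estimate also compares scale j with the functions themselves. Their derivatives are bounded
      near K, which contributes an error of order rho^(p - 2). *)
  have lim: "T ----> triform a b Phi" if fin: "E < \<infinity>"
  proof -
   obtain d where d0: "d > 0" "(\<Union>x\<in>K. cball x d) \<subseteq> A"
    by (rule compact_subset_open_imp_cball_epsilon_subset[OF K(1) oA K(2)])
   have "thicken K d \<subseteq> A"
   proof
    fix x assume "x \<in> thicken K d"
    then obtain y where "y \<in> K" "x \<in> cball y d" by (auto simp: mem_thicken dist_commute)
    then show "x \<in> A" using d0(2) by blast
   qed
   note d = d0(1) this
   let ?K = "thicken K d"
   have KV: "?K \<subseteq> V" using d V by auto
   obtain Ma where Ma: "Ma >= 0" "!!x v. x \<in> ?K ==> norm (fder a x v) <= Ma * norm v"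
    using smooth_derivative_bounded[OF a cT KV] by blast
   obtain Mb where Mb: "Mb >= 0" "!!x v. x \<in> ?K ==> norm (fder b x v) <= Mb * norm v"
    using smooth_derivative_bounded[OF b cT KV] by blast
   define M where "M = Ma + Mb"
   define mK where "mK = measure lborel ?K"
   have mK: "emeasure lborel ?K = ennreal mK" "mK >= 0" "M >= 0"
    using emeasure_eq_ennreal_measure[of lborel ?K] emeasure_compact_finite[OF cT, of d] Ma Mb by (auto simp: mK_def M_def)
   have Kb[measurable]: "?K \<in> sets borel" using compact_imp_closed[OF cT] by simp
   have pd: "\<bar>pderiv_at i a x\<bar> <= M" "\<bar>pderiv_at i b x\<bar> <= M" if "x \<in> ?K" for i x
    using Ma(2)[OF that, of "axis i 1"] Mb(2)[OF that, of "axis i 1"] Ma(1) Mb(1) by (auto simp: pderiv_at_def norm_axis_1 M_def)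
   define D where "D = 4 * Cm + Ca + G * 12^4"
   define EN where "EN = (%j. energy_near (12 * rho j) p A a + energy_near (12 * rho j) p A b + energy_near (12 * rho j) q UNIV Phi)"
   have EN0: "EN ----> 0"
   proof -
    have r12: "(%j. 12 * rho j) ----> 0" using tendsto_mult_right_zero[OF rho0] .
    have "energy p A a < \<infinity>" "energy p A b < \<infinity>" "energy q UNIV Phi < \<infinity>" using fin by (auto simp: E_def)
    then have "EN ----> 0 + 0 + 0" unfolding EN_def by (intro tendsto_add energy_near_tendsto_0 r12) auto
    then show ?thesis by simp
   qed
   have near_bd: "ennreal (G / rho j^2) * pair_int (near (12 * rho j)) e B f <= ennreal (G * 12^4 * rho j^2) * energy_near (12 * rho j) e B f"
    if [measurable]: "B \<in> sets borel" "f \<in> Borel" for e B f j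
   proof -
    have "ennreal (G / rho j^2) * pair_int (near (12 * rho j)) e B f <= ennreal (G / rho j^2) * (ennreal ((12 * rho j)^4) * energy_near (12 * rho j) e B f)"
     using rho(1)[of j] by (intro mult_left_mono near_le_energy_near) auto
    also have "... = ennreal (G / rho j^2 * (12 * rho j)^4) * energy_near (12 * rho j) e B f" using G by (intro ennreal_mult_merge) auto
    also have "G / rho j^2 * (12 * rho j)^4 = G * 12^4 * rho j^2" using rho(1)[of j] by (simp add: power_mult_distrib eval_nat_numeral)
    finally show ?thesis .
   qed
   have tot: "X + Y <= ennreal (D * rho j^2) * W" if "X <= ennreal x * W" "Y <= ennreal (G * 12^4 * rho j^2) * W" "0 <= x" "x <= (4 * Cm + Ca) * rho j^2"
    for X Y W x j
   proof -
    have "X + Y <= (ennreal x + ennreal (G * 12^4 * rho j^2)) * W" unfolding distrib_right by (intro add_mono that)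
    also have "ennreal x + ennreal (G * 12^4 * rho j^2) = ennreal (x + G * 12^4 * rho j^2)" using that G by (simp flip: ennreal_plus)
    also have "... * W <= ennreal (D * rho j^2) * W" using that by (intro mult_right_mono ennreal_leI) (auto simp: D_def distrib_right)
    finally show ?thesis .
   qed
   have "ennreal \<bar>T (Suc j) - triform a b Phi\<bar> <= ennreal (6 * D) * EN j + ennreal (12 * M powr p * mK * rho j powr (p - 2))" if j: "rho j <= d" for j
   proof -
    define L where "L = ennreal ((rho j * M) powr p)"
    define A1 where "A1 = (%x. indicator A x * epow p (\<alpha> (Suc j) x - a x) + OA j x + L * indicator ?K x)"
    define B1 where "B1 = (%x. indicator A x * epow p (\<beta> (Suc j) x - b x) + OB j x + L * indicator ?K x)"
    define C1 where "C1 = (%x. indicator UNIV x * epow q (phi (Suc j) x - Phi x) + OC j x)"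
    have tK: "thicken K (rho j) \<subseteq> ?K" using j by (force simp: mem_thicken)
    define U where "U = V \<inter> {x. mollifier_mass A (2 * rho j) x ~= 0}"
    have r2: "2 * rho j > 0" "2 * rho j / 4 <= t0" "rho (Suc j) > 0" "rho (Suc j) / 4 <= t0" "rho (Suc j) = rho j / 2"
     using rho[of j] rho[of "Suc j"] by (auto simp: rho_def)
    have U: "open U" unfolding U_def using smooth_on_mollify_mass(1)[OF r2(1) A la] V by auto
    have KU: "thicken K (rho j) \<subseteq> U"
    proof
     fix x assume x: "x \<in> thicken K (rho j)"
     then obtain x' where "x' \<in> A" "dist x x' <= rho j" using near_x by blast
     then show "x \<in> U" unfolding U_def using plump_mass_nonzero[OF pl _ _ r2(1,2), of x' x] x tK KV by auto
    qed
    have s: "smooth_on U (\<alpha> (Suc j))" "smooth_on U a" "smooth_on U (\<beta> (Suc j))" "smooth_on U b"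
     using smooth_on_mollify_mass(2)[OF r2(1) A la] smooth_on_mollify_mass(2)[OF r2(1) A lb] a b
     by (auto simp: U_def \<alpha>_def \<beta>_def rhoS(1) intro: smooth_on_subset)
    have zz: "phi (Suc j) x = 0" "Phi x = 0" if "x \<notin> thicken K (rho j)" for x
    proof -
     show "phi (Suc j) x = 0" using zphi[OF that, of "Suc j"] r2(3,5) by simp
     show "Phi x = 0" using that rho(1)[of j] by (intro z) (auto simp: mem_thicken)
    qed
    have m\<alpha>[measurable]: "\<alpha> (Suc j) \<in> Borel" "\<beta> (Suc j) \<in> Borel" "phi (Suc j) \<in> Borel"
     unfolding \<alpha>_def \<beta>_def phi_def rhoS(1) by (rule mollify_borel[OF r2(1) A la], rule mollify_borel[OF r2(1) A lb], rule mollify_borel[OF r2(3) _ lPhi']) simp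
    have sm: "epow p (rho j * y) <= L" if "\<bar>y\<bar> <= M" for y
     unfolding L_def using that p0 rho(1)[of j] by (intro ennreal_leI powr_mono2) (auto simp: abs_mult)
    have "ennreal \<bar>T (Suc j) - triform a b Phi\<bar> <= ennreal (6 / rho j^2) * ((NN x. A1 x) + (NN x. B1 x) + (NN x. C1 x))"
     unfolding T_def
    proof (rule triform_step[OF p0 q0 pq rho(1) U cT KU s smphi Phi zz])
     fix x i assume x: "x \<in> thicken K (rho j)"
     then have xK: "x \<in> ?K" "x \<in> A" using tK d(2) by auto
     show "epow p (\<alpha> (Suc j) x - a x) <= A1 x" "epow p (\<beta> (Suc j) x - b x) <= B1 x"
      "epow q (phi (Suc j) x - Phi x) <= C1 x"
      using xK by (simp_all add: A1_def B1_def C1_def add.assoc)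
     show "epow p (rho j * pderiv_at i a x) <= A1 x" using sm[OF pd(1)[OF xK(1)]] xK by (simp add: A1_def add_increasing)
     show "epow p (rho j * pderiv_at i (\<beta> (Suc j)) x) <= B1 x" using OBp'[OF x] by (simp add: B1_def add_increasing add_increasing2)
     show "epow p (rho j * pderiv_at i b x) <= B1 x" using sm[OF pd(2)[OF xK(1)]] xK by (simp add: B1_def add_increasing)
     show "epow q (rho j * pderiv_at i (phi (Suc j)) x) <= C1 x" using OCp by (simp add: C1_def add_increasing)
    qed (unfold A1_def B1_def C1_def L_def, measurable)
    also have "... <= ennreal (6 / rho j^2) * (ennreal (D * rho j^2) * EN j + ennreal (2 * (rho j * M) powr p * mK))"
    proof (intro mult_left_mono)
     have AB: "(NN x. indicator A x * epow p (mollify A (2 * rho j) f x - f x) + ennreal Cp * scale_osc p A (rho j) f x + L * indicator ?K x)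
      <= ennreal (D * rho j^2) * energy_near (12 * rho j) p A f + L * ennreal mK"
      if f[measurable]: "f \<in> Borel" and lf: "locally_integrable_on A f" for f
     proof -
      have [measurable]: "mollify A (2 * rho j) f \<in> Borel" by (rule mollify_borel[OF r2(1) A lf])
      have "(NN x. indicator A x * epow p (mollify A (2 * rho j) f x - f x) + ennreal Cp * scale_osc p A (rho j) f x + L * indicator ?K x)
       = Lp_int p A (%x. mollify A (2 * rho j) f x - f x) + (NN x. ennreal Cp * scale_osc p A (rho j) f x) + L * ennreal mK"
       by (simp add: nn_integral_add nn_integral_cmult Lp_int_def mK)
      also have "... <= ennreal (D * rho j^2) * energy_near (12 * rho j) p A f + L * ennreal mK"
       using Cm(2)[OF pl r2(1,2) f lf] Cm(1) Ca(1)
       by (intro add_right_mono tot[OF _ order_trans[OF intAB[OF f] near_bd[OF A f]]]) (auto simp: power_mult_distrib distrib_right)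
      finally show ?thesis .
     qed
     have "(NN x. C1 x) = Lp_int q UNIV (%x. phi (Suc j) x - Phi x) + (NN x. OC j x)"
      unfolding C1_def Lp_int_def by (rule nn_integral_add) auto
     also have "... <= ennreal (D * rho j^2) * energy_near (12 * rho j) q UNIV Phi"
     proof (rule tot[OF _ order_trans[OF intC near_bd]])
      have "Lp_int q UNIV (%x. phi (Suc j) x - Phi x) <= ennreal (Ca * rho (Suc j)^2) * energy_near (6 * rho (Suc j)) q UNIV Phi"
       unfolding phi_def by (rule Ca(2)[OF plU r2(3,4) Phim lPhi'])
      also have "... <= ennreal (Ca * rho (Suc j)^2) * energy_near (12 * rho j) q UNIV Phi"
       using r2 by (intro mult_left_mono energy_near_mono) auto
      finally show "Lp_int q UNIV (%x. phi (Suc j) x - Phi x) <= ennreal (Ca * rho (Suc j)^2) * energy_near (12 * rho j) q UNIV Phi" .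
      show "Ca * rho (Suc j)^2 <= (4 * Cm + Ca) * rho j^2" unfolding r2(5) using Ca(1) Cm(1) by (intro mult_mono) (auto simp: power_divide)
     qed (use Ca(1) in auto)
     finally have "(NN x. A1 x) + (NN x. B1 x) + (NN x. C1 x) <=
      (ennreal (D * rho j^2) * energy_near (12 * rho j) p A a + L * ennreal mK) + (ennreal (D * rho j^2) * energy_near (12 * rho j) p A b + L * ennreal mK)
      + ennreal (D * rho j^2) * energy_near (12 * rho j) q UNIV Phi"
      unfolding A1_def B1_def OA_def OB_def \<alpha>_def \<beta>_def rhoS(1) by (intro add_mono AB am bm la lb)
     also have "... = ennreal (D * rho j^2) * EN j + (L * ennreal mK + L * ennreal mK)" by (simp only: EN_def distrib_left add_ac)
     also have "L * ennreal mK + L * ennreal mK = ennreal (2 * (rho j * M) powr p * mK)"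
      using mK by (simp add: L_def mult.assoc flip: ennreal_mult ennreal_plus)
     finally show "(NN x. A1 x) + (NN x. B1 x) + (NN x. C1 x) <= ennreal (D * rho j^2) * EN j + ennreal (2 * (rho j * M) powr p * mK)" .
    qed simp
    also have "... = ennreal (6 / rho j^2 * (D * rho j^2)) * EN j + ennreal (6 / rho j^2 * (2 * (rho j * M) powr p * mK))"
     using Cm(1) Ca(1) G mK unfolding distrib_left by (subst ennreal_mult_merge) (auto simp: D_def ennreal_mult[symmetric])
    also have "6 / rho j^2 * (D * rho j^2) = 6 * D" using rho(1)[of j] by simp
    also have "6 / rho j^2 * (2 * (rho j * M) powr p * mK) = 12 * M powr p * mK * rho j powr (p - 2)"
     using rho(1)[of j] mK by (simp add: powr_mult powr_diff powr_numeral mult_ac)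
    finally show ?thesis .
   qed
   moreover have "eventually (%j. rho j <= d) sequentially"
    using order_tendstoD(2)[OF rho0 d(1)] by (rule eventually_mono) simp
   ultimately have ev: "eventually (%j. ennreal \<bar>T (Suc j) - triform a b Phi\<bar> <= ennreal (6 * D) * EN j + ennreal (12 * M powr p * mK * rho j powr (p - 2))) sequentially"
    by (auto elim: eventually_mono)
   have "(%j. rho j powr (p - 2)) ----> 0"
    using p rho(1) by (intro tendsto_zero_powrI[OF rho0 tendsto_const]) (auto intro!: always_eventually less_imp_le)
   then have "(%j. ennreal (12 * M powr p * mK * rho j powr (p - 2))) ----> ennreal 0"
    by (intro tendsto_ennrealI tendsto_mult_right_zero)
   then have "(%j. ennreal (6 * D) * EN j + ennreal (12 * M powr p * mK * rho j powr (p - 2))) ----> ennreal (6 * D) * 0 + ennreal 0"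
    by (intro tendsto_add ennreal_tendsto_cmult EN0) auto
   then have "(%j. ennreal \<bar>T (Suc j) - triform a b Phi\<bar>) ----> ennreal 0"
    using ev by (intro tendsto_sandwich[OF _ ev tendsto_const]) auto
   then have "(%j. \<bar>T (Suc j) - triform a b Phi\<bar>) ----> 0" by (subst (asm) tendsto_ennreal_iff) auto
   then have "(%j. T (Suc j)) ----> triform a b Phi" by (simp add: tendsto_rabs_zero_iff LIM_zero_iff)
   then show ?thesis by (rule LIMSEQ_imp_Suc)
  qed
  show "ennreal \<bar>triform a b Phi\<bar> <= ennreal C * (energy p A a + energy p A b + energy q UNIV Phi + Lp_int q UNIV Phi)"
  proof (cases "E < \<infinity>")
   case True
   have "(%n. ennreal \<bar>T n\<bar>) ----> ennreal \<bar>triform a b Phi\<bar>" by (intro tendsto_intros lim True)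
   then have "ennreal \<bar>triform a b Phi\<bar> <= ?B" by (rule LIMSEQ_le_const2) (use Tn in auto)
   then show ?thesis by (simp add: E_def)
  next
   case False
   then have "E = top" using less_top[of E] by auto
   then show ?thesis unfolding E_def[symmetric] using C by (simp add: ennreal_mult_top)
  qed
 qed
 qed
 qed
 qed
 qed
qed

section \<open>Smooth boundaries\<close>

text \<open>The ball is centred at height \<open>t / 2\<close> above \<open>x\<close>; its radius is so small, depending on the Lipschitz constant of \<open>\<gamma>\<close>, that it
 stays above the graph.\<close>

lemma epigraph_corkscrew:
 fixes Om :: "'a::euclidean_space set" and \<gamma> :: "'a => real"
 assumes r: "r > 0" and e: "norm e = 1" and \<gamma>: "smooth_on UNIV \<gamma>"
  and eq: "Om \<inter> ball x0 r = {x \<in> ball x0 r. x \<bullet> e > \<gamma> (x - (x \<bullet> e) *\<^sub>R e)}"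
 shows "\<exists>kappa. 0 < kappa \<and> kappa <= 1 \<and> (\<forall>x t. x \<in> Om \<inter> ball x0 (r / 2) --> 0 < t --> t <= r / 2 --> (\<exists>c. ball c (kappa * t) \<subseteq> Om \<inter> ball x t))"
proof -
 define P where "P = (%x. x - (x \<bullet> e) *\<^sub>R e)"
 have ee: "e \<bullet> e = 1" using e by (simp add: norm_eq_1)
 have Pn: "norm (P w) <= norm w" for w
 proof -
  have "P w \<bullet> P w = w \<bullet> w - (w \<bullet> e)^2" by (simp add: P_def inner_diff inner_commute ee power2_eq_square algebra_simps)
  then have "(norm (P w))^2 <= (norm w)^2" by (simp add: power2_norm_eq_inner)
  then show ?thesis by (rule power2_le_imp_le) simp
 qed
 obtain L where L: "L >= 0" "!!x y. x \<in> cball 0 (norm x0 + r) ==> y \<in> cball 0 (norm x0 + r) ==> norm (\<gamma> x - \<gamma> y) <= L * norm (x - y)"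
  using smooth_Lipschitz_on_convex[OF \<gamma> compact_cball subset_UNIV convex_cball] by metis
 have Pb: "P y \<in> cball 0 (norm x0 + r)" if "y \<in> ball x0 r" for y
  using Pn[of y] norm_triangle_ineq2[of y x0] that by (auto simp: dist_norm norm_minus_commute)
 define kappa where "kappa = 1 / (2 * (1 + L))"
 have kappa: "0 < kappa" "kappa <= 1/2" "(1 + L) * kappa = 1/2" using L(1) by (auto simp: kappa_def field_simps)
 show ?thesis
 proof (intro exI[of _ kappa] conjI allI impI)
  show "0 < kappa" "kappa <= 1" using kappa by auto
  fix x t assume x: "x \<in> Om \<inter> ball x0 (r / 2)" and t: "0 < t" "t <= r / 2"
  have xr: "x \<in> ball x0 r" using x r by auto
  have xe: "x \<bullet> e > \<gamma> (P x)" using x xr eq unfolding P_def by blast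
  show "\<exists>c. ball c (kappa * t) \<subseteq> Om \<inter> ball x t"
  proof (intro exI subsetI)
   fix y assume y: "y \<in> ball (x + (t / 2) *\<^sub>R e) (kappa * t)"
   define w where "w = y - (x + (t / 2) *\<^sub>R e)"
   have yw: "y = x + (t / 2) *\<^sub>R e + w" by (simp add: w_def)
   have w: "norm w < kappa * t" using y by (simp add: w_def dist_norm norm_minus_commute)
   have "norm (y - x) <= norm ((t / 2) *\<^sub>R e) + norm w" using norm_triangle_ineq[of "(t / 2) *\<^sub>R e" w] by (simp add: yw)
   also have "... < t / 2 + kappa * t" using w e t by simp
   also have "... <= t / 2 + 1/2 * t" using kappa t by (intro add_left_mono mult_right_mono) auto
   finally have yx: "norm (y - x) < t" by simp
   have yr: "y \<in> ball x0 r" using dist_triangle[of x0 y x] x yx t by (simp add: dist_norm norm_minus_commute)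
   have Py: "P y = P x + P w" by (simp add: P_def yw inner_add_left ee algebra_simps)
   have "\<gamma> (P y) - \<gamma> (P x) <= L * norm (P y - P x)" using L(2)[OF Pb[OF yr] Pb[OF xr]] by simp
   also have "... <= L * norm w" using Pn[of w] L(1) by (simp add: Py mult_left_mono)
   finally have g: "\<gamma> (P y) <= \<gamma> (P x) + L * norm w" by simp
   have "y \<bullet> e = x \<bullet> e + t / 2 + w \<bullet> e" by (simp add: yw inner_add_left ee)
   moreover have "- norm w <= w \<bullet> e" using Cauchy_Schwarz_ineq2[of w e] e by simp
   moreover have "(1 + L) * norm w < t / 2"
   proof -
    have "(1 + L) * norm w < (1 + L) * (kappa * t)" using w L(1) by (intro mult_strict_left_mono) auto
    also have "... = t / 2" using kappa(3) by (simp add: mult.assoc[symmetric])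
    finally show ?thesis .
   qed
   ultimately have "y \<bullet> e > \<gamma> (P y)" using g xe by (simp add: algebra_simps)
   then have "y \<in> Om" using yr eq unfolding P_def by blast
   then show "y \<in> Om \<inter> ball x t" using yx by (simp add: dist_norm norm_minus_commute)
  qed
 qed
qed

text \<open>Compactness of the boundary makes the constants of \<open>epigraph_corkscrew\<close> uniform.\<close>

lemma smooth_boundary_plump:
 fixes Om :: "(real^2) set"
 assumes o: "open Om" and b: "bounded Om" and s: "has_smooth_boundary Om"
 shows "\<exists>kappa t0. plump Om kappa t0"
proof -
 have "\<exists>R kappa. 0 < R \<and> 0 < kappa \<and> kappa <= 1 \<and> (\<forall>x t. x \<in> Om \<inter> ball z R --> 0 < t --> t <= R --> (\<exists>c. ball c (kappa * t) \<subseteq> Om \<inter> ball x t))"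
  if z: "z \<in> frontier Om" for z
 proof -
  obtain r e and \<gamma> :: "real^2 => real" where h: "r > 0" "norm e = 1" "smooth_on UNIV \<gamma>"
   "Om \<inter> ball z r = {x \<in> ball z r. x \<bullet> e > \<gamma> (x - (x \<bullet> e) *\<^sub>R e)}"
   using s z unfolding has_smooth_boundary_def by blast
  obtain k where k: "0 < k \<and> k <= 1 \<and> (\<forall>x t. x \<in> Om \<inter> ball z (r / 2) --> 0 < t --> t <= r / 2 --> (\<exists>c. ball c (k * t) \<subseteq> Om \<inter> ball x t))"
   using epigraph_corkscrew[OF h] by blast
  have "0 < r / 2" using h(1) by simp
  then show ?thesis using k by blast
 qed
 then obtain R kappa where R: "!!z. z \<in> frontier Om ==> 0 < R z \<and> 0 < kappa z \<and> kappa z <= 1 \<and>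
   (\<forall>x t. x \<in> Om \<inter> ball z (R z) --> 0 < t --> t <= R z --> (\<exists>c. ball c (kappa z * t) \<subseteq> Om \<inter> ball x t))"
  by metis
 have cf: "compact (frontier Om)" using b by (rule compact_frontier_bounded)
 obtain D where D: "D \<subseteq> frontier Om" "finite D" "frontier Om \<subseteq> (\<Union>z\<in>D. ball z (R z / 2))"
 proof (rule compactE_image[OF cf, of "frontier Om" "%z. ball z (R z / 2)"])
  show "frontier Om \<subseteq> (\<Union>z\<in>frontier Om. ball z (R z / 2))" using R by force
 qed auto
 define t0 where "t0 = Min (insert 1 ((%z. R z / 2) ` D))"
 define k where "k = Min (insert 1 (kappa ` D))"
 have RD: "0 < R z" "0 < kappa z" if "z \<in> D" for z using R[of z] that D(1) by auto
 have fin: "finite (insert 1 ((%z. R z / 2) ` D))" "finite (insert 1 (kappa ` D))" using D(2) by auto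
 have t0: "t0 > 0" unfolding t0_def using fin(1) RD by (subst Min_gr_iff) auto
 have t0R: "t0 <= R z / 2" if "z \<in> D" for z unfolding t0_def using fin(1) that by (intro Min_le) auto
 have k0: "k > 0" unfolding k_def using fin(2) RD by (subst Min_gr_iff) auto
 have k1: "k <= 1" unfolding k_def using fin(2) by (intro Min_le) auto
 have kD: "k <= kappa z" if "z \<in> D" for z unfolding k_def using fin(2) that by (intro Min_le) auto
 note k = k0 k1 kD
 have "\<exists>c. ball c (k * t) \<subseteq> Om \<inter> ball x t" if x: "x \<in> Om" and t: "0 < t" "t <= t0" for x t
 proof (cases "ball x t \<inter> frontier Om = {}")
  case True
  have "x \<in> ball x t \<inter> Om" using x t by simp
  then have "ball x t \<inter> Om ~= {}" by blast
  then have "ball x t - Om = {}" using connected_Int_frontier[of "ball x t" Om] True connected_ball by blast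
  then have "ball x t \<subseteq> Om" by blast
  moreover have "ball x (k * t) \<subseteq> ball x t" using k t by (intro subset_ball) (simp add: mult_left_le_one_le)
  ultimately show ?thesis by blast
 next
  case False
  then obtain w where w: "w \<in> frontier Om" "dist x w < t" by auto
  then obtain z where z: "z \<in> D" "dist z w < R z / 2" using D(3) by auto
  have "dist z x < R z" using dist_triangle[of z x w] w z t t0R[OF z(1)] by (simp add: dist_commute)
  then have xz: "x \<in> Om \<inter> ball z (R z)" using x by simp
  have tR: "t <= R z" using t(2) t0R[OF z(1)] RD(1)[OF z(1)] by linarith
  have zf: "z \<in> frontier Om" using z(1) D(1) by blast
  have "\<forall>x t. x \<in> Om \<inter> ball z (R z) --> 0 < t --> t <= R z --> (\<exists>c. ball c (kappa z * t) \<subseteq> Om \<inter> ball x t)"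
   using R[OF zf] by blast
  then obtain c where c: "ball c (kappa z * t) \<subseteq> Om \<inter> ball x t"
   using xz t(1) tR by blast
  have "ball c (k * t) \<subseteq> ball c (kappa z * t)" using k(3)[OF z(1)] t by (intro subset_ball mult_right_mono) auto
  then show ?thesis using c by blast
 qed
 then have "ennreal (k^2 * t^2) <= emeasure lborel (Om \<inter> ball x t)" if x: "x \<in> Om" and t: "0 < t" "t <= t0" for x t
 proof -
  obtain c where c: "ball c (k * t) \<subseteq> Om \<inter> ball x t" using \<open>!!x t. x \<in> Om ==> 0 < t ==> t <= t0 ==> \<exists>c. ball c (k * t) \<subseteq> Om \<inter> ball x t\<close>[OF x t] by blast
  have "k^2 * t^2 <= pi * (k * t)^2" using pi_gt3 mult_right_mono[of 1 pi "(k * t)^2"] by (simp add: power_mult_distrib)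
  then have "ennreal (k^2 * t^2) <= ennreal (pi * (k * t)^2)" by (rule ennreal_leI)
  also have "... = emeasure lborel (ball c (k * t))" using k t by (simp add: emeasure_ball_2)
  also have "... <= emeasure lborel (Om \<inter> ball x t)" using c o by (intro emeasure_mono) auto
  finally show ?thesis .
 qed
 then have "plump Om (k^2) t0" unfolding plump_def using t0 k o by auto
 then show ?thesis by blast
qed

section \<open>Continuity of the trilinear form\<close>

definition smooth_near :: "(real^2) set => (real^2 => real) => bool" where
 "smooth_near A a \<longleftrightarrow> a \<in> Borel \<and> (\<exists>V. open V \<and> closure A \<subseteq> V \<and> smooth_on V a)"

lemma smooth_near_diff: "smooth_near A a ==> smooth_near A b ==> smooth_near A (%x. a x - b x)"
proof -
 assume "smooth_near A a" "smooth_near A b"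
 then obtain V W where "open V" "closure A \<subseteq> V" "smooth_on V a" "open W" "closure A \<subseteq> W" "smooth_on W b"
  and [measurable]: "a \<in> Borel" "b \<in> Borel"
  unfolding smooth_near_def by blast
 then have "smooth_on (V \<inter> W) (%x. a x - b x)" "open (V \<inter> W)" "closure A \<subseteq> V \<inter> W"
  by (auto intro!: smooth_on_diff intro: smooth_on_subset)
 moreover have "(%x. a x - b x) \<in> Borel" by measurable
 ultimately show ?thesis unfolding smooth_near_def by blast
qed

lemma smooth_near_cmult: "smooth_near A a ==> smooth_near A (%x. c * a x)"
 unfolding smooth_near_def by (auto intro: smooth_on_cmult)

lemma smooth_near_locally_integrable:
 assumes "smooth_near A a" "bounded A" "A \<in> sets borel"
 shows "locally_integrable_on A a"
proof -
 obtain V where V: "closure A \<subseteq> V" "smooth_on V a" and [measurable]: "a \<in> Borel" "A \<in> sets borel"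
  using assms by (auto simp: smooth_near_def)
 have "compact (closure A)" using assms(2) by simp
 then have "bounded (a ` closure A)"
  using compact_continuous_image[OF continuous_on_subset[OF smooth_on_continuous[OF V(2)] V(1)]] compact_imp_bounded by blast
 then obtain M where M: "!!x. x \<in> A ==> \<bar>a x\<bar> <= M" unfolding bounded_iff using closure_subset[of A] by fastforce
 show ?thesis
 proof (rule bounded_locally_integrable[of _ "max 0 M"])
  show "(%z. indicator A z * a z) \<in> Borel" by measurable
  show "\<bar>indicator A x * a x\<bar> <= max 0 M" for x using M[of x] by (auto simp: indicator_def le_max_iff_disj)
 qed
qed

lemma pair_int_scale:
 assumes [measurable]: "w \<in> Borel" "A \<in> sets borel" "f \<in> Borel"
 shows "pair_int w p A (%x. c * f x) = epow p c * pair_int w p A f"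
proof -
 have "pair_int w p A (%x. c * f x) = (NN x. (NN y. epow p c * (indicator A x * indicator A y * (w (x - y) * epow p (f x - f y)))))"
  unfolding pair_int_def
 proof (intro nn_integral_cong)
  fix x y
  have "\<bar>c * f x - c * f y\<bar> powr p = \<bar>c\<bar> powr p * \<bar>f x - f y\<bar> powr p"
   by (simp add: abs_mult powr_mult flip: right_diff_distrib)
  then show "indicator A x * indicator A y * (w (x - y) * epow p (c * f x - c * f y)) =
   epow p c * (indicator A x * indicator A y * (w (x - y) * epow p (f x - f y)))"
   by (simp add: ennreal_mult mult_ac)
 qed
 also have "... = epow p c * pair_int w p A f"
  unfolding pair_int_def by (simp add: nn_integral_cmult)
 finally show ?thesis .
qed

lemma Lp_int_scale:
 assumes [measurable]: "A \<in> sets borel" "f \<in> Borel"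
 shows "Lp_int p A (%x. c * f x) = epow p c * Lp_int p A f"
proof -
 have "Lp_int p A (%x. c * f x) = (NN x. epow p c * (indicator A x * epow p (f x)))"
  unfolding Lp_int_def by (intro nn_integral_cong) (simp add: abs_mult powr_mult ennreal_mult mult_ac)
 then show ?thesis unfolding Lp_int_def by (simp add: nn_integral_cmult)
qed

lemma support_closure_zero: "x \<notin> closure {x. f x ~= 0} ==> f x = 0"
 using closure_subset[of "{x. f x ~= 0}"] by blast

lemma test_functionsD:
 assumes "Phi \<in> test_functions A"
 shows "smooth_on UNIV Phi" "compact (closure {x. Phi x ~= 0})" "closure {x. Phi x ~= 0} \<subseteq> A" "x \<notin> closure {x. Phi x ~= 0} ==> Phi x = 0"
  "Phi \<in> Borel" "\<exists>B. \<forall>x. \<bar>Phi x\<bar> <= B"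
proof -
 show 1: "smooth_on UNIV Phi" "compact (closure {x. Phi x ~= 0})" "closure {x. Phi x ~= 0} \<subseteq> A"
  using assms by (auto simp: test_functions_def)
 show 2: "Phi x = 0" if "x \<notin> closure {x. Phi x ~= 0}" for x
  using that closure_subset[of "{x. Phi x ~= 0}"] by blast
 show "Phi \<in> Borel" by (rule borel_measurable_continuous_onI[OF smooth_on_continuous[OF 1(1)]])
 show "\<exists>B. \<forall>x. \<bar>Phi x\<bar> <= B" using smooth_compact_support_bounded[OF 1(1,2) 2] by metis
qed

lemma test_functionsI:
 assumes "smooth_on UNIV Phi" "compact K" "K \<subseteq> A" "!!x. x \<notin> K ==> Phi x = 0"
 shows "Phi \<in> test_functions A"
proof -
 have "closure {x. Phi x ~= 0} \<subseteq> K"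
  using assms(4) by (intro closure_minimal compact_imp_closed assms) auto
 moreover have "compact (K \<inter> closure {x. Phi x ~= 0})" by (rule compact_Int_closed[OF assms(2) closed_closure])
 ultimately have "compact (closure {x. Phi x ~= 0})" "closure {x. Phi x ~= 0} \<subseteq> A"
  using assms(3) by (auto simp: Int_absorb1)
 then show ?thesis unfolding test_functions_def using assms(1) by simp
qed

lemma test_functions_diff:
 fixes Phi \<Psi> :: "'a::euclidean_space => real"
 assumes "Phi \<in> test_functions A" "\<Psi> \<in> test_functions A"
 shows "(%x. Phi x - \<Psi> x) \<in> test_functions A"
proof (rule test_functionsI)
 show "smooth_on UNIV (%x. Phi x - \<Psi> x)" using assms by (intro smooth_on_diff) (auto simp: test_functions_def)
 show "compact (closure {x. Phi x ~= 0} \<union> closure {x. \<Psi> x ~= 0})" using assms by (auto simp: test_functions_def)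
 show "closure {x. Phi x ~= 0} \<union> closure {x. \<Psi> x ~= 0} \<subseteq> A" using assms by (auto simp: test_functions_def)
 show "Phi x - \<Psi> x = 0" if "x \<notin> closure {x. Phi x ~= 0} \<union> closure {x. \<Psi> x ~= 0}" for x
  using that support_closure_zero[of x Phi] support_closure_zero[of x \<Psi>] by simp
qed

lemma test_functions_cmult:
 fixes Phi :: "'a::euclidean_space => real"
 assumes "Phi \<in> test_functions A"
 shows "(%x. c * Phi x) \<in> test_functions A"
proof (rule test_functionsI)
 show "smooth_on UNIV (%x. c * Phi x)" using assms by (intro smooth_on_cmult) (auto simp: test_functions_def)
 show "compact (closure {x. Phi x ~= 0})" "closure {x. Phi x ~= 0} \<subseteq> A" using assms by (auto simp: test_functions_def)
 show "c * Phi x = 0" if "x \<notin> closure {x. Phi x ~= 0}" for x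
  using that support_closure_zero[of x Phi] by simp
qed

definition tri_admissible :: "(real^2) set => (real^2 => real) => (real^2 => real) => (real^2 => real) => bool" where
 "tri_admissible A a b Phi \<longleftrightarrow> smooth_near A a \<and> smooth_near A b \<and> Phi \<in> test_functions A"

abbreviation test_size :: "real => (real^2) set => (real^2 => real) => ennreal" where
 "test_size q A Phi \<equiv> energy q A Phi + Lp_int q A Phi"

lemma pderiv_at_cmult:
 fixes a :: "real^'n => real"
 assumes "smooth_on V a" "x \<in> V"
 shows "pderiv_at i (%x. c * a x) x = c * pderiv_at i a x"
 using pderiv_at_eq[OF has_derivative_mult_right[OF smooth_on_has_derivative[OF assms], of c], of i]
 by (simp add: pderiv_at_def)

lemma triform_scale:
 assumes "tri_admissible A a b Phi"
 shows "triform (%x. c * a x) b Phi = c * triform a b Phi" "triform a (%x. c * b x) Phi = c * triform a b Phi"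
  "triform a b (%x. c * Phi x) = c * triform a b Phi"
proof -
 obtain V W where V: "closure A \<subseteq> V" "smooth_on V a" "closure A \<subseteq> W" "smooth_on W b"
  using assms by (auto simp: tri_admissible_def smooth_near_def)
 have Phi: "Phi \<in> test_functions A" using assms by (simp add: tri_admissible_def)
 have inVW: "x \<in> V" "x \<in> W" if "Phi x ~= 0" for x
  using test_functionsD(3,4)[OF Phi] that V closure_subset[of A] by blast+
 have "triform (%x. c * a x) b Phi = (LBINT x. c * (bracket a b x * Phi x))"
  unfolding triform_def
 proof (intro Bochner_Integration.integral_cong refl)
  fix x show "bracket (%x. c * a x) b x * Phi x = c * (bracket a b x * Phi x)"
   using pderiv_at_cmult[OF V(2) inVW(1), of x] by (cases "Phi x = 0") (simp_all add: bracket_def algebra_simps)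
 qed
 then show "triform (%x. c * a x) b Phi = c * triform a b Phi" by (simp add: triform_def)
 have "triform a (%x. c * b x) Phi = (LBINT x. c * (bracket a b x * Phi x))"
  unfolding triform_def
 proof (intro Bochner_Integration.integral_cong refl)
  fix x show "bracket a (%x. c * b x) x * Phi x = c * (bracket a b x * Phi x)"
   using pderiv_at_cmult[OF V(4) inVW(2), of x] by (cases "Phi x = 0") (simp_all add: bracket_def algebra_simps)
 qed
 then show "triform a (%x. c * b x) Phi = c * triform a b Phi" by (simp add: triform_def)
 have "triform a b (%x. c * Phi x) = (LBINT x. c * (bracket a b x * Phi x))"
  unfolding triform_def by (intro Bochner_Integration.integral_cong refl) simp
 then show "triform a b (%x. c * Phi x) = c * triform a b Phi" by (simp add: triform_def)
qed

lemma triform_bound: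
 assumes pl: "plump A kappa0 t0" and oA: "open A" and bA: "bounded A" and p: "p > 2" and q: "q > 2" and pq: "2 / p + 1 / q = 1"
 obtains C where "C > 0"
  "!!a b Phi. tri_admissible A a b Phi ==> ennreal \<bar>triform a b Phi\<bar> <= ennreal C * (energy p A a + energy p A b + test_size q A Phi)"
proof -
 have A: "A \<in> sets borel" using oA by simp
 have q0: "q > 0" using q by simp
 show ?thesis
 proof (rule triform_energy_bound[OF pl oA p q pq], goal_cases)
 case C1: (1 C1)
 show ?thesis
 proof (rule energy_zero_extension[OF q0], goal_cases)
 case C2: (1 C2)
 show ?thesis
 proof (rule that[of "C1 * (C2 + 1)"])
  show "C1 * (C2 + 1) > 0" using C1 C2 by simp
  fix a b Phi assume adm: "tri_admissible A a b Phi"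
  obtain V W where V: "open V" "closure A \<subseteq> V" "smooth_on V a" "open W" "closure A \<subseteq> W" "smooth_on W b"
   and m: "a \<in> Borel" "b \<in> Borel"
   using adm by (auto simp: tri_admissible_def smooth_near_def)
  have Phi: "Phi \<in> test_functions A" using adm by (simp add: tri_admissible_def)
  note t = test_functionsD[OF Phi]
  define K where "K = closure {x. Phi x ~= 0}"
  have "ennreal \<bar>triform a b Phi\<bar> <= ennreal C1 * (energy p A a + energy p A b + energy q UNIV Phi + Lp_int q UNIV Phi)"
  proof (rule C1(2)[of "V \<inter> W" a b Phi K])
   show "A \<subseteq> V \<inter> W" using V closure_subset[of A] by auto
   show "smooth_on (V \<inter> W) a" "smooth_on (V \<inter> W) b" using V by (auto intro: smooth_on_subset)
   show "locally_integrable_on A a" "locally_integrable_on A b"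
    using adm smooth_near_locally_integrable bA A by (auto simp: tri_admissible_def)
   show "open (V \<inter> W)" using V by auto
   show "a \<in> Borel" "b \<in> Borel" by (rule m)+
   show "smooth_on UNIV Phi" by (rule t(1))
   show "compact K" "K \<subseteq> A" unfolding K_def by (rule t(2), rule t(3))
   show "\<forall>x. x \<notin> K --> Phi x = 0" unfolding K_def using support_closure_zero[of _ Phi] by blast
  qed
  also have "... <= ennreal C1 * (ennreal (C2 + 1) * energy p A a + ennreal (C2 + 1) * energy p A b + (ennreal (C2 + 1) * energy q A Phi + ennreal (C2 + 1) * Lp_int q A Phi))"
  proof (intro mult_left_mono)
   have one: "X <= ennreal (C2 + 1) * X" for X :: ennreal
   proof -
    have "ennreal 1 <= ennreal (C2 + 1)" using C2(1) by (intro ennreal_leI) auto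
    from mult_right_mono[OF this, of X] show ?thesis by simp
   qed
   have e: "energy q UNIV Phi <= ennreal (C2 + 1) * energy q A Phi"
   proof -
    have "energy q UNIV Phi <= ennreal C2 * energy q A Phi"
     by (rule C2(2)[OF oA t(2,3,5,6)]) (rule t(4))
    also have "... <= ennreal (C2 + 1) * energy q A Phi" by (intro mult_right_mono ennreal_leI) auto
    finally show ?thesis .
   qed
   have "Lp_int q UNIV Phi = Lp_int q A Phi"
    unfolding Lp_int_def
   proof (intro nn_integral_cong)
    fix x show "indicator UNIV x * epow q (Phi x) = indicator A x * epow q (Phi x)"
     using t(3) t(4)[of x] q0 by (cases "x \<in> A") auto
   qed
   then show "energy p A a + energy p A b + energy q UNIV Phi + Lp_int q UNIV Phi <=
    ennreal (C2 + 1) * energy p A a + ennreal (C2 + 1) * energy p A b + (ennreal (C2 + 1) * energy q A Phi + ennreal (C2 + 1) * Lp_int q A Phi)"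
    unfolding add.assoc by (intro add_mono one e) (simp add: one)
  qed simp
  also have "... = ennreal C1 * (ennreal (C2 + 1) * (energy p A a + energy p A b + test_size q A Phi))"
   by (simp only: distrib_left)
  also have "... = ennreal (C1 * (C2 + 1)) * (energy p A a + energy p A b + test_size q A Phi)"
   using C1(1) C2(1) by (intro ennreal_mult_merge) auto
  finally show "ennreal \<bar>triform a b Phi\<bar> <= ennreal (C1 * (C2 + 1)) * (energy p A a + energy p A b + test_size q A Phi)" .
 qed
 qed
 qed
qed

lemma ennreal_powr_scale_le:
 assumes "e > 0" "p > 0" "X <= ennreal (e powr p)"
 shows "epow p (1 / e) * X <= 1"
proof -
 have "epow p (1 / e) * X <= epow p (1 / e) * ennreal (e powr p)"
  by (intro mult_left_mono assms) simp
 also have "... = ennreal (\<bar>1 / e\<bar> powr p * e powr p)" by (rule ennreal_mult[symmetric]) auto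
 also have "\<bar>1 / e\<bar> powr p * e powr p = 1" using assms by (simp add: powr_divide)
 finally show ?thesis by simp
qed

text \<open>Dividing the small argument by a small number \<open>e\<close> keeps it bounded, so \<open>triform_bound\<close> still applies; undoing the division
 gains the factor \<open>e\<close>.\<close>

lemma triform_small:
 assumes pl: "plump A kappa0 t0" and oA: "open A" and bA: "bounded A" and p: "p > 2" and q: "q > 2" and pq: "2 / p + 1 / q = 1"
  and B: "B >= 0" and \<eta>: "\<eta> > 0"
 obtains \<delta> where "\<delta> > 0"
  "!!a b Phi. tri_admissible A a b Phi ==> energy p A a <= ennreal B ==> energy p A b <= ennreal B ==> test_size q A Phi <= ennreal B ==>
   energy p A a <= ennreal \<delta> \<or> energy p A b <= ennreal \<delta> \<or> test_size q A Phi <= ennreal \<delta> ==> \<bar>triform a b Phi\<bar> <= \<eta>"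
proof -
 have A[measurable]: "A \<in> sets borel" using oA by simp
 have p0: "p > 0" and q0: "q > 0" using p q by auto
 obtain C where C: "C > 0"
  "!!a b Phi. tri_admissible A a b Phi ==> ennreal \<bar>triform a b Phi\<bar> <= ennreal C * (energy p A a + energy p A b + test_size q A Phi)"
  using triform_bound[OF pl oA bA p q pq] by blast
 define e where "e = \<eta> / (C * (1 + 2 * B))"
 have e: "e > 0" using \<eta> C(1) B by (simp add: e_def)
 have eC: "e * (C * (1 + 2 * B)) = \<eta>" using C(1) B by (simp add: e_def)
 define \<delta> where "\<delta> = min (e powr p) (e powr q)"
 have \<delta>: "\<delta> > 0" "\<delta> <= e powr p" "\<delta> <= e powr q" using e by (auto simp: \<delta>_def)
 define c where "c = 1 / e"
 have fin: "\<bar>T\<bar> <= \<eta>" if "ennreal \<bar>c * T\<bar> <= ennreal C * (X + Y + Z)" "X <= 1" "Y <= ennreal B" "Z <= ennreal B" for T X Y Z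
 proof -
  have "ennreal \<bar>c * T\<bar> <= ennreal C * (1 + ennreal B + ennreal B)"
   by (rule order_trans[OF that(1)]) (intro mult_left_mono add_mono that, simp)
  also have "... = ennreal C * ennreal (1 + B + B)"
  proof -
   have "ennreal (1 + B + B) = ennreal (1 + B) + ennreal B" using B by (intro ennreal_plus) auto
   also have "ennreal (1 + B) = ennreal 1 + ennreal B" using B by (intro ennreal_plus) auto
   finally show ?thesis by simp
  qed
  also have "... = ennreal (C * (1 + B + B))" using C(1) B by (intro ennreal_mult[symmetric]) auto
  finally have "\<bar>c * T\<bar> <= C * (1 + B + B)" using C(1) B by (subst (asm) ennreal_le_iff) auto
  moreover have "C * (1 + B + B) = C * (1 + 2 * B)" by simp
  moreover have "\<bar>c * T\<bar> = \<bar>T\<bar> / e" using e by (simp add: c_def abs_mult)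
  ultimately have "\<bar>T\<bar> / e <= C * (1 + 2 * B)" by (simp only:)
  then have "\<bar>T\<bar> <= C * (1 + 2 * B) * e" using e by (simp add: pos_divide_le_eq)
  then show ?thesis using eC by (simp add: mult.commute)
 qed
 show ?thesis
 proof (rule that[OF \<delta>(1)])
  fix a b Phi
  assume adm: "tri_admissible A a b Phi" and bd: "energy p A a <= ennreal B" "energy p A b <= ennreal B" "test_size q A Phi <= ennreal B"
   and sm: "energy p A a <= ennreal \<delta> \<or> energy p A b <= ennreal \<delta> \<or> test_size q A Phi <= ennreal \<delta>"
  have ad: "smooth_near A a" "smooth_near A b" "Phi \<in> test_functions A" using adm by (auto simp: tri_admissible_def)
  have m[measurable]: "a \<in> Borel" "b \<in> Borel" "Phi \<in> Borel"
   using ad test_functionsD(5)[OF ad(3)] by (auto simp: smooth_near_def)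
  have dp: "ennreal \<delta> <= ennreal (e powr p)" and dq: "ennreal \<delta> <= ennreal (e powr q)"
   using \<delta> by (auto intro: ennreal_leI)
  from sm consider "energy p A a <= ennreal (e powr p)" | "energy p A b <= ennreal (e powr p)" | "test_size q A Phi <= ennreal (e powr q)"
  proof (elim disjE)
   assume "energy p A a <= ennreal \<delta>" then show thesis by (rule that(1)[OF order_trans[OF _ dp]])
  next
   assume "energy p A b <= ennreal \<delta>" then show thesis by (rule that(2)[OF order_trans[OF _ dp]])
  next
   assume "test_size q A Phi <= ennreal \<delta>" then show thesis by (rule that(3)[OF order_trans[OF _ dq]])
  qed
  then show "\<bar>triform a b Phi\<bar> <= \<eta>"
  proof cases
   case 1
   have "tri_admissible A (%x. c * a x) b Phi" unfolding tri_admissible_def by (intro conjI smooth_near_cmult ad)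
   note h = C(2)[OF this, unfolded triform_scale(1)[OF adm]]
   have "energy p A (%x. c * a x) <= 1"
    unfolding pair_int_scale[OF inv4_borel A m(1)] c_def by (rule ennreal_powr_scale_le[OF e p0 1])
   from fin[OF h this bd(2,3)] show ?thesis .
  next
   case 2
   have "tri_admissible A a (%x. c * b x) Phi" unfolding tri_admissible_def by (intro conjI smooth_near_cmult ad)
   note h = C(2)[OF this, unfolded triform_scale(2)[OF adm] add.commute[of "energy p A a"]]
   have "energy p A (%x. c * b x) <= 1"
    unfolding pair_int_scale[OF inv4_borel A m(2)] c_def by (rule ennreal_powr_scale_le[OF e p0 2])
   from fin[OF h this bd(1,3)] show ?thesis .
  next
   case 3
   have "tri_admissible A a b (%x. c * Phi x)" unfolding tri_admissible_def by (intro conjI test_functions_cmult ad)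
   note h = C(2)[OF this, unfolded triform_scale(3)[OF adm]]
   have "test_size q A (%x. c * Phi x) = epow q c * test_size q A Phi"
    unfolding pair_int_scale[OF inv4_borel A m(3)] Lp_int_scale[OF A m(3)] by (simp only: distrib_left)
   also have "... <= 1" unfolding c_def by (rule ennreal_powr_scale_le[OF e q0 3])
   finally have t: "test_size q A (%x. c * Phi x) <= 1" .
   have "energy p A a + energy p A b + test_size q A (%x. c * Phi x) = test_size q A (%x. c * Phi x) + energy p A a + energy p A b"
    by (simp only: add.commute add.left_commute add.assoc)
   from fin[OF h[unfolded this] t bd(1,2)] show ?thesis .
  qed
 qed
qed

lemma triform_diff:
 assumes "tri_admissible A a b Phi" "tri_admissible A a' b' Phi'"
 shows "triform a b Phi - triform a' b' Phi' = triform (%x. a x - a' x) b Phi + triform a' (%x. b x - b' x) Phi + triform a' b' (%x. Phi x - Phi' x)"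
proof -
 obtain V1 V2 V3 V4 where V: "open V1" "closure A \<subseteq> V1" "smooth_on V1 a" "open V2" "closure A \<subseteq> V2" "smooth_on V2 b"
  "open V3" "closure A \<subseteq> V3" "smooth_on V3 a'" "open V4" "closure A \<subseteq> V4" "smooth_on V4 b'"
  using assms by (auto simp: tri_admissible_def smooth_near_def)
 define V where "V = V1 \<inter> V2 \<inter> V3 \<inter> V4"
 have oV: "open V" and AV: "A \<subseteq> V" using V closure_subset[of A] by (auto simp: V_def)
 have s: "smooth_on V a" "smooth_on V a'" "smooth_on V b" "smooth_on V b'" using V by (auto simp: V_def intro: smooth_on_subset)
 have Phi: "Phi \<in> test_functions A" "Phi' \<in> test_functions A" using assms by (auto simp: tri_admissible_def)
 have i: "integrable lborel (%x. bracket f g x * \<Psi> x)" if "smooth_on V f" "smooth_on V g" "\<Psi> \<in> test_functions A" for f g \<Psi>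
  by (rule integral_bracket_by_parts(1)[OF oV test_functionsD(2)[OF that(3)] subset_trans[OF test_functionsD(3)[OF that(3)] AV] that(1,2)
     test_functionsD(1)[OF that(3)] test_functionsD(4)[OF that(3)]])
 have z: "x \<in> V" if "Phi x ~= 0" for x
 proof -
  have "x \<in> closure {x. Phi x ~= 0}" using support_closure_zero[of x Phi] that by blast
  then show ?thesis using test_functionsD(3)[OF Phi(1)] AV by blast
 qed
 have 1: "triform a b Phi - triform a' b Phi = triform (%x. a x - a' x) b Phi"
  unfolding triform_def Bochner_Integration.integral_diff[OF i[OF s(1,3) Phi(1)] i[OF s(2,3) Phi(1)], symmetric]
 proof (intro Bochner_Integration.integral_cong refl)
  fix x show "bracket a b x * Phi x - bracket a' b x * Phi x = bracket (%x. a x - a' x) b x * Phi x"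
   using bracket_diff_left[OF s(1,2) z, of x b] by (cases "Phi x = 0") (simp_all add: left_diff_distrib)
 qed
 have 2: "triform a' b Phi - triform a' b' Phi = triform a' (%x. b x - b' x) Phi"
  unfolding triform_def Bochner_Integration.integral_diff[OF i[OF s(2,3) Phi(1)] i[OF s(2,4) Phi(1)], symmetric]
 proof (intro Bochner_Integration.integral_cong refl)
  fix x show "bracket a' b x * Phi x - bracket a' b' x * Phi x = bracket a' (%x. b x - b' x) x * Phi x"
   using bracket_diff_right[OF s(3,4) z, of x a'] by (cases "Phi x = 0") (simp_all add: left_diff_distrib)
 qed
 have 3: "triform a' b' Phi - triform a' b' Phi' = triform a' b' (%x. Phi x - Phi' x)"
  unfolding triform_def Bochner_Integration.integral_diff[OF i[OF s(2,4) Phi(1)] i[OF s(2,4) Phi(2)], symmetric]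
  by (simp add: right_diff_distrib)
 show ?thesis using 1 2 3 by simp
qed

section \<open>Gagliardo energies\<close>

definition genergy :: "real => (real^2) set => (real^2 => 'b::euclidean_space) => ennreal" where
 "genergy p A f = (NN x. (NN y. indicator A x * indicator A y * (inv4 (x - y) * ennreal (norm (f x - f y) powr p))))"

definition gLp :: "real => (real^2) set => (real^2 => 'b::euclidean_space) => ennreal" where
 "gLp p A f = (NN x. indicator A x * ennreal (norm (f x) powr p))"

lemma genergy_real: "genergy p A (f :: real^2 => real) = energy p A f"
 by (simp add: genergy_def pair_int_def)

lemma gLp_real: "gLp p A (f :: real^2 => real) = Lp_int p A f"
 by (simp add: gLp_def Lp_int_def)

lemma nn_integral_lebesgue_on:
 "A \<in> sets borel ==> (\<integral>\<^sup>+x. h x \<partial>lebesgue_on A) = (NN x. indicator A x * h x)"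
 by (subst nn_integral_restrict_space) (auto simp: nn_integral_completion mult.commute)

text \<open>In the plane the exponent \<open>DIM + s * p\<close> is \<open>4\<close> whenever \<open>s * p = 2\<close>. This covers both the space of the maps and the space of
 the test functions.\<close>

lemma gagliardo_energy_eq:
 fixes f :: "real^2 => 'b::euclidean_space"
 assumes A: "A \<in> sets borel" and sp: "s * p = 2"
 shows "gagliardo_energy A s p f = genergy p A f"
proof -
 have k: "ennreal (norm (f x - f y) powr p / norm (x - y) powr (real DIM(real^2) + s * p)) = inv4 (x - y) * ennreal (norm (f x - f y) powr p)" for x y
 proof (cases "x = y")
  case False
  have "norm (x - y) powr (real DIM(real^2) + s * p) = norm (x - y) ^ 4"
   using False by (simp add: sp powr_numeral[symmetric] del: powr_numeral)
  then show ?thesis by (simp add: inv4_def ennreal_mult[symmetric])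
 qed simp
 have "gagliardo_energy A s p f = (NN x. indicator A x * (NN y. indicator A y * (inv4 (x - y) * ennreal (norm (f x - f y) powr p))))"
  unfolding gagliardo_energy_def k nn_integral_lebesgue_on[OF A] ..
 also have "... = genergy p A f"
  unfolding genergy_def
 proof (intro nn_integral_cong)
  fix x show "indicator A x * (NN y. indicator A y * (inv4 (x - y) * ennreal (norm (f x - f y) powr p))) =
   (NN y. indicator A x * indicator A y * (inv4 (x - y) * ennreal (norm (f x - f y) powr p)))"
   by (cases "x \<in> A") simp_all
 qed
 finally show ?thesis .
qed

lemma genergy_cong_AE:
 assumes "AE x in lborel. x \<in> A --> f x = g x"
 shows "genergy p A f = genergy p A g"
 unfolding genergy_def
proof (rule nn_integral_cong_AE, use assms in eventually_elim)
 fix x assume x: "x \<in> A --> f x = g x"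
 show "(NN y. indicator A x * indicator A y * (inv4 (x - y) * ennreal (norm (f x - f y) powr p))) =
  (NN y. indicator A x * indicator A y * (inv4 (x - y) * ennreal (norm (g x - g y) powr p)))"
 proof (rule nn_integral_cong_AE, use assms in eventually_elim)
  fix y assume "y \<in> A --> f y = g y"
  with x show "indicator A x * indicator A y * (inv4 (x - y) * ennreal (norm (f x - f y) powr p)) =
   indicator A x * indicator A y * (inv4 (x - y) * ennreal (norm (g x - g y) powr p))"
   by (cases "x \<in> A"; cases "y \<in> A") auto
 qed
qed

lemma gLp_cong_AE:
 assumes "AE x in lborel. x \<in> A --> f x = g x"
 shows "gLp p A f = gLp p A g"
 unfolding gLp_def
proof (rule nn_integral_cong_AE, use assms in eventually_elim)
 fix x assume "x \<in> A --> f x = g x"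
 then show "indicator A x * ennreal (norm (f x) powr p) = indicator A x * ennreal (norm (g x) powr p)"
  by (cases "x \<in> A") auto
qed

lemma norm_powr_diff_bound: "p >= 0 ==> norm (a - b) powr p <= 2 powr p * (norm a powr p + norm b powr p)"
proof -
 assume p: "p >= 0"
 have "norm (a - b) powr p <= (norm a + norm b) powr p" using p norm_triangle_ineq4[of a b] by (intro powr_mono2) auto
 also have "... <= 2 powr p * (norm a powr p + norm b powr p)" using powr_diff_bound[OF p, of "norm a" "- norm b"] by simp
 finally show ?thesis .
qed

lemma genergy_diff_le:
 assumes [measurable]: "A \<in> sets borel" "f \<in> Borel" "g \<in> Borel" and p: "p >= 0"
 shows "genergy p A (%x. f x - g x) <= ennreal (2 powr p) * (genergy p A f + genergy p A g)"
proof -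
 have "genergy p A (%x. f x - g x) <= (NN x. (NN y. ennreal (2 powr p) * (indicator A x * indicator A y * (inv4 (x - y) * ennreal (norm (f x - f y) powr p))
   + indicator A x * indicator A y * (inv4 (x - y) * ennreal (norm (g x - g y) powr p)))))"
  unfolding genergy_def
 proof (intro nn_integral_mono)
  fix x y
  have "norm (f x - g x - (f y - g y)) powr p <= 2 powr p * (norm (f x - f y) powr p + norm (g x - g y) powr p)"
   using norm_powr_diff_bound[OF p, of "f x - f y" "g x - g y"] by (simp add: algebra_simps)
  then have "ennreal (norm (f x - g x - (f y - g y)) powr p) <= ennreal (2 powr p) * (ennreal (norm (f x - f y) powr p) + ennreal (norm (g x - g y) powr p))"
   by (auto simp: ennreal_mult[symmetric] ennreal_plus[symmetric] simp del: ennreal_plus intro!: ennreal_leI)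
  from mult_left_mono[OF this, of "indicator A x * indicator A y * inv4 (x - y)"]
  show "indicator A x * indicator A y * (inv4 (x - y) * ennreal (norm (f x - g x - (f y - g y)) powr p)) <=
   ennreal (2 powr p) * (indicator A x * indicator A y * (inv4 (x - y) * ennreal (norm (f x - f y) powr p))
   + indicator A x * indicator A y * (inv4 (x - y) * ennreal (norm (g x - g y) powr p)))"
   by (simp add: distrib_left mult_ac)
 qed
 also have "... = ennreal (2 powr p) * (genergy p A f + genergy p A g)"
  unfolding genergy_def by (simp add: nn_integral_cmult nn_integral_add)
 finally show ?thesis .
qed

lemma gLp_diff_le:
 assumes [measurable]: "A \<in> sets borel" "f \<in> Borel" "g \<in> Borel" and p: "p >= 0"
 shows "gLp p A (%x. f x - g x) <= ennreal (2 powr p) * (gLp p A f + gLp p A g)"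
proof -
 have "gLp p A (%x. f x - g x) <= (NN x. ennreal (2 powr p) * (indicator A x * ennreal (norm (f x) powr p) + indicator A x * ennreal (norm (g x) powr p)))"
  unfolding gLp_def
 proof (intro nn_integral_mono)
  fix x
  have "ennreal (norm (f x - g x) powr p) <= ennreal (2 powr p) * (ennreal (norm (f x) powr p) + ennreal (norm (g x) powr p))"
   using norm_powr_diff_bound[OF p, of "f x" "g x"]
   by (auto simp: ennreal_mult[symmetric] ennreal_plus[symmetric] simp del: ennreal_plus intro!: ennreal_leI)
  then show "indicator A x * ennreal (norm (f x - g x) powr p) <= ennreal (2 powr p) * (indicator A x * ennreal (norm (f x) powr p) + indicator A x * ennreal (norm (g x) powr p))"
   by (cases "x \<in> A") simp_all
 qed
 also have "... = ennreal (2 powr p) * (gLp p A f + gLp p A g)"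
  unfolding gLp_def by (simp add: nn_integral_cmult nn_integral_add)
 finally show ?thesis .
qed

lemma AE_lebesgue_on_iff: "A \<in> sets borel ==> (AE x in lebesgue_on A. P x) \<longleftrightarrow> (AE x in lborel. x \<in> A --> P x)"
 by (subst AE_restrict_space_iff) (auto simp: AE_completion_iff)

lemma borel_representative_real:
 fixes g :: "real^2 => real"
 assumes "g \<in> borel_measurable (lebesgue_on A)" "A \<in> sets borel"
 shows "\<exists>a\<in>Borel. AE x in lborel. x \<in> A --> g x = a x"
proof -
 have "(%x. indicator A x *\<^sub>R g x) \<in> borel_measurable lebesgue"
  using assms by (subst (asm) borel_measurable_restrict_space_iff) auto
 from completion_ex_borel_measurable_real[OF this] obtain a where a: "a \<in> borel_measurable lborel" "AE x in lborel. indicator A x *\<^sub>R g x = a x" by blast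
 have "AE x in lborel. x \<in> A --> g x = a x" using a(2) by eventually_elim auto
 then show ?thesis using a(1) by auto
qed

lemma vec2_eq: "v = v $ 1 *\<^sub>R axis 1 1 + v $ 2 *\<^sub>R axis (2::2) (1::real)"
 by (simp add: vec_eq_iff forall_2 axis_def)

lemma borel_representative_vec:
 fixes g :: "real^2 => real^2"
 assumes "g \<in> borel_measurable (lebesgue_on A)" "A \<in> sets borel"
 shows "\<exists>a\<in>Borel. AE x in lborel. x \<in> A --> g x = a x"
proof -
 have "(%x. g x $ i) \<in> borel_measurable (lebesgue_on A)" for i
  using borel_measurable_continuous_on[OF continuous_on_component[OF continuous_on_id, of UNIV i] assms(1)] by simp
 note rep = borel_representative_real[OF this assms(2)]
 obtain a where a[measurable]: "a \<in> Borel" and a1: "AE x in lborel. x \<in> A --> g x $ 1 = a x"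
  using rep[of 1] by blast
 obtain b where b[measurable]: "b \<in> Borel" and b1: "AE x in lborel. x \<in> A --> g x $ 2 = b x"
  using rep[of 2] by blast
 define h where "h = (%x. a x *\<^sub>R axis 1 1 + b x *\<^sub>R axis (2::2) (1::real))"
 have "h \<in> Borel" unfolding h_def by measurable
 moreover have "AE x in lborel. x \<in> A --> g x = h x"
  using a1 b1
 proof eventually_elim
  case (elim x)
  show ?case unfolding h_def using elim vec2_eq[of "g x"] by metis
 qed
 ultimately show ?thesis by blast
qed

lemma measurable_lebesgue_on_borel: "f \<in> Borel ==> f \<in> borel_measurable (lebesgue_on A)"
 by (rule measurable_restrict_space1) (auto intro: measurable_completion)

lemma WspI:
 fixes f :: "real^2 => 'b::euclidean_space"
 assumes A: "A \<in> sets borel" and sp: "s * p = 2" and [measurable]: "f \<in> Borel" and "genergy p A f < \<infinity>" "gLp p A f < \<infinity>"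
 shows "f \<in> Wsp A s p"
 unfolding Wsp_def
proof (intro CollectI conjI)
 show m: "f \<in> borel_measurable (lebesgue_on A)" by (rule measurable_lebesgue_on_borel) simp
 show "gagliardo_energy A s p f < \<infinity>" using assms by (simp add: gagliardo_energy_eq)
 show "integrable (lebesgue_on A) (%x. norm (f x) powr p)"
  unfolding integrable_iff_bounded
 proof
  show "(%x. norm (f x) powr p) \<in> borel_measurable (lebesgue_on A)" by (rule measurable_lebesgue_on_borel) measurable
  show "(\<integral>\<^sup>+x. ennreal (norm (norm (f x) powr p)) \<partial>lebesgue_on A) < \<infinity>"
   using assms(5) by (simp add: nn_integral_lebesgue_on[OF A] gLp_def)
 qed
qed

lemma Wsp_finite:
 fixes f :: "real^2 => 'b::euclidean_space"
 assumes A: "A \<in> sets borel" and sp: "s * p = 2" and f: "f \<in> Wsp A s p"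
 shows "genergy p A f < \<infinity>" "gLp p A f < \<infinity>"
proof -
 show "genergy p A f < \<infinity>" using f by (simp add: Wsp_def gagliardo_energy_eq[OF A sp])
 have "(\<integral>\<^sup>+x. ennreal (norm (norm (f x) powr p)) \<partial>lebesgue_on A) < \<infinity>"
  using f by (simp add: Wsp_def integrable_iff_bounded)
 then show "gLp p A f < \<infinity>" by (simp add: nn_integral_lebesgue_on[OF A] gLp_def)
qed

lemma LINT_norm_powr:
 assumes A: "A \<in> sets borel" and m: "h \<in> borel_measurable (lebesgue_on A)"
 shows "(LINT x|lebesgue_on A. norm (h x) powr p) = enn2real (gLp p A h)"
proof -
 have m': "(%x. norm (h x) powr p) \<in> borel_measurable (lebesgue_on A)" using m by measurable
 have "(LINT x|lebesgue_on A. norm (h x) powr p) = enn2real (\<integral>\<^sup>+x. ennreal (norm (h x) powr p) \<partial>lebesgue_on A)"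
  by (rule integral_eq_nn_integral[OF m']) simp
 then show ?thesis by (simp add: nn_integral_lebesgue_on[OF A] gLp_def)
qed

lemma Wsp_tendsto_iff:
 fixes F :: "nat => real^2 => 'b::euclidean_space"
 assumes A: "A \<in> sets borel" and sp: "s * p = 2" and p: "p > 0"
  and F: "!!k. F k \<in> Wsp A s p" and f: "f \<in> Wsp A s p"
  and F'[measurable]: "!!k. F' k \<in> Borel" and f'[measurable]: "f' \<in> Borel"
  and eF: "!!k x. x \<in> A ==> F k x = F' k x" and ef: "AE x in lborel. x \<in> A --> f x = f' x"
 shows "Wsp_tendsto A s p F f \<longleftrightarrow>
  (%k. genergy p A (%x. F' k x - f' x)) ----> 0 \<and> (%k. gLp p A (%x. F' k x - f' x)) ----> 0"
proof -
 note A[measurable]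
 have AEd: "AE x in lborel. x \<in> A --> F k x - f x = F' k x - f' x" for k
  using ef by eventually_elim (simp add: eF)
 define E where "E = (%k. genergy p A (%x. F' k x - f' x))"
 define N where "N = (%k. gLp p A (%x. F' k x - f' x))"
 have eFk: "AE x in lborel. x \<in> A --> F k x = F' k x" for k by (simp add: eF)
 have finF: "genergy p A (F' k) < \<infinity>" "gLp p A (F' k) < \<infinity>" for k
  using Wsp_finite[OF A sp F[of k]] genergy_cong_AE[OF eFk[of k], of p] gLp_cong_AE[OF eFk[of k], of p] by auto
 have finf: "genergy p A f' < \<infinity>" "gLp p A f' < \<infinity>"
  using Wsp_finite[OF A sp f] genergy_cong_AE[OF ef, of p] gLp_cong_AE[OF ef, of p] by auto
 have fE: "E k < \<infinity>" for k
  unfolding E_def using p finF(1)[of k] finf(1)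
  by (intro le_less_trans[OF genergy_diff_le]) (auto simp: ennreal_mult_less_top)
 have fN: "N k < \<infinity>" for k
  unfolding N_def using p finF(2)[of k] finf(2)
  by (intro le_less_trans[OF gLp_diff_le]) (auto simp: ennreal_mult_less_top)
 have mF: "F k \<in> borel_measurable (lebesgue_on A)" "f \<in> borel_measurable (lebesgue_on A)" for k
  using F f by (auto simp: Wsp_def)
 have nrm: "Wsp_norm A s p (%x. F k x - f x) = enn2real (N k) powr (1 / p) + enn2real (E k) powr (1 / p)" for k
 proof -
  have "(%x. F k x - f x) \<in> borel_measurable (lebesgue_on A)" using mF(1)[of k] mF(2) by measurable
  then show ?thesis
   unfolding Wsp_norm_def by (simp add: LINT_norm_powr[OF A] gagliardo_energy_eq[OF A sp] genergy_cong_AE[OF AEd] gLp_cong_AE[OF AEd] E_def N_def)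
 qed
 have conv: "(%k. X k) ----> 0 \<longleftrightarrow> (%k. enn2real (X k) powr (1 / p)) ----> 0" if fin: "!!k. X k < \<infinity>" for X :: "nat => ennreal"
 proof
  assume "X ----> 0"
  then have "(%k. enn2real (X k)) ----> 0" by (intro tendsto_enn2real[where l = 0]) auto
  then show "(%k. enn2real (X k) powr (1 / p)) ----> 0" using p by (intro tendsto_zero_powrI[where b = "1 / p"]) auto
 next
  assume h: "(%k. enn2real (X k) powr (1 / p)) ----> 0"
  have "(%k. (enn2real (X k) powr (1 / p)) powr p) ----> 0"
   by (rule tendsto_zero_powrI[OF h tendsto_const]) (use p in auto)
  then have "(%k. enn2real (X k)) ----> 0" using p by (simp add: powr_powr)
  then have "(%k. ennreal (enn2real (X k))) ----> ennreal 0" by (rule tendsto_ennrealI)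
  then show "X ----> 0" using fin by (simp add: less_top)
 qed
 have sum0: "(%k. a k + b k) ----> 0 \<longleftrightarrow> a ----> 0 \<and> b ----> 0" if "!!k. a k >= 0" "!!k. b k >= 0" for a b :: "nat => real"
 proof
  assume h: "(%k. a k + b k) ----> 0"
  have "a ----> 0" by (rule tendsto_sandwich[OF _ _ tendsto_const h]) (use that in auto)
  moreover have "b ----> 0" by (rule tendsto_sandwich[OF _ _ tendsto_const h]) (use that in auto)
  ultimately show "a ----> 0 \<and> b ----> 0" ..
 qed (auto intro: tendsto_add_zero)
 show ?thesis
  unfolding Wsp_tendsto_def nrm E_def[symmetric] N_def[symmetric]
  using F f conv[of E, OF fE] conv[of N, OF fN] sum0[of "%k. enn2real (N k) powr (1 / p)" "%k. enn2real (E k) powr (1 / p)"]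
  by auto
qed

lemma genergy_component_le: "p >= 0 ==> energy p A (%x. f x $ i) <= genergy p A (f :: real^2 => real^2)"
 unfolding genergy_def pair_int_def
proof (intro nn_integral_mono mult_left_mono ennreal_leI powr_mono2)
 fix x y show "\<bar>f x $ i - f y $ i\<bar> <= norm (f x - f y)" using component_le_norm_cart[of "f x - f y" i] by simp
qed auto

lemma gLp_component_le: "p >= 0 ==> Lp_int p A (%x. f x $ i) <= gLp p A (f :: real^2 => real^2)"
 unfolding gLp_def Lp_int_def
proof (intro nn_integral_mono mult_left_mono ennreal_leI powr_mono2)
 fix x show "\<bar>f x $ i\<bar> <= norm (f x)" using component_le_norm_cart[of "f x" i] by simp
qed auto

lemma norm_vec2_powr: "p >= 0 ==> norm (v :: real^2) powr p <= 2 powr p * (\<bar>v $ 1\<bar> powr p + \<bar>v $ 2\<bar> powr p)"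
proof -
 assume p: "p >= 0"
 have "norm v <= \<bar>v $ 1\<bar> + \<bar>v $ 2\<bar>" using norm_le_l1_cart[of v] by (simp add: sum_2)
 then have "norm v powr p <= (\<bar>v $ 1\<bar> + \<bar>v $ 2\<bar>) powr p" using p by (intro powr_mono2) auto
 also have "... <= 2 powr p * (\<bar>v $ 1\<bar> powr p + \<bar>v $ 2\<bar> powr p)" using powr_diff_bound[OF p, of "\<bar>v $ 1\<bar>" "- \<bar>v $ 2\<bar>"] by simp
 finally show ?thesis .
qed

lemma genergy_le_components:
 fixes f :: "real^2 => real^2"
 assumes [measurable]: "A \<in> sets borel" "!!i. (%x. f x $ i) \<in> Borel" and p: "p >= 0"
 shows "genergy p A f <= ennreal (2 powr p) * (energy p A (%x. f x $ 1) + energy p A (%x. f x $ 2))"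
proof -
 have "genergy p A f <= (NN x. (NN y. ennreal (2 powr p) * (indicator A x * indicator A y * (inv4 (x - y) * epow p (f x $ 1 - f y $ 1))
   + indicator A x * indicator A y * (inv4 (x - y) * epow p (f x $ 2 - f y $ 2)))))"
  unfolding genergy_def
 proof (intro nn_integral_mono)
  fix x y
  have "ennreal (norm (f x - f y) powr p) <= ennreal (2 powr p) * (epow p (f x $ 1 - f y $ 1) + epow p (f x $ 2 - f y $ 2))"
   using norm_vec2_powr[OF p, of "f x - f y"]
   by (auto simp: ennreal_mult[symmetric] ennreal_plus[symmetric] simp del: ennreal_plus intro!: ennreal_leI)
  from mult_left_mono[OF this, of "indicator A x * indicator A y * inv4 (x - y)"]
  show "indicator A x * indicator A y * (inv4 (x - y) * ennreal (norm (f x - f y) powr p)) <=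
   ennreal (2 powr p) * (indicator A x * indicator A y * (inv4 (x - y) * epow p (f x $ 1 - f y $ 1))
   + indicator A x * indicator A y * (inv4 (x - y) * epow p (f x $ 2 - f y $ 2)))"
   by (simp add: distrib_left mult_ac)
 qed
 also have "... = ennreal (2 powr p) * (energy p A (%x. f x $ 1) + energy p A (%x. f x $ 2))"
  unfolding pair_int_def by (simp add: nn_integral_cmult nn_integral_add)
 finally show ?thesis .
qed

lemma gLp_le_components:
 fixes f :: "real^2 => real^2"
 assumes [measurable]: "A \<in> sets borel" "!!i. (%x. f x $ i) \<in> Borel" and p: "p >= 0"
 shows "gLp p A f <= ennreal (2 powr p) * (Lp_int p A (%x. f x $ 1) + Lp_int p A (%x. f x $ 2))"
proof -
 have "gLp p A f <= (NN x. ennreal (2 powr p) * (indicator A x * epow p (f x $ 1) + indicator A x * epow p (f x $ 2)))"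
  unfolding gLp_def
 proof (intro nn_integral_mono)
  fix x
  have "ennreal (norm (f x) powr p) <= ennreal (2 powr p) * (epow p (f x $ 1) + epow p (f x $ 2))"
   using norm_vec2_powr[OF p, of "f x"]
   by (auto simp: ennreal_mult[symmetric] ennreal_plus[symmetric] simp del: ennreal_plus intro!: ennreal_leI)
  then show "indicator A x * ennreal (norm (f x) powr p) <= ennreal (2 powr p) * (indicator A x * epow p (f x $ 1) + indicator A x * epow p (f x $ 2))"
   by (cases "x \<in> A") simp_all
 qed
 also have "... = ennreal (2 powr p) * (Lp_int p A (%x. f x $ 1) + Lp_int p A (%x. f x $ 2))"
  unfolding Lp_int_def by (simp add: nn_integral_cmult nn_integral_add)
 finally show ?thesis .
qed

lemma lipschitz_energy_finite:
 fixes f :: "real^2 => real"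
 assumes A[measurable]: "A \<in> sets borel" and bA: "bounded A" and p: "p > 2" and L: "L >= 0"
  and lip: "!!x y. x \<in> A ==> y \<in> A ==> \<bar>f x - f y\<bar> <= L * norm (x - y)"
 shows "energy p A f < \<infinity>"
proof -
 obtain R0 where R0: "!!x. x \<in> A ==> norm x <= R0" using bA bounded_iff by metis
 define R where "R = 2 * max R0 0 + 1"
 have R: "R > 0" by (simp add: R_def)
 have nearA: "norm (x - y) < R" if "x \<in> A" "y \<in> A" for x y
  using norm_triangle_ineq4[of x y] R0[OF that(1)] R0[OF that(2)] by (simp add: R_def max_def split: if_splits)
 have fin: "emeasure lborel A < \<infinity>" using bA by (intro emeasure_bounded_finite)
 have "energy p A f <= (NN x. (NN y. (ennreal (L powr p) * indicator A x) * (near R (x - y) * (inv4 (x - y) * ennreal (norm (x - y) powr p)))))"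
  unfolding pair_int_def
 proof (intro nn_integral_mono)
  fix x y
  show "indicator A x * indicator A y * (inv4 (x - y) * epow p (f x - f y)) <= (ennreal (L powr p) * indicator A x) * (near R (x - y) * (inv4 (x - y) * ennreal (norm (x - y) powr p)))"
  proof (cases "x \<in> A \<and> y \<in> A")
   case True
   have "\<bar>f x - f y\<bar> powr p <= (L * norm (x - y)) powr p" using lip True p by (intro powr_mono2) auto
   also have "... = L powr p * norm (x - y) powr p" using L by (simp add: powr_mult)
   finally have "epow p (f x - f y) <= ennreal (L powr p) * ennreal (norm (x - y) powr p)"
    by (simp add: ennreal_mult[symmetric] ennreal_leI)
   from mult_left_mono[OF this, of "inv4 (x - y)"] show ?thesis using True nearA[of x y] by (simp add: near_def mult_ac)
  qed auto
 qed
 also have "... = (ennreal (L powr p) * emeasure lborel A) * (NN u. near R u * (inv4 u * ennreal (norm u powr p)))"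
 proof -
  have "(NN y. (near R (x - y) * (inv4 (x - y) * ennreal (norm (x - y) powr p)))) = (NN u. near R u * (inv4 u * ennreal (norm u powr p)))" for x
   by (rule nn_integral_lborel_diff) measurable
  then show ?thesis by (simp add: nn_integral_cmult nn_integral_multc nn_integral_cmult_indicator)
 qed
 also have "... <= (ennreal (L powr p) * emeasure lborel A) * ennreal (4 * pi / (1 - 2 powr (2 - p)) * R powr (p - 2))"
  by (intro mult_left_mono nn_integral_near_power p R) auto
 also have "... < \<infinity>" using fin by (simp add: ennreal_mult_less_top)
 finally show ?thesis .
qed

lemma bounded_Lp_finite:
 assumes A[measurable]: "A \<in> sets borel" and bA: "bounded A" and "p >= 0" and B: "!!x. x \<in> A ==> \<bar>f x\<bar> <= B"
 shows "Lp_int p A f < \<infinity>"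
proof -
 have "Lp_int p A f <= (NN x. epow p B * indicator A x)"
  unfolding Lp_int_def
 proof (intro nn_integral_mono)
  fix x show "indicator A x * epow p (f x) <= epow p B * indicator A x"
   using B[of x] assms(3) by (cases "x \<in> A") (auto intro!: ennreal_leI powr_mono2)
 qed
 also have "... = epow p B * emeasure lborel A" by (rule nn_integral_cmult_indicator) simp
 also have "... < \<infinity>" using emeasure_bounded_finite[OF bA] by (simp add: ennreal_mult_less_top)
 finally show ?thesis .
qed

lemma test_function_finite:
 assumes A: "A \<in> sets borel" and bA: "bounded A" and p: "p > 2" and Phi: "Phi \<in> test_functions A"
 shows "energy p A Phi < \<infinity>" "Lp_int p A Phi < \<infinity>"
proof -
 note t = test_functionsD[OF Phi]
 obtain L where L: "L >= 0" "!!x y. norm (Phi x - Phi y) <= L * norm (x - y)"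
  by (rule smooth_compact_support_Lipschitz[OF t(1,2) support_closure_zero[of _ Phi]], assumption, rule that)
 show "energy p A Phi < \<infinity>" by (rule lipschitz_energy_finite[OF A bA p L(1)]) (use L(2) in simp)
 obtain B where "!!x. \<bar>Phi x\<bar> <= B" using t(6) by blast
 then show "Lp_int p A Phi < \<infinity>" using p by (intro bounded_Lp_finite[OF A bA]) auto
qed

lemma pair_int_add_le:
 assumes "w \<in> Borel" "A \<in> sets borel" "f \<in> Borel" "g \<in> Borel" "p >= 0"
 shows "pair_int w p A (%x. f x + g x) <= ennreal (2 powr p) * (pair_int w p A f + pair_int w p A g)"
proof -
 have "pair_int w p A (%x. - g x) = pair_int w p A g"
  unfolding pair_int_def by (simp add: abs_minus_commute)
 then show ?thesis using pair_int_diff[OF assms(1-3), of "%x. - g x" p] assms(4,5) by simp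
qed

lemma ennreal_bound_powr2:
 assumes "X <= ennreal x" "Y <= ennreal y" "x >= 0" "y >= 0"
 shows "ennreal (2 powr p) * (X + Y) <= ennreal (2 powr p * (x + y))"
proof -
 have "ennreal (2 powr p) * (X + Y) <= ennreal (2 powr p) * (ennreal x + ennreal y)"
  by (intro mult_left_mono add_mono assms) simp
 also have "... = ennreal (2 powr p) * ennreal (x + y)" using assms by (subst ennreal_plus) auto
 also have "... = ennreal (2 powr p * (x + y))" using assms by (intro ennreal_mult[symmetric]) auto
 finally show ?thesis .
qed

lemma test_size_diff_le:
 assumes "A \<in> sets borel" "f \<in> Borel" "g \<in> Borel" "q >= 0"
 shows "test_size q A (%x. f x - g x) <= ennreal (2 powr q) * (test_size q A f + test_size q A g)"
proof -
 have "test_size q A (%x. f x - g x) <= ennreal (2 powr q) * (energy q A f + energy q A g) + ennreal (2 powr q) * (Lp_int q A f + Lp_int q A g)"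
  using gLp_diff_le[OF assms] by (intro add_mono pair_int_diff assms inv4_borel) (simp add: gLp_real)
 also have "... = ennreal (2 powr q) * (test_size q A f + test_size q A g)" by (simp add: distrib_left add_ac)
 finally show ?thesis .
qed

lemma triform_cauchy:
 assumes pl: "plump A kappa0 t0" and oA: "open A" and bA: "bounded A" and p: "p > 2" and q: "q > 2" and pq: "2 / p + 1 / q = 1"
  and m: "a \<in> Borel" "b \<in> Borel" "phi \<in> Borel"
  and fin: "energy p A a < \<infinity>" "energy p A b < \<infinity>" "test_size q A phi < \<infinity>" and \<eta>: "\<eta> > 0"
 obtains eps where "eps > 0"
  "!!u v Phi u' v' Phi'. tri_admissible A u v Phi ==> tri_admissible A u' v' Phi' ==>
   energy p A (%x. u x - a x) <= ennreal eps ==> energy p A (%x. u' x - a x) <= ennreal eps ==>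
   energy p A (%x. v x - b x) <= ennreal eps ==> energy p A (%x. v' x - b x) <= ennreal eps ==>
   test_size q A (%x. Phi x - phi x) <= ennreal eps ==> test_size q A (%x. Phi' x - phi x) <= ennreal eps ==>
   \<bar>triform u v Phi - triform u' v' Phi'\<bar> <= \<eta>"
proof -
 have A: "A \<in> sets borel" using oA by simp
 have p0: "p >= 0" and q0: "q >= 0" using p q by auto
 obtain Ba where Ba: "Ba >= 0" "energy p A a = ennreal Ba" using fin(1) by (cases "energy p A a") auto
 obtain Bb where Bb: "Bb >= 0" "energy p A b = ennreal Bb" using fin(2) by (cases "energy p A b") auto
 obtain Bf where Bf: "Bf >= 0" "test_size q A phi = ennreal Bf" using fin(3) by (cases "test_size q A phi") auto
 define P where "P = 2 powr p + 2 powr q"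
 have P: "P > 0" "2 powr p <= P" "2 powr q <= P" by (auto simp: P_def add_pos_pos)
 (* All functions that occur below have size at most B. *)
 define B where "B = P * (1 + Ba + Bb + Bf) + 1"
 have B: "B >= 1" using P Ba Bb Bf by (simp add: B_def)
 obtain \<delta> where \<delta>: "\<delta> > 0"
  "!!a b Phi. tri_admissible A a b Phi ==> energy p A a <= ennreal B ==> energy p A b <= ennreal B ==> test_size q A Phi <= ennreal B ==>
   energy p A a <= ennreal \<delta> \<or> energy p A b <= ennreal \<delta> \<or> test_size q A Phi <= ennreal \<delta> ==> \<bar>triform a b Phi\<bar> <= \<eta> / 3"
 proof (rule triform_small[OF pl oA bA p q pq])
  show "B >= 0" "\<eta> / 3 > 0" using B \<eta> by auto
 qed (rule that)
 define eps where "eps = min 1 (min \<delta> 1 / (2 * P))"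
 have eps: "eps > 0" "eps <= 1" using \<delta>(1) P by (auto simp: eps_def)
 have "eps <= min \<delta> 1 / (2 * P)" unfolding eps_def by simp
 then have Peps: "P * (eps + eps) <= min \<delta> 1" using P by (simp add: pos_le_divide_eq algebra_simps)
 have small: "2 powr r * (eps + eps) <= \<delta>" "2 powr r * (eps + eps) <= B" if "2 powr r <= P" for r
 proof -
  have "2 powr r * (eps + eps) <= P * (eps + eps)" using that eps by (intro mult_right_mono) auto
  then show "2 powr r * (eps + eps) <= \<delta>" "2 powr r * (eps + eps) <= B" using Peps B by auto
 qed
 have bigB: "2 powr r * (eps + x) <= B" if "2 powr r <= P" "x = Ba \<or> x = Bb \<or> x = Bf" for r x
 proof -
  have "2 powr r * (eps + x) <= P * (1 + Ba + Bb + Bf)" using that eps Ba Bb Bf P by (intro mult_mono) auto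
  then show ?thesis by (simp add: B_def)
 qed
 have Esmall: "energy p A (%x. u x - u' x) <= ennreal \<delta>" "energy p A (%x. u x - u' x) <= ennreal B"
  if "u \<in> Borel" "u' \<in> Borel" "c \<in> Borel"
   "energy p A (%x. u x - c x) <= ennreal eps" "energy p A (%x. u' x - c x) <= ennreal eps" for u u' c
 proof -
  have "energy p A (%x. (u x - c x) - (u' x - c x)) <= ennreal (2 powr p) * (energy p A (%x. u x - c x) + energy p A (%x. u' x - c x))"
   by (rule pair_int_diff) (use that A p0 in auto)
  also have "... <= ennreal (2 powr p * (eps + eps))" using that eps by (intro ennreal_bound_powr2) auto
  finally have "energy p A (%x. u x - u' x) <= ennreal (2 powr p * (eps + eps))" by simp
  then show "energy p A (%x. u x - u' x) <= ennreal \<delta>" "energy p A (%x. u x - u' x) <= ennreal B"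
   using small[OF P(2)] by (auto elim!: order_trans intro!: ennreal_leI)
 qed
 have Ebig: "energy p A u <= ennreal B"
  if "u \<in> Borel" "c \<in> Borel" "energy p A (%x. u x - c x) <= ennreal eps" "energy p A c <= ennreal x" "x = Ba \<or> x = Bb" for u c x
 proof -
  have x: "x >= 0" using that(5) Ba Bb by auto
  have "energy p A (%x. (u x - c x) + c x) <= ennreal (2 powr p) * (energy p A (%x. u x - c x) + energy p A c)"
   by (rule pair_int_add_le) (use that A p0 in auto)
  also have "... <= ennreal (2 powr p * (eps + x))" using that eps x by (intro ennreal_bound_powr2) auto
  also have "... <= ennreal B" using bigB[OF P(2), of x] that(5) by (intro ennreal_leI) auto
  finally show ?thesis by simp
 qed
 show ?thesis
 proof (rule that[OF eps(1)])
  fix u v Phi u' v' Phi'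
  assume adm: "tri_admissible A u v Phi" "tri_admissible A u' v' Phi'"
   and e: "energy p A (%x. u x - a x) <= ennreal eps" "energy p A (%x. u' x - a x) <= ennreal eps"
    "energy p A (%x. v x - b x) <= ennreal eps" "energy p A (%x. v' x - b x) <= ennreal eps"
    "test_size q A (%x. Phi x - phi x) <= ennreal eps" "test_size q A (%x. Phi' x - phi x) <= ennreal eps"
  have ad: "smooth_near A u" "smooth_near A v" "smooth_near A u'" "smooth_near A v'" "Phi \<in> test_functions A" "Phi' \<in> test_functions A"
   using adm by (auto simp: tri_admissible_def)
  note mm = ad(1-4)[unfolded smooth_near_def, THEN conjunct1] test_functionsD(5)[OF ad(5)] test_functionsD(5)[OF ad(6)]
  have B1: "energy p A v <= ennreal B" by (rule Ebig[OF mm(2) m(2) e(3), of Bb]) (use Bb in auto)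
  have B2: "energy p A u' <= ennreal B" by (rule Ebig[OF mm(3) m(1) e(2), of Ba]) (use Ba in auto)
  have B3: "energy p A v' <= ennreal B" by (rule Ebig[OF mm(4) m(2) e(4), of Bb]) (use Bb in auto)
  have B4: "test_size q A Phi <= ennreal B"
  proof -
   have "test_size q A (%x. (Phi x - phi x) - (- phi x)) <= ennreal (2 powr q) * (test_size q A (%x. Phi x - phi x) + test_size q A (%x. - phi x))"
    by (rule test_size_diff_le) (use mm m A q0 in auto)
   also have "test_size q A (%x. - phi x) = test_size q A phi"
    unfolding pair_int_def Lp_int_def by (simp add: abs_minus_commute)
   also have "ennreal (2 powr q) * (test_size q A (%x. Phi x - phi x) + test_size q A phi) <= ennreal (2 powr q * (eps + Bf))"
    using e(5) eps Bf by (intro ennreal_bound_powr2) auto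
   also have "... <= ennreal B" using bigB[OF P(3), of Bf] by (intro ennreal_leI) auto
   finally show ?thesis by simp
  qed
  have D3: "test_size q A (%x. Phi x - Phi' x) <= ennreal (2 powr q * (eps + eps))"
  proof -
   have "test_size q A (%x. (Phi x - phi x) - (Phi' x - phi x)) <= ennreal (2 powr q) * (test_size q A (%x. Phi x - phi x) + test_size q A (%x. Phi' x - phi x))"
    by (rule test_size_diff_le) (use mm m A q0 in auto)
   also have "... <= ennreal (2 powr q * (eps + eps))" using e(5,6) eps by (intro ennreal_bound_powr2) auto
   finally show ?thesis by simp
  qed
  have D3a: "test_size q A (%x. Phi x - Phi' x) <= ennreal \<delta>" by (rule order_trans[OF D3 ennreal_leI[OF small(1)[OF P(3)]]])
  have D3b: "test_size q A (%x. Phi x - Phi' x) <= ennreal B" by (rule order_trans[OF D3 ennreal_leI[OF small(2)[OF P(3)]]])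
  note D1 = Esmall[OF mm(1,3) m(1) e(1,2)] and D2 = Esmall[OF mm(2,4) m(2) e(3,4)]
  have T1: "\<bar>triform (%x. u x - u' x) v Phi\<bar> <= \<eta> / 3"
   by (rule \<delta>(2)[OF _ D1(2) B1 B4 disjI1[OF D1(1)]]) (unfold tri_admissible_def, intro conjI smooth_near_diff ad)
  have T2: "\<bar>triform u' (%x. v x - v' x) Phi\<bar> <= \<eta> / 3"
   by (rule \<delta>(2)[OF _ B2 D2(2) B4 disjI2[OF disjI1[OF D2(1)]]]) (unfold tri_admissible_def, intro conjI smooth_near_diff ad)
  have T3: "\<bar>triform u' v' (%x. Phi x - Phi' x)\<bar> <= \<eta> / 3"
   by (rule \<delta>(2)[OF _ B2 B3 D3b disjI2[OF disjI2[OF D3a]]]) (unfold tri_admissible_def, intro conjI test_functions_diff ad)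
  show "\<bar>triform u v Phi - triform u' v' Phi'\<bar> <= \<eta>"
   unfolding triform_diff[OF adm] using T1 T2 T3 by linarith
 qed
qed

section \<open>The distributional Jacobian\<close>

text \<open>Cut off outside \<open>U\<close> because nothing is known there about the measurability of \<open>F\<close>.\<close>

definition component :: "(real^2) set => 2 => (real^2 => real^2) => real^2 => real" where
 "component U i F x = (if x \<in> U then F x $ i else 0)"

lemma smooth_near_component:
 assumes "open U" "closure A \<subseteq> U" "smooth_on U F"
 shows "smooth_near A (component U i F)"
proof -
 have s: "smooth_on U (%x. F x $ i)" by (rule smooth_on_bounded_linear[OF bounded_linear_vec_nth assms(1,3)])
 have "(%x. indicator U x *\<^sub>R (F x $ i)) \<in> Borel"
  by (rule borel_measurable_continuous_on_indicator[OF _ smooth_on_continuous[OF s]]) (use assms in auto)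
 moreover have "(%x. indicator U x *\<^sub>R (F x $ i)) = component U i F" by (auto simp: component_def fun_eq_iff)
 ultimately have "component U i F \<in> Borel" by simp
 moreover have "smooth_on U (component U i F)"
  by (rule smooth_on_cong[OF s assms(1)]) (simp add: component_def)
 ultimately show ?thesis using assms unfolding smooth_near_def by blast
qed

lemma pderiv_component:
 assumes "open U" "smooth_on U F" "x \<in> U"
 shows "pderiv_at j (component U i F) x = fder F x (axis j 1) $ i"
proof -
 have "(F has_derivative fder F x) (at x)" by (rule smooth_on_has_derivative[OF assms(2,3)])
 then have "((%x. F x $ i) has_derivative (%v. fder F x v $ i)) (at x)"
  by (rule bounded_linear.has_derivative[OF bounded_linear_vec_nth])
 then have "(component U i F has_derivative (%v. fder F x v $ i)) (at x)"
  by (rule has_derivative_transform_within_open[OF _ assms(1,3)]) (simp add: component_def)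
 then show ?thesis by (rule pderiv_at_eq)
qed

lemma LINT_lebesgue_on:
 fixes g :: "real^2 => real"
 assumes A: "A \<in> sets borel" and m: "g' \<in> Borel" and eq: "!!x. x \<in> A ==> g x = g' x" and z: "!!x. x \<notin> A ==> g' x = 0"
 shows "(LINT x|lebesgue_on A. g x) = (LBINT x. g' x)"
proof -
 have "(LINT x|lebesgue_on A. g x) = (LINT x|lebesgue. indicator A x *\<^sub>R g x)"
  by (rule integral_restrict_space) (use A in auto)
 also have "... = (LINT x|lebesgue. g' x)"
  using eq z by (intro Bochner_Integration.integral_cong refl) (auto simp: indicator_def)
 also have "... = (LBINT x. g' x)" by (rule integral_completion) (use m in simp)
 finally show ?thesis .
qed

lemma det_triform:
 assumes U: "open U" "closure A \<subseteq> U" "smooth_on U F" and Phi: "Phi \<in> test_functions A" and A: "A \<in> sets borel"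
 shows "(LINT x|lebesgue_on A. det (jacobian F (at x)) * Phi x) = triform (component U 1 F) (component U 2 F) Phi"
 unfolding triform_def
proof (rule LINT_lebesgue_on[OF A])
 note t = test_functionsD[OF Phi]
 have AU: "A \<subseteq> U" using U closure_subset[of A] by auto
 have s: "smooth_on U (component U i F)" for i
  by (rule smooth_on_cong[OF smooth_on_bounded_linear[OF bounded_linear_vec_nth U(1,3)] U(1)]) (simp add: component_def)
 have "integrable lborel (%x. bracket (component U 1 F) (component U 2 F) x * Phi x)"
  by (rule integral_bracket_by_parts(1)[OF U(1) t(2) _ s s t(1) support_closure_zero[of _ Phi]]) (use t(3) AU in auto)
 then show "(%x. bracket (component U 1 F) (component U 2 F) x * Phi x) \<in> Borel"
  using borel_measurable_integrable by force
 show "det (jacobian F (at x)) * Phi x = bracket (component U 1 F) (component U 2 F) x * Phi x" if "x \<in> A" for x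
  using that AU
  by (simp add: subset_iff bracket_def pderiv_component[OF U(1,3)] det_2 jacobian_def matrix_def)
 show "bracket (component U 1 F) (component U 2 F) x * Phi x = 0" if "x \<notin> A" for x
  using that t(3) support_closure_zero[of x Phi] by auto
qed

lemma Lp_finite_integrable:
 assumes A[measurable]: "A \<in> sets borel" and bA: "bounded A" and a[measurable]: "a \<in> Borel" and p: "p >= 1" and fin: "Lp_int p A a < \<infinity>"
 shows "integrable lborel (%z. indicator A z * a z)"
proof (rule integrableI_bounded)
 have "(%z. indicator A z * a z) \<in> Borel" by measurable
 then show "(%z. indicator A z * a z) \<in> borel_measurable lborel" by simp
 have "(NN z. ennreal (norm (indicator A z * a z))) <= (NN z. indicator A z + indicator A z * epow p (a z))"
 proof (intro nn_integral_mono)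
  fix z
  have "\<bar>a z\<bar> <= 1 + \<bar>a z\<bar> powr p" using powr_young[of "\<bar>a z\<bar>" 1 p] p by simp
  then have "ennreal \<bar>a z\<bar> <= 1 + epow p (a z)"
   by (metis ennreal_1 ennreal_leI ennreal_plus powr_ge_zero zero_le_one)
  then show "ennreal (norm (indicator A z * a z)) <= indicator A z + indicator A z * epow p (a z)"
   by (cases "z \<in> A") simp_all
 qed
 also have "... = emeasure lborel A + Lp_int p A a" unfolding Lp_int_def by (simp add: nn_integral_add)
 also have "... < \<infinity>" using fin emeasure_bounded_finite[OF bA] by simp
 finally show "(NN z. ennreal (norm (indicator A z * a z))) < \<infinity>" .
qed

lemma ennreal_tendsto_zero_le:
 fixes X Y :: "nat => ennreal"
 assumes "!!k. X k <= ennreal c * Y k" "Y ----> 0"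
 shows "X ----> 0"
proof (rule tendsto_sandwich[OF _ _ tendsto_const])
 have "(%k. ennreal c * Y k) ----> ennreal c * 0" by (rule ennreal_tendsto_cmult) (use assms in auto)
 then show "(%k. ennreal c * Y k) ----> 0" by simp
qed (use assms in auto)

lemma smooth_approximation:
 fixes f :: "real^2 => real^2"
 assumes pl: "plump Om kappa t0" and o: "open Om" and bd: "bounded Om" and sp: "s * p = 2" and p: "p > 2" and f: "f \<in> Wsp Om s p"
 shows "\<exists>F. (\<forall>k. F k \<in> smooth_closure Om) \<and> Wsp_tendsto Om s p F f"
proof -
 have A[measurable]: "Om \<in> sets borel" using o by simp
 have kappa: "kappa > 0" and t0: "t0 > 0" using pl by (auto simp: plump_def)
 have p0: "p >= 0" and p1: "p >= 1" using p by auto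
 obtain f' where f'[measurable]: "f' \<in> Borel" and ff: "AE x in lborel. x \<in> Om --> f x = f' x"
  using borel_representative_vec[of f Om] f A by (auto simp: Wsp_def)
 have finf: "genergy p Om f' < \<infinity>" "gLp p Om f' < \<infinity>"
  using Wsp_finite[OF A sp f] genergy_cong_AE[OF ff, of p] gLp_cong_AE[OF ff, of p] by auto
 define a where "a = (%i x. f' x $ i)"
 have am[measurable]: "a i \<in> Borel" for i
  unfolding a_def using borel_measurable_continuous_on[OF continuous_on_component[OF continuous_on_id, of UNIV i] f'] by simp
 have ea: "energy p Om (a i) < \<infinity>" "Lp_int p Om (a i) < \<infinity>" for i
  using finf genergy_component_le[OF p0, of Om f' i] gLp_component_le[OF p0, of Om f' i] by (auto simp: a_def order_le_less_trans)
 have la: "locally_integrable (%z. indicator Om z * a i z)" for i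
  by (rule integrable_locally_integrable[OF Lp_finite_integrable[OF A bd am p1 ea(2)]])
 show ?thesis
 proof (rule mollify_approximation[OF kappa p], goal_cases)
 case C: (1 C)
 define r where "r = (%k. t0 * (1 / real (Suc k)))"
 have r: "0 < r k" "r k <= t0" "r k / 4 <= t0" for k
 proof -
  show 1: "0 < r k" using t0 by (simp add: r_def)
  show 2: "r k <= t0" using t0 by (simp add: r_def divide_le_eq)
  show "r k / 4 <= t0" using 1 2 by simp
 qed
 have r0: "(%k. 6 * r k) ----> 0"
  unfolding r_def by (intro tendsto_mult_right_zero LIMSEQ_inverse_real_of_nat[unfolded inverse_eq_divide])
 define G where "G = (%k i. mollify Om (r k) (a i))"
 have Gm[measurable]: "G k i \<in> Borel" for k i unfolding G_def by (rule mollify_borel[OF r(1) A la])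
 have en: "energy p Om (%x. G k i x - a i x) <= ennreal C * energy_near (6 * r k) p Om (a i)" for k i
  unfolding G_def by (rule C(3)[OF pl r(1,3) am la])
 have ln: "Lp_int p Om (%x. G k i x - a i x) <= ennreal (C * t0^2) * energy_near (6 * r k) p Om (a i)" for k i
 proof -
  have "Lp_int p Om (%x. G k i x - a i x) <= ennreal (C * r k^2) * energy_near (6 * r k) p Om (a i)"
   unfolding G_def by (rule C(2)[OF pl r(1,3) am la])
  also have "... <= ennreal (C * t0^2) * energy_near (6 * r k) p Om (a i)"
   using C(1) r[of k] by (intro mult_right_mono ennreal_leI mult_left_mono power_mono) auto
  finally show ?thesis .
 qed
 have e0: "(%k. energy_near (6 * r k) p Om (a i)) ----> 0" for i
  by (rule energy_near_tendsto_0[OF A am ea(1) r0])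
 have en0: "(%k. energy p Om (%x. G k i x - a i x)) ----> 0" "(%k. Lp_int p Om (%x. G k i x - a i x)) ----> 0" for i
  by (rule ennreal_tendsto_zero_le[OF en e0], rule ennreal_tendsto_zero_le[OF ln e0])
 define F where "F = (%k x. G k 1 x *\<^sub>R axis 1 1 + G k 2 x *\<^sub>R axis (2::2) (1::real))"
 have Fi: "F k x $ i = G k i x" for k x i
  using exhaust_2[of i] by (auto simp: F_def axis_def)
 have Fm[measurable]: "F k \<in> Borel" for k unfolding F_def by measurable
 have sc: "F k \<in> smooth_closure Om" for k
 proof -
  define U where "U = {x. mollifier_mass Om (r k) x ~= 0}"
  have U: "open U" unfolding U_def by (rule smooth_on_mollify_mass(1)[OF r(1) A la])
  have sG: "smooth_on U (G k i)" for i unfolding G_def U_def by (rule smooth_on_mollify_mass(2)[OF r(1) A la])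
  have "smooth_on U (F k)"
   unfolding F_def by (intro smooth_on_add[OF U] smooth_on_bounded_linear[OF bounded_linear_scaleR_left U sG])
  moreover have "closure Om \<subseteq> U"
  proof
   fix x assume "x \<in> closure Om"
   then obtain y where y: "y \<in> Om" "dist y x < r k / 2" using closure_approachable[of x Om] r(1)[of k] half_gt_zero by blast
   show "x \<in> U"
    unfolding U_def using plump_mass_nonzero[OF pl y(1) _ r(1,3), of x k] y(2) by (simp add: dist_commute)
  qed
  ultimately show ?thesis using U unfolding smooth_closure_def by blast
 qed
 have FW: "F k \<in> Wsp Om s p" for k
 proof (rule WspI[OF A sp Fm])
  have fE: "energy p Om (G k i) < \<infinity>" for i
  proof -
   have "energy p Om (%x. (G k i x - a i x) + a i x) <= ennreal (2 powr p) * (energy p Om (%x. G k i x - a i x) + energy p Om (a i))"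
    by (rule pair_int_add_le) (use p0 in auto)
   also have "... <= ennreal (2 powr p) * (ennreal C * energy p Om (a i) + energy p Om (a i))"
    by (intro mult_left_mono add_mono order_trans[OF en] energy_near_le order_refl) auto
   also have "... < \<infinity>" using ea(1)[of i] by (simp add: ennreal_mult_less_top)
   finally show ?thesis by simp
  qed
  have fL: "Lp_int p Om (G k i) < \<infinity>" for i
  proof -
   have "Lp_int p Om (%x. (G k i x - a i x) + a i x) <= ennreal (2 powr p) * (Lp_int p Om (%x. G k i x - a i x) + Lp_int p Om (a i))"
    by (rule Lp_int_add_le) (use p0 in auto)
   also have "... <= ennreal (2 powr p) * (ennreal (C * t0^2) * energy p Om (a i) + Lp_int p Om (a i))"
    by (intro mult_left_mono add_mono order_trans[OF ln] energy_near_le order_refl) auto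
   also have "... < \<infinity>" using ea[of i] by (simp add: ennreal_mult_less_top)
   finally show ?thesis by simp
  qed
  show "genergy p Om (F k) < \<infinity>"
   using fE[of 1] fE[of 2] p0 by (intro le_less_trans[OF genergy_le_components]) (auto simp: Fi ennreal_mult_less_top)
  show "gLp p Om (F k) < \<infinity>"
   using fL[of 1] fL[of 2] p0 by (intro le_less_trans[OF gLp_le_components]) (auto simp: Fi ennreal_mult_less_top)
 qed
 have Fd: "(F k x - f' x) $ i = G k i x - a i x" for k x i by (simp add: Fi a_def)
 have "(%k. genergy p Om (%x. F k x - f' x)) ----> 0"
 proof (rule ennreal_tendsto_zero_le)
  show "genergy p Om (%x. F k x - f' x) <= ennreal (2 powr p) * (energy p Om (%x. G k 1 x - a 1 x) + energy p Om (%x. G k 2 x - a 2 x))" for k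
   using genergy_le_components[OF A _ p0, of "%x. F k x - f' x"] unfolding Fd by simp
  show "(%k. energy p Om (%x. G k 1 x - a 1 x) + energy p Om (%x. G k 2 x - a 2 x)) ----> 0"
   using tendsto_add[OF en0(1)[of 1] en0(1)[of 2]] by simp
 qed
 moreover have "(%k. gLp p Om (%x. F k x - f' x)) ----> 0"
 proof (rule ennreal_tendsto_zero_le)
  show "gLp p Om (%x. F k x - f' x) <= ennreal (2 powr p) * (Lp_int p Om (%x. G k 1 x - a 1 x) + Lp_int p Om (%x. G k 2 x - a 2 x))" for k
   using gLp_le_components[OF A _ p0, of "%x. F k x - f' x"] unfolding Fd by simp
  show "(%k. Lp_int p Om (%x. G k 1 x - a 1 x) + Lp_int p Om (%x. G k 2 x - a 2 x)) ----> 0"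
   using tendsto_add[OF en0(2)[of 1] en0(2)[of 2]] by simp
 qed
 ultimately have "Wsp_tendsto Om s p F f"
  using Wsp_tendsto_iff[OF A sp _ FW f Fm f' refl ff] p by simp
 then show ?thesis using sc by blast
 qed
qed

lemma test_function_Wsp:
 fixes Om :: "(real^2) set" and Phi :: "real^2 => real"
 assumes "open Om" "bounded Om" "Phi \<in> test_functions Om" "s * p = 2" "p > 2"
 shows "Phi \<in> Wsp Om s p" "Wsp_tendsto Om s p (%_. Phi) Phi"
proof -
 have A: "Om \<in> sets borel" using assms(1) by simp
 show W: "Phi \<in> Wsp Om s p"
  by (rule WspI[OF A assms(4) test_functionsD(5)[OF assms(3)]])
   (use test_function_finite[OF A assms(2,5,3)] in \<open>auto simp: genergy_real gLp_real\<close>)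
 have "p > 0" using assms(5) by simp
 then show "Wsp_tendsto Om s p (%_. Phi) Phi"
  using Wsp_tendsto_iff[OF A assms(4) _ W W test_functionsD(5)[OF assms(3)] test_functionsD(5)[OF assms(3)] refl AE_I2]
  by (simp add: genergy_def gLp_def)
qed

definition converging_pair :: "(real^2) set => real => (nat => real^2 => real) => (real^2 => real) => bool" where
 "converging_pair A p u a \<longleftrightarrow> (\<forall>k. smooth_near A (u k)) \<and> a \<in> Borel \<and> energy p A a < \<infinity> \<and> Lp_int p A a < \<infinity> \<and>
   (%k. energy p A (%x. u k x - a x)) ----> 0 \<and> (%k. Lp_int p A (%x. u k x - a x)) ----> 0"

lemma converging_components:
 fixes f :: "real^2 => real^2"
 assumes o: "open Om" and sp: "s * p = 2" and p: "p > 0"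
  and F: "!!k. F k \<in> smooth_closure Om" "Wsp_tendsto Om s p F f"
  and f'[measurable]: "f' \<in> Borel" and ff: "AE x in lborel. x \<in> Om --> f x = f' x"
 obtains U where "!!k. open (U k) \<and> closure Om \<subseteq> U k \<and> smooth_on (U k) (F k)"
  "!!i. converging_pair Om p (%k. component (U k) i (F k)) (%x. f' x $ i)"
proof -
 have A[measurable]: "Om \<in> sets borel" using o by simp
 have p0: "p >= 0" using p by simp
 have "\<exists>U. open U \<and> closure Om \<subseteq> U \<and> smooth_on U (F k)" for k using F(1)[of k] by (simp add: smooth_closure_def)
 then obtain U where U: "!!k. open (U k) \<and> closure Om \<subseteq> U k \<and> smooth_on (U k) (F k)" by metis
 define c where "c = (%k i. component (U k) i (F k))"
 have sn: "smooth_near Om (c k i)" for k i unfolding c_def using U[of k] by (intro smooth_near_component) auto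
 have [measurable]: "c k i \<in> Borel" for k i using sn[of k i] by (simp add: smooth_near_def)
 define F' where "F' = (%k x. c k 1 x *\<^sub>R axis 1 1 + c k 2 x *\<^sub>R axis (2::2) (1::real))"
 have F'i: "F' k x $ i = c k i x" for k x i using exhaust_2[of i] by (auto simp: F'_def axis_def)
 have F'm[measurable]: "F' k \<in> Borel" for k unfolding F'_def by measurable
 have FF: "F k x = F' k x" if "x \<in> Om" for k x
 proof -
  have "x \<in> U k" using that U[of k] closure_subset[of Om] by auto
  then show ?thesis by (simp add: vec_eq_iff F'i c_def component_def)
 qed
 have W: "F k \<in> Wsp Om s p" "f \<in> Wsp Om s p" for k using F(2) by (auto simp: Wsp_tendsto_def)
 have t: "(%k. genergy p Om (%x. F' k x - f' x)) ----> 0" "(%k. gLp p Om (%x. F' k x - f' x)) ----> 0"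
  using Wsp_tendsto_iff[OF A sp p W F'm f' FF ff] F(2) by auto
 have finf: "genergy p Om f' < \<infinity>" "gLp p Om f' < \<infinity>"
  using Wsp_finite[OF A sp W(2)] genergy_cong_AE[OF ff, of p] gLp_cong_AE[OF ff, of p] by auto
 have Fd: "(F' k x - f' x) $ i = c k i x - f' x $ i" for k x i by (simp add: F'i)
 show ?thesis
 proof (rule that[OF U])
  fix i
  have m: "(%x. f' x $ i) \<in> Borel"
   using borel_measurable_continuous_on[OF continuous_on_component[OF continuous_on_id, of UNIV i] f'] by simp
  have e: "energy p Om (%x. f' x $ i) < \<infinity>" "Lp_int p Om (%x. f' x $ i) < \<infinity>"
   using finf genergy_component_le[OF p0, of Om f' i] gLp_component_le[OF p0, of Om f' i] by (auto simp: order_le_less_trans)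
  have "energy p Om (%x. c k i x - f' x $ i) <= ennreal 1 * genergy p Om (%x. F' k x - f' x)" for k
   using genergy_component_le[OF p0, of Om "%x. F' k x - f' x" i] unfolding Fd by simp
  then have t1: "(%k. energy p Om (%x. c k i x - f' x $ i)) ----> 0" by (rule ennreal_tendsto_zero_le[OF _ t(1)])
  have "Lp_int p Om (%x. c k i x - f' x $ i) <= ennreal 1 * gLp p Om (%x. F' k x - f' x)" for k
   using gLp_component_le[OF p0, of Om "%x. F' k x - f' x" i] unfolding Fd by simp
  then have t2: "(%k. Lp_int p Om (%x. c k i x - f' x $ i)) ----> 0" by (rule ennreal_tendsto_zero_le[OF _ t(2)])
  show "converging_pair Om p (%k. component (U k) i (F k)) (%x. f' x $ i)"
   unfolding converging_pair_def using sn m e t1 t2 by (simp add: c_def)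
 qed
qed

lemma eventually_le_ennreal: "X ----> 0 ==> eps > 0 ==> \<exists>N::nat. \<forall>k\<ge>N. X k <= ennreal eps"
proof -
 assume "X ----> 0" "eps > 0"
 then have "eventually (%k. X k < ennreal eps) sequentially" by (intro order_tendstoD(2)) auto
 then show ?thesis unfolding eventually_sequentially by (meson less_imp_le)
qed

lemma triform_sequences:
 assumes pl: "plump A kappa0 t0" and oA: "open A" and bA: "bounded A" and p: "p > 2" and q: "q > 2" and pq: "2 / p + 1 / q = 1"
  and u: "converging_pair A p u a" "converging_pair A p u' a" and v: "converging_pair A p v b" "converging_pair A p v' b"
  and Phi: "!!k. Phi k \<in> test_functions A" "!!k. Phi' k \<in> test_functions A" and phi: "phi \<in> Borel" "test_size q A phi < \<infinity>"
  and l: "(%k. test_size q A (%x. Phi k x - phi x)) ----> 0" "(%k. test_size q A (%x. Phi' k x - phi x)) ----> 0"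
  and \<eta>: "\<eta> > 0"
 shows "\<exists>N. \<forall>k\<ge>N. \<forall>l\<ge>N. \<bar>triform (u k) (v k) (Phi k) - triform (u' l) (v' l) (Phi' l)\<bar> <= \<eta>"
proof -
 have m: "a \<in> Borel" "b \<in> Borel" and e: "energy p A a < \<infinity>" "energy p A b < \<infinity>"
  using u(1) v(1) by (auto simp: converging_pair_def)
 show ?thesis
 proof (rule triform_cauchy[OF pl oA bA p q pq m phi(1) e phi(2) \<eta>], goal_cases)
 case eps: (1 eps)
 have lim: "(%k. energy p A (%x. u k x - a x)) ----> 0" "(%k. energy p A (%x. u' k x - a x)) ----> 0"
  "(%k. energy p A (%x. v k x - b x)) ----> 0" "(%k. energy p A (%x. v' k x - b x)) ----> 0"
  using u v by (auto simp: converging_pair_def)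
 note ev = eventually_le_ennreal[OF _ eps(1)]
 obtain N1 where N1: "\<forall>k\<ge>N1. energy p A (%x. u k x - a x) <= ennreal eps" using ev[OF lim(1)] by blast
 obtain N2 where N2: "\<forall>k\<ge>N2. energy p A (%x. u' k x - a x) <= ennreal eps" using ev[OF lim(2)] by blast
 obtain N3 where N3: "\<forall>k\<ge>N3. energy p A (%x. v k x - b x) <= ennreal eps" using ev[OF lim(3)] by blast
 obtain N4 where N4: "\<forall>k\<ge>N4. energy p A (%x. v' k x - b x) <= ennreal eps" using ev[OF lim(4)] by blast
 obtain N5 where N5: "\<forall>k\<ge>N5. test_size q A (%x. Phi k x - phi x) <= ennreal eps" using ev[OF l(1)] by blast
 obtain N6 where N6: "\<forall>k\<ge>N6. test_size q A (%x. Phi' k x - phi x) <= ennreal eps" using ev[OF l(2)] by blast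
 have adm: "tri_admissible A (u k) (v k) (Phi k)" "tri_admissible A (u' k) (v' k) (Phi' k)" for k
  using u v Phi by (auto simp: tri_admissible_def converging_pair_def)
 show ?thesis
 proof (intro exI[of _ "Max {N1, N2, N3, N4, N5, N6}"] allI impI)
  fix k l assume "Max {N1, N2, N3, N4, N5, N6} <= k" "Max {N1, N2, N3, N4, N5, N6} <= l"
  then show "\<bar>triform (u k) (v k) (Phi k) - triform (u' l) (v' l) (Phi' l)\<bar> <= \<eta>"
   using N1 N2 N3 N4 N5 N6 by (intro eps(2) adm) auto
 qed
 qed
qed

definition jac_approximation :: "(real^2) set => real => (real^2 => real^2) => (real^2 => real) => (nat => real^2 => real^2) => (nat => real^2 => real) => bool" where
 "jac_approximation Om s f phi F Phi \<longleftrightarrow> (\<forall>k. F k \<in> smooth_closure Om) \<and> Wsp_tendsto Om s (2 / s) F f \<and>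
   (\<forall>k. Phi k \<in> test_functions Om) \<and> Wsp_tendsto Om ((1 - s) * 2) (1 / (1 - s)) Phi phi"

lemma jac_approximation_close:
 fixes f :: "real^2 => real^2" and phi :: "real^2 => real"
 assumes pl: "plump Om kappa t0" and o: "open Om" and bd: "bounded Om" and s: "2 / 3 <= s" "s < 1"
  and phi: "phi \<in> test_functions Om"
  and 1: "jac_approximation Om s f phi F Phi" and 2: "jac_approximation Om s f phi F' Phi'" and \<eta>: "\<eta> > 0"
 shows "\<exists>N. \<forall>k\<ge>N. \<forall>l\<ge>N. \<bar>(LINT x|lebesgue_on Om. det (jacobian (F k) (at x)) * Phi k x) -
   (LINT x|lebesgue_on Om. det (jacobian (F' l) (at x)) * Phi' l x)\<bar> <= \<eta>"
proof -
 have A[measurable]: "Om \<in> sets borel" using o by simp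
 define p q where "p = 2 / s" and "q = 1 / (1 - s)"
 have p: "p > 2" and q: "q > 2" and pq: "2 / p + 1 / q = 1" and sp: "s * p = 2" and sq: "(1 - s) * 2 * q = 2"
  using s by (auto simp: p_def q_def field_simps)
 have W: "f \<in> Wsp Om s p" using 1 by (simp add: jac_approximation_def Wsp_tendsto_def p_def)
 obtain f' where f': "f' \<in> Borel" and ff: "AE x in lborel. x \<in> Om --> f x = f' x"
  using borel_representative_vec[of f Om] W A by (auto simp: Wsp_def)
 have p0: "p > 0" "q > 0" using p q by auto
 have F: "!!k. F k \<in> smooth_closure Om" "Wsp_tendsto Om s p F f" "!!k. F' k \<in> smooth_closure Om" "Wsp_tendsto Om s p F' f"
  and Phi: "!!k. Phi k \<in> test_functions Om" "!!k. Phi' k \<in> test_functions Om"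
  and t: "Wsp_tendsto Om ((1 - s) * 2) q Phi phi" "Wsp_tendsto Om ((1 - s) * 2) q Phi' phi"
  using 1 2 by (auto simp: jac_approximation_def p_def q_def)
 have size0: "(%k. test_size q Om (%x. \<Psi> k x - phi x)) ----> 0"
  if \<Psi>: "!!k. \<Psi> k \<in> test_functions Om" "Wsp_tendsto Om ((1 - s) * 2) q \<Psi> phi" for \<Psi> :: "nat => real^2 => real"
 proof -
  have W: "\<Psi> k \<in> Wsp Om ((1 - s) * 2) q" "phi \<in> Wsp Om ((1 - s) * 2) q" for k
   using test_function_Wsp(1)[OF o bd _ sq q] \<Psi>(1) phi by auto
  have "(%k. energy q Om (%x. \<Psi> k x - phi x)) ----> 0 \<and> (%k. Lp_int q Om (%x. \<Psi> k x - phi x)) ----> 0"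
   using Wsp_tendsto_iff[OF A sq p0(2) W test_functionsD(5)[OF \<Psi>(1)] test_functionsD(5)[OF phi] refl AE_I2[of _ "%x. x \<in> Om --> phi x = phi x"]] \<Psi>(2)
   by (simp add: genergy_real gLp_real)
  then show ?thesis using tendsto_add[of "%k. energy q Om (%x. \<Psi> k x - phi x)" 0 sequentially "%k. Lp_int q Om (%x. \<Psi> k x - phi x)" 0] by simp
 qed
 obtain U where U: "!!k. open (U k) \<and> closure Om \<subseteq> U k \<and> smooth_on (U k) (F k)"
  "!!i. converging_pair Om p (%k. component (U k) i (F k)) (%x. f' x $ i)"
  by (rule converging_components[OF o sp p0(1) F(1,2) f' ff], rule that)
 obtain U' where U': "!!k. open (U' k) \<and> closure Om \<subseteq> U' k \<and> smooth_on (U' k) (F' k)"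
  "!!i. converging_pair Om p (%k. component (U' k) i (F' k)) (%x. f' x $ i)"
  by (rule converging_components[OF o sp p0(1) F(3,4) f' ff], rule that)
 have fin: "test_size q Om phi < \<infinity>" using test_function_finite[OF A bd q phi] by simp
 have d: "(LINT x|lebesgue_on Om. det (jacobian (F k) (at x)) * Phi k x) = triform (component (U k) 1 (F k)) (component (U k) 2 (F k)) (Phi k)"
  "(LINT x|lebesgue_on Om. det (jacobian (F' k) (at x)) * Phi' k x) = triform (component (U' k) 1 (F' k)) (component (U' k) 2 (F' k)) (Phi' k)" for k
  using U(1)[of k] U'(1)[of k] det_triform[OF _ _ _ Phi(1) A] det_triform[OF _ _ _ Phi(2) A] by auto
 show ?thesis unfolding d
  by (rule triform_sequences[OF pl o bd p q pq U(2) U'(2) U(2) U'(2) Phi test_functionsD(5)[OF phi] fin size0[OF Phi(1) t(1)] size0[OF Phi(2) t(2)] \<eta>])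
qed

text \<open>The integrals along any two approximating sequences become close by \<open>jac_approximation_close\<close>. Hence all of them converge to
 a common limit, and the description in \<open>distr_Jac\<close> denotes it.\<close>

lemma distr_Jac_tendsto:
 fixes f :: "real^2 => real^2" and phi :: "real^2 => real"
 assumes pl: "plump Om kappa t0" and o: "open Om" and bd: "bounded Om" and s: "2 / 3 <= s" "s < 1"
  and phi: "phi \<in> test_functions Om" and F: "!!k. F k \<in> smooth_closure Om" "Wsp_tendsto Om s (2 / s) F f"
 shows "(%k. LINT x|lebesgue_on Om. det (jacobian (F k) (at x)) * phi x) ----> distr_Jac Om s f phi"
proof -
 define J where "J = (%F Phi (k::nat). LINT x|lebesgue_on Om. det (jacobian (F k :: real^2 => real^2) (at x)) * (Phi k x :: real))"
 have "(1 - s) * 2 * (1 / (1 - s)) = 2" "1 / (1 - s) > 2" using s by (auto simp: field_simps)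
 then have ref: "jac_approximation Om s f phi F (%_. phi)"
  using F phi test_function_Wsp(2)[OF o bd phi] by (simp add: jac_approximation_def)
 have close: "\<exists>N. \<forall>k\<ge>N. \<forall>l\<ge>N. \<bar>J F1 Phi1 k - J F2 Phi2 l\<bar> <= \<eta>"
  if "jac_approximation Om s f phi F1 Phi1" "jac_approximation Om s f phi F2 Phi2" "\<eta> > 0" for F1 F2 Phi1 Phi2 \<eta>
  unfolding J_def by (rule jac_approximation_close[OF pl o bd s phi that])
 have "Cauchy (J F (%_. phi))"
  unfolding Cauchy_altdef2
 proof (intro allI impI)
  fix e :: real assume "e > 0"
  then obtain N where N: "\<forall>k\<ge>N. \<forall>l\<ge>N. \<bar>J F (%_. phi) k - J F (%_. phi) l\<bar> <= e / 2" using close[OF ref ref, of "e / 2"] by auto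
  have "dist (J F (%_. phi) n) (J F (%_. phi) N) < e" if "n >= N" for n
   using N[rule_format, OF that order_refl] \<open>e > 0\<close> by (simp add: dist_real_def)
  then show "\<exists>N. \<forall>n\<ge>N. dist (J F (%_. phi) n) (J F (%_. phi) N) < e" by blast
 qed
 then obtain L where L: "J F (%_. phi) ----> L" using Cauchy_convergent convergent_def by blast
 have lim: "J F2 Phi2 ----> L" if j: "jac_approximation Om s f phi F2 Phi2" for F2 Phi2
 proof (rule LIMSEQ_I)
  fix e :: real assume e: "e > 0"
  then obtain N where N: "\<forall>k\<ge>N. \<forall>l\<ge>N. \<bar>J F (%_. phi) k - J F2 Phi2 l\<bar> <= e / 2" using close[OF ref j, of "e / 2"] by auto
  obtain M where M: "\<forall>k\<ge>M. norm (J F (%_. phi) k - L) < e / 2" using LIMSEQ_D[OF L, of "e / 2"] e by auto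
  have "norm (J F2 Phi2 l - L) < e" if "l >= max N M" for l
  proof -
   have "\<bar>J F (%_. phi) l - J F2 Phi2 l\<bar> <= e / 2" "\<bar>J F (%_. phi) l - L\<bar> < e / 2"
    using N M that by auto
   then show ?thesis unfolding real_norm_def by arith
  qed
  then show "\<exists>no. \<forall>n\<ge>no. norm (J F2 Phi2 n - L) < e" by blast
 qed
 have "distr_Jac Om s f phi = (THE L. \<forall>F Phi. jac_approximation Om s f phi F Phi --> J F Phi ----> L)"
  unfolding distr_Jac_def jac_approximation_def J_def by simp
 also have "... = L"
  using lim LIMSEQ_unique[OF L] ref by (intro the_equality) blast+
 finally show ?thesis using L by (simp add: J_def)
qed

lemma approximating_pairs:
 fixes f :: "real^2 => real^2"
 assumes pl: "plump Om kappa t0" and o: "open Om" and bd: "bounded Om" and s: "2 / 3 <= s" "s < 1"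
  and f: "f \<in> Wsp Om s (2 / s)" and pos: "distr_Jac_nonneg Om s f"
 obtains f' u v where "f' \<in> Borel" "AE x in lborel. x \<in> Om --> f x = f' x"
  "converging_pair Om (2 / s) u (%x. f' x $ 1)" "converging_pair Om (2 / s) v (%x. f' x $ 2)"
  "!!phi. phi \<in> test_functions Om ==> \<forall>x. phi x >= 0 ==> \<exists>L\<ge>0. (%k. triform (u k) (v k) phi) ----> L"
proof -
 have A: "Om \<in> sets borel" using o by simp
 have sp: "s * (2 / s) = 2" and p: "2 / s > 2" "2 / s > 0" using s by (auto simp: field_simps)
 obtain F where F: "!!k. F k \<in> smooth_closure Om" "Wsp_tendsto Om s (2 / s) F f"
  using smooth_approximation[OF pl o bd sp p(1) f] by blast
 obtain f' where f': "f' \<in> Borel" and ff: "AE x in lborel. x \<in> Om --> f x = f' x"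
  using borel_representative_vec[of f Om] f A by (auto simp: Wsp_def)
 obtain U where U: "!!k. open (U k) \<and> closure Om \<subseteq> U k \<and> smooth_on (U k) (F k)"
  "!!i. converging_pair Om (2 / s) (%k. component (U k) i (F k)) (%x. f' x $ i)"
  by (rule converging_components[OF o sp p(2) F f' ff], rule that)
 show ?thesis
 proof (rule that[OF f' ff U(2) U(2)])
  fix phi :: "real^2 => real" assume phi: "phi \<in> test_functions Om" and nn: "\<forall>x. phi x >= 0"
  have "(LINT x|lebesgue_on Om. det (jacobian (F k) (at x)) * phi x) = triform (component (U k) 1 (F k)) (component (U k) 2 (F k)) phi" for k
   using U(1)[of k] det_triform[OF _ _ _ phi A] by blast
  then have "(%k. triform (component (U k) 1 (F k)) (component (U k) 2 (F k)) phi) ----> distr_Jac Om s f phi"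
   using distr_Jac_tendsto[OF pl o bd s phi F] by simp
  moreover have "phi \<in> Wsp0 Om s (2 / s)"
   using test_function_Wsp(2)[OF o bd phi sp p(1)] phi unfolding Wsp0_def mem_Collect_eq by (intro exI[of _ "%_. phi"]) simp
  then have "distr_Jac Om s f phi >= 0" using pos nn unfolding distr_Jac_nonneg_def by simp
  ultimately show "\<exists>L\<ge>0. (%k. triform (component (U k) 1 (F k)) (component (U k) 2 (F k)) phi) ----> L" by blast
 qed
qed

section \<open>Good circles\<close>

definition average :: "(real^2) set => (real^2 => real) => real" where
 "average S f = (LBINT z. indicator S z * f z) / measure lborel S"

lemma integrable_on_subset:
 fixes f :: "real^2 => real"
 assumes "compact K" "continuous_on K f" "f \<in> Borel" "T \<subseteq> K" "T \<in> sets borel"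
 shows "integrable lborel (%z. indicator T z * f z)"
proof (rule Bochner_Integration.integrable_bound)
 show "integrable lborel (%z. indicator K z *\<^sub>R f z)" by (rule borel_integrable_compact[OF assms(1,2)])
 have "(%z. indicator T z * f z) \<in> Borel" using assms(3,5) by measurable
 then show "(%z. indicator T z * f z) \<in> borel_measurable lborel" by simp
 show "AE z in lborel. norm (indicator T z * f z) <= norm (indicator K z *\<^sub>R f z)"
  using assms(4) by (intro AE_I2) (auto simp: indicator_def)
qed

lemma measure_cball_2: "r >= 0 ==> measure lborel (cball (x::real^2) r) = pi * r^2"
 by (simp add: emeasure_cball_2 measure_def)

text \<open>The difference of two averages is an integral against a kernel of mean zero.\<close>

lemma average_diff_bound:
 assumes p: "p >= 1" and r: "r > 0" and S[measurable]: "S \<in> sets borel" and eS: "emeasure lborel S = ennreal (pi * r^2)"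
  and st: "cball x s \<subseteq> S" "cball y t \<subseteq> S" "s >= r / 3" "t >= r / 3"
  and f: "f \<in> Borel" "integrable lborel (%z. indicator S z * f z)"
 shows "epow p (average (cball x s) f - average (cball y t) f) <= ennreal (2 * 9 / pi * (2 * 9 * pi) powr (p - 1) / r^4) * pair_osc p S f"
proof -
 define k where "k = (%z. indicator (cball x s) z / (pi * s^2) - indicator (cball y t) z / (pi * t^2) :: real)"
 have s0: "s > 0" "t > 0" using st r by auto
 have b: "1 / (pi * u^2) <= 9 / r^2" if "u >= r / 3" for u
 proof -
  have "(r / 3)^2 <= u^2" using that r by (intro power_mono) auto
  then have "r^2 <= 9 * u^2" by (simp add: power_divide)
  moreover have "u^2 <= pi * u^2" using pi_gt3 by (intro mult_right_mono[of 1 pi, simplified]) auto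
  ultimately have "r^2 <= 9 * (pi * u^2)" by linarith
  moreover have "u > 0" using that r by simp
  ultimately show ?thesis using r by (simp add: field_simps)
 qed
 have ii: "integrable lborel (indicator (cball z u) :: real^2 => real)" for z u
  using emeasure_lborel_cball_finite[of z u] by (intro integrable_real_indicator) auto
 have zk: "zero_mean_kernel k S (9 / r^2)"
  unfolding zero_mean_kernel_def
 proof (intro conjI allI impI)
  show "k \<in> Borel"
   unfolding k_def by (intro borel_measurable_diff borel_measurable_divide borel_measurable_const borel_measurable_indicator) auto
  show "\<bar>k z\<bar> <= 9 / r^2" for z
  proof -
   define A B where "A = indicator (cball x s) z / (pi * s^2)" and "B = indicator (cball y t) z / (pi * t^2)"
   have "0 <= A" "A <= 9 / r^2" "0 <= B" "B <= 9 / r^2"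
    using b[OF st(3)] b[OF st(4)] by (auto simp: A_def B_def indicator_def)
   then have "\<bar>A - B\<bar> <= 9 / r^2" by linarith
   then show ?thesis by (simp add: k_def A_def B_def)
  qed
  show "k z = 0" if "z \<notin> S" for z using that st by (auto simp: k_def indicator_def)
  show "(LBINT z. k z) = 0"
   unfolding k_def using s0 by (subst Bochner_Integration.integral_diff) (auto intro!: integrable_divide ii simp: measure_cball_2)
 qed
 have i: "integrable lborel (%z. indicator (cball z' u) z * f z)" if "cball z' u \<subseteq> S" for z' u
 proof (rule Bochner_Integration.integrable_bound[OF f(2)])
  have "(%z. indicator (cball z' u) z * f z) \<in> Borel"
   using f(1) by (intro borel_measurable_times borel_measurable_indicator) auto
  then show "(%z. indicator (cball z' u) z * f z) \<in> borel_measurable lborel" by simp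
  show "AE z in lborel. norm (indicator (cball z' u) z * f z) <= norm (indicator S z * f z)"
   using that by (intro AE_I2) (auto simp: indicator_def)
 qed
 have "(LBINT z. k z * f z) = (LBINT z. indicator (cball x s) z * f z / (pi * s^2) - indicator (cball y t) z * f z / (pi * t^2))"
  by (intro Bochner_Integration.integral_cong) (simp_all add: k_def left_diff_distrib)
 also have "... = average (cball x s) f - average (cball y t) f"
  using s0 i[OF st(1)] i[OF st(2)] by (subst Bochner_Integration.integral_diff) (auto intro!: integrable_divide simp: average_def measure_cball_2)
 finally show ?thesis
  using zero_mean_kernel_bound[OF zk S r pi_gt_zero _ _ _ p f] eS by simp
qed

lemma average_tendsto:
 assumes f: "f \<in> Borel" "isCont f x" and r: "!!j. r j > 0" "r ----> 0" and i: "!!j. integrable lborel (%z. indicator (cball x (r j)) z * f z)"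
 shows "(%j. average (cball x (r j)) f) ----> f x"
proof (rule LIMSEQ_I)
 fix e :: real assume e: "e > 0"
 then obtain d where d: "d > 0" "!!y. dist y x < d ==> dist (f y) (f x) < e / 2"
  using f(2) unfolding continuous_at_eps_delta by (metis half_gt_zero)
 obtain N where N: "!!j. j >= N ==> r j < d" using order_tendstoD(2)[OF r(2) d(1)] unfolding eventually_sequentially by blast
 have "norm (average (cball x (r j)) f - f x) < e" if "j >= N" for j
 proof -
  let ?I = "%z. indicator (cball x (r j)) z :: real"
  have ii: "integrable lborel (%z. ?I z * f x)"
   using emeasure_lborel_cball_finite[of x "r j"] by (intro integrable_mult_left integrable_real_indicator) auto
  have "(LBINT z. ?I z * (f z - f x)) = (LBINT z. ?I z * f z) - (LBINT z. ?I z * f x)"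
   unfolding right_diff_distrib by (rule Bochner_Integration.integral_diff[OF i ii])
  also have "(LBINT z. ?I z * f x) = pi * (r j)^2 * f x" using r(1)[of j] by (simp add: measure_cball_2)
  finally have eq: "(LBINT z. ?I z * (f z - f x)) = (LBINT z. ?I z * f z) - pi * (r j)^2 * f x" .
  have "\<bar>LBINT z. ?I z * (f z - f x)\<bar> <= e / 2 * (pi * (r j)^2)"
  proof (rule kernel_integral_bound[OF r(1), of _ _ x j])
   show "\<bar>?I z * (f z - f x)\<bar> <= e / 2" for z
    using d(2)[of z] N[OF that] e by (auto simp: indicator_def dist_real_def dist_commute)
   show "integrable lborel (%z. ?I z * (f z - f x))" unfolding right_diff_distrib by (rule Bochner_Integration.integrable_diff[OF i ii])
  qed (simp add: indicator_def)
  moreover have pr: "pi * (r j)^2 > 0" using r(1)[of j] by simp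
  moreover have "average (cball x (r j)) f - f x = ((LBINT z. ?I z * f z) - pi * (r j)^2 * f x) / (pi * (r j)^2)"
   using pr r(1)[of j] by (simp add: average_def measure_cball_2 diff_divide_distrib)
  ultimately have "\<bar>average (cball x (r j)) f - f x\<bar> <= e / 2"
   unfolding eq by (simp add: abs_divide pos_divide_le_eq)
  then show ?thesis using e by simp
 qed
 then show "\<exists>no. \<forall>n\<ge>no. norm (average (cball x (r n)) f - f x) < e" by blast
qed

text \<open>Oscillation at scale \<open>r\<close> near the circle of radius \<open>rho\<close>. Integration over \<open>rho\<close> gains the width \<open>2 * r\<close> of the annulus, which
 is what makes restriction to almost every circle possible.\<close>

definition annular_osc :: "real => (real^2) set => real^2 => real => (real^2 => real) => real => ennreal" where
 "annular_osc p S x0 r f rho = (NN z. indicator {dist x0 z - r .. dist x0 z + r} rho *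
   (NN w. indicator S z * indicator S w * (near (3 * r) (z - w) * epow p (f z - f w))))"

lemma annular_osc_borel [measurable]:
 assumes [measurable]: "S \<in> sets borel" "f \<in> Borel"
 shows "annular_osc p S x0 r f \<in> Borel"
proof -
 have "(%rho. \<integral>\<^sup>+z. indicator {-r..r} (dist x0 z - rho) *
   (NN w. indicator S z * indicator S w * (near (3 * r) (z - w) * epow p (f z - f w))) \<partial>lborel) \<in> Borel"
  by measurable
 moreover have "(indicator {-r..r} (dist x0 z - rho) :: ennreal) = indicator {dist x0 z - r .. dist x0 z + r} rho" for z rho
  by (auto simp: indicator_def)
 ultimately show ?thesis unfolding annular_osc_def[abs_def] by simp
qed

lemma integral_annular_osc:
 assumes [measurable]: "S \<in> sets borel" "f \<in> Borel" and r: "r >= 0"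
 shows "(NN rho. annular_osc p S x0 r f rho) = ennreal (2 * r) * pair_int (near (3 * r)) p S f"
proof -
 define g where "g = (%z. \<integral>\<^sup>+w. indicator S z * indicator S w * (near (3 * r) (z - w) * epow p (f z - f w)) \<partial>lborel)"
 have [measurable]: "g \<in> Borel" unfolding g_def by measurable
 have ind: "(indicator {dist x0 z - r .. dist x0 z + r} rho :: ennreal) = indicator {-r..r} (dist x0 z - rho)" for z rho
  by (auto simp: indicator_def)
 have "(NN rho. annular_osc p S x0 r f rho) = (NN rho. (NN z. indicator {-r..r} (dist x0 z - rho) * g z))"
  by (simp add: annular_osc_def g_def ind)
 also have "... = (NN z. (NN rho. indicator {-r..r} (dist x0 z - rho) * g z))"
  by (rule lborel_pair.Fubini') measurable
 also have "... = (NN z. ennreal (2 * r) * g z)"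
  unfolding ind[symmetric] using r by (simp add: nn_integral_multc)
 also have "... = ennreal (2 * r) * pair_int (near (3 * r)) p S f"
  by (subst nn_integral_cmult) (simp_all add: pair_int_def g_def)
 finally show ?thesis .
qed

lemma pair_osc_le_annular:
 assumes "dist x0 x = rho" "r > 0" "cball x r \<subseteq> S"
 shows "pair_osc p (cball x r) f <= annular_osc p S x0 r f rho"
proof -
 have a: "indicator (cball x r) z <= (indicator {dist x0 z - r .. dist x0 z + r} rho :: ennreal)" for z
  using assms(1) dist_triangle[of x0 z x] dist_triangle[of x0 x z] by (auto simp: indicator_def dist_commute)
 have n: "indicator (cball x r) z * indicator (cball x r) w <= near (3 * r) (z - w)" for z w
 proof -
  have "norm (z - w) < 3 * r" if "z \<in> cball x r" "w \<in> cball x r"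
   using that dist_triangle[of z w x] assms(2) by (simp add: dist_norm norm_minus_commute)
  then show ?thesis by (auto simp: near_def indicator_def)
 qed
 have "pair_osc p (cball x r) f <= (NN z. (NN w. indicator {dist x0 z - r .. dist x0 z + r} rho *
   (indicator S z * indicator S w * (near (3 * r) (z - w) * epow p (f z - f w)))))"
  unfolding pair_osc_def
 proof (intro nn_integral_mono)
  fix z w
  show "indicator (cball x r) z * indicator (cball x r) w * epow p (f z - f w) <= indicator {dist x0 z - r .. dist x0 z + r} rho *
   (indicator S z * indicator S w * (near (3 * r) (z - w) * epow p (f z - f w)))"
  proof (cases "z \<in> cball x r \<and> w \<in> cball x r")
   case True
   then have "z \<in> S" "w \<in> S" using assms(3) by auto
   then show ?thesis using True a[of z] n[of z w] by (auto simp: indicator_def near_def split: if_splits)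
  qed auto
 qed
 also have "... = annular_osc p S x0 r f rho"
  unfolding annular_osc_def
 proof (intro nn_integral_cong)
  fix z show "(NN w. indicator {dist x0 z - r .. dist x0 z + r} rho * (indicator S z * indicator S w * (near (3 * r) (z - w) * epow p (f z - f w)))) =
   indicator {dist x0 z - r .. dist x0 z + r} rho * (NN w. indicator S z * indicator S w * (near (3 * r) (z - w) * epow p (f z - f w)))"
   by (cases "rho \<in> {dist x0 z - r .. dist x0 z + r}") simp_all
 qed
 finally show ?thesis .
qed

text \<open>After integration over \<open>rho\<close>, scale \<open>j\<close> carries a factor \<open>2^-j\<close>. The weights \<open>(3/2)^j\<close> spend a part of this decay: the sum
 remains integrable, and a bound on it forces the oscillation at scale \<open>j\<close> to decay like \<open>(2/3)^j\<close>.\<close>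

definition circle_osc :: "real => real^2 => real => (real^2 => real) => real => ennreal" where
 "circle_osc p x0 R f rho = (\<Sum>j. ennreal ((3/2)^j / (R / 2^j)^4) * annular_osc p (ball x0 (3 * R)) x0 (R / 2^j) f rho)"

lemma integral_circle_osc:
 assumes [measurable]: "f \<in> Borel" and R: "R > 0" and E: "E >= 0" "energy p (ball x0 (3 * R)) f <= ennreal E"
 shows "(NN rho. circle_osc p x0 R f rho) <= ennreal (648 * R * E)"
proof -
 let ?S = "ball x0 (3 * R)"
 have "(NN rho. circle_osc p x0 R f rho) = (\<Sum>j. \<integral>\<^sup>+rho. ennreal ((3/2)^j / (R / 2^j)^4) * annular_osc p ?S x0 (R / 2^j) f rho \<partial>lborel)"
  unfolding circle_osc_def by (rule nn_integral_suminf) measurable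
 also have "... <= (\<Sum>j. ennreal (162 * R * E * (3/4)^j))"
 proof (intro suminf_le)
  fix j
  define r where "r = R / 2^j"
  have r: "r > 0" using R by (simp add: r_def)
  have "pair_int (near (3 * r)) p ?S f <= ennreal ((3 * r)^4) * energy_near (3 * r) p ?S f"
   using r by (intro near_le_energy_near) auto
  also have "... <= ennreal ((3 * r)^4) * ennreal E"
   by (intro mult_left_mono order_trans[OF energy_near_le E(2)]) simp
  finally have h: "pair_int (near (3 * r)) p ?S f <= ennreal ((3 * r)^4) * ennreal E" .
  have "(NN rho. ennreal ((3/2)^j / r^4) * annular_osc p ?S x0 r f rho) = ennreal ((3/2)^j / r^4) * (ennreal (2 * r) * pair_int (near (3 * r)) p ?S f)"
   using r by (subst nn_integral_cmult) (auto simp: integral_annular_osc)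
  also have "... <= ennreal ((3/2)^j / r^4) * (ennreal (2 * r) * (ennreal ((3 * r)^4) * ennreal E))"
   by (intro mult_left_mono h) auto
  also have "... = ennreal ((3/2)^j / r^4 * (2 * r * ((3 * r)^4 * E)))"
  proof -
   have "ennreal a * (ennreal b * (ennreal c * ennreal E)) = ennreal (a * (b * (c * E)))" if "a >= 0" "b >= 0" "c >= 0" for a b c
    using that E(1) by (simp add: ennreal_mult)
   then show ?thesis using r by simp
  qed
  also have "(3/2)^j / r^4 * (2 * r * ((3 * r)^4 * E)) = 162 * E * ((3/2)^j * r)"
   using r by (simp add: power_mult_distrib)
  also have "(3/2)^j * r = R * (3/4)^j" by (simp add: r_def power_divide flip: power_mult_distrib)
  finally show "(NN rho. ennreal ((3/2)^j / (R / 2^j)^4) * annular_osc p ?S x0 (R / 2^j) f rho) <= ennreal (162 * R * E * (3/4)^j)"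
   by (simp add: r_def mult_ac)
 qed auto
 also have "... = ennreal (\<Sum>j. 162 * R * E * (3/4)^j)"
  using R E by (intro suminf_ennreal2) (auto intro!: summable_mult summable_geometric)
 also have "(\<Sum>j. 162 * R * E * (3/4::real)^j) = 648 * R * E"
  by (subst suminf_mult) (simp_all add: suminf_geometric)
 finally show ?thesis .
qed

lemma geometric_telescope:
 fixes A :: "nat => real"
 assumes "!!j. \<bar>A (Suc j) - A j\<bar> <= b * t ^ j" "0 <= t" "t < 1" "A ----> L" "b >= 0"
 shows "\<bar>L - A 0\<bar> <= b / (1 - t)"
proof -
 have "\<bar>A n - A 0\<bar> <= b * (\<Sum>j<n. t ^ j)" for n
 proof (induction n)
  case (Suc n)
  have "\<bar>A (Suc n) - A 0\<bar> <= \<bar>A (Suc n) - A n\<bar> + \<bar>A n - A 0\<bar>" by linarith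
  then show ?case using Suc assms(1)[of n] by (simp add: distrib_left)
 qed simp
 moreover have "(\<Sum>j<n. t ^ j) <= 1 / (1 - t)" for n
  using sum_le_suminf[of "%j. t ^ j" "{..<n}"] assms(2,3) by (simp add: suminf_geometric summable_geometric)
 ultimately have "\<bar>A n - A 0\<bar> <= b / (1 - t)" for n
  using mult_left_mono[OF _ assms(5)] order_trans by (metis times_divide_eq_right mult.right_neutral)
 moreover have "(%n. \<bar>A n - A 0\<bar>) ----> \<bar>L - A 0\<bar>" by (intro tendsto_intros assms)
 ultimately show ?thesis by (intro LIMSEQ_le_const2) auto
qed

text \<open>Telescope the averages over the balls of radius \<open>R / 2^j\<close> around \<open>x\<close>, then compare the largest one with the ball around \<open>x0\<close>.\<close>

lemma circle_value_bound:
 assumes p: "p >= 1" and R: "R > 0" and c: "continuous_on (cball x0 (3 * R)) f" and f[measurable]: "f \<in> Borel"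
  and E: "E > 0" "energy p (ball x0 (3 * R)) f <= ennreal E" and co: "circle_osc p x0 R f rho <= ennreal (649 * E)"
  and x: "dist x0 x = rho" "rho < 2 * R"
  and K: "K = 2 * 9 / pi * (2 * 9 * pi) powr (p - 1)" and t: "t = (2 / 3) powr (1 / p)"
 shows "\<bar>f x - average (cball x0 R) f\<bar> <= ((649 * K) powr (1 / p) / (1 - t) + (16 * K) powr (1 / p)) * E powr (1 / p)"
proof -
 let ?S = "ball x0 (3 * R)"
 define r where "r = (%j. R / 2^j :: real)"
 have r: "r j > 0" "r j <= R" "r (Suc j) = r j / 2" for j using R by (auto simp: r_def divide_le_eq)
 have K0: "K > 0" unfolding K by simp
 have inS: "cball x u \<subseteq> ?S" if "u <= R" for u
 proof
  fix z assume "z \<in> cball x u"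
  then show "z \<in> ?S" using dist_triangle[of x0 z x] x that by simp
 qed
 have i: "integrable lborel (%z. indicator T z * f z)" if "T \<subseteq> ?S" "T \<in> sets borel" for T
  using that ball_subset_cball[of x0 "3 * R"] by (intro integrable_on_subset[OF _ c f]) auto
 have root: "a <= (c * E) powr (1 / p)" if "ennreal (a powr p) <= ennreal (c * E)" "a >= 0" "c >= 0" for a c
 proof -
  have "a powr p <= c * E" using that E(1) by (simp add: ennreal_le_iff)
  then have "(a powr p) powr (1 / p) <= (c * E) powr (1 / p)" using p by (intro powr_mono2) auto
  then show ?thesis using p that by (simp add: powr_powr)
 qed
 define A where "A = (%j. average (cball x (r j)) f)"
 have step: "\<bar>A (Suc j) - A j\<bar> <= (649 * K * E) powr (1 / p) * t ^ j" for j
 proof -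
  have "epow p (A (Suc j) - A j) <= ennreal (K / r j^4) * pair_osc p (cball x (r j)) f"
   unfolding A_def K using r[of j] by (intro average_diff_bound[OF p r(1)] i inS) (auto simp: emeasure_cball_2 intro: inS[THEN subsetD])
  also have "... <= ennreal (K / r j^4) * annular_osc p ?S x0 (r j) f rho"
   by (intro mult_left_mono pair_osc_le_annular x inS r) simp
  also have "... = ennreal (K * (2/3)^j) * (ennreal ((3/2)^j / r j^4) * annular_osc p ?S x0 (r j) f rho)"
  proof -
   have "ennreal (K * (2/3)^j) * ennreal ((3/2)^j / r j^4) = ennreal (K * (2/3)^j * ((3/2)^j / r j^4))"
    using K0 r(1)[of j] by (intro ennreal_mult[symmetric]) auto
   also have "K * (2/3)^j * ((3/2)^j / r j^4) = K / r j^4" by (simp add: power_divide)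
   finally show ?thesis by (simp add: mult.assoc[symmetric])
  qed
  also have "... <= ennreal (K * (2/3)^j) * circle_osc p x0 R f rho"
   unfolding circle_osc_def r_def
   by (intro mult_left_mono order_trans[OF _ sum_le_suminf[of _ "{j}"]]) auto
  also have "... <= ennreal (K * (2/3)^j) * ennreal (649 * E)" by (intro mult_left_mono co) simp
  also have "... = ennreal (649 * K * (2/3)^j * E)"
   using K0 E by (subst ennreal_mult[symmetric]) (auto simp: mult_ac)
  finally have "\<bar>A (Suc j) - A j\<bar> <= (649 * K * (2/3)^j * E) powr (1 / p)" using K0 by (intro root) auto
  also have "649 * K * (2/3)^j * E = 649 * K * E * (2/3)^j" by simp
  also have "(649 * K * E * (2/3)^j) powr (1 / p) = (649 * K * E) powr (1 / p) * ((2/3)^j) powr (1 / p)"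
   using K0 E by (intro powr_mult)
  also have "((2/3::real)^j) powr (1 / p) = t ^ j"
   unfolding t by (simp add: powr_powr mult.commute flip: powr_realpow)
  finally show ?thesis .
 qed
 have t1: "0 <= t" "t < 1" unfolding t using p powr_less_mono2[of "1 / p" "2/3" 1] by auto
 have "isCont f x"
  using c inS[of 0] R x(2) x(1) by (intro continuous_on_interior[OF c]) (simp add: interior_cball)
 moreover have "r ----> 0"
  unfolding r_def using LIMSEQ_divide_realpow_zero[of 2 R] by simp
 ultimately have "A ----> f x"
  unfolding A_def by (intro average_tendsto f r i inS) auto
 then have 1: "\<bar>f x - A 0\<bar> <= (649 * K * E) powr (1 / p) / (1 - t)"
  by (rule geometric_telescope[OF step t1 _ powr_ge_zero])
 have po1: "pair_osc p ?S f <= pair_int (near (6 * R)) p ?S f"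
  unfolding pair_osc_def pair_int_def
 proof (intro nn_integral_mono)
  fix z w
  have "norm (z - w) < 6 * R" if "z \<in> ?S" "w \<in> ?S"
   using that dist_triangle[of z w x0] by (simp add: dist_norm norm_minus_commute)
  then show "indicator ?S z * indicator ?S w * epow p (f z - f w) <= indicator ?S z * indicator ?S w * (near (6 * R) (z - w) * epow p (f z - f w))"
   by (auto simp: indicator_def near_def)
 qed
 have po2: "pair_int (near (6 * R)) p ?S f <= ennreal ((6 * R)^4) * ennreal E"
  using near_le_energy_near[of "6 * R" ?S f p] R order_trans[OF energy_near_le E(2)]
  by (intro order_trans[OF near_le_energy_near] mult_left_mono) auto
 have "epow p (A 0 - average (cball x0 R) f) <= ennreal (K / (3 * R)^4) * pair_osc p ?S f"
  unfolding A_def K using R r(2)[of 0] by (intro average_diff_bound[OF p] i inS) (auto simp: emeasure_ball_2 r_def)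
 also have "... <= ennreal (K / (3 * R)^4) * (ennreal ((6 * R)^4) * ennreal E)"
  by (intro mult_left_mono order_trans[OF po1 po2]) simp
 also have "... = ennreal (16 * K * E)"
 proof -
  have "ennreal a * (ennreal b * ennreal E) = ennreal (a * (b * E))" if "a >= 0" "b >= 0" for a b
   using that E(1) by (simp add: ennreal_mult)
  then have "ennreal (K / (3 * R)^4) * (ennreal ((6 * R)^4) * ennreal E) = ennreal (K / (3 * R)^4 * ((6 * R)^4 * E))"
   using K0 by simp
  also have "K / (3 * R)^4 * ((6 * R)^4 * E) = 16 * K * E" using R by (simp add: power_mult_distrib)
  finally show ?thesis .
 qed
 finally have 2: "\<bar>A 0 - average (cball x0 R) f\<bar> <= (16 * K * E) powr (1 / p)"
  using K0 by (intro root) auto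
 have "((649 * K) powr (1 / p) / (1 - t) + (16 * K) powr (1 / p)) * E powr (1 / p) = (649 * K * E) powr (1 / p) / (1 - t) + (16 * K * E) powr (1 / p)"
  using K0 E by (simp add: powr_mult distrib_right)
 then show ?thesis using 1 2 by linarith
qed

text \<open>A single radius has to serve infinitely many \<open>k\<close>. Fatou's lemma, applied to the integral over the radius, provides it.\<close>

lemma good_circle:
 assumes p: "p >= 1"
 obtains C where "C > 0"
  "!!x0 R (v :: nat => real^2 => real) E. R > 0 ==> E > 0 ==> (!!k. continuous_on (cball x0 (3 * R)) (v k)) ==> (!!k. v k \<in> Borel) ==>
   eventually (%k. energy p (ball x0 (3 * R)) (v k) <= ennreal E) sequentially ==>
   \<exists>rho. R < rho \<and> rho < 2 * R \<and> frequently (%k. \<forall>x. dist x0 x = rho --> \<bar>v k x - average (cball x0 R) (v k)\<bar> <= C * E powr (1 / p)) sequentially"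
proof -
 define K where "K = 2 * 9 / pi * (2 * 9 * pi) powr (p - 1)"
 define t where "t = (2 / 3 :: real) powr (1 / p)"
 define C where "C = (649 * K) powr (1 / p) / (1 - t) + (16 * K) powr (1 / p)"
 have "t < 1" unfolding t_def using p powr_less_mono2[of "1 / p" "2/3" 1] by auto
 moreover have "K > 0" unfolding K_def by simp
 ultimately have C: "C > 0" unfolding C_def by (intro add_pos_pos divide_pos_pos) auto
 show ?thesis
 proof (rule that[OF C])
  fix x0 R E and v :: "nat => real^2 => real"
  assume R: "R > 0" and E: "E > 0" and c: "!!k. continuous_on (cball x0 (3 * R)) (v k)" and [measurable]: "!!k. v k \<in> Borel"
   and ev: "eventually (%k. energy p (ball x0 (3 * R)) (v k) <= ennreal E) sequentially"
  have [measurable]: "circle_osc p x0 R (v k) \<in> Borel" for k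
   unfolding circle_osc_def[abs_def] by measurable
  have "(NN rho. liminf (%k. circle_osc p x0 R (v k) rho)) <= liminf (%k. \<integral>\<^sup>+rho. circle_osc p x0 R (v k) rho \<partial>lborel)"
   by (rule nn_integral_liminf) simp
  also have "... <= limsup (%k. \<integral>\<^sup>+rho. circle_osc p x0 R (v k) rho \<partial>lborel)" by (rule Liminf_le_Limsup) simp
  also have "... <= ennreal (648 * R * E)"
   by (rule Limsup_bounded, rule eventually_mono[OF ev]) (use R E in \<open>auto intro: integral_circle_osc\<close>)
  finally have int: "(NN rho. liminf (%k. circle_osc p x0 R (v k) rho)) <= ennreal (648 * R * E)" .
  (* If 649 E were exceeded on the whole interval of length R, the integral would exceed 648 R E. *)
  have "\<exists>rho. R < rho \<and> rho < 2 * R \<and> liminf (%k. circle_osc p x0 R (v k) rho) < ennreal (649 * E)"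
  proof (rule ccontr)
   assume "\<not> ?thesis"
   then have h: "ennreal (649 * E) <= liminf (%k. circle_osc p x0 R (v k) rho)" if "R < rho" "rho < 2 * R" for rho
    using that by (meson linorder_not_le)
   have "ennreal (649 * E * R) = ennreal (649 * E) * ennreal R" using E R by (intro ennreal_mult) auto
   also have "... = (NN rho. ennreal (649 * E) * indicator {R<..<2 * R} rho)"
    using R by (subst nn_integral_cmult) auto
   also have "... <= (NN rho. liminf (%k. circle_osc p x0 R (v k) rho))"
    using h by (intro nn_integral_mono) (auto simp: indicator_def)
   also note int
   finally show False using E R by (simp add: ennreal_le_iff mult.commute mult.left_commute)
  qed
  then obtain rho where rho: "R < rho" "rho < 2 * R" and li: "liminf (%k. circle_osc p x0 R (v k) rho) < ennreal (649 * E)" by blast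
  have "frequently (%k. circle_osc p x0 R (v k) rho < ennreal (649 * E)) sequentially"
  proof (rule ccontr)
   assume "\<not> ?thesis"
   then have "eventually (%k. ennreal (649 * E) <= circle_osc p x0 R (v k) rho) sequentially"
    by (simp add: not_frequently not_less)
   from Liminf_bounded[OF this] li show False by simp
  qed
  from frequently_eventually_conj[OF this ev]
  have "frequently (%k. \<forall>x. dist x0 x = rho --> \<bar>v k x - average (cball x0 R) (v k)\<bar> <= C * E powr (1 / p)) sequentially"
  proof (rule frequently_elim1, intro allI impI)
   fix k x assume "energy p (ball x0 (3 * R)) (v k) <= ennreal E \<and> circle_osc p x0 R (v k) rho < ennreal (649 * E)" "dist x0 x = rho"
   then show "\<bar>v k x - average (cball x0 R) (v k)\<bar> <= C * E powr (1 / p)"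
    unfolding C_def by (intro circle_value_bound[OF p R c _ E _ _ _ rho(2) K_def t_def]) auto
  qed
  then show "\<exists>rho. R < rho \<and> rho < 2 * R \<and> frequently (%k. \<forall>x. dist x0 x = rho --> \<bar>v k x - average (cball x0 R) (v k)\<bar> <= C * E powr (1 / p)) sequentially"
   using rho by blast
 qed
qed

section \<open>Making the Jacobian strictly positive\<close>

lemma converging_integral:
 assumes cp: "converging_pair A p u a" and A[measurable]: "A \<in> sets borel" and bA: "bounded A" and p: "p >= 1" and B: "B >= 0"
  and F: "!!k. integrable lborel (F k)" "integrable lborel F0" "!!k x. \<bar>F k x - F0 x\<bar> <= B * (indicator A x * \<bar>u k x - a x\<bar>)"
 shows "(%k. LBINT x. F k x) ----> (LBINT x. F0 x)"
proof (rule LIMSEQ_I)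
 fix e :: real assume e: "e > 0"
 have [measurable]: "u k \<in> Borel" "a \<in> Borel" for k
  using cp by (auto simp: converging_pair_def smooth_near_def)
 define m where "m = measure lborel A"
 have m: "emeasure lborel A = ennreal m" "m >= 0"
  using emeasure_eq_ennreal_measure[of lborel A] emeasure_bounded_finite[OF bA] by (auto simp: m_def)
 define lam where "lam = e / (4 * (B + 1) * (m + 1))"
 have lam: "lam > 0" using e B m by (simp add: lam_def)
 define D where "D = B * lam powr (1 - p)"
 have D: "D >= 0" using B by (simp add: D_def)
 have Bm: "B * lam * m <= e / 4"
 proof -
  have "B * m <= (B + 1) * (m + 1)" using B m by (intro mult_mono) auto
  then have "lam * (B * m) <= lam * ((B + 1) * (m + 1))" using lam by (intro mult_left_mono) auto
  also have "... = e / 4" using B m unfolding lam_def by (simp add: field_simps add_nonneg_eq_0_iff)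
  finally show ?thesis by (simp add: mult_ac)
 qed
 have "(%k. Lp_int p A (%x. u k x - a x)) ----> 0" using cp by (simp add: converging_pair_def)
 from eventually_le_ennreal[OF this, of "e / (4 * (D + 1))"] obtain N where
  N: "!!k. k >= N ==> Lp_int p A (%x. u k x - a x) <= ennreal (e / (4 * (D + 1)))" using e D by auto
 have "norm ((LBINT x. F k x) - (LBINT x. F0 x)) < e" if k: "k >= N" for k
 proof -
  have "ennreal \<bar>(LBINT x. F k x) - (LBINT x. F0 x)\<bar> = ennreal \<bar>LBINT x. F k x - F0 x\<bar>"
   by (simp add: Bochner_Integration.integral_diff[OF F(1,2)])
  also have "... <= (NN x. ennreal \<bar>F k x - F0 x\<bar>)" by (rule ennreal_abs_integral_le)
  also have "... <= (NN x. ennreal (B * lam) * indicator A x + ennreal D * (indicator A x * epow p (u k x - a x)))"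
  proof (intro nn_integral_mono)
   fix x
   have "B * \<bar>u k x - a x\<bar> <= B * (lam + lam powr (1 - p) * \<bar>u k x - a x\<bar> powr p)"
    by (intro mult_left_mono powr_young B lam p) simp
   also have "... = B * lam + D * \<bar>u k x - a x\<bar> powr p" by (simp add: D_def algebra_simps)
   finally have "ennreal (B * \<bar>u k x - a x\<bar>) <= ennreal (B * lam + D * \<bar>u k x - a x\<bar> powr p)" by (rule ennreal_leI)
   also have "... = ennreal (B * lam) + ennreal D * epow p (u k x - a x)"
    using B lam D by (simp add: ennreal_mult)
   finally show "ennreal \<bar>F k x - F0 x\<bar> <= ennreal (B * lam) * indicator A x + ennreal D * (indicator A x * epow p (u k x - a x))"
    using order_trans[OF ennreal_leI[OF F(3)[of k x]]] F(3)[of k x] by (cases "x \<in> A") auto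
  qed
  also have "... = ennreal (B * lam) * emeasure lborel A + ennreal D * Lp_int p A (%x. u k x - a x)"
   unfolding Lp_int_def by (simp add: nn_integral_add nn_integral_cmult)
  also have "... <= ennreal (B * lam) * ennreal m + ennreal D * ennreal (e / (4 * (D + 1)))"
   unfolding m(1) by (intro add_left_mono mult_left_mono N k) simp
  also have "... = ennreal (B * lam * m + D * (e / (4 * (D + 1))))"
  proof -
   have "ennreal s * ennreal t + ennreal s' * ennreal t' = ennreal (s * t + s' * t')" if "s >= 0" "t >= 0" "s' >= 0" "t' >= 0" for s t s' t'
    using that by (simp add: ennreal_mult)
   then show ?thesis using B lam m D e by auto
  qed
  finally have "\<bar>(LBINT x. F k x) - (LBINT x. F0 x)\<bar> <= B * lam * m + D * (e / (4 * (D + 1)))"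
   using B lam m D e by (subst (asm) ennreal_le_iff) auto
  also have "D * (e / (4 * (D + 1))) <= e / 4" using D e by (simp add: field_simps)
  finally show ?thesis using Bm e by simp
 qed
 then show "\<exists>no. \<forall>n\<ge>no. norm ((LBINT x. F n x) - (LBINT x. F0 x)) < e" by blast
qed

lemma converging_pair_integrable:
 assumes cp: "converging_pair A p u a" and A: "A \<in> sets borel" and bA: "bounded A" and p: "p >= 1"
  and \<psi>: "\<psi> \<in> Borel" "!!x. \<bar>\<psi> x\<bar> <= B" "!!x. x \<notin> A ==> \<psi> x = 0"
 shows "integrable lborel (%x. u k x * \<psi> x)" "integrable lborel (%x. a x * \<psi> x)"
proof -
 have *: "integrable lborel (%x. f x * \<psi> x)" if i: "integrable lborel (%x. indicator A x * f x)" for f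
 proof -
  have "integrable lborel (%x. \<psi> x * (indicator A x * f x))"
  proof (rule Bochner_Integration.integrable_bound[OF integrable_mult_right[OF i, of B]])
   show "(%x. \<psi> x * (indicator A x * f x)) \<in> borel_measurable lborel"
    by (rule borel_measurable_times[OF _ borel_measurable_integrable[OF i]]) (use \<psi>(1) in simp)
   show "AE x in lborel. norm (\<psi> x * (indicator A x * f x)) <= norm (B * (indicator A x * f x))"
    using order_trans[OF \<psi>(2) abs_ge_self] by (intro AE_I2) (simp add: abs_mult mult_right_mono)
  qed
  moreover have "\<psi> x * (indicator A x * f x) = f x * \<psi> x" for x using \<psi>(3)[of x] by (cases "x \<in> A") auto
  ultimately show ?thesis by simp
 qed
 obtain R where "!!x. x \<in> A ==> norm x <= R" using bA by (auto simp: bounded_iff)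
 then have R: "A \<subseteq> cball 0 R" by auto
 have "locally_integrable (%x. indicator A x * u k x)"
  by (rule smooth_near_locally_integrable[OF _ bA A]) (use cp in \<open>simp add: converging_pair_def\<close>)
 from locally_integrable_integrable_cball[OF this, of 0 R]
 have "integrable lborel (%x. indicator (cball 0 R) x * (indicator A x * u k x))" .
 moreover have "indicator (cball 0 R) x * (indicator A x * u k x) = indicator A x * u k x" for x using R by (auto simp: indicator_def)
 ultimately show "integrable lborel (%x. u k x * \<psi> x)" by (intro *) simp
 show "integrable lborel (%x. a x * \<psi> x)"
  using cp by (intro * Lp_finite_integrable[OF A bA _ p]) (auto simp: converging_pair_def)
qed

lemma converging_pair_weak:
 assumes cp: "converging_pair A p u a" and A: "A \<in> sets borel" and bA: "bounded A" and p: "p >= 1"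
  and \<psi>: "\<psi> \<in> Borel" "!!x. \<bar>\<psi> x\<bar> <= B" "!!x. x \<notin> A ==> \<psi> x = 0"
 shows "(%k. LBINT x. u k x * \<psi> x) ----> (LBINT x. a x * \<psi> x)"
proof (rule converging_integral[OF cp A bA p _ converging_pair_integrable[OF cp A bA p \<psi>]])
 show "B >= 0" using \<psi>(2)[of 0] by linarith
 show "\<bar>u k x * \<psi> x - a x * \<psi> x\<bar> <= B * (indicator A x * \<bar>u k x - a x\<bar>)" for k x
 proof (cases "x \<in> A")
  case True
  have "\<bar>u k x * \<psi> x - a x * \<psi> x\<bar> = \<bar>\<psi> x\<bar> * \<bar>u k x - a x\<bar>" by (metis abs_mult left_diff_distrib mult.commute)
  then show ?thesis using True \<psi>(2)[of x] by (simp add: mult_right_mono)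
 qed (simp add: \<psi>(3))
qed

lemma smooth_on_coordinate: "open V ==> smooth_on V (%x::real^2. c * x $ i)"
 using smooth_on_bounded_linear[of "%x::real^2. c * x $ i" V "%x. x"]
  bounded_linear_compose[OF bounded_linear_mult_right bounded_linear_vec_nth, of c i]
 by (auto simp: smooth_on_def Ck_on_id)

lemma converging_pair_shift:
 assumes cp: "converging_pair A p u a" and A: "A \<in> sets borel" and bA: "bounded A" and p: "p > 2"
 shows "converging_pair A p (%k x. u k x - c * x $ i) (%x. a x - c * x $ i)"
proof -
 let ?l = "%x::real^2. c * x $ i"
 have p0: "p >= 0" using p by simp
 have s: "smooth_on UNIV ?l" by (rule smooth_on_coordinate) simp
 have l[measurable]: "?l \<in> Borel" by (rule borel_measurable_continuous_onI[OF smooth_on_continuous[OF s]])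
 have a[measurable]: "a \<in> Borel" using cp by (simp add: converging_pair_def)
 have "smooth_near A ?l" unfolding smooth_near_def using s l by blast
 then have sn: "smooth_near A (%x. u k x - c * x $ i)" for k
  using cp by (intro smooth_near_diff) (auto simp: converging_pair_def)
 have lip: "\<bar>?l x - ?l y\<bar> <= \<bar>c\<bar> * norm (x - y)" for x y
  using component_le_norm_cart[of "x - y" i] by (simp add: abs_mult mult_left_mono flip: right_diff_distrib)
 have fe: "energy p A ?l < \<infinity>" by (rule lipschitz_energy_finite[OF A bA p _ lip]) simp
 obtain R where R: "!!x. x \<in> A ==> norm x <= R" using bA by (auto simp: bounded_iff)
 have fl: "Lp_int p A (%x. - ?l x) < \<infinity>"
 proof (rule bounded_Lp_finite[OF A bA p0])
  fix x assume "x \<in> A"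
  then have "\<bar>x $ i\<bar> <= R" using R component_le_norm_cart[of x i] order_trans by blast
  then show "\<bar>- ?l x\<bar> <= \<bar>c\<bar> * R" by (simp add: abs_mult mult_left_mono)
 qed
 have "energy p A (%x. a x - ?l x) < \<infinity>"
  using cp fe by (intro le_less_trans[OF pair_int_diff[OF inv4_borel A a l p0]]) (auto simp: converging_pair_def ennreal_mult_less_top)
 moreover have "Lp_int p A (%x. a x + - ?l x) < \<infinity>"
  using cp fl by (intro le_less_trans[OF Lp_int_add_le[OF A a _ p0]]) (auto simp: converging_pair_def ennreal_mult_less_top)
 ultimately show ?thesis using cp sn unfolding converging_pair_def by simp
qed

lemma converging_pair_minus:
 assumes cp: "converging_pair A p u a"
 shows "converging_pair A p (%k x. - u k x) (%x. - a x)"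
proof -
 have "smooth_near A (%x. - 1 * u k x)" for k using cp by (intro smooth_near_cmult) (simp add: converging_pair_def)
 moreover have "\<bar>- s - - t\<bar> = \<bar>s - t\<bar>" for s t :: real by linarith
 then have "pair_int w p A (%x. - f x) = pair_int w p A f" "Lp_int p A (%x. - f x) = Lp_int p A f" for w f
  by (simp_all add: pair_int_def Lp_int_def)
 moreover have "(%x. - u k x - - a x) = (%x. - (u k x - a x))" for k by auto
 ultimately show ?thesis using cp unfolding converging_pair_def by (simp del: minus_diff_eq uminus_add_conv_diff diff_minus_eq_add)
qed

text \<open>The map \<open>(u, v) + (- x_2, x_1)\<close> has Jacobian \<open>det D(u,v) + curl (u,v) + 1\<close>; here this identity is tested with \<open>phi\<close>.\<close>

lemma triform_shift:
 assumes "tri_admissible A u v phi"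
 shows "triform (%x. u x - x $ 2) (%x. v x + x $ 1) phi =
  triform u v phi + (LBINT x. u x * pderiv_at 2 phi x) - (LBINT x. v x * pderiv_at 1 phi x) + (LBINT x. phi x)"
proof -
 obtain V W where VW: "open V" "closure A \<subseteq> V" "smooth_on V u" "open W" "closure A \<subseteq> W" "smooth_on W v"
  using assms by (auto simp: tri_admissible_def smooth_near_def)
 define U where "U = V \<inter> W"
 have U: "open U" "A \<subseteq> U" "smooth_on U u" "smooth_on U v" using VW closure_subset[of A] by (auto simp: U_def intro: smooth_on_subset)
 have phi: "phi \<in> test_functions A" using assms by (simp add: tri_admissible_def)
 define X where "X = (%(i::2) (x::real^2). 1 * x $ i)"
 have sX: "smooth_on U (X i)" for i unfolding X_def by (rule smooth_on_coordinate[OF U(1)])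
 have dX: "pderiv_at j (X i) x = (if i = j then 1 else 0)" for i j x
 proof -
  have "(X i has_derivative (%v. v $ i)) (at x)"
   unfolding X_def using bounded_linear_imp_has_derivative[OF bounded_linear_vec_nth] by simp
  then show ?thesis by (simp add: pderiv_at_eq axis_def)
 qed
 note ibp = integral_bracket_by_parts[OF U(1) test_functionsD(2)[OF phi] subset_trans[OF test_functionsD(3)[OF phi] U(2)] _ _ test_functionsD(1)[OF phi] test_functionsD(4)[OF phi]]
 note i1 = ibp[OF U(3,4)] and i2 = ibp[OF U(3) sX[of 1]] and i3 = ibp[OF U(4) sX[of 2]]
 have iphi: "integrable lborel phi"
  by (rule integrable_continuous_compact[OF smooth_on_continuous[OF test_functionsD(1)[OF phi]] test_functionsD(2)[OF phi] test_functionsD(4)[OF phi]])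
 have "triform (%x. u x - x $ 2) (%x. v x + x $ 1) phi =
  (LBINT x. bracket u v x * phi x + bracket u (X 1) x * phi x + bracket v (X 2) x * phi x + phi x)"
  unfolding triform_def
 proof (intro Bochner_Integration.integral_cong refl)
  fix x
  show "bracket (%x. u x - x $ 2) (%x. v x + x $ 1) x * phi x =
   bracket u v x * phi x + bracket u (X 1) x * phi x + bracket v (X 2) x * phi x + phi x"
  proof (cases "phi x = 0")
   case False
   then have x: "x \<in> U" using support_closure_zero[of x phi] test_functionsD(3)[OF phi] U(2) by blast
   have 1: "pderiv_at i (%x. u x - x $ 2) x = pderiv_at i u x - pderiv_at i (X 2) x" for i
    using pderiv_at_diff[OF U(3) sX[of 2] x, of i] by (simp add: X_def)
   have 2: "pderiv_at i (%x. v x + x $ 1) x = pderiv_at i v x + pderiv_at i (X 1) x" for i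
    using pderiv_at_diff[OF U(4) smooth_on_cmult[OF U(1) sX[of 1], of "- 1"] x, of i] pderiv_at_cmult[OF sX[of 1] x, of i "- 1"]
    by (simp add: X_def)
   show ?thesis unfolding bracket_def 1 2 by (simp add: dX algebra_simps)
  qed simp
 qed
 also have "... = triform u v phi + (LBINT x. u x * bracket (X 1) phi x) + (LBINT x. v x * bracket (X 2) phi x) + (LBINT x. phi x)"
  by (simp add: i1(1) i2(1) i3(1) iphi triform_def i2(3) i3(3))
 also have "... = triform u v phi + (LBINT x. u x * pderiv_at 2 phi x) - (LBINT x. v x * pderiv_at 1 phi x) + (LBINT x. phi x)"
  by (simp add: bracket_def dX)
 finally show ?thesis .
qed

lemma test_function_pderiv:
 fixes phi :: "real^2 => real"
 assumes phi: "phi \<in> test_functions A"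
 obtains B where "!!i. pderiv_at i phi \<in> Borel" "!!i x. \<bar>pderiv_at i phi x\<bar> <= B" "!!i x. x \<notin> A ==> pderiv_at i phi x = 0"
proof -
 have "smooth_on UNIV (pderiv_at i phi)" for i using smooth_on_pderiv[OF test_functionsD(1)[OF phi], of i] .
 then have m: "pderiv_at i phi \<in> Borel" for i by (intro borel_measurable_continuous_onI smooth_on_continuous)
 have z: "pderiv_at i phi x = 0" if "x \<notin> closure {x. phi x ~= 0}" for i x
  by (rule pderiv_at_zero_outside[OF closed_closure support_closure_zero that])
 have zA: "pderiv_at i phi x = 0" if "x \<notin> A" for i x using z that test_functionsD(3)[OF phi] by blast
 obtain M where M: "M >= 0" "!!x v. x \<in> closure {x. phi x ~= 0} ==> norm (fder phi x v) <= M * norm v"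
  by (rule smooth_derivative_bounded[OF test_functionsD(1)[OF phi] test_functionsD(2)[OF phi] subset_UNIV], rule that)
 have B: "\<bar>pderiv_at i phi x\<bar> <= M" for i x
   using M(2)[of x "axis i 1"] z[of x i] M(1) by (cases "x \<in> closure {x. phi x ~= 0}") (auto simp: pderiv_at_def)
 show ?thesis by (rule that[OF m B zA])
qed

text \<open>Without curl, the shift raises the Jacobian by \<open>1\<close>.\<close>

lemma shifted_jacobian_positive:
 assumes u: "converging_pair A p u a" and v: "converging_pair A p v b" and A: "A \<in> sets borel" and bA: "bounded A" and p: "p >= 1"
  and pos: "\<exists>L\<ge>0. (%k. triform (u k) (v k) phi) ----> L" and phi: "phi \<in> test_functions A"
  and curl: "(LBINT x. b x * pderiv_at 1 phi x) - (LBINT x. a x * pderiv_at 2 phi x) = 0"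
 shows "\<exists>L. L >= (LBINT x. phi x) \<and> (%k. triform (%x. u k x - x $ 2) (%x. v k x + x $ 1) phi) ----> L"
proof -
 obtain L where L: "L >= 0" "(%k. triform (u k) (v k) phi) ----> L" using pos by blast
 obtain B where m: "!!i. pderiv_at i phi \<in> Borel" and B: "!!i x. \<bar>pderiv_at i phi x\<bar> <= B"
  and zA: "!!i x. x \<notin> A ==> pderiv_at i phi x = 0"
  by (rule test_function_pderiv[OF phi], rule that)
 have "(%k. triform (u k) (v k) phi + (LBINT x. u k x * pderiv_at 2 phi x) - (LBINT x. v k x * pderiv_at 1 phi x) + (LBINT x. phi x))
  ----> L + (LBINT x. a x * pderiv_at 2 phi x) - (LBINT x. b x * pderiv_at 1 phi x) + (LBINT x. phi x)"
  by (intro tendsto_intros L converging_pair_weak[OF u A bA p m B zA] converging_pair_weak[OF v A bA p m B zA])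
 moreover have "tri_admissible A (u k) (v k) phi" for k using u v phi by (simp add: tri_admissible_def converging_pair_def)
 ultimately have "(%k. triform (%x. u k x - x $ 2) (%x. v k x + x $ 1) phi) ----> L + (LBINT x. phi x)"
  using curl by (simp add: triform_shift[of A])
 then show ?thesis using L(1) by (intro exI[of _ "L + (LBINT x. phi x)"]) simp
qed

section \<open>Continuous representatives\<close>

lemma AE_meets_open:
 fixes U :: "(real^2) set"
 assumes "AE z in lborel. P z" "open U" "y \<in> U"
 shows "\<exists>z\<in>U. P z"
proof (rule ccontr)
 assume n: "\<not> ?thesis"
 obtain r where r: "r > 0" "ball y r \<subseteq> U" using assms(2,3) by (auto simp: open_contains_ball)
 have "AE z in lborel. z \<notin> ball y r" using assms(1) by eventually_elim (use n r in blast)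
 then have "emeasure lborel (ball y r) = 0" using AE_iff_null_sets[of "ball y r" lborel] null_setsD1 by auto
 then show False using r by (simp add: emeasure_ball_2)
qed

text \<open>It suffices to look at countably many basic open sets and tolerances, which leaves a single exceptional null set. Its
 complement is dense, and near every point \<open>f\<close> oscillates little on it; so \<open>f\<close> extends continuously from there.\<close>

lemma continuous_representative:
 fixes f :: "real^2 => 'b::banach"
 assumes o: "open Om"
  and osc: "!!x eps. x \<in> Om ==> eps > 0 ==> \<exists>r>0. \<exists>m. AE z in lborel. z \<in> ball x r --> norm (f z - m) <= eps"
 shows "\<exists>g. continuous_on Om g \<and> (AE x in lborel. x \<in> Om --> f x = g x)"
proof -
 obtain BB :: "(real^2) set set" where BB: "countable BB" "topological_basis BB" using ex_countable_basis by blast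
 define e where "e = (%n. 1 / real (Suc n))"
 define good where "good = (%b n m. AE z in lborel. z \<in> b --> norm (f z - m) <= e n)"
 define M where "M = (%b n. SOME m. good b n m)"
 define P where "P = (%z. \<forall>b\<in>BB. \<forall>n. (\<exists>m. good b n m) --> z \<in> b --> norm (f z - M b n) <= e n)"
 have "AE z in lborel. (\<exists>m. good b n m) --> z \<in> b --> norm (f z - M b n) <= e n" for b n
 proof (cases "\<exists>m. good b n m")
  case True
  then have "good b n (M b n)" unfolding M_def by (rule someI_ex)
  then show ?thesis unfolding good_def using AE_mp by fastforce
 qed simp
 then have AEP: "AE z in lborel. P z" unfolding P_def using BB(1) by (simp add: AE_ball_countable AE_all_countable)
 have loc: "\<exists>r>0. \<exists>m. \<forall>z. P z --> z \<in> ball y r --> norm (f z - m) <= eps" if y: "y \<in> Om" and eps: "eps > 0" for y eps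
 proof -
  obtain n where n: "e n < eps" using reals_Archimedean[OF eps] by (auto simp: e_def inverse_eq_divide)
  obtain r m where r: "r > 0" "AE z in lborel. z \<in> ball y r --> norm (f z - m) <= e n"
   using osc[OF y, of "e n"] by (auto simp: e_def)
  obtain b where b: "b \<in> BB" "y \<in> b" "b \<subseteq> ball y r" using topological_basisE[OF BB(2), of "ball y r" y] r(1) by auto
  have "good b n m" unfolding good_def using r(2) by eventually_elim (use b in blast)
  then have h: "norm (f z - M b n) <= e n" if "P z" "z \<in> b" for z using that b(1) unfolding P_def by blast
  obtain s where s: "s > 0" "ball y s \<subseteq> b" using topological_basis_open[OF BB(2) b(1)] b(2) by (auto simp: open_contains_ball)
  show ?thesis using s h n by (intro exI[of _ s] conjI exI[of _ "M b n"]) force+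
 qed
 have pt: "\<exists>z. P z \<and> z \<in> ball y r \<and> z \<in> ball y' r'" if "r' > 0" "y' \<in> ball y r" for y y' r r'
  using AE_meets_open[OF AEP open_Int[OF open_ball open_ball], of y' y r y' r'] that by auto
 have "\<exists>c. \<forall>eps>0. \<exists>r>0. \<forall>z. P z --> z \<in> ball y r --> norm (f z - c) <= eps" if y: "y \<in> Om" for y
 proof -
  have e0: "e n > 0" for n by (simp add: e_def)
  have "\<forall>n. \<exists>r m. r > 0 \<and> (\<forall>z. P z --> z \<in> ball y r --> norm (f z - m) <= e n)" using loc[OF y e0] by blast
  then obtain r m where rm: "!!n. r n > 0" "!!n z. P z ==> z \<in> ball y (r n) ==> norm (f z - m n) <= e n" by metis
  have mm: "norm (m n - m k) <= e n + e k" for n k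
  proof -
   obtain z where z: "P z" "z \<in> ball y (r n)" "z \<in> ball y (r k)" using pt[of "r k" y y "r n"] rm(1)[of n] rm(1)[of k] by auto
   have "norm (m n - m k) <= norm (f z - m n) + norm (f z - m k)"
    using norm_triangle_ineq4[of "f z - m k" "f z - m n"] by simp
   then show ?thesis using rm(2)[OF z(1,2)] rm(2)[OF z(1,3)] by linarith
  qed
  have el: "e ----> 0" unfolding e_def using LIMSEQ_inverse_real_of_nat by (simp add: inverse_eq_divide)
  have emono: "e k <= e n" if "n <= k" for n k using that by (simp add: e_def frac_le)
  have "Cauchy m"
  proof (rule metric_CauchyI)
   fix eps :: real assume "eps > 0"
   then obtain N where N: "e N < eps / 2" using order_tendstoD(2)[OF el, of "eps / 2"] by (auto simp: eventually_sequentially)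
   have "dist (m n) (m k) < eps" if "n >= N" "k >= N" for n k
    using mm[of n k] emono[OF that(1)] emono[OF that(2)] N by (simp add: dist_norm)
   then show "\<exists>N. \<forall>n\<ge>N. \<forall>k\<ge>N. dist (m n) (m k) < eps" by blast
  qed
  then obtain c where c: "m ----> c" using Cauchy_convergent convergent_def by blast
  show ?thesis
  proof (intro exI[of _ c] allI impI)
   fix eps :: real assume eps: "eps > 0"
   obtain N where N: "\<forall>n\<ge>N. norm (m n - c) < eps / 2" using LIMSEQ_D[OF c, of "eps / 2"] eps by auto
   obtain N' where N': "e N' < eps / 2" using order_tendstoD(2)[OF el, of "eps / 2"] eps by (auto simp: eventually_sequentially)
   let ?n = "max N N'"
   have "norm (f z - c) <= eps" if "P z" "z \<in> ball y (r ?n)" for z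
    using norm_triangle_ineq[of "f z - m ?n" "m ?n - c"] rm(2)[OF that] N[rule_format, of ?n] N' emono[of N' ?n] by simp
   then show "\<exists>r>0. \<forall>z. P z --> z \<in> ball y r --> norm (f z - c) <= eps" using rm(1)[of ?n] by blast
  qed
 qed
 then have "\<forall>y\<in>Om. \<exists>c. \<forall>eps>0. \<exists>r>0. \<forall>z. P z --> z \<in> ball y r --> norm (f z - c) <= eps" by blast
 then obtain g where "\<forall>y\<in>Om. \<forall>eps>0. \<exists>r>0. \<forall>z. P z --> z \<in> ball y r --> norm (f z - g y) <= eps"
  by (rule bchoice[THEN exE])
 then have g: "\<exists>r>0. \<forall>z. P z --> z \<in> ball y r --> norm (f z - g y) <= eps" if "y \<in> Om" "eps > 0" for y eps
  using that by blast
 have eq: "f x = g x" if x: "x \<in> Om" "P x" for x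
 proof (rule ccontr)
  assume "f x ~= g x"
  then have "norm (f x - g x) / 2 > 0" by simp
  from g[OF x(1) this] obtain r where "r > 0" "\<forall>z. P z --> z \<in> ball x r --> norm (f z - g x) <= norm (f x - g x) / 2" by blast
  then have "norm (f x - g x) <= norm (f x - g x) / 2" using x(2) by simp
  then show False using \<open>f x ~= g x\<close> by simp
 qed
 have "continuous_on Om g"
  unfolding continuous_on_iff
 proof (intro ballI allI impI)
  fix y and eps :: real assume y: "y \<in> Om" and eps: "eps > 0"
  obtain r where r: "r > 0" "!!z. P z ==> z \<in> ball y r ==> norm (f z - g y) <= eps / 4" using g[OF y, of "eps / 4"] eps by auto
  have "dist (g y') (g y) < eps" if y': "y' \<in> Om" "dist y' y < r" for y'
  proof -
   obtain r' where r': "r' > 0" "!!z. P z ==> z \<in> ball y' r' ==> norm (f z - g y') <= eps / 4" using g[OF y'(1), of "eps / 4"] eps by auto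
   obtain z where z: "P z" "z \<in> ball y r" "z \<in> ball y' r'" using pt[of r' y' y r] r'(1) y'(2) by (auto simp: dist_commute)
   have "norm (g y' - g y) <= norm (f z - g y') + norm (f z - g y)"
    using norm_triangle_ineq4[of "f z - g y" "f z - g y'"] by simp
   then show ?thesis using r(2)[OF z(1,2)] r'(2)[OF z(1,3)] eps by (simp add: dist_norm)
  qed
  then show "\<exists>d>0. \<forall>x'\<in>Om. dist x' y < d --> dist (g x') (g y) < eps" using r(1) by blast
 qed
 moreover have "AE x in lborel. x \<in> Om --> f x = g x" using AEP by eventually_elim (use eq in blast)
 ultimately show ?thesis by blast
qed

section \<open>The maximum principle and continuity\<close>

text \<open>The excess of \<open>G\<close> over \<open>M\<close> inside the circle, made smooth and bounded by \<open>flat\<close>.\<close>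

definition cutoff :: "(real^2 => real) => real => real^2 => real => real^2 => real" where
 "cutoff G M x0 rho x = indicator (ball x0 rho) x * flat (G x - M)"

lemma bracket_flat:
 assumes "smooth_on V G" "x \<in> V"
 shows "bracket G (%x. flat (G x - M)) x = 0"
proof -
 define D where "D = fder G x"
 obtain d where d: "(flat has_real_derivative d) (at (G x - M))" unfolding flat_def using flat_deriv_DERIV by blast
 have G: "(G has_derivative D) (at x)" unfolding D_def by (rule smooth_on_has_derivative[OF assms])
 then have "((%x. G x - M) has_derivative D) (at x)" using has_derivative_diff[OF G has_derivative_const, of M] by simp
 from has_derivative_compose[OF this d[unfolded has_field_derivative_def]]
 have "((%x. flat (G x - M)) has_derivative (%v. d * D v)) (at x)" .
 then show ?thesis by (simp add: bracket_def pderiv_at_eq[OF G] pderiv_at_eq)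
qed

lemma cutoff_properties:
 assumes V: "open V" "cball x0 rho \<subseteq> V" "smooth_on V G" and A: "cball x0 rho \<subseteq> A" and rho: "rho > 0"
  and c: "!!x. dist x0 x = rho ==> G x < M"
 defines "K \<equiv> {x \<in> cball x0 rho. M <= G x}"
 shows "cutoff G M x0 rho \<in> test_functions A" "compact K" "K \<subseteq> ball x0 rho" "!!x. x \<notin> K ==> cutoff G M x0 rho x = 0"
  "bracket G (cutoff G M x0 rho) x = 0"
proof -
 have "closed K"
  unfolding K_def using continuous_on_subset[OF smooth_on_continuous[OF V(3)] V(2)] by (intro continuous_on_closed_Collect_le[of _ "%_. M", simplified] continuous_closed_preimage)
   (auto intro: continuous_on_const)
 moreover have "bounded K" by (rule bounded_subset[OF bounded_cball[of x0 rho]]) (auto simp: K_def)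
 ultimately show K: "compact K" by (simp add: compact_eq_bounded_closed)
 show KB: "K \<subseteq> ball x0 rho"
 proof
  fix x assume x: "x \<in> K"
  then have "dist x0 x ~= rho" using c[of x] by (auto simp: K_def)
  then show "x \<in> ball x0 rho" using x by (auto simp: K_def)
 qed
 show z: "cutoff G M x0 rho x = 0" if "x \<notin> K" for x
  using that by (auto simp: cutoff_def K_def flat_eq indicator_def)
 have "smooth_on (ball x0 rho) (%x. flat (G x - M))"
  using V ball_subset_cball[of x0 rho] by (intro smooth_on_flat smooth_on_diff smooth_on_const smooth_on_subset[OF V(3)]) auto
 then have "smooth_on (ball x0 rho) (cutoff G M x0 rho)" by (rule smooth_on_cong) (auto simp: cutoff_def)
 then have s: "smooth_on UNIV (cutoff G M x0 rho)"
  by (rule smooth_on_zero_extension[OF open_ball compact_imp_closed[OF K] KB _ z])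
 show "cutoff G M x0 rho \<in> test_functions A"
  by (rule test_functionsI[OF s K _ z]) (use A in \<open>auto simp: K_def\<close>)
 show "bracket G (cutoff G M x0 rho) x = 0"
 proof (cases "x \<in> ball x0 rho")
  case True
  have "pderiv_at i (cutoff G M x0 rho) x = pderiv_at i (%x. flat (G x - M)) x" for i
  proof -
   have "((%x. flat (G x - M)) has_derivative fder (cutoff G M x0 rho) x) (at x)"
    by (rule has_derivative_transform_within_open[OF smooth_on_has_derivative[OF s UNIV_I] open_ball True]) (simp add: cutoff_def)
   then show ?thesis by (simp add: pderiv_at_eq) (simp add: pderiv_at_def)
  qed
  then have "bracket G (cutoff G M x0 rho) x = bracket G (%x. flat (G x - M)) x" by (simp add: bracket_def)
  moreover have "x \<in> V" using True V(2) by (auto simp: subset_iff)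
  ultimately show ?thesis using bracket_flat[OF V(3), of x M] by simp
 next
  case False
  then have "pderiv_at i (cutoff G M x0 rho) x = 0" for i
   using KB by (intro pderiv_at_zero_outside[OF compact_imp_closed[OF K]] z) auto
  then show ?thesis by (simp add: bracket_def)
 qed
qed

text \<open>Being a function of \<open>G\<close>, the cutoff has a gradient parallel to that of \<open>G\<close>.\<close>

lemma triform_cutoff_zero:
 assumes G: "smooth_near A G" and H: "smooth_near A H" and A: "cball x0 rho \<subseteq> A" and rho: "rho > 0"
  and c: "!!x. dist x0 x = rho ==> G x < M"
 shows "triform G H (cutoff G M x0 rho) = 0"
proof -
 obtain V W where VW: "open V" "closure A \<subseteq> V" "smooth_on V G" "open W" "closure A \<subseteq> W" "smooth_on W H"
  using G H by (auto simp: smooth_near_def)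
 define U where "U = V \<inter> W"
 have U: "open U" "cball x0 rho \<subseteq> U" "smooth_on U G" "smooth_on U H"
  using VW A closure_subset[of A] by (auto simp: U_def intro: smooth_on_subset)
 note c = cutoff_properties[OF U(1-3) A rho c]
 have KU: "{x \<in> cball x0 rho. M <= G x} \<subseteq> U" using U(2) by blast
 have "triform G H (cutoff G M x0 rho) = - triform H G (cutoff G M x0 rho)"
  unfolding triform_def by (subst bracket_antisym) simp
 also have "triform H G (cutoff G M x0 rho) = (LBINT x. H x * bracket G (cutoff G M x0 rho) x)"
  by (rule triform_cyclic[OF U(1) c(2) KU U(4,3) test_functionsD(1)[OF c(1)] c(4)])
 finally show ?thesis by (simp add: c(5))
qed

text \<open>The cutoff is bounded by \<open>1\<close>, and for differences of size at most \<open>1\<close> the power \<open>q\<close> is dominated by the smaller power \<open>p\<close>.\<close>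

lemma cutoff_size:
 assumes q: "q > 0" and p: "0 < p" "p <= q"
 obtains C where "C > 0"
  "!!A x0 rho G M. smooth_near A G ==> A \<in> sets borel ==> cball x0 rho \<subseteq> A ==> rho > 0 ==> (!!x. dist x0 x = rho ==> G x < M) ==>
   test_size q A (cutoff G M x0 rho) <= ennreal C * energy p A G + emeasure lborel A"
proof -
 show ?thesis
 proof (rule energy_zero_extension[OF q], goal_cases)
 case C: (1 C)
 show ?thesis
 proof (rule that[of "C * 2 powr p"])
  show "C * 2 powr p > 0" using C(1) by simp
  fix A x0 rho G M
  assume G: "smooth_near A G" and Ab[measurable]: "A \<in> sets borel" and A: "cball x0 rho \<subseteq> A" and rho: "rho > 0" and c: "!!x. dist x0 x = rho ==> G x < M"
  obtain V where V: "open V" "cball x0 rho \<subseteq> V" "smooth_on V G" and [measurable]: "G \<in> Borel"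
   using G A closure_subset[of A] unfolding smooth_near_def by (metis order_trans)
  let ?Phi = "cutoff G M x0 rho"
  note cp = cutoff_properties[OF V A rho c]
  have "energy q (ball x0 rho) ?Phi <= pair_int (%u. ennreal (2 powr p) * inv4 u) p (ball x0 rho) G"
   unfolding pair_int_def
  proof (intro nn_integral_mono)
   fix x y
   define t where "t = \<bar>flat (G x - M) - flat (G y - M)\<bar>"
   have t: "0 <= t" "t <= 1" "t <= 2 * \<bar>G x - G y\<bar>"
    using flat_nonneg[of "G x - M"] flat_le_1[of "G x - M"] flat_nonneg[of "G y - M"] flat_le_1[of "G y - M"] flat_Lipschitz[of "G x - M" "G y - M"]
    by (auto simp: t_def)
   have "t powr q <= t powr p" using t p by (intro powr_mono') auto
   also have "... <= (2 * \<bar>G x - G y\<bar>) powr p" using t p by (intro powr_mono2) auto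
   also have "... = 2 powr p * \<bar>G x - G y\<bar> powr p" by (rule powr_mult)
   finally have "ennreal (t powr q) <= ennreal (2 powr p) * epow p (G x - G y)"
    by (simp add: ennreal_leI flip: ennreal_mult)
   from mult_left_mono[OF this, of "inv4 (x - y)"]
   show "indicator (ball x0 rho) x * indicator (ball x0 rho) y * (inv4 (x - y) * epow q (?Phi x - ?Phi y)) <=
    indicator (ball x0 rho) x * indicator (ball x0 rho) y * (ennreal (2 powr p) * inv4 (x - y) * epow p (G x - G y))"
    by (auto simp: indicator_def cutoff_def t_def mult_ac)
  qed
  also have "... = ennreal (2 powr p) * energy p (ball x0 rho) G" by (rule pair_int_cmult) auto
  also have "... <= ennreal (2 powr p) * energy p A G"
   using A ball_subset_cball[of x0 rho] by (intro mult_left_mono pair_int_mono_set) auto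
  finally have h: "energy q (ball x0 rho) ?Phi <= ennreal (2 powr p) * energy p A G" .
  have "energy q A ?Phi <= energy q UNIV ?Phi" by (rule pair_int_mono_set) simp
  also have "... <= ennreal C * energy q (ball x0 rho) ?Phi"
   by (rule C(2)[OF open_ball cp(2,3) test_functionsD(5,6)[OF cp(1)]]) (assumption | rule cp(4))+
  also have "... <= ennreal C * (ennreal (2 powr p) * energy p A G)" by (intro mult_left_mono h) simp
  also have "... = ennreal (C * 2 powr p) * energy p A G"
   using C(1) by (intro ennreal_mult_merge) auto
  finally have 1: "energy q A ?Phi <= ennreal (C * 2 powr p) * energy p A G" .
  have "Lp_int q A ?Phi <= (NN x. indicator A x)"
   unfolding Lp_int_def
  proof (intro nn_integral_mono)
   fix x
   have "\<bar>?Phi x\<bar> powr q <= 1 powr q"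
    using flat_nonneg[of "G x - M"] flat_le_1[of "G x - M"] q by (intro powr_mono2) (auto simp: cutoff_def indicator_def)
   then show "indicator A x * epow q (?Phi x) <= indicator A x" by (auto simp: indicator_def)
  qed
  then have "Lp_int q A ?Phi <= emeasure lborel A" by simp
  from add_mono[OF 1 this] show "test_size q A ?Phi <= ennreal (C * 2 powr p) * energy p A G + emeasure lborel A" .
 qed
 qed
qed

lemma converging_pair_bounded:
 assumes cp: "converging_pair A p u a" and A: "A \<in> sets borel" and p: "p >= 0"
 shows "\<exists>B\<ge>0. \<exists>N. \<forall>k\<ge>N. energy p A (u k) <= ennreal B"
  and "\<delta> > 0 ==> \<exists>N. \<forall>k\<ge>N. \<forall>l\<ge>N. energy p A (%x. u k x - u l x) <= ennreal \<delta>"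
proof -
 have m: "(%x. u k x - a x) \<in> Borel" "a \<in> Borel" for k
  using cp by (auto simp: converging_pair_def smooth_near_def intro!: borel_measurable_diff)
 have lim: "(%k. energy p A (%x. u k x - a x)) ----> 0" and fin: "energy p A a < \<infinity>" using cp by (auto simp: converging_pair_def)
 obtain e where e: "energy p A a = ennreal e" "e >= 0" using fin by (cases "energy p A a") auto
 obtain N where N: "\<forall>k\<ge>N. energy p A (%x. u k x - a x) <= ennreal 1" using eventually_le_ennreal[OF lim, of 1] by auto
 have "energy p A (u k) <= ennreal (2 powr p * (1 + e))" if "k >= N" for k
 proof -
  have "energy p A (%x. (u k x - a x) + a x) <= ennreal (2 powr p) * (energy p A (%x. u k x - a x) + energy p A a)"
   by (rule pair_int_add_le[OF inv4_borel A m p])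
  also have "... <= ennreal (2 powr p * (1 + e))"
   by (rule ennreal_bound_powr2) (use N that e in auto)
  finally show ?thesis by simp
 qed
 then show "\<exists>B\<ge>0. \<exists>N. \<forall>k\<ge>N. energy p A (u k) <= ennreal B" using e by (intro exI[of _ "2 powr p * (1 + e)"]) auto
 show "\<exists>N. \<forall>k\<ge>N. \<forall>l\<ge>N. energy p A (%x. u k x - u l x) <= ennreal \<delta>" if \<delta>: "\<delta> > 0"
 proof -
  define d where "d = \<delta> / (2 * 2 powr p)"
  have d: "d > 0" using \<delta> by (simp add: d_def)
  obtain N where N: "\<forall>k\<ge>N. energy p A (%x. u k x - a x) <= ennreal d" using eventually_le_ennreal[OF lim d] by auto
  have "energy p A (%x. u k x - u l x) <= ennreal \<delta>" if "k >= N" "l >= N" for k l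
  proof -
   have "energy p A (%x. (u k x - a x) - (u l x - a x)) <= ennreal (2 powr p) * (energy p A (%x. u k x - a x) + energy p A (%x. u l x - a x))"
    by (rule pair_int_diff[OF inv4_borel A m(1) m(1) p])
   also have "... <= ennreal (2 powr p * (d + d))" by (rule ennreal_bound_powr2) (use N that d in auto)
   also have "2 powr p * (d + d) = \<delta>" by (simp add: d_def)
   finally show ?thesis by simp
  qed
  then show ?thesis by blast
 qed
qed

text \<open>Test the Jacobian of \<open>(G l, H l)\<close> with the cutoff of \<open>G k\<close>. As \<open>l\<close> grows, the limit is at least the integral of the
 cutoff. On the other hand, for large \<open>k\<close> and \<open>l\<close> the form is close to that of \<open>(G k, H k)\<close>, which is zero by
 \<open>triform_cutoff_zero\<close>. So the integrals of the cutoffs tend to zero, and the excess of \<open>g\<close> over \<open>M\<close> vanishes.\<close>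

lemma circle_maximum_principle:
 assumes pl: "plump A kappa t0" and oA: "open A" and bA: "bounded A" and p: "p > 2" and q: "q > 2" and pq: "2 / p + 1 / q = 1" "p <= q"
  and G: "converging_pair A p G g" and H: "converging_pair A p H h"
  and pos: "!!phi. phi \<in> test_functions A ==> (!!x. phi x >= 0) ==> \<exists>L. L >= (LBINT x. phi x) \<and> (%k. triform (G k) (H k) phi) ----> L"
  and rho: "rho > 0" "cball x0 rho \<subseteq> A" and fr: "frequently (%k. \<forall>x. dist x0 x = rho --> G k x < M) sequentially"
 shows "AE x in lborel. x \<in> ball x0 rho --> g x <= M"
proof -
 have A[measurable]: "A \<in> sets borel" using oA by simp
 have p0: "p >= 0" "0 < p" "p >= 1" and q0: "q > 0" using p q by auto
 have sn: "smooth_near A (G k)" "smooth_near A (H k)" for k using G H by (auto simp: converging_pair_def)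
 have gm[measurable]: "g \<in> Borel" "G k \<in> Borel" for k using G sn by (auto simp: converging_pair_def smooth_near_def)
 define Phi where "Phi = (%k. cutoff (G k) M x0 rho)"
 define ok where "ok = (%k. \<forall>x. dist x0 x = rho --> G k x < M)"
 have test: "Phi k \<in> test_functions A" if "ok k" for k
 proof -
  obtain V where "open V" "cball x0 rho \<subseteq> V" "smooth_on V (G k)"
   using sn(1)[of k] rho(2) closure_subset[of A] unfolding smooth_near_def by (metis order_trans)
  then show ?thesis unfolding Phi_def using cutoff_properties(1)[OF _ _ _ rho(2,1)] that by (simp add: ok_def)
 qed
 have small: "\<exists>N. \<forall>k\<ge>N. ok k --> (LBINT x. Phi k x) <= eps" if eps: "eps > 0" for eps
 proof -
  obtain B1 N1 where B1: "B1 >= 0" "\<forall>k\<ge>N1. energy p A (G k) <= ennreal B1" using converging_pair_bounded(1)[OF G A p0(1)] by blast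
  obtain B2 N2 where B2: "B2 >= 0" "\<forall>k\<ge>N2. energy p A (H k) <= ennreal B2" using converging_pair_bounded(1)[OF H A p0(1)] by blast
  show ?thesis
  proof (rule cutoff_size[OF q0 p0(2) pq(2)], goal_cases)
  case C: (1 C)
  obtain m where m: "emeasure lborel A = ennreal m" "m >= 0" using emeasure_bounded_finite[OF bA] by (cases "emeasure lborel A") auto
  define B where "B = 1 + B1 + B2 + (C * B1 + m)"
  have B: "B > 0" "B1 <= B" "B2 <= B" "C * B1 + m <= B" using B1(1) B2(1) m(2) mult_nonneg_nonneg[of C B1] C(1) unfolding B_def by linarith+
  have Bs: "ennreal B1 <= ennreal B" "ennreal B2 <= ennreal B" "ennreal (C * B1 + m) <= ennreal B" using B by (auto intro: ennreal_leI)
  have size: "test_size q A (Phi k) <= ennreal B" if "ok k" "k >= N1" for k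
  proof -
   have "test_size q A (Phi k) <= ennreal C * energy p A (G k) + emeasure lborel A"
    unfolding Phi_def by (rule C(2)[OF sn(1) A rho(2,1)]) (use that(1) in \<open>simp add: ok_def\<close>)
   also have "... <= ennreal C * ennreal B1 + ennreal m" unfolding m(1) using B1(2) that by (intro add_right_mono mult_left_mono) auto
   also have "... = ennreal (C * B1 + m)" using C(1) B1(1) m(2) by (simp add: ennreal_mult)
   finally show ?thesis using Bs(3) by (rule order_trans)
  qed
  have "B >= 0" "eps / 2 > 0" using B eps by auto
  show ?thesis
  proof (rule triform_small[OF pl oA bA p q pq(1) \<open>B >= 0\<close> \<open>eps / 2 > 0\<close>], goal_cases)
  case \<delta>: (1 \<delta>)
  define d where "d = min \<delta> B"
  have d: "d > 0" "ennreal d <= ennreal \<delta>" "ennreal d <= ennreal B" using \<delta>(1) B(1) by (auto simp: d_def intro: ennreal_leI)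
  obtain N3 where N3: "\<forall>k\<ge>N3. \<forall>l\<ge>N3. energy p A (%x. G k x - G l x) <= ennreal d" using converging_pair_bounded(2)[OF G A p0(1) d(1)] by blast
  obtain N4 where N4: "\<forall>k\<ge>N4. \<forall>l\<ge>N4. energy p A (%x. H k x - H l x) <= ennreal d" using converging_pair_bounded(2)[OF H A p0(1) d(1)] by blast
  define N where "N = Max {N1, N2, N3, N4}"
  have N: "N1 <= N" "N2 <= N" "N3 <= N" "N4 <= N" by (auto simp: N_def)
  have "(LBINT x. Phi k x) <= eps" if k: "k >= N" "ok k" for k
  proof -
   have "triform (G l) (H l) (Phi k) <= eps" if l: "l >= N" for l
   proof -
    have adm: "tri_admissible A (G l) (H l) (Phi k)" "tri_admissible A (G k) (H k) (Phi k)"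
     "tri_admissible A (%x. G l x - G k x) (H l) (Phi k)" "tri_admissible A (G k) (%x. H l x - H k x) (Phi k)"
     unfolding tri_admissible_def by (intro conjI smooth_near_diff sn test[OF k(2)])+
    have "triform (G k) (H k) (Phi k) = 0"
     unfolding Phi_def by (rule triform_cutoff_zero[OF sn rho(2,1)]) (use k(2) in \<open>simp add: ok_def\<close>)
    then have "triform (G l) (H l) (Phi k) = triform (%x. G l x - G k x) (H l) (Phi k) + triform (G k) (%x. H l x - H k x) (Phi k)"
     using triform_diff[OF adm(1,2)] by (simp add: triform_def)
    moreover have "\<bar>triform (%x. G l x - G k x) (H l) (Phi k)\<bar> <= eps / 2"
    proof (rule \<delta>(2)[OF adm(3)])
     have e: "energy p A (%x. G l x - G k x) <= ennreal d" using N3 N k(1) l by auto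
     then show "energy p A (%x. G l x - G k x) <= ennreal B" using d(3) by (rule order_trans)
     show "energy p A (%x. G l x - G k x) <= ennreal \<delta> \<or> energy p A (H l) <= ennreal \<delta> \<or> test_size q A (Phi k) <= ennreal \<delta>"
      by (rule disjI1, rule order_trans[OF e d(2)])
     show "energy p A (H l) <= ennreal B" using B2(2) N l by (intro order_trans[OF _ Bs(2)]) auto
     show "test_size q A (Phi k) <= ennreal B" using N k by (intro size) auto
    qed
    moreover have "\<bar>triform (G k) (%x. H l x - H k x) (Phi k)\<bar> <= eps / 2"
    proof (rule \<delta>(2)[OF adm(4)])
     have e: "energy p A (%x. H l x - H k x) <= ennreal d" using N4 N k(1) l by auto
     then show "energy p A (%x. H l x - H k x) <= ennreal B" using d(3) by (rule order_trans)
     show "energy p A (G k) <= ennreal \<delta> \<or> energy p A (%x. H l x - H k x) <= ennreal \<delta> \<or> test_size q A (Phi k) <= ennreal \<delta>"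
      by (rule disjI2, rule disjI1, rule order_trans[OF e d(2)])
     show "energy p A (G k) <= ennreal B" using B1(2) N k(1) by (intro order_trans[OF _ Bs(1)]) auto
     show "test_size q A (Phi k) <= ennreal B" using N k by (intro size) auto
    qed
    ultimately show ?thesis by linarith
   qed
   moreover have "Phi k x >= 0" for x by (simp add: Phi_def cutoff_def flat_nonneg)
   then obtain L where "L >= (LBINT x. Phi k x)" "(%l. triform (G l) (H l) (Phi k)) ----> L" using pos[OF test[OF k(2)]] by blast
   ultimately show ?thesis using LIMSEQ_le_const2[of "%l. triform (G l) (H l) (Phi k)" L eps] by fastforce
  qed
  then show ?thesis by blast
  qed
  qed
 qed
 define F where "F = cutoff g M x0 rho"
 have flatm: "flat \<in> Borel"
  using smooth_on_continuous[OF smooth_on_flat[OF open_UNIV, of "%x::real. x"]] by (intro borel_measurable_continuous_onI) (simp add: smooth_on_def Ck_on_id)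
 have ci: "integrable lborel (cutoff f M x0 rho)" if [measurable]: "f \<in> Borel" for f
 proof (rule Bochner_Integration.integrable_bound)
  show "integrable lborel (indicator (ball x0 rho) :: _ => real)" using emeasure_lborel_ball_finite[of x0 rho] by (intro integrable_real_indicator) auto
  have "(%x. flat (f x - M)) \<in> Borel" using flatm by measurable
  then have "(%x. indicator (ball x0 rho) x * flat (f x - M)) \<in> Borel" by (intro borel_measurable_times borel_measurable_indicator) auto
  then show "cutoff f M x0 rho \<in> borel_measurable lborel" by (simp add: cutoff_def[abs_def])
  show "AE x in lborel. norm (cutoff f M x0 rho x) <= norm (indicator (ball x0 rho) x :: real)"
   using flat_nonneg flat_le_1 by (intro AE_I2) (auto simp: cutoff_def indicator_def)
 qed
 have "(%k. LBINT x. Phi k x) ----> (LBINT x. F x)"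
  unfolding Phi_def F_def
 proof (rule converging_integral[OF G A bA p0(3) _ ci[OF gm(2)] ci[OF gm(1)], of 2])
  show "\<bar>cutoff (G k) M x0 rho x - cutoff g M x0 rho x\<bar> <= 2 * (indicator A x * \<bar>G k x - g x\<bar>)" for k x
   using flat_Lipschitz[of "G k x - M" "g x - M"] subsetD[OF rho(2), of x] by (auto simp: cutoff_def indicator_def)
 qed simp
 moreover define I where "I = (LBINT x. F x)"
 ultimately have lim: "(%k. LBINT x. Phi k x) ----> I" by simp
 have "I <= 0"
 proof (rule ccontr)
  assume "\<not> I <= 0"
  then have I: "I / 2 > 0" "I / 2 < I" by auto
  obtain N where "\<forall>k\<ge>N. ok k --> (LBINT x. Phi k x) <= I / 2" using small[OF I(1)] by blast
  then have "eventually (%k. ok k --> (LBINT x. Phi k x) <= I / 2) sequentially" unfolding eventually_sequentially by blast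
  from eventually_conj[OF this order_tendstoD(1)[OF lim I(2)]]
  have "eventually (%k. \<not> ok k) sequentially" by (rule eventually_mono) auto
  then show False using fr by (simp add: frequently_def ok_def)
 qed
 moreover have F0: "F x >= 0" for x by (simp add: F_def cutoff_def flat_nonneg)
 ultimately have "(LBINT x. F x) = 0" using integral_nonneg_AE[of F lborel] by (simp add: I_def antisym)
 then have "AE x in lborel. F x = 0"
  using integral_nonneg_eq_0_iff_AE[of lborel F] ci[OF gm(1)] F0 by (simp add: F_def)
 then show ?thesis
 proof eventually_elim
  case (elim x)
  then show ?case using flat_pos_iff[of "g x - M"] by (auto simp: F_def cutoff_def indicator_def)
 qed
qed

text \<open>Small balls carry little energy. On a good circle \<open>G k\<close> then exceeds its average only slightly, and the maximum principle
 transports this bound into the disc.\<close>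

lemma local_upper_bound:
 assumes pl: "plump A kappa t0" and oA: "open A" and bA: "bounded A" and p: "p > 2" and q: "q > 2" and pq: "2 / p + 1 / q = 1" "p <= q"
  and G: "converging_pair A p G g" and H: "converging_pair A p H h"
  and pos: "!!phi. phi \<in> test_functions A ==> (!!x. phi x >= 0) ==> \<exists>L. L >= (LBINT x. phi x) \<and> (%k. triform (G k) (H k) phi) ----> L"
  and x0: "x0 \<in> A" and eps: "eps > 0"
 shows "\<exists>r>0. \<forall>R. 0 < R --> R < r --> (AE x in lborel. x \<in> ball x0 R --> g x <= average (cball x0 R) g + eps)"
proof -
 have A[measurable]: "A \<in> sets borel" using oA by simp
 have p0: "p >= 0" "p >= 1" "p > 0" using p by auto
 have gm[measurable]: "g \<in> Borel" "G k \<in> Borel" for k using G by (auto simp: converging_pair_def smooth_near_def)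
 show ?thesis
 proof (rule good_circle[OF p0(2)], goal_cases)
 case C: (1 C)
 define E where "E = (eps / (4 * C)) powr p"
 have E: "E > 0" and CE: "C * E powr (1 / p) = eps / 4" using C(1) eps p0 by (auto simp: E_def powr_powr)
 define d where "d = E / (2 * 2 powr p)"
 have d: "d > 0" "2 powr p * (d + d) = E" using E by (auto simp: d_def)
 obtain r0 where r0: "r0 > 0" "cball x0 r0 \<subseteq> A" using open_contains_cball[of A] oA x0 by blast
 define e where "e = (%n. 1 / real (Suc n))"
 have e0: "e ----> 0" unfolding e_def using LIMSEQ_inverse_real_of_nat by (simp add: inverse_eq_divide)
 have "energy p A g < \<infinity>" using G by (simp add: converging_pair_def)
 from eventually_le_ennreal[OF energy_near_tendsto_0[OF A gm(1) this e0] d(1)]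
 obtain n where n: "energy_near (e n) p A g <= ennreal d" by blast
 define r where "r = min (r0 / 3) (e n / 6)"
 have r: "r > 0" using r0 by (simp add: r_def e_def)
 have "AE x in lborel. x \<in> ball x0 R --> g x <= average (cball x0 R) g + eps" if R: "0 < R" "R < r" for R
 proof -
  have R3: "3 * R <= r0" "6 * R <= e n" using R by (auto simp: r_def)
  have cA: "cball x0 (3 * R) \<subseteq> A" using r0(2) R3 by auto
  then have BA: "ball x0 (3 * R) \<subseteq> A" using ball_subset_cball by blast
  have "energy p (ball x0 (3 * R)) g <= energy_near (e n) p A g"
   unfolding pair_int_def
  proof (intro nn_integral_mono)
   fix x y
   have "norm (x - y) < e n" if "x \<in> ball x0 (3 * R)" "y \<in> ball x0 (3 * R)"
    using that dist_triangle[of x y x0] R3 by (simp add: dist_norm norm_minus_commute)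
   then show "indicator (ball x0 (3 * R)) x * indicator (ball x0 (3 * R)) y * (inv4 (x - y) * epow p (g x - g y)) <=
    indicator A x * indicator A y * (near (e n) (x - y) * inv4 (x - y) * epow p (g x - g y))"
    using subsetD[OF BA, of x] subsetD[OF BA, of y] by (auto simp: indicator_def near_def)
  qed
  with n have eg: "energy p (ball x0 (3 * R)) g <= ennreal d" by simp
  have "(%k. energy p A (%x. G k x - g x)) ----> 0" using G by (simp add: converging_pair_def)
  from eventually_le_ennreal[OF this d(1)] obtain N where N: "\<forall>k\<ge>N. energy p A (%x. G k x - g x) <= ennreal d" by blast
  have "energy p (ball x0 (3 * R)) (G k) <= ennreal E" if "k >= N" for k
  proof -
   have "energy p (ball x0 (3 * R)) (%x. (G k x - g x) + g x) <= ennreal (2 powr p) * (energy p (ball x0 (3 * R)) (%x. G k x - g x) + energy p (ball x0 (3 * R)) g)"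
    by (rule pair_int_add_le) (use p0 in auto)
   also have "... <= ennreal (2 powr p * (d + d))"
    using N that d(1) order_trans[OF pair_int_mono_set[OF BA]] by (intro ennreal_bound_powr2 eg) auto
   finally show ?thesis unfolding d(2) by simp
  qed
  then have ev: "eventually (%k. energy p (ball x0 (3 * R)) (G k) <= ennreal E) sequentially" unfolding eventually_sequentially by blast
  have con: "continuous_on (cball x0 (3 * R)) (G k)" for k
  proof -
   obtain V where "cball x0 (3 * R) \<subseteq> V" "smooth_on V (G k)"
    using G cA closure_subset[of A] unfolding converging_pair_def smooth_near_def by (metis order_trans)
   then show ?thesis using smooth_on_continuous continuous_on_subset by blast
  qed
  obtain rho where rho: "R < rho" "rho < 2 * R"
   and fr: "frequently (%k. \<forall>x. dist x0 x = rho --> \<bar>G k x - average (cball x0 R) (G k)\<bar> <= eps / 4) sequentially"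
   using C(2)[OF R(1) E con gm(2) ev] unfolding CE by blast
  have "(%k. LBINT x. G k x * indicator (cball x0 R) x) ----> (LBINT x. g x * indicator (cball x0 R) x)"
  proof (rule converging_pair_weak[OF G A bA p0(2), of _ 1])
   show "indicator (cball x0 R) x = (0::real)" if "x \<notin> A" for x using that subsetD[OF cA, of x] R(1) by (auto simp: indicator_def)
   show "(indicator (cball x0 R) :: real^2 => real) \<in> Borel" by (rule borel_measurable_indicator) simp
  qed (simp add: indicator_def)
  then have "(%k. average (cball x0 R) (G k)) ----> average (cball x0 R) g"
   unfolding average_def using R(1) by (intro tendsto_divide) (auto simp: mult.commute measure_cball_2)
  from order_tendstoD(2)[OF this, of "average (cball x0 R) g + eps / 2"] eps
  have ev': "eventually (%k. average (cball x0 R) (G k) < average (cball x0 R) g + eps / 2) sequentially" by simp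
  have "frequently (%k. \<forall>x. dist x0 x = rho --> G k x < average (cball x0 R) g + eps) sequentially"
   using frequently_eventually_conj[OF fr ev']
  proof (rule frequently_elim1, intro allI impI)
   fix k x
   assume a: "average (cball x0 R) (G k) < average (cball x0 R) g + eps / 2 \<and> (\<forall>x. dist x0 x = rho --> \<bar>G k x - average (cball x0 R) (G k)\<bar> <= eps / 4)"
    and x: "dist x0 x = rho"
   then have "\<bar>G k x - average (cball x0 R) (G k)\<bar> <= eps / 4" by blast
   with a eps show "G k x < average (cball x0 R) g + eps" by linarith
  qed
  moreover have "rho > 0" "cball x0 rho \<subseteq> A" using rho R(1) cA by auto
  ultimately have "AE x in lborel. x \<in> ball x0 rho --> g x <= average (cball x0 R) g + eps"
   by (intro circle_maximum_principle[OF pl oA bA p q pq G H pos])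
  then show ?thesis by eventually_elim (use rho(1) in auto)
 qed
 then show ?thesis using r by blast
 qed
qed

text \<open>Rotating the target by a right angle preserves the Jacobian. This turns the upper bound for the first component into
 bounds from above and below for both components.\<close>

lemma triform_rotations:
 assumes "tri_admissible A a b Phi"
 shows "triform (%x. - a x) (%x. - b x) Phi = triform a b Phi" "triform b (%x. - a x) Phi = triform a b Phi" "triform (%x. - b x) a Phi = triform a b Phi"
proof -
 have s: "smooth_near A a" "smooth_near A b" "Phi \<in> test_functions A" using assms by (auto simp: tri_admissible_def)
 have m: "smooth_near A (%x. - c x)" if "smooth_near A c" for c using smooth_near_cmult[OF that, of "- 1"] by simp
 have anti: "triform c d Phi = - triform d c Phi" for c d
  unfolding triform_def by (subst bracket_antisym) simp
 have neg: "triform (%x. - c x) d Phi = - triform c d Phi" "triform c (%x. - d x) Phi = - triform c d Phi"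
  if "smooth_near A c" "smooth_near A d" for c d
  using triform_scale(1,2)[of A c d Phi "- 1"] that s(3) by (auto simp: tri_admissible_def)
 show "triform (%x. - a x) (%x. - b x) Phi = triform a b Phi" using neg(1)[OF s(1) m[OF s(2)]] neg(2)[OF s(1,2)] by simp
 show "triform b (%x. - a x) Phi = triform a b Phi" using neg(2)[OF s(2,1)] anti[of a b] by simp
 show "triform (%x. - b x) a Phi = triform a b Phi" using neg(1)[OF s(2,1)] anti[of a b] by simp
qed

lemma average_minus: "average S (%x. - f x) = - average S f"
 by (simp add: average_def)

lemma continuous_component:
 assumes pl: "plump A kappa t0" and oA: "open A" and bA: "bounded A" and p: "p > 2" and q: "q > 2" and pq: "2 / p + 1 / q = 1" "p <= q"
  and G: "converging_pair A p G g" and H: "converging_pair A p H h"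
  and pos: "!!phi. phi \<in> test_functions A ==> (!!x. phi x >= 0) ==> \<exists>L. L >= (LBINT x. phi x) \<and> (%k. triform (G k) (H k) phi) ----> L"
 shows "\<exists>g'. continuous_on A g' \<and> (AE x in lborel. x \<in> A --> g x = g' x)"
proof (rule continuous_representative[OF oA])
 fix x eps assume x: "x \<in> A" and eps: "(eps::real) > 0"
 have pos': "\<exists>L. L >= (LBINT x. phi x) \<and> (%k. triform (%x. - G k x) (%x. - H k x) phi) ----> L"
  if "phi \<in> test_functions A" "!!x. phi x >= 0" for phi
 proof -
  have "tri_admissible A (G k) (H k) phi" for k using G H that(1) by (simp add: tri_admissible_def converging_pair_def)
  then show ?thesis using pos[OF that] triform_rotations(1)[of A] by simp
 qed
 obtain r where r: "r > 0" "\<forall>R. 0 < R --> R < r --> (AE z in lborel. z \<in> ball x R --> g z <= average (cball x R) g + eps)"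
  using local_upper_bound[OF pl oA bA p q pq G H pos x eps] by blast
 obtain r' where r': "r' > 0" "\<forall>R. 0 < R --> R < r' --> (AE z in lborel. z \<in> ball x R --> - g z <= average (cball x R) (%z. - g z) + eps)"
  using local_upper_bound[OF pl oA bA p q pq converging_pair_minus[OF G] converging_pair_minus[OF H] pos' x eps] by blast
 define R where "R = min r r' / 2"
 have R: "0 < R" "R < r" "R < r'" using r(1) r'(1) by (auto simp: R_def)
 have "AE z in lborel. z \<in> ball x R --> norm (g z - average (cball x R) g) <= eps"
  using r(2)[rule_format, OF R(1,2)] r'(2)[rule_format, OF R(1,3)]
  by eventually_elim (auto simp: average_minus abs_le_iff)
 then show "\<exists>r>0. \<exists>m. AE z in lborel. z \<in> ball x r --> norm (g z - m) <= eps" using R(1) by blast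
qed

lemma curl_representative:
 fixes f f' :: "real^2 => real^2"
 assumes A: "A \<in> sets borel" and bA: "bounded A" and u: "converging_pair A p u (%x. f' x $ 1)" and v: "converging_pair A p v (%x. f' x $ 2)" and p: "p >= 1"
  and f: "f \<in> borel_measurable (lebesgue_on A)" and ff: "AE x in lborel. x \<in> A --> f x = f' x" and phi: "phi \<in> test_functions A"
  and curl: "(LINT x|lebesgue_on A. f x $ 2 * pderiv_at 1 phi x - f x $ 1 * pderiv_at 2 phi x) = 0"
 shows "(LBINT x. f' x $ 2 * pderiv_at 1 phi x) - (LBINT x. f' x $ 1 * pderiv_at 2 phi x) = 0"
proof -
 obtain B where m: "!!i. pderiv_at i phi \<in> Borel" and B: "!!i x. \<bar>pderiv_at i phi x\<bar> <= B"
  and zA: "!!i x. x \<notin> A ==> pderiv_at i phi x = 0"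
  by (rule test_function_pderiv[OF phi], rule that)
 have f'm: "(%x. f' x $ 1) \<in> Borel" "(%x. f' x $ 2) \<in> Borel"
  using u v by (auto simp: converging_pair_def)
 have fm: "(%x. f x $ i) \<in> borel_measurable (lebesgue_on A)" for i
  by (rule borel_measurable_continuous_on[OF continuous_on_component[OF continuous_on_id, of UNIV i] f])
 define w where "w = (%x. f' x $ 2 * pderiv_at 1 phi x - f' x $ 1 * pderiv_at 2 phi x)"
 have wm: "w \<in> Borel" unfolding w_def by (intro borel_measurable_diff borel_measurable_times f'm m)
 have "(LINT x|lebesgue_on A. f x $ 2 * pderiv_at 1 phi x - f x $ 1 * pderiv_at 2 phi x) = (LINT x|lebesgue_on A. w x)"
 proof (rule integral_cong_AE)
  show "(%x. f x $ 2 * pderiv_at 1 phi x - f x $ 1 * pderiv_at 2 phi x) \<in> borel_measurable (lebesgue_on A)"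
   by (intro borel_measurable_diff borel_measurable_times fm measurable_lebesgue_on_borel m)
  show "AE x in lebesgue_on A. f x $ 2 * pderiv_at 1 phi x - f x $ 1 * pderiv_at 2 phi x = w x"
   unfolding AE_lebesgue_on_iff[OF A] using ff by eventually_elim (simp add: w_def)
 qed (rule measurable_lebesgue_on_borel[OF wm])
 also have "... = (LBINT x. w x)" by (rule LINT_lebesgue_on[OF A wm refl]) (simp add: w_def zA)
 also have "... = (LBINT x. f' x $ 2 * pderiv_at 1 phi x) - (LBINT x. f' x $ 1 * pderiv_at 2 phi x)"
  unfolding w_def
  by (rule Bochner_Integration.integral_diff[OF converging_pair_integrable(2)[OF v A bA p m B zA] converging_pair_integrable(2)[OF u A bA p m B zA]])
 finally show ?thesis using curl by simp
qed

theorem theorem1p6: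
  fixes \<Omega> :: "(real^2) set" and s :: real and f :: "real^2 \<Rightarrow> real^2"
  assumes "open \<Omega>" and "bounded \<Omega>" and "has_smooth_boundary \<Omega>"
    and "2 / 3 \<le> s" and "s < 1"
    and "f \<in> Wsp \<Omega> s (2 / s)"
    and "distr_Jac_nonneg \<Omega> s f"
    and "\<forall>\<phi> \<in> test_functions \<Omega>.
           - (LINT x|lebesgue_on \<Omega>. f x $ 2 * pderiv_at 1 \<phi> x - f x $ 1 * pderiv_at 2 \<phi> x) = 0"
  shows "\<exists>g. continuous_on \<Omega> g \<and> (AE x in lebesgue_on \<Omega>. f x = g x)"
proof -
 have A: "\<Omega> \<in> sets borel" using assms(1) by simp
 define p q where "p = 2 / s" and "q = 1 / (1 - s)"
 have p: "p > 2" "p >= 1" and q: "q > 2" and pq: "2 / p + 1 / q = 1" "p <= q"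
  using assms(4,5) by (auto simp: p_def q_def field_simps)
 obtain \<kappa> t0 where pl: "plump \<Omega> \<kappa> t0" using smooth_boundary_plump[OF assms(1-3)] by blast
 obtain f' u v where ff: "AE x in lborel. x \<in> \<Omega> --> f x = f' x"
  and uv: "converging_pair \<Omega> p u (%x. f' x $ 1)" "converging_pair \<Omega> p v (%x. f' x $ 2)"
  and jac: "!!\<phi>. \<phi> \<in> test_functions \<Omega> ==> \<forall>x. \<phi> x >= 0 ==> \<exists>L\<ge>0. (%k. triform (u k) (v k) \<phi>) ----> L"
  by (rule approximating_pairs[OF pl assms(1,2,4-7), folded p_def], rule that)
 have f: "f \<in> borel_measurable (lebesgue_on \<Omega>)" using assms(6) by (simp add: Wsp_def)
 (* The rotation field is taken with strength 1: it is smooth, so it affects continuity nowhere. *)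
 define G H g h where "G = (%k x. u k x - x $ 2)" and "H = (%k x. v k x + x $ 1)"
  and "g = (%x. f' x $ 1 - x $ 2)" and "h = (%x. f' x $ 2 + x $ 1)"
 have G: "converging_pair \<Omega> p G g" and H: "converging_pair \<Omega> p H h"
  using converging_pair_shift[OF uv(1) A assms(2) p(1), of 1 2] converging_pair_shift[OF uv(2) A assms(2) p(1), of "- 1" 1]
  by (simp_all add: G_def H_def g_def h_def)
 have pos: "\<exists>L. L >= (LBINT x. \<phi> x) \<and> (%k. triform (G k) (H k) \<phi>) ----> L"
  if \<phi>: "\<phi> \<in> test_functions \<Omega>" "!!x. \<phi> x >= 0" for \<phi>
 proof -
  have "(LINT x|lebesgue_on \<Omega>. f x $ 2 * pderiv_at 1 \<phi> x - f x $ 1 * pderiv_at 2 \<phi> x) = 0" using assms(8) \<phi>(1) by fastforce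
  from shifted_jacobian_positive[OF uv A assms(2) p(2) jac[OF \<phi>(1) allI[OF \<phi>(2)]] \<phi>(1) curl_representative[OF A assms(2) uv p(2) f ff \<phi>(1) this]]
  show ?thesis unfolding G_def H_def .
 qed
 have pos': "\<exists>L. L >= (LBINT x. \<phi> x) \<and> (%k. triform (H k) (%x. - G k x) \<phi>) ----> L"
  if "\<phi> \<in> test_functions \<Omega>" "!!x. \<phi> x >= 0" for \<phi>
 proof -
  have "tri_admissible \<Omega> (G k) (H k) \<phi>" for k using G H that(1) by (simp add: tri_admissible_def converging_pair_def)
  then show ?thesis using pos[OF that] triform_rotations(2)[of \<Omega>] by simp
 qed
 obtain g' where g': "continuous_on \<Omega> g'" "AE x in lborel. x \<in> \<Omega> --> g x = g' x"
  using continuous_component[OF pl assms(1,2) p(1) q pq G H pos] by blast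
 obtain h' where h': "continuous_on \<Omega> h'" "AE x in lborel. x \<in> \<Omega> --> h x = h' x"
  using continuous_component[OF pl assms(1,2) p(1) q pq H converging_pair_minus[OF G] pos'] by blast
 define F where "F = (%x. (g' x + x $ 2) *\<^sub>R axis 1 1 + (h' x - x $ 1) *\<^sub>R axis (2::2) (1::real))"
 have "continuous_on \<Omega> F" unfolding F_def by (intro continuous_intros g' h')
 moreover have "AE x in lborel. x \<in> \<Omega> --> f x = F x"
  using ff g'(2) h'(2)
 proof eventually_elim
  case (elim x)
  show ?case
  proof
   assume x: "x \<in> \<Omega>"
   then have "g' x + x $ 2 = f' x $ 1" "h' x - x $ 1 = f' x $ 2" using elim by (auto simp: g_def h_def)
   then have "F x = f' x" unfolding F_def by (simp only: vec2_eq[symmetric])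
   then show "f x = F x" using elim x by simp
  qed
 qed
 ultimately show ?thesis unfolding AE_lebesgue_on_iff[OF A] by blast
qed

end
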